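(* Let $s\ge 0$ and let $\phi\in H^s(\mathbb{T})$ be real-valued. Then for any $T>0$ and every $\varepsilon\in(0,1]$ there exists a unique solution $u\in C([0,T];H^s(\mathbb{T}))$ of the KdV-Burgers equation $$\partial_t u+\partial_x^3u-\varepsilon\,\partial_x^2u=\partial_x(u^2),\qquad u(0,x)=\phi(x),$$ and it satisfies, for all $0<\varepsilon\le 1$, $$\|u\|_{L^\infty_t([0,T];H^s_x)}\le C(T,\|\phi\|_{H^s}),$$ where the constant $C(T,\|\phi\|_{H^s})$ does not depend on $\varepsilon$. Moreover, the solution map $S^\varepsilon:\phi\mapsto u$ is continuous from $H^s(\mathbb{T})$ to $C([0,T];H^s(\mathbb{T}))$ uniformly in $\varepsilon\in(0,1]$; that is, for every $\phi\in H^s(\mathbb{T})$ and every $\eta>0$ there is $\delta>0$, independent of $\varepsilon$, such that for every real-valued $\psi\in H^s(\mathbb{T})$ with $\|\psi-\phi\|_{H^s}<\delta$ one has $\|S^\varepsilon(\psi)-S^\varepsilon(\phi)\|_{C([0,T];H^s)}<\eta$ for all $\varepsilon\in(0,1]$.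
   Context: $\mathbb{T}=[0,2\pi]$ with periodic boundary conditions (the torus). Solutions $u(t,x)$ are real-valued functions, and the equation is understood in the sense of distributions (equivalently, via the time-integrated equation for each Fourier coefficient of $u$); uniqueness is unconditional, i.e. within the class $C([0,T];H^s(\mathbb{T}))$. The Sobolev norm is $\|f\|_{H^s(\mathbb{T})}=\big(2\pi\sum_{k\in\mathbb{Z}}(1+|k|^2)^s|\hat f_k|^2\big)^{1/2}$ with $\hat f_k=\frac1{2\pi}\int_{\mathbb{T}}e^{-ikx}f(x)\,dx$. *)

theory Defs
  imports "HOL-Analysis.Analysis"
begin

text \<open>
  A function on the torus is represented by a function on the reals, of which only the
  values on $[0,2\pi]$ matter, and those only up to null sets.  Differentiation on the torus is
  multiplication of the \<open>k\<close>-th Fourier coefficient by \<open>\<i> k\<close>, so periodicity is built in.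
\<close>

abbreviation torus :: "real measure" where
  "torus \<equiv> lebesgue_on {0..2 * pi}"

definition fourier_coeff :: "(real \<Rightarrow> real) \<Rightarrow> int \<Rightarrow> complex" where
  "fourier_coeff f k =
     1 / (2 * pi) * (\<integral>x. exp (- (\<i> * of_int k * of_real x)) * of_real (f x) \<partial>torus)"

definition sobolev_norm :: "real \<Rightarrow> (real \<Rightarrow> real) \<Rightarrow> real" where
  "sobolev_norm s f =
     sqrt (2 * pi * (\<Sum>\<^sub>\<infinity>k::int. (1 + (real_of_int \<bar>k\<bar>)\<^sup>2) powr s * (cmod (fourier_coeff f k))\<^sup>2))"

text \<open>
  The real-valued elements of $H^s$.  This is meant for \<open>s \<ge> 0\<close>, where $H^s$ consists of
  square-integrable functions.  The summability clause is needed because \<open>infsum\<close> is 0 on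
  families that are not summable.
\<close>

definition sobolev :: "real \<Rightarrow> (real \<Rightarrow> real) set" where
  "sobolev s = {f. f \<in> borel_measurable torus \<and> integrable torus (\<lambda>x. (f x)\<^sup>2) \<and>
     (\<lambda>k::int. (1 + (real_of_int \<bar>k\<bar>)\<^sup>2) powr s * (cmod (fourier_coeff f k))\<^sup>2) summable_on UNIV}"

definition C_sobolev :: "real \<Rightarrow> real \<Rightarrow> (real \<Rightarrow> real \<Rightarrow> real) set" where
  "C_sobolev s T = {u. (\<forall>t\<in>{0..T}. u t \<in> sobolev s) \<and>
     (\<forall>t\<in>{0..T}. ((\<lambda>\<tau>. sobolev_norm s (\<lambda>x. u \<tau> x - u t x)) \<longlongrightarrow> 0) (at t within {0..T}))}"

text \<open>
  On \<open>C_sobolev s T\<close> the supremum is over a bounded set, and it agrees with the essential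
  supremum, i.e. with the norm of $L^\infty_t([0,T];H^s_x)$.
\<close>

definition C_sobolev_norm :: "real \<Rightarrow> real \<Rightarrow> (real \<Rightarrow> real \<Rightarrow> real) \<Rightarrow> real" where
  "C_sobolev_norm s T u = (SUP t\<in>{0..T}. sobolev_norm s (u t))"

text \<open>
  $\partial_t u = - \partial_x^3 u + \varepsilon \partial_x^2 u + \partial_x (u^2)$, integrated
  in time, for each Fourier coefficient.
\<close>

definition kdvb_solution ::
  "real \<Rightarrow> real \<Rightarrow> real \<Rightarrow> (real \<Rightarrow> real) \<Rightarrow> (real \<Rightarrow> real \<Rightarrow> real) \<Rightarrow> bool" where
  "kdvb_solution s T \<epsilon> \<phi> u \<longleftrightarrow>
     u \<in> C_sobolev s T \<and>
     (AE x in torus. u 0 x = \<phi> x) \<and>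
     (\<forall>k::int. \<forall>t\<in>{0..T}.
        ((\<lambda>\<tau>. - ((\<i> * of_int k) ^ 3 * fourier_coeff (u \<tau>) k)
              + of_real \<epsilon> * (\<i> * of_int k)\<^sup>2 * fourier_coeff (u \<tau>) k
              + \<i> * of_int k * fourier_coeff (\<lambda>x. (u \<tau> x)\<^sup>2) k)
          has_integral (fourier_coeff (u t) k - fourier_coeff (u 0) k)) {0..t})"

text \<open>
  The solution map $S^\varepsilon$ on $[0,T]$.  Solutions are unique only up to null sets in
  \<open>x\<close> (and their values at times outside $[0,T]$ are arbitrary), so a representative is chosen.
\<close>

definition kdvb_solution_map ::
  "real \<Rightarrow> real \<Rightarrow> real \<Rightarrow> (real \<Rightarrow> real) \<Rightarrow> real \<Rightarrow> real \<Rightarrow> real" where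
  "kdvb_solution_map s T \<epsilon> \<phi> = (SOME u. kdvb_solution s T \<epsilon> \<phi> u)"

end

theory Submission
  imports Defs
begin

text \<open>
  On the Fourier side the equation reads
  \<open>c\<^sub>k' = \<lambda>\<^sub>k c\<^sub>k + i k (c * c)\<^sub>k\<close> with \<open>\<lambda>\<^sub>k = i k^3 - \<epsilon> k^2\<close>, where \<open>*\<close> is convolution.
  The whole theorem is a statement about this system, and the difficulty is to find estimates in
  which the derivative \<open>i k\<close> in front of the nonlinearity is paid for by dispersion and not by the
  dissipation \<open>\<epsilon> k^2\<close>, so that the constants do not depend on \<open>\<epsilon>\<close>.

  Mean-zero solutions come first; the mean \<open>m\<close> is conserved, and the Galilean phase
  \<open>exp (2 i k m t)\<close> removes it (\<open>fourier_sol_mean_zero_sol\<close>, \<open>mean_zero_sol_fourier_sol\<close>).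

  Uniform estimates.  For \<open>k = a + b\<close> one has
  \<open>\<lambda>\<^sub>a + \<lambda>\<^sub>b - \<lambda>\<^sub>k = a b (2 \<epsilon> - 3 i k)\<close>, whose modulus is at least \<open>3 |a b k|\<close> for every \<open>\<epsilon>\<close>.
  Dividing by it (differentiation by parts) turns the quadratic term into a time derivative plus a
  cubic term.  The nonresonant part of the cubic term has the divisor \<open>cubic_phase\<close> of modulus at
  least \<open>3 |a + b| |k - a| |k - b|\<close>, and dividing once more leaves only terms that are bounded on
  \<open>H^s\<close>.  The resulting variable \<open>normal_form\<close> satisfies \<open>z' = \<lambda> z + r\<close> with \<open>r\<close> locally Lipschitz
  in \<open>H^s\<close> (\<open>normal_form_deriv\<close>, \<open>remainder_est\<close>), and differs from \<open>v\<close> by terms that gain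
  a factor \<open>1 / |k|\<close> (\<open>boundary_est\<close>).  Since \<open>Re \<lambda> \<le> 0\<close>, an energy that uses \<open>v\<close> at low and
  \<open>normal_form\<close> at high frequencies obeys a Gronwall inequality (\<open>galerkin_lipschitz\<close>): finitely
  supported solutions depend on their data in a Lipschitz way, with a constant that depends only
  on \<open>T\<close> and the sizes of the data.  The same argument with the weight
  \<open>1 + l (1 + k^2)^(s/2)\<close> compares a solution with \<open>0\<close> and needs only its \<open>L^2\<close> norm, which
  does not increase; so the \<open>H^s\<close> norm stays bounded on \<open>[0,T]\<close> (\<open>galerkin_tame_bound\<close>).

  Existence and uniqueness for fixed \<open>\<epsilon> > 0\<close>.  Here dissipation is available.  In a norm with the
  factor \<open>exp (- \<Omega> t)\<close> and \<open>\<Omega>\<close> large the Duhamel formula contracts on \<open>L^2\<close>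
  (\<open>mode_flow_comparison\<close>).  This compares a Galerkin approximation with any bounded solution:
  the approximations converge, and the limit is the only solution in the class, without further
  conditions.  Consequently every solution inherits the uniform estimates.

  Uniformity in \<open>\<epsilon>\<close>.  Approximating the data by trigonometric polynomials, whose solutions are
  bounded in \<open>H^(s+1)\<close>, shows that the high frequencies of solutions are small in \<open>H^s\<close>
  uniformly in \<open>t\<close> and \<open>\<epsilon>\<close> (\<open>mean_zero_sol_tight\<close>).  This gives continuity in time, and
  it controls the phases \<open>exp (2 i k m t)\<close> when the means of the data differ (\<open>fourier_sol_stable\<close>);
  because of these phases the argument gives continuity of the solution map but no Lipschitz bound.

  The transfer to functions uses three facts about Fourier series on the torus: integrable functions
  with vanishing coefficients vanish almost everywhere (\<open>fourier_coeff_zero_imp_AE_zero\<close>), every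
  square-summable sequence with the right symmetry is the coefficient sequence of a real function
  (\<open>riesz_fischer\<close>), and the coefficients of \<open>f^2\<close> are the convolution square of those of \<open>f\<close>
  (\<open>fc_square\<close>).
\<close>

section \<open>Lattice sums with small divisors\<close>

text \<open>
  The divisor \<open>1 / |n|\<close>, with value \<open>0\<close> at \<open>n = 0\<close>; all small divisors below are products of these.
\<close>

definition inv_abs :: "int \<Rightarrow> real" where "inv_abs n = 1 / \<bar>real_of_int n\<bar>"

lemma inv_abs_nonneg [simp]: "0 \<le> inv_abs n" by (simp add: inv_abs_def)
lemma inv_abs_zero [simp]: "inv_abs 0 = 0" by (simp add: inv_abs_def)
lemma inv_abs_le_1 [simp]: "inv_abs n \<le> 1"
  by (cases "n = 0") (auto simp: inv_abs_def divide_simps)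

lemma sum_inv_abs_pos: "(\<Sum>n = 1..m. (inv_abs (int n))\<^sup>2) \<le> 2 - 1 / real m"
proof (induction m)
  case (Suc m)
  show ?case
  proof (cases "m = 0")
    case False
    then have "(inv_abs (int (Suc m)))\<^sup>2 \<le> 1 / real m - 1 / real (Suc m)"
      by (simp add: inv_abs_def divide_simps power2_eq_square)
    then show ?thesis using Suc by simp
  qed (simp add: inv_abs_def)
qed auto

lemma sum_inv_abs_sq:
  assumes "finite S"
  shows "(\<Sum>n\<in>S. (inv_abs n)\<^sup>2) \<le> 4"
proof -
  obtain m where m: "S \<subseteq> {- int m..int m}"
  proof -
    have "finite (abs ` S)" using assms by simp
    then obtain M where M: "\<And>n. n \<in> S \<Longrightarrow> \<bar>n\<bar> \<le> M"
      by (metis Max_ge imageI)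
    show ?thesis
      by (rule that[of "nat M"]) (use M in \<open>fastforce simp: abs_le_iff\<close>)
  qed
  have eq: "{- int m..int m} = insert 0 (int ` {1..m} \<union> (\<lambda>n. - int n) ` {1..m})"
  proof (intro equalityI subsetI)
    fix x assume x: "x \<in> {- int m..int m}"
    show "x \<in> insert 0 (int ` {1..m} \<union> (\<lambda>n. - int n) ` {1..m})"
    proof (cases "x = 0")
      case False
      show ?thesis
      proof (cases "x > 0")
        case True
        then have "x = int (nat x)" "nat x \<in> {1..m}" using x by auto
        then show ?thesis by blast
      next
        case F: False
        then have "x = - int (nat (-x))" "nat (-x) \<in> {1..m}" using x False by auto
        then show ?thesis by blast
      qed
    qed auto
  qed auto
  have "(\<Sum>n\<in>S. (inv_abs n)\<^sup>2) \<le> (\<Sum>n\<in>{- int m..int m}. (inv_abs n)\<^sup>2)"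
    by (rule sum_mono2) (use m in auto)
  also have "\<dots> \<le> (\<Sum>n\<in>int ` {1..m} \<union> (\<lambda>n. - int n) ` {1..m}. (inv_abs n)\<^sup>2)"
    unfolding eq by (subst sum.insert_if) auto
  also have "\<dots> \<le> (\<Sum>n\<in>int ` {1..m}. (inv_abs n)\<^sup>2) + (\<Sum>n\<in>(\<lambda>n. - int n) ` {1..m}. (inv_abs n)\<^sup>2)"
    by (subst sum.union_disjoint) auto
  also have "(\<Sum>n\<in>int ` {1..m}. (inv_abs n)\<^sup>2) = (\<Sum>n = 1..m. (inv_abs (int n))\<^sup>2)"
    by (subst sum.reindex) auto
  also have "(\<Sum>n\<in>(\<lambda>n. - int n) ` {1..m}. (inv_abs n)\<^sup>2) = (\<Sum>n = 1..m. (inv_abs (int n))\<^sup>2)"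
    by (subst sum.reindex) (auto simp: inj_on_def inv_abs_def)
  finally have "(\<Sum>n\<in>S. (inv_abs n)\<^sup>2) \<le> (\<Sum>n = 1..m. (inv_abs (int n))\<^sup>2) + (\<Sum>n = 1..m. (inv_abs (int n))\<^sup>2)" .
  moreover have "(\<Sum>n = 1..m. (inv_abs (int n))\<^sup>2) \<le> 2"
    by (rule order_trans[OF sum_inv_abs_pos]) simp
  ultimately show ?thesis by linarith
qed

lemma sum_inv_abs_sq_inj:
  assumes "finite S" "inj_on f S"
  shows "(\<Sum>a\<in>S. (inv_abs (f a))\<^sup>2) \<le> 4"
  using sum_inv_abs_sq[of "f ` S"] assms by (simp add: sum.reindex)

lemma sum_inv_abs_shift [simp]:
  assumes "finite S"
  shows "(\<Sum>a\<in>S. (inv_abs (k - a))\<^sup>2) \<le> 4" "(\<Sum>a\<in>S. (inv_abs (a - k))\<^sup>2) \<le> 4"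
    "(\<Sum>a\<in>S. (inv_abs (a + k))\<^sup>2) \<le> 4" "(\<Sum>a\<in>S. (inv_abs (k + a))\<^sup>2) \<le> 4"
  using assms by (auto intro!: sum_inv_abs_sq_inj simp: inj_on_def)

lemma sum_inv_abs_two:
  assumes "(\<Sum>a\<in>S. (f a)\<^sup>2) \<le> 4" "(\<Sum>a\<in>S. (h a)\<^sup>2) \<le> (4::real)"
  shows "(\<Sum>a\<in>S. (f a + h a)\<^sup>2) \<le> 16"
proof -
  have "(f a + h a)\<^sup>2 \<le> 2 * (f a)\<^sup>2 + 2 * (h a)\<^sup>2" for a
    using sum_squares_ge_zero[of "f a - h a" 0] by (simp add: power2_eq_square algebra_simps)
  then have "(\<Sum>a\<in>S. (f a + h a)\<^sup>2) \<le> (\<Sum>a\<in>S. 2 * (f a)\<^sup>2 + 2 * (h a)\<^sup>2)" by (intro sum_mono)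
  also have "\<dots> = 2 * (\<Sum>a\<in>S. (f a)\<^sup>2) + 2 * (\<Sum>a\<in>S. (h a)\<^sup>2)"
    by (simp add: sum.distrib sum_distrib_left)
  finally show ?thesis using assms by simp
qed

lemma sum_prod_le:
  fixes x :: "'a \<Rightarrow> real"
  assumes "\<And>a. a \<in> S \<Longrightarrow> 0 \<le> x a" "\<And>a. a \<in> S \<Longrightarrow> (\<Sum>b\<in>R. y a b) \<le> C" "(\<Sum>a\<in>S. x a) \<le> D" "0 \<le> C"
  shows "(\<Sum>a\<in>S. \<Sum>b\<in>R. x a * y a b) \<le> D * C"
proof -
  have "(\<Sum>a\<in>S. \<Sum>b\<in>R. x a * y a b) = (\<Sum>a\<in>S. x a * (\<Sum>b\<in>R. y a b))"
    by (simp add: sum_distrib_left)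
  also have "\<dots> \<le> (\<Sum>a\<in>S. x a * C)" by (intro sum_mono mult_left_mono assms)
  also have "\<dots> = (\<Sum>a\<in>S. x a) * C" by (simp add: sum_distrib_right)
  also have "\<dots> \<le> D * C" using assms by (intro mult_right_mono)
  finally show ?thesis .
qed

text \<open>
  The trilinear sums are estimated for one nonnegative majorant \<open>g\<close> in the unit ball of \<open>\<ell>^2\<close>; the
  sequences of interest are later bounded by multiples of \<open>g\<close> after division by a weight.
\<close>

locale unit_seq =
  fixes I :: "int set" and g :: "int \<Rightarrow> real"
  assumes fin: "finite I" and nz: "0 \<notin> I" and pos: "\<And>k. 0 \<le> g k" and off: "\<And>k. k \<notin> I \<Longrightarrow> g k = 0"
    and tot: "(\<Sum>k\<in>I. (g k)\<^sup>2) \<le> 1"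
begin

lemma sum_sq: assumes "finite S" shows "(\<Sum>k\<in>S. (g k)\<^sup>2) \<le> 1"
proof -
  have "(\<Sum>k\<in>S. (g k)\<^sup>2) = (\<Sum>k\<in>S \<inter> I. (g k)\<^sup>2)"
    by (rule sum.mono_neutral_right) (use assms off in auto)
  also have "\<dots> \<le> (\<Sum>k\<in>I. (g k)\<^sup>2)" by (rule sum_mono2) (use fin in auto)
  finally show ?thesis using tot by simp
qed

lemma sum_sq_inj: assumes "finite S" "inj_on f S" shows "(\<Sum>k\<in>S. (g (f k))\<^sup>2) \<le> 1"
  using sum_sq[of "f ` S"] assms by (simp add: sum.reindex)

lemma le1: "g k \<le> 1"
  using sum_sq[of "{k}"] pos[of k] power2_le_imp_le[of "g k" 1] by simp

lemma conv_le: assumes "finite S" shows "(\<Sum>a\<in>S. g a * g (k - a)) \<le> 1"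
proof -
  have "(\<Sum>a\<in>S. g a * g (k - a)) \<le> (\<Sum>a\<in>S. ((g a)\<^sup>2 + (g (k-a))\<^sup>2) / 2)"
  proof (intro sum_mono)
    fix a show "g a * g (k - a) \<le> ((g a)\<^sup>2 + (g (k-a))\<^sup>2) / 2"
      using sum_squares_bound[of "g a" "g (k - a)"] by simp
  qed
  also have "\<dots> = ((\<Sum>a\<in>S. (g a)\<^sup>2) + (\<Sum>a\<in>S. (g (k-a))\<^sup>2)) / 2"
    by (simp add: sum.distrib flip: sum_divide_distrib)
  finally show ?thesis using sum_sq[OF assms] sum_sq_inj[OF assms, of "\<lambda>a. k - a"] by (simp add: inj_on_def)
qed

text \<open>
  The Cauchy-Schwarz inequality in \<open>a\<close> puts the divisors into one factor, where their squares are
  summable uniformly in \<open>k\<close>, and leaves the convolution of \<open>g^2\<close> with itself.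
\<close>

lemma bil_est:
  assumes "finite S"
  shows "(\<Sum>k\<in>S. (\<Sum>a\<in>I. g a * g (k - a) * (inv_abs a + inv_abs (k - a)))\<^sup>2) \<le> 16"
proof -
  have "(\<Sum>a\<in>I. g a * g (k - a) * (inv_abs a + inv_abs (k - a)))\<^sup>2 \<le> 16 * (\<Sum>a\<in>I. (g a)\<^sup>2 * (g (k - a))\<^sup>2)" for k
  proof -
    have "(\<Sum>a\<in>I. g a * g (k - a) * (inv_abs a + inv_abs (k - a)))\<^sup>2
       \<le> (\<Sum>a\<in>I. (g a * g (k - a))\<^sup>2) * (\<Sum>a\<in>I. (inv_abs a + inv_abs (k - a))\<^sup>2)"
      by (rule Cauchy_Schwarz_ineq_sum)
    also have "\<dots> \<le> (\<Sum>a\<in>I. (g a * g (k - a))\<^sup>2) * 16"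
      by (intro mult_left_mono sum_inv_abs_two sum_nonneg sum_inv_abs_sq sum_inv_abs_shift fin) auto
    finally show ?thesis by (simp add: power_mult_distrib)
  qed
  then have "(\<Sum>k\<in>S. (\<Sum>a\<in>I. g a * g (k - a) * (inv_abs a + inv_abs (k - a)))\<^sup>2)
     \<le> (\<Sum>k\<in>S. 16 * (\<Sum>a\<in>I. (g a)\<^sup>2 * (g (k - a))\<^sup>2))" by (intro sum_mono)
  also have "\<dots> = 16 * (\<Sum>a\<in>I. \<Sum>k\<in>S. (g a)\<^sup>2 * (g (k - a))\<^sup>2)"
    by (subst sum.swap) (simp add: sum_distrib_left)
  also have "(\<Sum>a\<in>I. \<Sum>k\<in>S. (g a)\<^sup>2 * (g (k - a))\<^sup>2) \<le> 1 * 1"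
    by (rule sum_prod_le) (use tot sum_sq_inj[OF assms, of "\<lambda>k. k - a" for a] in \<open>auto simp: inj_on_def\<close>)
  finally show ?thesis by simp
qed

text \<open>
  For trilinear sums the divisors are distributed: \<open>p\<close> carries two of the three factors \<open>g\<close> and one
  divisor and is square-summable in all three variables, while \<open>y\<close> carries the other divisors and is
  square-summable in \<open>(a, b)\<close> uniformly in \<open>k\<close>.  Only two factors \<open>g\<close> are needed because the third is at
  most \<open>1\<close>, or is absent since a convolution has been bounded by a constant.
\<close>

lemma tri_gen:
  assumes S: "finite S" and J: "\<And>k. J k \<subseteq> I \<times> I"
    and p: "(\<Sum>k\<in>S. \<Sum>a\<in>I. \<Sum>b\<in>I. (p k a b)\<^sup>2) \<le> 4"
    and y: "\<And>k. (\<Sum>a\<in>I. \<Sum>b\<in>I. (y k a b)\<^sup>2) \<le> (64::real)"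
  shows "(\<Sum>k\<in>S. (\<Sum>(a,b)\<in>J k. p k a b * y k a b)\<^sup>2) \<le> 256"
proof -
  have up: "(\<Sum>(a,b)\<in>J k. (f a b)\<^sup>2) \<le> (\<Sum>a\<in>I. \<Sum>b\<in>I. (f a b)\<^sup>2)" for k and f :: "int \<Rightarrow> int \<Rightarrow> real"
    unfolding sum.cartesian_product using J fin by (intro sum_mono2) auto
  have "(\<Sum>(a,b)\<in>J k. p k a b * y k a b)\<^sup>2 \<le> (\<Sum>a\<in>I. \<Sum>b\<in>I. (p k a b)\<^sup>2) * 64" for k
  proof -
    have "(\<Sum>(a,b)\<in>J k. p k a b * y k a b)\<^sup>2 \<le> (\<Sum>(a,b)\<in>J k. (p k a b)\<^sup>2) * (\<Sum>(a,b)\<in>J k. (y k a b)\<^sup>2)"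
      using Cauchy_Schwarz_ineq_sum[of "\<lambda>(a,b). p k a b" "\<lambda>(a,b). y k a b" "J k"]
      by (simp add: case_prod_beta)
    also have "\<dots> \<le> (\<Sum>a\<in>I. \<Sum>b\<in>I. (p k a b)\<^sup>2) * 64"
      by (intro mult_mono up order_trans[OF up y] sum_nonneg) auto
    finally show ?thesis .
  qed
  then have "(\<Sum>k\<in>S. (\<Sum>(a,b)\<in>J k. p k a b * y k a b)\<^sup>2) \<le> (\<Sum>k\<in>S. (\<Sum>a\<in>I. \<Sum>b\<in>I. (p k a b)\<^sup>2) * 64)"
    by (intro sum_mono)
  also have "\<dots> = (\<Sum>k\<in>S. (\<Sum>a\<in>I. \<Sum>b\<in>I. (p k a b)\<^sup>2)) * 64" by (simp add: sum_distrib_right)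
  finally show ?thesis using p by simp
qed

lemma p_ab:
  assumes S: "finite S"
  shows "(\<Sum>k\<in>S. \<Sum>a\<in>I. \<Sum>b\<in>I. (g a * g b * inv_abs (k - a))\<^sup>2) \<le> 4"
    "(\<Sum>k\<in>S. \<Sum>a\<in>I. \<Sum>b\<in>I. (g a * g b * inv_abs (k - b))\<^sup>2) \<le> 4"
proof -
  have *: "(\<Sum>a\<in>I. \<Sum>k\<in>S. (g a)\<^sup>2 * (inv_abs (k - a))\<^sup>2) \<le> 1 * 4"
    by (rule sum_prod_le) (use tot S in auto)
  have **: "(\<Sum>k\<in>S. \<Sum>a\<in>I. (g a)\<^sup>2 * (inv_abs (k - a))\<^sup>2) \<le> 4" using * by (subst sum.swap) simp
  have "(\<Sum>b\<in>I. (g a * g b * inv_abs (k - a))\<^sup>2) \<le> (g a)\<^sup>2 * (inv_abs (k - a))\<^sup>2" for k a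
  proof -
    have "(\<Sum>b\<in>I. (g a * g b * inv_abs (k - a))\<^sup>2) = (g a)\<^sup>2 * (inv_abs (k - a))\<^sup>2 * (\<Sum>b\<in>I. (g b)\<^sup>2)"
      by (simp add: power_mult_distrib sum_distrib_left mult_ac)
    also have "\<dots> \<le> (g a)\<^sup>2 * (inv_abs (k - a))\<^sup>2 * 1" using tot by (intro mult_left_mono) auto
    finally show ?thesis by simp
  qed
  then have "(\<Sum>k\<in>S. \<Sum>a\<in>I. \<Sum>b\<in>I. (g a * g b * inv_abs (k - a))\<^sup>2) \<le> (\<Sum>k\<in>S. \<Sum>a\<in>I. (g a)\<^sup>2 * (inv_abs (k - a))\<^sup>2)"
    by (intro sum_mono)
  also note **
  finally show 1: "(\<Sum>k\<in>S. \<Sum>a\<in>I. \<Sum>b\<in>I. (g a * g b * inv_abs (k - a))\<^sup>2) \<le> 4" .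
  have "(\<Sum>a\<in>I. \<Sum>b\<in>I. (g a * g b * inv_abs (k - b))\<^sup>2) = (\<Sum>a\<in>I. \<Sum>b\<in>I. (g a * g b * inv_abs (k - a))\<^sup>2)" for k
    by (subst sum.swap) (simp add: mult.commute)
  then show "(\<Sum>k\<in>S. \<Sum>a\<in>I. \<Sum>b\<in>I. (g a * g b * inv_abs (k - b))\<^sup>2) \<le> 4" using 1 by simp
qed

lemma p_ac:
  assumes S: "finite S"
  shows "(\<Sum>k\<in>S. \<Sum>a\<in>I. \<Sum>b\<in>I. (g a * g (k - a - b) * inv_abs (k - a))\<^sup>2) \<le> 4"
    "(\<Sum>k\<in>S. \<Sum>a\<in>I. \<Sum>b\<in>I. (g b * g (k - a - b) * inv_abs (k - b))\<^sup>2) \<le> 4"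
proof -
  have *: "(\<Sum>a\<in>I. \<Sum>k\<in>S. (g a)\<^sup>2 * (inv_abs (k - a))\<^sup>2) \<le> 1 * 4"
    by (rule sum_prod_le) (use tot S in auto)
  have **: "(\<Sum>k\<in>S. \<Sum>a\<in>I. (g a)\<^sup>2 * (inv_abs (k - a))\<^sup>2) \<le> 4" using * by (subst sum.swap) simp
  have "(\<Sum>b\<in>I. (g a * g (k - a - b) * inv_abs (k - a))\<^sup>2) \<le> (g a)\<^sup>2 * (inv_abs (k - a))\<^sup>2" for k a
  proof -
    have "(\<Sum>b\<in>I. (g a * g (k - a - b) * inv_abs (k - a))\<^sup>2) = (g a)\<^sup>2 * (inv_abs (k - a))\<^sup>2 * (\<Sum>b\<in>I. (g (k - a - b))\<^sup>2)"
      by (simp add: power_mult_distrib sum_distrib_left mult_ac)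
    also have "\<dots> \<le> (g a)\<^sup>2 * (inv_abs (k - a))\<^sup>2 * 1"
      using sum_sq_inj[OF fin, of "\<lambda>b. k - a - b"] by (intro mult_left_mono) (auto simp: inj_on_def)
    finally show ?thesis by simp
  qed
  then have "(\<Sum>k\<in>S. \<Sum>a\<in>I. \<Sum>b\<in>I. (g a * g (k - a - b) * inv_abs (k - a))\<^sup>2) \<le> (\<Sum>k\<in>S. \<Sum>a\<in>I. (g a)\<^sup>2 * (inv_abs (k - a))\<^sup>2)"
    by (intro sum_mono)
  also note **
  finally show 1: "(\<Sum>k\<in>S. \<Sum>a\<in>I. \<Sum>b\<in>I. (g a * g (k - a - b) * inv_abs (k - a))\<^sup>2) \<le> 4" .
  have "(\<Sum>a\<in>I. \<Sum>b\<in>I. (g b * g (k - a - b) * inv_abs (k - b))\<^sup>2) = (\<Sum>a\<in>I. \<Sum>b\<in>I. (g a * g (k - a - b) * inv_abs (k - a))\<^sup>2)" for k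
    by (subst sum.swap) (simp add: algebra_simps)
  then show "(\<Sum>k\<in>S. \<Sum>a\<in>I. \<Sum>b\<in>I. (g b * g (k - a - b) * inv_abs (k - b))\<^sup>2) \<le> 4" using 1 by simp
qed

lemma y_est:
  "(\<Sum>a\<in>I. \<Sum>b\<in>I. ((inv_abs a + inv_abs (k - a)) * inv_abs (a + b))\<^sup>2) \<le> 64"
  "(\<Sum>a\<in>I. \<Sum>b\<in>I. (inv_abs (a + b) * inv_abs (k - a))\<^sup>2) \<le> 64"
  "(\<Sum>a\<in>I. \<Sum>b\<in>I. (inv_abs (k - b) * (inv_abs a + inv_abs (a + b)))\<^sup>2) \<le> 64"
  "(\<Sum>a\<in>I. \<Sum>b\<in>I. (inv_abs (a + b) * (inv_abs (k - b) + inv_abs a))\<^sup>2) \<le> 64"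
proof -
  have "(\<Sum>a\<in>I. \<Sum>b\<in>I. ((inv_abs a + inv_abs (k - a)))\<^sup>2 * (inv_abs (a + b))\<^sup>2) \<le> 16 * 4"
    by (rule sum_prod_le) (use fin in \<open>auto intro!: sum_inv_abs_two sum_inv_abs_sq\<close>)
  then show "(\<Sum>a\<in>I. \<Sum>b\<in>I. ((inv_abs a + inv_abs (k - a)) * inv_abs (a + b))\<^sup>2) \<le> 64"
    by (simp add: power_mult_distrib)
  have "(\<Sum>a\<in>I. \<Sum>b\<in>I. (inv_abs (k - a))\<^sup>2 * (inv_abs (a + b))\<^sup>2) \<le> 4 * 4"
    by (rule sum_prod_le) (use fin in auto)
  then show "(\<Sum>a\<in>I. \<Sum>b\<in>I. (inv_abs (a + b) * inv_abs (k - a))\<^sup>2) \<le> 64"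
    by (simp add: power_mult_distrib mult.commute)
  have "(\<Sum>b\<in>I. \<Sum>a\<in>I. (inv_abs (k - b))\<^sup>2 * (inv_abs a + inv_abs (a + b))\<^sup>2) \<le> 4 * 16"
    by (rule sum_prod_le) (use fin in \<open>auto intro!: sum_inv_abs_two sum_inv_abs_sq\<close>)
  then show "(\<Sum>a\<in>I. \<Sum>b\<in>I. (inv_abs (k - b) * (inv_abs a + inv_abs (a + b)))\<^sup>2) \<le> 64"
    by (subst sum.swap) (simp add: power_mult_distrib)
  have 1: "(\<Sum>b\<in>I. \<Sum>a\<in>I. (inv_abs (k - b))\<^sup>2 * (inv_abs (a + b))\<^sup>2) \<le> 4 * 4"
    by (rule sum_prod_le) (use fin in auto)
  have 2: "(\<Sum>a\<in>I. \<Sum>b\<in>I. (inv_abs a)\<^sup>2 * (inv_abs (a + b))\<^sup>2) \<le> 4 * 4"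
    by (rule sum_prod_le) (use fin in \<open>auto intro: sum_inv_abs_sq\<close>)
  have "(inv_abs (a + b) * (inv_abs (k - b) + inv_abs a))\<^sup>2 \<le> 2 * ((inv_abs (k - b))\<^sup>2 * (inv_abs (a + b))\<^sup>2) + 2 * ((inv_abs a)\<^sup>2 * (inv_abs (a + b))\<^sup>2)" for a b
  proof -
    have "(inv_abs (k - b) + inv_abs a)\<^sup>2 \<le> 2 * (inv_abs (k - b))\<^sup>2 + 2 * (inv_abs a)\<^sup>2"
      using sum_squares_ge_zero[of "inv_abs (k - b) - inv_abs a" 0] by (simp add: power2_eq_square algebra_simps)
    then have "(inv_abs (a + b))\<^sup>2 * (inv_abs (k - b) + inv_abs a)\<^sup>2 \<le> (inv_abs (a + b))\<^sup>2 * (2 * (inv_abs (k - b))\<^sup>2 + 2 * (inv_abs a)\<^sup>2)"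
      by (intro mult_left_mono) auto
    then show ?thesis unfolding power_mult_distrib by (simp add: algebra_simps)
  qed
  then have "(\<Sum>a\<in>I. \<Sum>b\<in>I. (inv_abs (a + b) * (inv_abs (k - b) + inv_abs a))\<^sup>2) \<le>
     (\<Sum>a\<in>I. \<Sum>b\<in>I. 2 * ((inv_abs (k - b))\<^sup>2 * (inv_abs (a + b))\<^sup>2) + 2 * ((inv_abs a)\<^sup>2 * (inv_abs (a + b))\<^sup>2))"
    by (intro sum_mono)
  also have "\<dots> = 2 * (\<Sum>a\<in>I. \<Sum>b\<in>I. (inv_abs (k - b))\<^sup>2 * (inv_abs (a + b))\<^sup>2) + 2 * (\<Sum>a\<in>I. \<Sum>b\<in>I. (inv_abs a)\<^sup>2 * (inv_abs (a + b))\<^sup>2)"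
    by (simp add: sum.distrib sum_distrib_left)
  also have "(\<Sum>a\<in>I. \<Sum>b\<in>I. (inv_abs (k - b))\<^sup>2 * (inv_abs (a + b))\<^sup>2) = (\<Sum>b\<in>I. \<Sum>a\<in>I. (inv_abs (k - b))\<^sup>2 * (inv_abs (a + b))\<^sup>2)"
    by (rule sum.swap)
  finally show "(\<Sum>a\<in>I. \<Sum>b\<in>I. (inv_abs (a + b) * (inv_abs (k - b) + inv_abs a))\<^sup>2) \<le> 64" using 1 2 by simp
qed

text \<open>
  The four combinations of divisors that occur: the first belongs to the cubic term of the
  normal form, the others to the three quartic remainders, in which one factor \<open>v\<close> has been replaced
  by its nonlinearity.
\<close>

lemma tri_est:
  assumes S: "finite S" and J: "\<And>k. J k \<subseteq> I \<times> I"
  shows "(\<Sum>k\<in>S. (\<Sum>(a,b)\<in>J k. (g a * g b * inv_abs (k - b)) * ((inv_abs a + inv_abs (k - a)) * inv_abs (a + b)))\<^sup>2) \<le> 256"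
    "(\<Sum>k\<in>S. (\<Sum>(a,b)\<in>J k. (g b * g (k - a - b) * inv_abs (k - b)) * (inv_abs (a + b) * inv_abs (k - a)))\<^sup>2) \<le> 256"
    "(\<Sum>k\<in>S. (\<Sum>(a,b)\<in>J k. (g a * g (k - a - b) * inv_abs (k - a)) * (inv_abs (k - b) * (inv_abs a + inv_abs (a + b))))\<^sup>2) \<le> 256"
    "(\<Sum>k\<in>S. (\<Sum>(a,b)\<in>J k. (g a * g b * inv_abs (k - a)) * (inv_abs (a + b) * (inv_abs (k - b) + inv_abs a)))\<^sup>2) \<le> 256"
  by (rule tri_gen[OF S J]; rule p_ab[OF S] p_ac[OF S] y_est)+

end

section \<open>The normal form of the mode equations\<close>

text \<open>
  The symbol of \<open>- \<partial>\<^sub>x^3 + \<epsilon> \<partial>\<^sub>x^2\<close>.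
\<close>

definition lam :: "real \<Rightarrow> int \<Rightarrow> complex" where
  "lam \<epsilon> k = \<i> * of_int k ^ 3 - of_real \<epsilon> * of_int k ^ 2"

text \<open>
  The quotient of the factor \<open>i k\<close> of the nonlinearity by the phase
  \<open>lam a + lam (k - a) - lam k = a (k - a) (2 \<epsilon> - 3 i k)\<close>, without the part \<open>a (k - a)\<close>, which is
  in \<open>nf_quad\<close>.
\<close>

definition nf_coeff :: "real \<Rightarrow> int \<Rightarrow> complex" where
  "nf_coeff \<epsilon> k = \<i> * of_int k / (2 * of_real \<epsilon> - 3 * \<i> * of_int k)"

definition cubic_phase :: "real \<Rightarrow> int \<Rightarrow> int \<Rightarrow> int \<Rightarrow> complex" where
  "cubic_phase \<epsilon> k a b = lam \<epsilon> a + lam \<epsilon> b + lam \<epsilon> (k - a - b) - lam \<epsilon> k"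

definition fin_conv :: "int set \<Rightarrow> (int \<Rightarrow> complex) \<Rightarrow> int \<Rightarrow> complex" where
  "fin_conv I v k = (\<Sum>a\<in>I. v a * v (k - a))"

definition nf_quad :: "int set \<Rightarrow> (int \<Rightarrow> complex) \<Rightarrow> int \<Rightarrow> complex" where
  "nf_quad I v k = (\<Sum>a\<in>I. v a * v (k - a) / (of_int a * of_int (k - a)))"

text \<open>
  After the first division the cubic interaction of \<open>a\<close>, \<open>b\<close> and \<open>k - a - b\<close> has a phase that is small
  only if \<open>a + b\<close>, \<open>k - b\<close> or \<open>k - a\<close> vanishes.  The third case does not occur when \<open>k - a\<close> belongs
  to a set \<open>I\<close> of nonzero modes; \<open>resonant\<close> collects the other two, where no division is possible.
\<close>

definition nonresonant :: "int set \<Rightarrow> int \<Rightarrow> (int \<times> int) set" where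
  "nonresonant I k = {(a,b). a \<in> I \<and> b \<in> I \<and> k - a \<in> I \<and> b \<noteq> - a \<and> b \<noteq> k}"

definition resonant :: "int set \<Rightarrow> int \<Rightarrow> (int \<times> int) set" where
  "resonant I k = {(a,b). a \<in> I \<and> b \<in> I \<and> k - a \<in> I \<and> (b = - a \<or> b = k)}"

definition nf_cubic :: "real \<Rightarrow> int set \<Rightarrow> (int \<Rightarrow> complex) \<Rightarrow> int \<Rightarrow> complex" where
  "nf_cubic \<epsilon> I v k = (\<Sum>(a,b)\<in>nonresonant I k. v a * v b * v (k - a - b) / (of_int a * cubic_phase \<epsilon> k a b))"

definition resonant_sum :: "int set \<Rightarrow> (int \<Rightarrow> complex) \<Rightarrow> int \<Rightarrow> complex" where
  "resonant_sum I v k = (\<Sum>(a,b)\<in>resonant I k. v a * v b * v (k - a - b) / of_int a)"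

text \<open>
  The three quartic remainders arise when the time derivative falls on the first, second or
  third factor of \<open>nf_cubic\<close>.
\<close>

definition nf_quartic1 :: "real \<Rightarrow> int set \<Rightarrow> (int \<Rightarrow> complex) \<Rightarrow> int \<Rightarrow> complex" where
  "nf_quartic1 \<epsilon> I v k = (\<Sum>(a,b)\<in>nonresonant I k. fin_conv I v a * v b * v (k - a - b) * (\<i> / cubic_phase \<epsilon> k a b))"
definition nf_quartic2 :: "real \<Rightarrow> int set \<Rightarrow> (int \<Rightarrow> complex) \<Rightarrow> int \<Rightarrow> complex" where
  "nf_quartic2 \<epsilon> I v k = (\<Sum>(a,b)\<in>nonresonant I k. v a * fin_conv I v b * v (k - a - b) * (\<i> * of_int b / (of_int a * cubic_phase \<epsilon> k a b)))"
definition nf_quartic3 :: "real \<Rightarrow> int set \<Rightarrow> (int \<Rightarrow> complex) \<Rightarrow> int \<Rightarrow> complex" where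
  "nf_quartic3 \<epsilon> I v k = (\<Sum>(a,b)\<in>nonresonant I k. v a * v b * fin_conv I v (k - a - b) *
     ((if k - a - b \<in> I then \<i> * of_int (k - a - b) else 0) / (of_int a * cubic_phase \<epsilon> k a b)))"

text \<open>
  The variable whose equation has no derivative loss: the quadratic correction removes the
  nonlinearity, the cubic correction removes the nonresonant part of what the first one produces.
\<close>

definition normal_form :: "real \<Rightarrow> int set \<Rightarrow> (int \<Rightarrow> complex) \<Rightarrow> int \<Rightarrow> complex" where
  "normal_form \<epsilon> I v k = v k - nf_coeff \<epsilon> k * nf_quad I v k + 2 * \<i> * nf_coeff \<epsilon> k * nf_cubic \<epsilon> I v k"
definition nf_rest :: "real \<Rightarrow> int set \<Rightarrow> (int \<Rightarrow> complex) \<Rightarrow> int \<Rightarrow> complex" where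
  "nf_rest \<epsilon> I v k = 2 * \<i> * nf_coeff \<epsilon> k * (nf_quartic1 \<epsilon> I v k + nf_quartic2 \<epsilon> I v k + nf_quartic3 \<epsilon> I v k - resonant_sum I v k)"

text \<open>
  The imaginary part does not see \<open>\<epsilon>\<close> and factorises, because
  \<open>(x + y + z)^3 - x^3 - y^3 - z^3 = 3 (x + y) (y + z) (z + x)\<close>.  Dissipation only adds a real part, so
  the lower bound on the modulus is uniform in \<open>\<epsilon>\<close>.
\<close>

lemma cubic_phase_eq: "cubic_phase \<epsilon> k a b = of_real \<epsilon> * 2 * of_int (a * b + (a + b) * (k - a - b))
     - 3 * \<i> * of_int ((a + b) * (k - b) * (k - a))"
  unfolding cubic_phase_def lam_def by (simp add: algebra_simps power2_eq_square power3_eq_cube)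

lemma cubic_phase_ge: "3 * (\<bar>real_of_int (a + b)\<bar> * \<bar>real_of_int (k - b)\<bar> * \<bar>real_of_int (k - a)\<bar>) \<le> cmod (cubic_phase \<epsilon> k a b)"
proof -
  have "Im (cubic_phase \<epsilon> k a b) = - 3 * (real_of_int (a + b) * real_of_int (k - b) * real_of_int (k - a))"
    unfolding cubic_phase_eq by simp
  then have "\<bar>Im (cubic_phase \<epsilon> k a b)\<bar> = 3 * (\<bar>real_of_int (a + b)\<bar> * \<bar>real_of_int (k - b)\<bar> * \<bar>real_of_int (k - a)\<bar>)"
    by (simp add: abs_mult)
  then show ?thesis using abs_Im_le_cmod[of "cubic_phase \<epsilon> k a b"] by linarith
qed

lemma cubic_phase_nz: assumes "a + b \<noteq> 0" "k \<noteq> b" "k \<noteq> a" shows "cubic_phase \<epsilon> k a b \<noteq> 0"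
proof
  assume "cubic_phase \<epsilon> k a b = 0"
  with cubic_phase_ge[of a b k \<epsilon>] have "3 * (\<bar>real_of_int (a + b)\<bar> * \<bar>real_of_int (k - b)\<bar> * \<bar>real_of_int (k - a)\<bar>) \<le> 0" by simp
  moreover have "0 < \<bar>real_of_int (a + b)\<bar> * \<bar>real_of_int (k - b)\<bar> * \<bar>real_of_int (k - a)\<bar>"
    using assms by (simp del: of_int_add of_int_diff)
  ultimately show False by linarith
qed

lemma cubic_phase_inv: assumes "a + b \<noteq> 0" "k \<noteq> b" "k \<noteq> a"
  shows "1 / cmod (cubic_phase \<epsilon> k a b) \<le> inv_abs (a + b) * inv_abs (k - b) * inv_abs (k - a)"
proof -
  have p: "0 < \<bar>real_of_int (a + b)\<bar> * \<bar>real_of_int (k - b)\<bar> * \<bar>real_of_int (k - a)\<bar>"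
    using assms by (simp del: of_int_add of_int_diff)
  then have "\<bar>real_of_int (a + b)\<bar> * \<bar>real_of_int (k - b)\<bar> * \<bar>real_of_int (k - a)\<bar> \<le> cmod (cubic_phase \<epsilon> k a b)"
    using cubic_phase_ge[of a b k \<epsilon>] by linarith
  with p have "1 / cmod (cubic_phase \<epsilon> k a b) \<le> 1 / (\<bar>real_of_int (a + b)\<bar> * \<bar>real_of_int (k - b)\<bar> * \<bar>real_of_int (k - a)\<bar>)"
    by (intro divide_left_mono mult_pos_pos[of "cmod _"]) (assumption | linarith)+
  then show ?thesis by (simp add: inv_abs_def)
qed

lemma nf_coeff_den_nz: "k \<noteq> 0 \<Longrightarrow> 2 * of_real \<epsilon> - 3 * \<i> * of_int k \<noteq> (0::complex)"
  by (auto simp: complex_eq_iff)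

lemma nf_coeff_le: "cmod (nf_coeff \<epsilon> k) \<le> 1"
proof (cases "k = 0")
  case False
  have "\<bar>Im (2 * of_real \<epsilon> - 3 * \<i> * of_int k :: complex)\<bar> \<le> cmod (2 * of_real \<epsilon> - 3 * \<i> * of_int k)"
    by (rule abs_Im_le_cmod)
  then have *: "3 * \<bar>real_of_int k\<bar> \<le> cmod (2 * of_real \<epsilon> - 3 * \<i> * of_int k)" by simp
  have "cmod (nf_coeff \<epsilon> k) = \<bar>real_of_int k\<bar> / cmod (2 * of_real \<epsilon> - 3 * \<i> * of_int k)"
    by (simp add: nf_coeff_def norm_divide norm_mult)
  also have "\<dots> \<le> 1" using * nf_coeff_den_nz[OF False, of \<epsilon>] by (subst divide_le_eq_1_pos) auto
  finally show ?thesis .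
qed (simp add: nf_coeff_def)

text \<open>
  The resonance identity of the quadratic interaction.
\<close>

lemma lam_pair:
  assumes "k \<noteq> 0"
  shows "nf_coeff \<epsilon> k * (lam \<epsilon> a + lam \<epsilon> (k - a) - lam \<epsilon> k) = \<i> * of_int k * (of_int a * of_int (k - a))"
proof -
  have "lam \<epsilon> a + lam \<epsilon> (k - a) - lam \<epsilon> k = of_int a * of_int (k - a) * (2 * of_real \<epsilon> - 3 * \<i> * of_int k)"
    unfolding lam_def by (simp add: algebra_simps power2_eq_square power3_eq_cube)
  then show ?thesis using nf_coeff_den_nz[OF assms, of \<epsilon>] by (simp add: nf_coeff_def)
qed

lemma finite_nonresonant [simp]: "finite I \<Longrightarrow> finite (nonresonant I k)"
  unfolding nonresonant_def by (rule finite_subset[of _ "I \<times> I"]) auto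
lemma finite_resonant [simp]: "finite I \<Longrightarrow> finite (resonant I k)"
  unfolding resonant_def by (rule finite_subset[of _ "I \<times> I"]) auto

lemma cubic_split:
  assumes fin: "finite I" and nz: "0 \<notin> I"
  shows "(\<Sum>a\<in>{a\<in>I. k - a \<in> I}. v a / of_int a * fin_conv I v (k - a))
     = resonant_sum I v k + (\<Sum>(a,b)\<in>nonresonant I k. v a * v b * v (k - a - b) / of_int a)"
proof -
  have "(\<Sum>a\<in>{a\<in>I. k - a \<in> I}. v a / of_int a * fin_conv I v (k - a))
    = (\<Sum>a\<in>{a\<in>I. k - a \<in> I}. \<Sum>b\<in>I. v a * v b * v (k - a - b) / of_int a)"
    unfolding fin_conv_def by (simp add: sum_distrib_left mult_ac)
  also have "\<dots> = (\<Sum>(a,b)\<in>{a\<in>I. k - a \<in> I} \<times> I. v a * v b * v (k - a - b) / of_int a)"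
    by (rule sum.cartesian_product)
  also have "{a\<in>I. k - a \<in> I} \<times> I = resonant I k \<union> nonresonant I k" by (auto simp: resonant_def nonresonant_def)
  also have "(\<Sum>(a,b)\<in>resonant I k \<union> nonresonant I k. v a * v b * v (k - a - b) / of_int a)
     = resonant_sum I v k + (\<Sum>(a,b)\<in>nonresonant I k. v a * v b * v (k - a - b) / of_int a)"
    unfolding resonant_sum_def by (rule sum.union_disjoint[OF finite_resonant[OF fin] finite_nonresonant[OF fin]]) (auto simp: resonant_def nonresonant_def)
  finally show ?thesis .
qed

context
  fixes \<epsilon> :: real and I :: "int set" and v :: "real \<Rightarrow> int \<Rightarrow> complex" and t :: real and S
  assumes fin: "finite I" and nz: "0 \<notin> I" and off: "\<And>s k. k \<notin> I \<Longrightarrow> v s k = 0"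
    and der: "\<And>k. k \<in> I \<Longrightarrow> ((\<lambda>s. v s k) has_vector_derivative
        (lam \<epsilon> k * v t k + \<i> * of_int k * fin_conv I (v t) k)) (at t within S)"
begin

definition dv :: "int \<Rightarrow> complex" where
  "dv k = (if k \<in> I then lam \<epsilon> k * v t k + \<i> * of_int k * fin_conv I (v t) k else 0)"

lemma dv_deriv: "((\<lambda>s. v s k) has_vector_derivative dv k) (at t within S)"
  using der[of k] by (auto simp: dv_def off)

lemma dv_eq: "dv k = lam \<epsilon> k * v t k + (if k \<in> I then \<i> * of_int k * fin_conv I (v t) k else 0)"
  by (simp add: dv_def off)

lemma deriv_two: "((\<lambda>s. v s a * v s b) has_vector_derivative (dv a * v t b + v t a * dv b)) (at t within S)"
  using has_vector_derivative_mult[OF dv_deriv[of a] dv_deriv[of b]] by (simp add: add.commute)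

lemma deriv_three: "((\<lambda>s. v s a * v s b * v s c) has_vector_derivative
    (dv a * v t b * v t c + v t a * dv b * v t c + v t a * v t b * dv c)) (at t within S)"
  using has_vector_derivative_mult[OF deriv_two[of a b] dv_deriv[of c]] by (simp add: algebra_simps)

text \<open>
  Differentiation by parts: the linear parts of the derivatives of the two factors combine, by the
  resonance identity, to the term \<open>i k (v * v)\<^sub>k\<close> that is to be removed.  The nonlinear parts cancel the
  divisor of the factor on which the derivative falls and give a cubic term without derivative loss.
\<close>

lemma nf_quad_deriv:
  assumes k: "k \<in> I"
  shows "((\<lambda>s. nf_coeff \<epsilon> k * nf_quad I (v s) k) has_vector_derivative
     lam \<epsilon> k * (nf_coeff \<epsilon> k * nf_quad I (v t) k) + \<i> * of_int k * fin_conv I (v t) k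
       + 2 * \<i> * nf_coeff \<epsilon> k * (\<Sum>a\<in>{a\<in>I. k - a \<in> I}. v t a / of_int a * fin_conv I (v t) (k - a))) (at t within S)"
proof -
  let ?v = "v t" let ?q = "fin_conv I (v t)"
  have k0: "k \<noteq> 0" using k nz by auto
  define d where "d a = (dv a * ?v (k - a) + ?v a * dv (k - a)) / (of_int a * of_int (k - a))" for a
  have D: "((\<lambda>s. nf_coeff \<epsilon> k * nf_quad I (v s) k) has_vector_derivative nf_coeff \<epsilon> k * (\<Sum>a\<in>I. d a)) (at t within S)"
    unfolding nf_quad_def d_def
    by (intro has_vector_derivative_mult_right has_vector_derivative_sum has_vector_derivative_divide deriv_two)
  define e1 where "e1 a = (if k - a \<in> I then \<i> * ?q a * ?v (k - a) / of_int (k - a) else 0)" for a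
  define e2 where "e2 a = (if k - a \<in> I then \<i> * ?v a * ?q (k - a) / of_int a else 0)" for a
  have trm: "nf_coeff \<epsilon> k * d a = lam \<epsilon> k * (nf_coeff \<epsilon> k * (?v a * ?v (k - a) / (of_int a * of_int (k - a))))
      + \<i> * of_int k * (?v a * ?v (k - a)) + nf_coeff \<epsilon> k * (e1 a + e2 a)" if a: "a \<in> I" for a
  proof (cases "k - a \<in> I")
    case False
    then show ?thesis using a by (simp add: d_def e1_def e2_def dv_eq off)
  next
    case True
    then have n: "(of_int a :: complex) \<noteq> 0" "(of_int (k - a) :: complex) \<noteq> 0" using a nz
      by (metis of_int_eq_0_iff)+
    have "nf_coeff \<epsilon> k * (lam \<epsilon> a + lam \<epsilon> (k - a)) = nf_coeff \<epsilon> k * lam \<epsilon> k + \<i> * of_int k * (of_int a * of_int (k - a))"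
      using lam_pair[OF k0, of \<epsilon> a] by (simp add: algebra_simps)
    moreover have "nf_coeff \<epsilon> k * d a = (nf_coeff \<epsilon> k * (lam \<epsilon> a + lam \<epsilon> (k - a))) * (?v a * ?v (k - a)) / (of_int a * of_int (k - a))
        + nf_coeff \<epsilon> k * (e1 a + e2 a)"
      using n a True unfolding d_def e1_def e2_def dv_eq
      by (simp add: divide_simps del: of_int_diff) (simp add: algebra_simps del: of_int_diff)
    ultimately show ?thesis using n by (simp add: divide_simps del: of_int_diff) (simp add: algebra_simps del: of_int_diff)
  qed
  have e2s: "(\<Sum>a\<in>I. e2 a) = \<i> * (\<Sum>a\<in>{a\<in>I. k - a \<in> I}. ?v a / of_int a * ?q (k - a))"
    unfolding e2_def sum_distrib_left using fin by (simp add: sum.inter_filter[symmetric] mult_ac flip: sum.inter_filter)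
  have "(\<Sum>a\<in>I. e1 a) = (\<Sum>a\<in>{a\<in>I. k - a \<in> I}. \<i> * ?q a * ?v (k - a) / of_int (k - a))"
    unfolding e1_def using fin by (simp add: sum.inter_filter del: of_int_diff)
  also have "\<dots> = (\<Sum>a\<in>{a\<in>I. k - a \<in> I}. \<i> * ?q (k - a) * ?v a / of_int a)"
    by (rule sum.reindex_bij_witness[of _ "\<lambda>a. k - a" "\<lambda>a. k - a"]) auto
  also have "\<dots> = \<i> * (\<Sum>a\<in>{a\<in>I. k - a \<in> I}. ?v a / of_int a * ?q (k - a))"
    by (simp add: sum_distrib_left mult_ac)
  finally have e1s: "(\<Sum>a\<in>I. e1 a) = \<i> * (\<Sum>a\<in>{a\<in>I. k - a \<in> I}. ?v a / of_int a * ?q (k - a))" .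
  have "nf_coeff \<epsilon> k * (\<Sum>a\<in>I. d a) = (\<Sum>a\<in>I. lam \<epsilon> k * (nf_coeff \<epsilon> k * (?v a * ?v (k - a) / (of_int a * of_int (k - a))))
      + \<i> * of_int k * (?v a * ?v (k - a)) + nf_coeff \<epsilon> k * (e1 a + e2 a))"
    unfolding sum_distrib_left by (rule sum.cong) (auto simp: trm)
  also have "\<dots> = lam \<epsilon> k * (nf_coeff \<epsilon> k * nf_quad I ?v k) + \<i> * of_int k * ?q k + nf_coeff \<epsilon> k * ((\<Sum>a\<in>I. e1 a) + (\<Sum>a\<in>I. e2 a))"
    unfolding nf_quad_def fin_conv_def by (simp only: sum.distrib flip: sum_distrib_left)
  also have "\<dots> = lam \<epsilon> k * (nf_coeff \<epsilon> k * nf_quad I ?v k) + \<i> * of_int k * ?q k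
       + 2 * \<i> * nf_coeff \<epsilon> k * (\<Sum>a\<in>{a\<in>I. k - a \<in> I}. ?v a / of_int a * ?q (k - a))"
    unfolding e1s e2s by (simp add: algebra_simps)
  finally show ?thesis using D by simp
qed

text \<open>
  The second differentiation by parts, in the nonresonant cubic sum.
\<close>

lemma nf_cubic_deriv:
  shows "((\<lambda>s. nf_cubic \<epsilon> I (v s) k) has_vector_derivative
     lam \<epsilon> k * nf_cubic \<epsilon> I (v t) k + (\<Sum>(a,b)\<in>nonresonant I k. v t a * v t b * v t (k - a - b) / of_int a)
       + (nf_quartic1 \<epsilon> I (v t) k + nf_quartic2 \<epsilon> I (v t) k + nf_quartic3 \<epsilon> I (v t) k)) (at t within S)"
proof -
  let ?v = "v t" let ?q = "fin_conv I (v t)"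
  define d where "d = (\<lambda>(a,b). (dv a * ?v b * ?v (k-a-b) + ?v a * dv b * ?v (k-a-b) + ?v a * ?v b * dv (k-a-b)) / (of_int a * cubic_phase \<epsilon> k a b))"
  have D: "((\<lambda>s. nf_cubic \<epsilon> I (v s) k) has_vector_derivative (\<Sum>x\<in>nonresonant I k. d x)) (at t within S)"
    unfolding nf_cubic_def d_def case_prod_beta
    by (intro has_vector_derivative_sum has_vector_derivative_divide deriv_three)
  have trm: "d (a,b) = lam \<epsilon> k * (?v a * ?v b * ?v (k - a - b) / (of_int a * cubic_phase \<epsilon> k a b))
     + ?v a * ?v b * ?v (k - a - b) / of_int a
     + (?q a * ?v b * ?v (k - a - b) * (\<i> / cubic_phase \<epsilon> k a b)
     + ?v a * ?q b * ?v (k - a - b) * (\<i> * of_int b / (of_int a * cubic_phase \<epsilon> k a b))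
     + ?v a * ?v b * ?q (k - a - b) * ((if k - a - b \<in> I then \<i> * of_int (k - a - b) else 0) / (of_int a * cubic_phase \<epsilon> k a b)))"
    if ab: "(a,b) \<in> nonresonant I k" for a b
  proof -
    define c where "c = k - a - b"
    have I: "a \<in> I" "b \<in> I" and n: "(of_int a :: complex) \<noteq> 0" "cubic_phase \<epsilon> k a b \<noteq> 0"
      using ab nz cubic_phase_nz[of a b k \<epsilon>] by (cases "k = a"; auto simp: nonresonant_def)+
    have l: "lam \<epsilon> a + lam \<epsilon> b + lam \<epsilon> c = lam \<epsilon> k + cubic_phase \<epsilon> k a b" by (simp add: cubic_phase_def c_def)
    define m where "m = (if c \<in> I then \<i> * of_int c else (0::complex))"
    have mm: "(if c \<in> I then \<i> * of_int c * ?q c else 0) = m * ?q c" by (simp add: m_def)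
    have "d (a,b) = ((lam \<epsilon> a + lam \<epsilon> b + lam \<epsilon> c) * (?v a * ?v b * ?v c)
       + (\<i> * of_int a * ?q a * ?v b * ?v c + ?v a * (\<i> * of_int b * ?q b) * ?v c + ?v a * ?v b * (m * ?q c))) / (of_int a * cubic_phase \<epsilon> k a b)"
      unfolding d_def c_def[symmetric] prod.case dv_eq mm using I by (simp add: algebra_simps)
    also have "\<dots> = lam \<epsilon> k * (?v a * ?v b * ?v c / (of_int a * cubic_phase \<epsilon> k a b))
     + ?v a * ?v b * ?v c / of_int a
     + (?q a * ?v b * ?v c * (\<i> / cubic_phase \<epsilon> k a b)
     + ?v a * ?q b * ?v c * (\<i> * of_int b / (of_int a * cubic_phase \<epsilon> k a b))
     + ?v a * ?v b * ?q c * (m / (of_int a * cubic_phase \<epsilon> k a b)))"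
      unfolding l using n by (simp add: divide_simps) (simp add: algebra_simps)
    finally show ?thesis unfolding m_def c_def .
  qed
  have "(\<Sum>x\<in>nonresonant I k. d x) = (\<Sum>(a,b)\<in>nonresonant I k. lam \<epsilon> k * (?v a * ?v b * ?v (k - a - b) / (of_int a * cubic_phase \<epsilon> k a b))
     + ?v a * ?v b * ?v (k - a - b) / of_int a
     + (?q a * ?v b * ?v (k - a - b) * (\<i> / cubic_phase \<epsilon> k a b)
     + ?v a * ?q b * ?v (k - a - b) * (\<i> * of_int b / (of_int a * cubic_phase \<epsilon> k a b))
     + ?v a * ?v b * ?q (k - a - b) * ((if k - a - b \<in> I then \<i> * of_int (k - a - b) else 0) / (of_int a * cubic_phase \<epsilon> k a b))))"
    by (rule sum.cong) (auto simp only: trm split: prod.splits)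
  also have "\<dots> = lam \<epsilon> k * nf_cubic \<epsilon> I (v t) k + (\<Sum>(a,b)\<in>nonresonant I k. v t a * v t b * v t (k - a - b) / of_int a)
       + (nf_quartic1 \<epsilon> I (v t) k + nf_quartic2 \<epsilon> I (v t) k + nf_quartic3 \<epsilon> I (v t) k)"
    unfolding nf_cubic_def nf_quartic1_def nf_quartic2_def nf_quartic3_def case_prod_beta by (simp only: sum.distrib sum_distrib_left)
  finally show ?thesis using D by simp
qed

lemma normal_form_deriv:
  assumes k: "k \<in> I"
  shows "((\<lambda>s. normal_form \<epsilon> I (v s) k) has_vector_derivative
     lam \<epsilon> k * normal_form \<epsilon> I (v t) k + nf_rest \<epsilon> I (v t) k) (at t within S)"
proof -
  let ?N = "\<Sum>(a,b)\<in>nonresonant I k. v t a * v t b * v t (k - a - b) / of_int a"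
  have "((\<lambda>s. normal_form \<epsilon> I (v s) k) has_vector_derivative
    (lam \<epsilon> k * v t k + \<i> * of_int k * fin_conv I (v t) k)
    - (lam \<epsilon> k * (nf_coeff \<epsilon> k * nf_quad I (v t) k) + \<i> * of_int k * fin_conv I (v t) k
       + 2 * \<i> * nf_coeff \<epsilon> k * (resonant_sum I (v t) k + ?N))
    + 2 * \<i> * nf_coeff \<epsilon> k * (lam \<epsilon> k * nf_cubic \<epsilon> I (v t) k + ?N
       + (nf_quartic1 \<epsilon> I (v t) k + nf_quartic2 \<epsilon> I (v t) k + nf_quartic3 \<epsilon> I (v t) k))) (at t within S)"
    unfolding normal_form_def cubic_split[OF fin nz, symmetric]
    by (intro has_vector_derivative_add has_vector_derivative_diff der k nf_quad_deriv
       has_vector_derivative_mult_right nf_cubic_deriv)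
  then show ?thesis by (rule has_vector_derivative_eq_rhs) (simp add: normal_form_def nf_rest_def algebra_simps)
qed

end

section \<open>Lipschitz estimates for the normal form in weighted spaces\<close>

text \<open>
  Partial fractions for \<open>1 / (m n)\<close>: a factor \<open>|m + n|\<close> is absorbed at the price of one of the two
  divisors.  This is how boundary terms gain \<open>1 / |k|\<close>.
\<close>

lemma inv_abs_split: "\<bar>real_of_int (m + n)\<bar> * (inv_abs m * inv_abs n) \<le> inv_abs m + inv_abs n"
proof (cases "m = 0 \<or> n = 0")
  case False
  then have p: "0 < \<bar>real_of_int m\<bar>" "0 < \<bar>real_of_int n\<bar>" by auto
  have "\<bar>real_of_int (m + n)\<bar> * (inv_abs m * inv_abs n) \<le> (\<bar>real_of_int m\<bar> + \<bar>real_of_int n\<bar>) * (inv_abs m * inv_abs n)"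
    by (intro mult_right_mono) auto
  also have "\<dots> = inv_abs m + inv_abs n" using p by (simp add: inv_abs_def field_simps)
  finally show ?thesis .
qed auto

lemma inv_abs_uminus [simp]: "inv_abs (- n) = inv_abs n" by (simp add: inv_abs_def)

text \<open>
  A pair of sequences with a common majorant.  The weight \<open>\<omega>\<close> is submultiplicative, which distributes it over
  products; \<open>P\<close> bounds both sequences and \<open>X\<close> their difference.  The estimates are wanted in the weight
  \<open>w0\<close>, and \<open>\<mu>\<close> relates the two weights: every difference is linear in \<open>\<mu> X\<close>, so \<open>\<mu>\<close> cancels, and the
  constant \<open>A^3 P^3\<close> does not depend on it.
\<close>

locale weighted_pair = unit_seq +
  fixes \<omega> :: "int \<Rightarrow> real" and \<mu> A P X :: real and w0 :: "int \<Rightarrow> real" and v u :: "int \<Rightarrow> complex"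
  assumes A: "1 \<le> A" and P: "1 \<le> P" and X: "0 \<le> X" and mu: "0 < \<mu>"
    and om: "\<And>k. 0 < \<omega> k" and sub: "\<And>a b. \<omega> (a + b) \<le> A * \<omega> a * \<omega> b"
    and v: "\<And>k. \<omega> k * cmod (v k) \<le> P * g k" and u: "\<And>k. \<omega> k * cmod (u k) \<le> P * g k"
    and vu: "\<And>k. \<omega> k * cmod (v k - u k) \<le> \<mu> * X * g k"
    and w0: "\<And>k. 0 \<le> w0 k" and w0\<omega>: "\<And>k. \<mu> * w0 k \<le> \<omega> k"
begin

text \<open>
  Bounds for one factor of a product: \<open>p h\<close> for the two competing values \<open>x\<close> and \<open>y\<close>, and \<open>w h\<close> for their
  difference.
\<close>

definition slot :: "(int \<Rightarrow> complex) \<Rightarrow> (int \<Rightarrow> complex) \<Rightarrow> real \<Rightarrow> real \<Rightarrow> (int \<Rightarrow> real) \<Rightarrow> bool" where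
  "slot x y p w h \<longleftrightarrow> 0 \<le> p \<and> 0 \<le> w \<and> (\<forall>k. 0 \<le> h k) \<and>
     (\<forall>k. \<omega> k * cmod (x k) \<le> p * h k \<and> \<omega> k * cmod (y k) \<le> p * h k \<and> \<omega> k * cmod (x k - y k) \<le> w * h k)"

definition D where "D = A ^ 3 * P ^ 3"

lemma slot_vu: "slot v u P (\<mu> * X) g"
  unfolding slot_def using v u vu P X mu pos by auto

lemma prod2:
  assumes "slot x1 y1 p1 w1 h1" "slot x2 y2 p2 w2 h2"
  shows "\<omega> (a + b) * cmod (x1 a * x2 b - y1 a * y2 b) \<le> A * (w1 * p2 + p1 * w2) * (h1 a * h2 b)"
    "\<omega> (a + b) * cmod (x1 a * x2 b) \<le> A * (p1 * p2) * (h1 a * h2 b)"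
    "\<omega> (a + b) * cmod (y1 a * y2 b) \<le> A * (p1 * p2) * (h1 a * h2 b)"
proof -
  note s = assms[unfolded slot_def]
  have step: "\<omega> (a + b) * cmod (e * f) \<le> A * (p * q)"
    if "\<omega> a * cmod e \<le> p" "\<omega> b * cmod f \<le> q" for e f p q
  proof -
    have "\<omega> (a + b) * cmod (e * f) \<le> A * \<omega> a * \<omega> b * cmod (e * f)"
      by (intro mult_right_mono sub) auto
    also have "\<dots> = A * ((\<omega> a * cmod e) * (\<omega> b * cmod f))" by (simp add: norm_mult)
    also have "\<dots> \<le> A * (p * q)"
      using that A om[of a] om[of b] by (intro mult_left_mono mult_mono order_trans[OF _ that(1)]) auto
    finally show ?thesis .
  qed
  show "\<omega> (a + b) * cmod (x1 a * x2 b) \<le> A * (p1 * p2) * (h1 a * h2 b)"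
    using step[of "x1 a" "p1 * h1 a" "x2 b" "p2 * h2 b"] s by (simp add: mult_ac)
  show "\<omega> (a + b) * cmod (y1 a * y2 b) \<le> A * (p1 * p2) * (h1 a * h2 b)"
    using step[of "y1 a" "p1 * h1 a" "y2 b" "p2 * h2 b"] s by (simp add: mult_ac)
  have "x1 a * x2 b - y1 a * y2 b = (x1 a - y1 a) * x2 b + y1 a * (x2 b - y2 b)" by (simp add: algebra_simps)
  then have "cmod (x1 a * x2 b - y1 a * y2 b) \<le> cmod ((x1 a - y1 a) * x2 b) + cmod (y1 a * (x2 b - y2 b))"
    by (metis norm_triangle_ineq)
  then have "\<omega> (a + b) * cmod (x1 a * x2 b - y1 a * y2 b)
      \<le> \<omega> (a + b) * (cmod ((x1 a - y1 a) * x2 b) + cmod (y1 a * (x2 b - y2 b)))"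
    by (rule mult_left_mono[OF _ less_imp_le[OF om]])
  also have "\<dots> \<le> A * ((w1 * h1 a) * (p2 * h2 b)) + A * ((p1 * h1 a) * (w2 * h2 b))"
    unfolding distrib_left using s by (intro add_mono step) auto
  finally show "\<omega> (a + b) * cmod (x1 a * x2 b - y1 a * y2 b) \<le> A * (w1 * p2 + p1 * w2) * (h1 a * h2 b)"
    by (simp add: algebra_simps)
qed

text \<open>
  The telescoping difference of products: one factor carries the difference, the others their bounds.
\<close>

lemma prod3:
  assumes 1: "slot x1 y1 p1 w1 h1" and 2: "slot x2 y2 p2 w2 h2" and 3: "slot x3 y3 p3 w3 h3" and k: "k = a + b + c"
  shows "\<omega> k * cmod (x1 a * x2 b * x3 c - y1 a * y2 b * y3 c)
    \<le> A\<^sup>2 * (w1 * p2 * p3 + p1 * w2 * p3 + p1 * p2 * w3) * (h1 a * h2 b * h3 c)"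
proof -
  note s = 1[unfolded slot_def] 2[unfolded slot_def] 3[unfolded slot_def]
  have step: "\<omega> k * cmod (e * f) \<le> A * (p * q)"
    if "\<omega> (a + b) * cmod e \<le> p" "\<omega> c * cmod f \<le> q" for e f p q
  proof -
    have "\<omega> k * cmod (e * f) \<le> A * \<omega> (a + b) * \<omega> c * cmod (e * f)"
      unfolding k by (intro mult_right_mono sub) auto
    also have "\<dots> = A * ((\<omega> (a + b) * cmod e) * (\<omega> c * cmod f))" by (simp add: norm_mult)
    also have "\<dots> \<le> A * (p * q)"
      using that A om[of "a + b"] om[of c] by (intro mult_left_mono mult_mono order_trans[OF _ that(1)]) auto
    finally show ?thesis .
  qed
  have "x1 a * x2 b * x3 c - y1 a * y2 b * y3 c
     = (x1 a * x2 b - y1 a * y2 b) * x3 c + y1 a * y2 b * (x3 c - y3 c)" by (simp add: algebra_simps)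
  then have "cmod (x1 a * x2 b * x3 c - y1 a * y2 b * y3 c)
     \<le> cmod ((x1 a * x2 b - y1 a * y2 b) * x3 c) + cmod (y1 a * y2 b * (x3 c - y3 c))"
    by (metis norm_triangle_ineq)
  then have "\<omega> k * cmod (x1 a * x2 b * x3 c - y1 a * y2 b * y3 c)
     \<le> \<omega> k * (cmod ((x1 a * x2 b - y1 a * y2 b) * x3 c) + cmod (y1 a * y2 b * (x3 c - y3 c)))"
    by (rule mult_left_mono[OF _ less_imp_le[OF om]])
  also have "\<dots> = \<omega> k * cmod ((x1 a * x2 b - y1 a * y2 b) * x3 c) + \<omega> k * cmod (y1 a * y2 b * (x3 c - y3 c))"
    by (rule distrib_left)
  also have "\<dots> \<le> A * ((A * (w1 * p2 + p1 * w2) * (h1 a * h2 b)) * (p3 * h3 c)) + A * ((A * (p1 * p2) * (h1 a * h2 b)) * (w3 * h3 c))"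
    using s by (intro add_mono step prod2[OF 1 2]) auto
  finally show ?thesis by (simp add: algebra_simps power2_eq_square)
qed

text \<open>
  A convolution of two factors is only bounded and not square-summable, whence the constant majorant \<open>1\<close>.
\<close>

lemma slot_fin_conv: "slot (fin_conv I v) (fin_conv I u) (A * P\<^sup>2) (2 * A * P * (\<mu> * X)) (\<lambda>_. 1)"
proof -
  have *: "\<omega> k * cmod (\<Sum>a\<in>I. f a) \<le> C"
    if "\<And>a. a \<in> I \<Longrightarrow> \<omega> k * cmod (f a) \<le> C * (g a * g (k - a))" and C: "0 \<le> C" for k f C
  proof -
    have "\<omega> k * cmod (\<Sum>a\<in>I. f a) \<le> \<omega> k * (\<Sum>a\<in>I. cmod (f a))"
      by (intro mult_left_mono norm_sum less_imp_le om)
    also have "\<dots> = (\<Sum>a\<in>I. \<omega> k * cmod (f a))" by (simp add: sum_distrib_left)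
    also have "\<dots> \<le> (\<Sum>a\<in>I. C * (g a * g (k - a)))" by (intro sum_mono that)
    also have "\<dots> = C * (\<Sum>a\<in>I. g a * g (k - a))" by (simp add: sum_distrib_left)
    also have "\<dots> \<le> C * 1" by (intro mult_left_mono conv_le fin C)
    finally show ?thesis by simp
  qed
  have "0 \<le> A * P\<^sup>2" "0 \<le> 2 * A * P * (\<mu> * X)" using A P mu X by auto
  moreover have "\<omega> k * cmod (fin_conv I v k) \<le> A * P\<^sup>2" for k
    unfolding fin_conv_def using prod2(2)[OF slot_vu slot_vu, of a "k - a" for a] A
    by (intro *) (auto simp: power2_eq_square)
  moreover have "\<omega> k * cmod (fin_conv I u k) \<le> A * P\<^sup>2" for k
    unfolding fin_conv_def using prod2(3)[OF slot_vu slot_vu, of a "k - a" for a] A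
    by (intro *) (auto simp: power2_eq_square)
  moreover have "\<omega> k * cmod (fin_conv I v k - fin_conv I u k) \<le> 2 * A * P * (\<mu> * X)" for k
    unfolding fin_conv_def sum_subtractf[symmetric] using prod2(1)[OF slot_vu slot_vu, of a "k - a" for a] A P mu X
    by (intro *) (auto simp: algebra_simps)
  ultimately show ?thesis unfolding slot_def by auto
qed

lemma D1: "1 \<le> A" "1 \<le> P" "1 \<le> D" "A * P \<le> D" "A\<^sup>2 * P\<^sup>2 \<le> D"
proof -
  have a: "1 \<le> A" "1 \<le> P" using A P .
  have "1 * 1 \<le> A * P" using a by (intro mult_mono) auto
  then have b: "1 \<le> A * P" by simp
  have D: "D = (A * P) ^ 3" by (simp add: D_def power_mult_distrib)
  show "1 \<le> D" unfolding D using b by (rule one_le_power)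
  show "A * P \<le> D" unfolding D using b power_increasing[of 1 3 "A * P"] by simp
  show "A\<^sup>2 * P\<^sup>2 \<le> D" unfolding D power_mult_distrib[symmetric] using b power_increasing[of 2 3 "A * P"] by simp
qed (use A P in auto)

lemma lift:
  assumes "\<omega> k * z \<le> 4 * D * (\<mu> * X) * y" "0 \<le> z"
  shows "w0 k * z \<le> 4 * D * X * y"
proof -
  have "\<mu> * (w0 k * z) \<le> \<omega> k * z"
    using mult_right_mono[OF w0\<omega> assms(2), of k] by (simp add: mult_ac)
  also note assms(1)
  finally have "\<mu> * (w0 k * z) \<le> \<mu> * (4 * D * X * y)" by (simp add: mult_ac)
  then show ?thesis using mu by simp
qed

lemma fin_conv_diff: "w0 k * cmod (fin_conv I v k - fin_conv I u k) \<le> 4 * D * X"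
proof -
  have "\<omega> k * cmod (fin_conv I v k - fin_conv I u k) \<le> 2 * (A * P) * (\<mu> * X)"
    using slot_fin_conv unfolding slot_def by (simp add: mult_ac)
  also have "\<dots> \<le> 4 * D * (\<mu> * X)" using D1 mu X by (intro mult_right_mono) auto
  finally show ?thesis using lift[of k _ 1] by simp
qed

lemma sum3_diff:
  assumes J: "finite J"
    and t: "\<And>a b. (a,b) \<in> J \<Longrightarrow> \<omega> k * cmod (f a b - f' a b) \<le> 4 * D * (\<mu> * X) * h a b"
    and m: "\<And>a b. (a,b) \<in> J \<Longrightarrow> h a b * cmod (m a b) \<le> y a b"
  shows "w0 k * cmod ((\<Sum>(a,b)\<in>J. f a b * m a b) - (\<Sum>(a,b)\<in>J. f' a b * m a b)) \<le> 4 * D * X * (\<Sum>(a,b)\<in>J. y a b)"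
proof (rule lift)
  have c: "0 \<le> 4 * D * (\<mu> * X)" using D1 mu X by auto
  have "(\<Sum>(a,b)\<in>J. f a b * m a b) - (\<Sum>(a,b)\<in>J. f' a b * m a b) = (\<Sum>(a,b)\<in>J. (f a b - f' a b) * m a b)"
    by (simp add: sum_subtractf[symmetric] case_prod_beta algebra_simps)
  then have "\<omega> k * cmod ((\<Sum>(a,b)\<in>J. f a b * m a b) - (\<Sum>(a,b)\<in>J. f' a b * m a b))
     \<le> \<omega> k * (\<Sum>(a,b)\<in>J. cmod ((f a b - f' a b) * m a b))"
    by (simp add: case_prod_beta less_imp_le om mult_left_mono norm_sum)
  also have "\<dots> = (\<Sum>(a,b)\<in>J. \<omega> k * cmod (f a b - f' a b) * cmod (m a b))"
    by (simp add: sum_distrib_left case_prod_beta norm_mult mult_ac)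
  also have "\<dots> \<le> (\<Sum>(a,b)\<in>J. 4 * D * (\<mu> * X) * y a b)"
  proof (intro sum_mono, clarify)
    fix a b assume ab: "(a,b) \<in> J"
    have "\<omega> k * cmod (f a b - f' a b) * cmod (m a b) \<le> 4 * D * (\<mu> * X) * h a b * cmod (m a b)"
      by (intro mult_right_mono t ab) auto
    also have "\<dots> = 4 * D * (\<mu> * X) * (h a b * cmod (m a b))" by simp
    also have "\<dots> \<le> 4 * D * (\<mu> * X) * y a b" by (intro mult_left_mono m ab c)
    finally show "\<omega> k * cmod (f a b - f' a b) * cmod (m a b) \<le> 4 * D * (\<mu> * X) * y a b" .
  qed
  finally show "\<omega> k * cmod ((\<Sum>(a,b)\<in>J. f a b * m a b) - (\<Sum>(a,b)\<in>J. f' a b * m a b))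
     \<le> 4 * D * (\<mu> * X) * (\<Sum>(a,b)\<in>J. y a b)"
    by (simp add: sum_distrib_left case_prod_beta)
qed auto

lemma t_vvv: "\<omega> k * cmod (v a * v b * v (k - a - b) - u a * u b * u (k - a - b)) \<le> 4 * D * (\<mu> * X) * (g a * g b * g (k - a - b))"
proof -
  have "\<omega> k * cmod (v a * v b * v (k - a - b) - u a * u b * u (k - a - b))
    \<le> A\<^sup>2 * (\<mu> * X * P * P + P * (\<mu> * X) * P + P * P * (\<mu> * X)) * (g a * g b * g (k - a - b))"
    by (rule prod3[OF slot_vu slot_vu slot_vu]) simp
  also have "\<dots> = 3 * (A\<^sup>2 * P\<^sup>2) * (\<mu> * X) * (g a * g b * g (k - a - b))"
    by (simp add: power2_eq_square algebra_simps)
  also have "\<dots> \<le> 4 * D * (\<mu> * X) * (g a * g b * g (k - a - b))"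
    using D1 mu X pos by (intro mult_right_mono mult_mono) auto
  finally show ?thesis .
qed

lemma t_q:
  "\<omega> k * cmod (fin_conv I v a * v b * v (k - a - b) - fin_conv I u a * u b * u (k - a - b)) \<le> 4 * D * (\<mu> * X) * (g b * g (k - a - b))"
  "\<omega> k * cmod (v a * fin_conv I v b * v (k - a - b) - u a * fin_conv I u b * u (k - a - b)) \<le> 4 * D * (\<mu> * X) * (g a * g (k - a - b))"
  "\<omega> k * cmod (v a * v b * fin_conv I v (k - a - b) - u a * u b * fin_conv I u (k - a - b)) \<le> 4 * D * (\<mu> * X) * (g a * g b)"
  using prod3[OF slot_fin_conv slot_vu slot_vu, of k a b "k - a - b"]
    prod3[OF slot_vu slot_fin_conv slot_vu, of k a b "k - a - b"]
    prod3[OF slot_vu slot_vu slot_fin_conv, of k a b "k - a - b"]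
  by (simp_all add: D_def power2_eq_square power3_eq_cube algebra_simps)

lemma cubic_phase_inv': "(a,b) \<in> nonresonant I k \<Longrightarrow> 1 / cmod (cubic_phase \<epsilon> k a b) \<le> inv_abs (a + b) * inv_abs (k - b) * inv_abs (k - a)"
  using nz by (intro cubic_phase_inv) (auto simp: nonresonant_def)

text \<open>
  The extra factor \<open>|k|\<close> is spent on \<open>1 / (|a| |k - a|)\<close> by partial fractions.
\<close>

lemma nf_cubic_diff:
  "\<bar>real_of_int k\<bar> * (w0 k * cmod (nf_cubic \<epsilon> I v k - nf_cubic \<epsilon> I u k))
    \<le> 4 * D * X * (\<Sum>(a,b)\<in>nonresonant I k. (g a * g b * inv_abs (k - b)) * ((inv_abs a + inv_abs (k - a)) * inv_abs (a + b)))"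
proof (cases "k = 0")
  case True
  then show ?thesis using D1 X pos by (auto intro!: mult_nonneg_nonneg sum_nonneg)
next
  case k: False
  have "w0 k * cmod ((\<Sum>(a,b)\<in>nonresonant I k. v a * v b * v (k - a - b) * (1 / (of_int a * cubic_phase \<epsilon> k a b)))
     - (\<Sum>(a,b)\<in>nonresonant I k. u a * u b * u (k - a - b) * (1 / (of_int a * cubic_phase \<epsilon> k a b))))
    \<le> 4 * D * X * (\<Sum>(a,b)\<in>nonresonant I k. (g a * g b * inv_abs (k - b)) * ((inv_abs a + inv_abs (k - a)) * inv_abs (a + b)) / \<bar>real_of_int k\<bar>)"
  proof (rule sum3_diff[OF finite_nonresonant[OF fin] t_vvv])
    fix a b assume ab: "(a,b) \<in> nonresonant I k"
    have "cmod (1 / (of_int a * cubic_phase \<epsilon> k a b)) = inv_abs a * (1 / cmod (cubic_phase \<epsilon> k a b))"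
      by (simp add: inv_abs_def norm_divide norm_mult)
    also have "\<dots> \<le> inv_abs a * (inv_abs (a + b) * inv_abs (k - b) * inv_abs (k - a))"
      by (intro mult_left_mono cubic_phase_inv' ab) auto
    also have "\<dots> = (\<bar>real_of_int (a + (k - a))\<bar> * (inv_abs a * inv_abs (k - a))) * inv_abs (a + b) * inv_abs (k - b) / \<bar>real_of_int k\<bar>"
      using k by simp
    also have "\<dots> \<le> (inv_abs a + inv_abs (k - a)) * inv_abs (a + b) * inv_abs (k - b) / \<bar>real_of_int k\<bar>"
      by (intro divide_right_mono mult_right_mono inv_abs_split) auto
    finally have "cmod (1 / (of_int a * cubic_phase \<epsilon> k a b)) \<le> (inv_abs a + inv_abs (k - a)) * inv_abs (a + b) * inv_abs (k - b) / \<bar>real_of_int k\<bar>" .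
    then have "g a * g b * g (k - a - b) * cmod (1 / (of_int a * cubic_phase \<epsilon> k a b)) \<le>
        g a * g b * 1 * ((inv_abs a + inv_abs (k - a)) * inv_abs (a + b) * inv_abs (k - b) / \<bar>real_of_int k\<bar>)"
      by (intro mult_mono le1) (auto simp: pos)
    then show "g a * g b * g (k - a - b) * cmod (1 / (of_int a * cubic_phase \<epsilon> k a b))
       \<le> g a * g b * inv_abs (k - b) * ((inv_abs a + inv_abs (k - a)) * inv_abs (a + b)) / \<bar>real_of_int k\<bar>"
      by (simp add: mult_ac)
  qed
  then have "w0 k * cmod (nf_cubic \<epsilon> I v k - nf_cubic \<epsilon> I u k) \<le>
      4 * D * X * ((\<Sum>(a,b)\<in>nonresonant I k. (g a * g b * inv_abs (k - b)) * ((inv_abs a + inv_abs (k - a)) * inv_abs (a + b))) / \<bar>real_of_int k\<bar>)"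
    by (simp add: nf_cubic_def case_prod_beta sum_divide_distrib)
  then have "\<bar>real_of_int k\<bar> * (w0 k * cmod (nf_cubic \<epsilon> I v k - nf_cubic \<epsilon> I u k)) \<le> \<bar>real_of_int k\<bar> *
      (4 * D * X * ((\<Sum>(a,b)\<in>nonresonant I k. (g a * g b * inv_abs (k - b)) * ((inv_abs a + inv_abs (k - a)) * inv_abs (a + b))) / \<bar>real_of_int k\<bar>))"
    by (intro mult_left_mono) auto
  then show ?thesis using k by simp
qed

lemma nf_quad_diff:
  "\<bar>real_of_int k\<bar> * (w0 k * cmod (nf_quad I v k - nf_quad I u k)) \<le> 4 * D * X * (\<Sum>a\<in>I. g a * g (k - a) * (inv_abs a + inv_abs (k - a)))"
proof -
  have c: "0 \<le> 4 * D * (\<mu> * X)" using D1 mu X by auto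
  have "\<omega> k * (\<bar>real_of_int k\<bar> * cmod (nf_quad I v k - nf_quad I u k))
     \<le> \<omega> k * (\<bar>real_of_int k\<bar> * (\<Sum>a\<in>I. cmod ((v a * v (k - a) - u a * u (k - a)) / (of_int a * of_int (k - a)))))"
    unfolding nf_quad_def sum_subtractf[symmetric] diff_divide_distrib
    by (intro mult_left_mono norm_sum abs_ge_zero less_imp_le[OF om])
  also have "\<dots> = (\<Sum>a\<in>I. (\<omega> (a + (k - a)) * cmod (v a * v (k - a) - u a * u (k - a))) * (\<bar>real_of_int (a + (k - a))\<bar> * (inv_abs a * inv_abs (k - a))))"
    by (simp add: sum_distrib_left norm_divide norm_mult inv_abs_def mult_ac del: of_int_diff)
  also have "\<dots> \<le> (\<Sum>a\<in>I. (4 * D * (\<mu> * X) * (g a * g (k - a))) * (inv_abs a + inv_abs (k - a)))"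
  proof (intro sum_mono mult_mono[OF _ inv_abs_split])
    fix a
    have "\<omega> (a + (k - a)) * cmod (v a * v (k - a) - u a * u (k - a)) \<le> 2 * (A * P) * (\<mu> * X) * (g a * g (k - a))"
      using prod2(1)[OF slot_vu slot_vu, of a "k - a"] by (simp add: algebra_simps)
    also have "\<dots> \<le> 4 * D * (\<mu> * X) * (g a * g (k - a))"
      using D1 mu X pos by (intro mult_right_mono mult_mono) auto
    finally show "\<omega> (a + (k - a)) * cmod (v a * v (k - a) - u a * u (k - a)) \<le> 4 * D * (\<mu> * X) * (g a * g (k - a))" .
    show "0 \<le> 4 * D * (\<mu> * X) * (g a * g (k - a))" using c pos by auto
  qed auto
  also have "\<dots> = 4 * D * (\<mu> * X) * (\<Sum>a\<in>I. g a * g (k - a) * (inv_abs a + inv_abs (k - a)))"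
    unfolding sum_distrib_left by (simp only: mult.assoc)
  finally have "w0 k * (\<bar>real_of_int k\<bar> * cmod (nf_quad I v k - nf_quad I u k)) \<le> 4 * D * X * (\<Sum>a\<in>I. g a * g (k - a) * (inv_abs a + inv_abs (k - a)))"
    by (rule lift) auto
  then show ?thesis by (simp add: mult_ac)
qed

text \<open>
  On the two resonant lines \<open>b = - a\<close> and \<open>b = k\<close> the cubic sum degenerates to \<open>v\<^sub>k\<close> or its reflection
  times a single sum, which is bounded by the \<open>\<ell>^2\<close> norm; there is no loss to compensate.
\<close>

lemma resonant_sum_diff: "w0 k * cmod (resonant_sum I v k - resonant_sum I u k) \<le> 4 * D * X * (2 * g k)"
proof -
  have "w0 k * cmod ((\<Sum>(a,b)\<in>resonant I k. v a * v b * v (k - a - b) * (1 / of_int a))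
     - (\<Sum>(a,b)\<in>resonant I k. u a * u b * u (k - a - b) * (1 / of_int a)))
    \<le> 4 * D * X * (\<Sum>(a,b)\<in>resonant I k. g a * g b * g (k - a - b))"
  proof (rule sum3_diff[OF finite_resonant[OF fin] t_vvv])
    fix a b
    have "cmod (1 / of_int a) = inv_abs a" by (simp add: inv_abs_def norm_divide)
    then have "cmod (1 / of_int a) \<le> 1" by simp
    then have "g a * g b * g (k - a - b) * cmod (1 / of_int a) \<le> g a * g b * g (k - a - b) * 1"
      by (intro mult_left_mono) (auto simp: pos)
    then show "g a * g b * g (k - a - b) * cmod (1 / of_int a) \<le> g a * g b * g (k - a - b)" by simp
  qed
  also have "(\<Sum>(a,b)\<in>resonant I k. g a * g b * g (k - a - b)) \<le> 2 * g k"
  proof -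
    have "(\<Sum>(a,b)\<in>resonant I k. g a * g b * g (k - a - b)) \<le> (\<Sum>(a,b)\<in>(\<lambda>a. (a, - a)) ` I \<union> (\<lambda>a. (a, k)) ` I. g a * g b * g (k - a - b))"
      by (rule sum_mono2) (use fin pos in \<open>auto simp: resonant_def\<close>)
    also have "\<dots> \<le> (\<Sum>(a,b)\<in>(\<lambda>a. (a, - a)) ` I. g a * g b * g (k - a - b)) + (\<Sum>(a,b)\<in>(\<lambda>a. (a, k)) ` I. g a * g b * g (k - a - b))"
      by (subst sum_Un) (use fin pos in \<open>auto intro!: sum_nonneg\<close>)
    also have "\<dots> = (\<Sum>a\<in>I. g a * g (0 - a)) * g k + (\<Sum>a\<in>I. g a * g (0 - a)) * g k"
      by (simp add: sum.reindex inj_on_def sum_distrib_left mult_ac)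
    also have "\<dots> \<le> 1 * g k + 1 * g k" by (intro add_mono mult_right_mono conv_le fin pos)
    finally show ?thesis by simp
  qed
  finally show ?thesis using D1 X by (simp add: resonant_sum_def mult_left_mono)
qed

lemma Q_diff:
  "w0 k * cmod (nf_quartic1 \<epsilon> I v k - nf_quartic1 \<epsilon> I u k) \<le> 4 * D * X *
     (\<Sum>(a,b)\<in>nonresonant I k. (g b * g (k - a - b) * inv_abs (k - b)) * (inv_abs (a + b) * inv_abs (k - a)))"
  "w0 k * cmod (nf_quartic2 \<epsilon> I v k - nf_quartic2 \<epsilon> I u k) \<le> 4 * D * X *
     (\<Sum>(a,b)\<in>nonresonant I k. (g a * g (k - a - b) * inv_abs (k - a)) * (inv_abs (k - b) * (inv_abs a + inv_abs (a + b))))"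
  "w0 k * cmod (nf_quartic3 \<epsilon> I v k - nf_quartic3 \<epsilon> I u k) \<le> 4 * D * X *
     (\<Sum>(a,b)\<in>nonresonant I k. (g a * g b * inv_abs (k - a)) * (inv_abs (a + b) * (inv_abs (k - b) + inv_abs a)))"
proof -
  show "w0 k * cmod (nf_quartic1 \<epsilon> I v k - nf_quartic1 \<epsilon> I u k) \<le> 4 * D * X *
     (\<Sum>(a,b)\<in>nonresonant I k. (g b * g (k - a - b) * inv_abs (k - b)) * (inv_abs (a + b) * inv_abs (k - a)))"
    unfolding nf_quartic1_def
  proof (rule sum3_diff[OF finite_nonresonant[OF fin] t_q(1)])
    fix a b assume ab: "(a,b) \<in> nonresonant I k"
    have "g b * g (k - a - b) * (1 / cmod (cubic_phase \<epsilon> k a b)) \<le> g b * g (k - a - b) * (inv_abs (a + b) * inv_abs (k - b) * inv_abs (k - a))"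
      by (intro mult_left_mono cubic_phase_inv' ab) (auto simp: pos)
    then show "g b * g (k - a - b) * cmod (\<i> / cubic_phase \<epsilon> k a b) \<le> g b * g (k - a - b) * inv_abs (k - b) * (inv_abs (a + b) * inv_abs (k - a))"
      by (simp add: norm_divide mult_ac)
  qed
  show "w0 k * cmod (nf_quartic2 \<epsilon> I v k - nf_quartic2 \<epsilon> I u k) \<le> 4 * D * X *
     (\<Sum>(a,b)\<in>nonresonant I k. (g a * g (k - a - b) * inv_abs (k - a)) * (inv_abs (k - b) * (inv_abs a + inv_abs (a + b))))"
    unfolding nf_quartic2_def
  proof (rule sum3_diff[OF finite_nonresonant[OF fin] t_q(2)])
    fix a b assume ab: "(a,b) \<in> nonresonant I k"
    have "cmod (\<i> * of_int b / (of_int a * cubic_phase \<epsilon> k a b)) = \<bar>real_of_int b\<bar> * inv_abs a * (1 / cmod (cubic_phase \<epsilon> k a b))"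
      by (simp add: inv_abs_def norm_divide norm_mult)
    also have "\<dots> \<le> \<bar>real_of_int b\<bar> * inv_abs a * (inv_abs (a + b) * inv_abs (k - b) * inv_abs (k - a))"
      by (intro mult_left_mono cubic_phase_inv' ab) auto
    also have "\<dots> = (\<bar>real_of_int (- a + (a + b))\<bar> * (inv_abs (- a) * inv_abs (a + b))) * (inv_abs (k - b) * inv_abs (k - a))" by simp
    also have "\<dots> \<le> (inv_abs (- a) + inv_abs (a + b)) * (inv_abs (k - b) * inv_abs (k - a))"
      by (intro mult_right_mono inv_abs_split) auto
    finally have "g a * g (k - a - b) * cmod (\<i> * of_int b / (of_int a * cubic_phase \<epsilon> k a b)) \<le>
        g a * g (k - a - b) * ((inv_abs a + inv_abs (a + b)) * (inv_abs (k - b) * inv_abs (k - a)))"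
      by (intro mult_left_mono) (auto simp: pos)
    then show "g a * g (k - a - b) * cmod (\<i> * of_int b / (of_int a * cubic_phase \<epsilon> k a b))
        \<le> g a * g (k - a - b) * inv_abs (k - a) * (inv_abs (k - b) * (inv_abs a + inv_abs (a + b)))" by (simp add: mult_ac)
  qed
  show "w0 k * cmod (nf_quartic3 \<epsilon> I v k - nf_quartic3 \<epsilon> I u k) \<le> 4 * D * X *
     (\<Sum>(a,b)\<in>nonresonant I k. (g a * g b * inv_abs (k - a)) * (inv_abs (a + b) * (inv_abs (k - b) + inv_abs a)))"
    unfolding nf_quartic3_def
  proof (rule sum3_diff[OF finite_nonresonant[OF fin] t_q(3)])
    fix a b assume ab: "(a,b) \<in> nonresonant I k"
    have "cmod ((if k - a - b \<in> I then \<i> * of_int (k - a - b) else 0) / (of_int a * cubic_phase \<epsilon> k a b))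
      \<le> \<bar>real_of_int (k - a - b)\<bar> * inv_abs a * (1 / cmod (cubic_phase \<epsilon> k a b))"
      by (simp add: inv_abs_def norm_divide norm_mult del: of_int_diff)
    also have "\<dots> \<le> \<bar>real_of_int (k - a - b)\<bar> * inv_abs a * (inv_abs (a + b) * inv_abs (k - b) * inv_abs (k - a))"
      by (intro mult_left_mono cubic_phase_inv' ab) auto
    also have "\<dots> = (\<bar>real_of_int (- a + (k - b))\<bar> * (inv_abs (- a) * inv_abs (k - b))) * (inv_abs (a + b) * inv_abs (k - a))" by (simp add: algebra_simps)
    also have "\<dots> \<le> (inv_abs (- a) + inv_abs (k - b)) * (inv_abs (a + b) * inv_abs (k - a))"
      by (intro mult_right_mono inv_abs_split) auto
    finally have "g a * g b * cmod ((if k - a - b \<in> I then \<i> * of_int (k - a - b) else 0) / (of_int a * cubic_phase \<epsilon> k a b)) \<le>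
        g a * g b * ((inv_abs a + inv_abs (k - b)) * (inv_abs (a + b) * inv_abs (k - a)))"
      by (intro mult_left_mono) (auto simp: pos)
    then show "g a * g b * cmod ((if k - a - b \<in> I then \<i> * of_int (k - a - b) else 0) / (of_int a * cubic_phase \<epsilon> k a b))
        \<le> g a * g b * inv_abs (k - a) * (inv_abs (a + b) * (inv_abs (k - b) + inv_abs a))" by (simp add: mult_ac add.commute)
  qed
qed

lemma nonresonant_sub: "nonresonant I k \<subseteq> I \<times> I" by (auto simp: nonresonant_def)

lemma sum_sq_scaled:
  assumes "\<And>k. k \<in> S \<Longrightarrow> 0 \<le> x k" "\<And>k. k \<in> S \<Longrightarrow> x k \<le> c * y k" "(\<Sum>k\<in>S. (y k)\<^sup>2) \<le> (B::real)"
  shows "(\<Sum>k\<in>S. (x k)\<^sup>2) \<le> c\<^sup>2 * B"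
proof -
  have "(\<Sum>k\<in>S. (x k)\<^sup>2) \<le> (\<Sum>k\<in>S. c\<^sup>2 * (y k)\<^sup>2)"
    unfolding power_mult_distrib[symmetric] by (intro sum_mono power_mono assms)
  also have "\<dots> = c\<^sup>2 * (\<Sum>k\<in>S. (y k)\<^sup>2)" by (simp add: sum_distrib_left)
  also have "\<dots> \<le> c\<^sup>2 * B" by (intro mult_left_mono assms) auto
  finally show ?thesis .
qed

text \<open>
  The corrections in the normal form gain one power of \<open>|k|\<close>.
\<close>

lemma boundary_est:
  "(\<Sum>k\<in>I. (\<bar>real_of_int k\<bar> * (w0 k * cmod ((normal_form \<epsilon> I v k - v k) - (normal_form \<epsilon> I u k - u k))))\<^sup>2) \<le> 33280 * D\<^sup>2 * X\<^sup>2"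
proof -
  define \<beta> where "\<beta> k = (\<Sum>a\<in>I. g a * g (k - a) * (inv_abs a + inv_abs (k - a)))" for k
  define \<gamma> where "\<gamma> k = (\<Sum>(a,b)\<in>nonresonant I k. (g a * g b * inv_abs (k - b)) * ((inv_abs a + inv_abs (k - a)) * inv_abs (a + b)))" for k
  have "(\<Sum>k\<in>I. (\<bar>real_of_int k\<bar> * (w0 k * cmod ((normal_form \<epsilon> I v k - v k) - (normal_form \<epsilon> I u k - u k))))\<^sup>2) \<le> (4 * D * X)\<^sup>2 * 2080"
  proof (rule sum_sq_scaled)
    fix k
    have "(normal_form \<epsilon> I v k - v k) - (normal_form \<epsilon> I u k - u k) = nf_coeff \<epsilon> k * (2 * \<i> * (nf_cubic \<epsilon> I v k - nf_cubic \<epsilon> I u k) - (nf_quad I v k - nf_quad I u k))"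
      unfolding normal_form_def by (simp add: algebra_simps)
    then have "cmod ((normal_form \<epsilon> I v k - v k) - (normal_form \<epsilon> I u k - u k)) \<le> 1 * cmod (2 * \<i> * (nf_cubic \<epsilon> I v k - nf_cubic \<epsilon> I u k) - (nf_quad I v k - nf_quad I u k))"
      by (simp only: norm_mult) (intro mult_right_mono nf_coeff_le norm_ge_zero)
    also have "\<dots> \<le> 1 * (2 * cmod (nf_cubic \<epsilon> I v k - nf_cubic \<epsilon> I u k) + cmod (nf_quad I v k - nf_quad I u k))"
      using norm_triangle_ineq4[of "2 * \<i> * (nf_cubic \<epsilon> I v k - nf_cubic \<epsilon> I u k)" "nf_quad I v k - nf_quad I u k"] by (simp add: norm_mult)
    finally have "\<bar>real_of_int k\<bar> * (w0 k * cmod ((normal_form \<epsilon> I v k - v k) - (normal_form \<epsilon> I u k - u k)))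
       \<le> \<bar>real_of_int k\<bar> * (w0 k * (2 * cmod (nf_cubic \<epsilon> I v k - nf_cubic \<epsilon> I u k) + cmod (nf_quad I v k - nf_quad I u k)))"
      by (intro mult_left_mono w0) auto
    also have "\<dots> = 2 * (\<bar>real_of_int k\<bar> * (w0 k * cmod (nf_cubic \<epsilon> I v k - nf_cubic \<epsilon> I u k))) + \<bar>real_of_int k\<bar> * (w0 k * cmod (nf_quad I v k - nf_quad I u k))"
      by (simp add: algebra_simps)
    also have "\<dots> \<le> 2 * (4 * D * X * \<gamma> k) + 4 * D * X * \<beta> k"
      unfolding \<gamma>_def \<beta>_def using nf_cubic_diff[of k \<epsilon>] nf_quad_diff[of k] by (intro add_mono mult_left_mono) auto
    finally show "\<bar>real_of_int k\<bar> * (w0 k * cmod ((normal_form \<epsilon> I v k - v k) - (normal_form \<epsilon> I u k - u k))) \<le> 4 * D * X * (\<beta> k + 2 * \<gamma> k)"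
      by (simp add: algebra_simps)
    show "0 \<le> \<bar>real_of_int k\<bar> * (w0 k * cmod ((normal_form \<epsilon> I v k - v k) - (normal_form \<epsilon> I u k - u k)))"
      using w0 by auto
  next
    have "(\<beta> k + 2 * \<gamma> k)\<^sup>2 \<le> 2 * (\<beta> k)\<^sup>2 + 8 * (\<gamma> k)\<^sup>2" for k
      using zero_le_power2[of "\<beta> k - 2 * \<gamma> k"] by (simp add: power2_eq_square algebra_simps)
    then have "(\<Sum>k\<in>I. (\<beta> k + 2 * \<gamma> k)\<^sup>2) \<le> (\<Sum>k\<in>I. 2 * (\<beta> k)\<^sup>2 + 8 * (\<gamma> k)\<^sup>2)" by (intro sum_mono)
    also have "\<dots> = 2 * (\<Sum>k\<in>I. (\<beta> k)\<^sup>2) + 8 * (\<Sum>k\<in>I. (\<gamma> k)\<^sup>2)" by (simp add: sum.distrib sum_distrib_left)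
    also have "\<dots> \<le> 2 * 16 + 8 * 256"
      using bil_est[OF fin] tri_est(1)[OF fin nonresonant_sub] by (intro add_mono mult_left_mono) (auto simp: \<beta>_def \<gamma>_def)
    finally show "(\<Sum>k\<in>I. (\<beta> k + 2 * \<gamma> k)\<^sup>2) \<le> 2080" by simp
  qed
  then show ?thesis by (simp add: power_mult_distrib)
qed

text \<open>
  The remainder of the normal form is Lipschitz in the weighted space; no derivative and no \<open>\<epsilon>\<close> is left.
\<close>

lemma remainder_est:
  "(\<Sum>k\<in>I. (w0 k * cmod (nf_rest \<epsilon> I v k - nf_rest \<epsilon> I u k))\<^sup>2) \<le> 197632 * D\<^sup>2 * X\<^sup>2"
proof -
  define q1 where "q1 k = (\<Sum>(a,b)\<in>nonresonant I k. (g b * g (k - a - b) * inv_abs (k - b)) * (inv_abs (a + b) * inv_abs (k - a)))" for k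
  define q2 where "q2 k = (\<Sum>(a,b)\<in>nonresonant I k. (g a * g (k - a - b) * inv_abs (k - a)) * (inv_abs (k - b) * (inv_abs a + inv_abs (a + b))))" for k
  define q3 where "q3 k = (\<Sum>(a,b)\<in>nonresonant I k. (g a * g b * inv_abs (k - a)) * (inv_abs (a + b) * (inv_abs (k - b) + inv_abs a)))" for k
  have "(\<Sum>k\<in>I. (w0 k * cmod (nf_rest \<epsilon> I v k - nf_rest \<epsilon> I u k))\<^sup>2) \<le> (8 * D * X)\<^sup>2 * 3088"
  proof (rule sum_sq_scaled)
    fix k
    let ?a = "nf_quartic1 \<epsilon> I v k - nf_quartic1 \<epsilon> I u k" let ?b = "nf_quartic2 \<epsilon> I v k - nf_quartic2 \<epsilon> I u k" let ?c = "nf_quartic3 \<epsilon> I v k - nf_quartic3 \<epsilon> I u k"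
    let ?d = "resonant_sum I v k - resonant_sum I u k"
    have "nf_rest \<epsilon> I v k - nf_rest \<epsilon> I u k = nf_coeff \<epsilon> k * (2 * \<i> * (?a + ?b + ?c - ?d))"
      unfolding nf_rest_def by (simp add: algebra_simps)
    then have "cmod (nf_rest \<epsilon> I v k - nf_rest \<epsilon> I u k) \<le> 1 * cmod (2 * \<i> * (?a + ?b + ?c - ?d))"
      by (simp only: norm_mult) (intro mult_right_mono nf_coeff_le mult_nonneg_nonneg norm_ge_zero)
    also have "\<dots> \<le> 2 * (cmod ?a + cmod ?b + cmod ?c + cmod ?d)"
      using norm_triangle_ineq4[of "?a + ?b + ?c" ?d] norm_triangle_ineq[of "?a + ?b" ?c] norm_triangle_ineq[of ?a ?b]
      by (simp add: norm_mult)
    finally have "w0 k * cmod (nf_rest \<epsilon> I v k - nf_rest \<epsilon> I u k) \<le> w0 k * (2 * (cmod ?a + cmod ?b + cmod ?c + cmod ?d))"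
      by (intro mult_left_mono w0)
    also have "\<dots> = 2 * (w0 k * cmod ?a + w0 k * cmod ?b + w0 k * cmod ?c + w0 k * cmod ?d)" by (simp add: algebra_simps)
    also have "\<dots> \<le> 2 * (4 * D * X * q1 k + 4 * D * X * q2 k + 4 * D * X * q3 k + 4 * D * X * (2 * g k))"
      unfolding q1_def q2_def q3_def by (intro mult_left_mono add_mono Q_diff resonant_sum_diff) auto
    finally show "w0 k * cmod (nf_rest \<epsilon> I v k - nf_rest \<epsilon> I u k) \<le> 8 * D * X * (q1 k + q2 k + q3 k + 2 * g k)"
      by (simp add: algebra_simps)
    show "0 \<le> w0 k * cmod (nf_rest \<epsilon> I v k - nf_rest \<epsilon> I u k)" using w0 by auto
  next
    have 4: "(a + b + c + 2 * d)\<^sup>2 \<le> 4 * a\<^sup>2 + 4 * b\<^sup>2 + 4 * c\<^sup>2 + 16 * d\<^sup>2" for a b c d :: real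
      using zero_le_power2[of "a - b"] zero_le_power2[of "a - c"] zero_le_power2[of "a - 2 * d"]
        zero_le_power2[of "b - c"] zero_le_power2[of "b - 2 * d"] zero_le_power2[of "c - 2 * d"]
      by (simp add: power2_eq_square algebra_simps)
    have "(\<Sum>k\<in>I. (q1 k + q2 k + q3 k + 2 * g k)\<^sup>2)
       \<le> (\<Sum>k\<in>I. 4 * (q1 k)\<^sup>2 + 4 * (q2 k)\<^sup>2 + 4 * (q3 k)\<^sup>2 + 16 * (g k)\<^sup>2)" by (intro sum_mono 4)
    also have "\<dots> = 4 * (\<Sum>k\<in>I. (q1 k)\<^sup>2) + 4 * (\<Sum>k\<in>I. (q2 k)\<^sup>2) + 4 * (\<Sum>k\<in>I. (q3 k)\<^sup>2) + 16 * (\<Sum>k\<in>I. (g k)\<^sup>2)"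
      by (simp add: sum.distrib sum_distrib_left)
    also have "\<dots> \<le> 4 * 256 + 4 * 256 + 4 * 256 + 16 * 1"
      unfolding q1_def q2_def q3_def using tot
      by (intro add_mono mult_left_mono tri_est[OF fin nonresonant_sub]) auto
    finally show "(\<Sum>k\<in>I. (q1 k + q2 k + q3 k + 2 * g k)\<^sup>2) \<le> 3088" by simp
  qed
  then show ?thesis by (simp add: power_mult_distrib)
qed

end

section \<open>Energy estimate for differences of solutions\<close>

lemma norm_sq_deriv:
  fixes f :: "real \<Rightarrow> complex"
  assumes "(f has_vector_derivative f') (at t within S)"
  shows "((\<lambda>s. (cmod (f s))\<^sup>2) has_real_derivative 2 * (f t \<bullet> f')) (at t within S)"
proof -
  have f: "(f has_derivative (\<lambda>x. x *\<^sub>R f')) (at t within S)" using assms by (simp add: has_vector_derivative_def)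
  have "((\<lambda>s. f s \<bullet> f s) has_derivative (\<lambda>x. f t \<bullet> (x *\<^sub>R f') + (x *\<^sub>R f') \<bullet> f t)) (at t within S)"
    by (rule has_derivative_inner[OF f f])
  moreover have "(\<lambda>x. f t \<bullet> (x *\<^sub>R f') + (x *\<^sub>R f') \<bullet> f t) = (*) (2 * (f t \<bullet> f'))"
    by (auto simp: inner_commute)
  ultimately show ?thesis
    by (simp add: power2_norm_eq_inner has_field_derivative_def)
qed

text \<open>
  Only the sign of the real part of \<open>lam\<close> is used: dissipation may be dropped.
\<close>

lemma damped_norm_sq:
  assumes "0 \<le> \<epsilon>"
  shows "2 * (z \<bullet> (lam \<epsilon> k * z + r)) \<le> 2 * (z \<bullet> r)" "2 * (z \<bullet> (lam \<epsilon> k * z + r)) \<le> (cmod z)\<^sup>2 + (cmod r)\<^sup>2"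
proof -
  have "z \<bullet> (lam \<epsilon> k * z) = Re (lam \<epsilon> k) * (cmod z)\<^sup>2"
    unfolding cmod_power2 by (simp add: inner_complex_def algebra_simps power2_eq_square)
  also have "Re (lam \<epsilon> k) = - (\<epsilon> * (real_of_int k)\<^sup>2)"
    by (simp add: lam_def power2_eq_square power3_eq_cube)
  finally have "z \<bullet> (lam \<epsilon> k * z) \<le> 0" using assms by (simp add: mult_nonneg_nonneg)
  then show 1: "2 * (z \<bullet> (lam \<epsilon> k * z + r)) \<le> 2 * (z \<bullet> r)" by (simp add: inner_add_right)
  have "0 \<le> (norm (z - r))\<^sup>2" by simp
  then have "2 * (z \<bullet> r) \<le> (cmod z)\<^sup>2 + (cmod r)\<^sup>2"
    by (simp add: power2_norm_eq_inner inner_diff_left inner_diff_right inner_commute)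
  with 1 show "2 * (z \<bullet> (lam \<epsilon> k * z + r)) \<le> (cmod z)\<^sup>2 + (cmod r)\<^sup>2" by linarith
qed

lemma gronwall_derivative:
  fixes E :: "real \<Rightarrow> real"
  assumes d: "\<And>t. t \<in> {0..T} \<Longrightarrow> (E has_real_derivative E' t) (at t within {0..T})"
    and le: "\<And>t. t \<in> {0..T} \<Longrightarrow> E' t \<le> K * E t" and t: "t \<in> {0..T}"
  shows "E t \<le> exp (K * t) * E 0"
proof -
  define G where "G s = exp (- K * s) * E s" for s
  have dG: "(G has_real_derivative exp (- K * s) * (E' s - K * E s)) (at s within {0..T})" if "s \<in> {0..T}" for s
    unfolding G_def by (rule derivative_eq_intros d that refl | simp add: algebra_simps)+
  have "G t \<le> G 0"
  proof (cases "t = 0")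
    case False
    show ?thesis
    proof (rule DERIV_nonpos_imp_decreasing_open[of 0 t G])
      show "0 \<le> t" using t by auto
      show "\<exists>y. DERIV G x :> y \<and> y \<le> 0" if "0 < x" "x < t" for x
      proof -
        have x: "x \<in> {0<..<T}" "x \<in> {0..T}" using that t by auto
        have "(G has_real_derivative exp (- K * x) * (E' x - K * E x)) (at x within {0<..<T})"
          using dG[OF x(2)] by (rule DERIV_subset) auto
        then have "DERIV G x :> exp (- K * x) * (E' x - K * E x)"
          unfolding at_within_open[OF x(1) open_greaterThanLessThan] .
        moreover have "exp (- K * x) * (E' x - K * E x) \<le> 0"
          using le[OF x(2)] by (intro mult_nonneg_nonpos) auto
        ultimately show ?thesis by blast
      qed
      have "continuous_on {0..T} G"
        unfolding continuous_on_eq_continuous_within by (intro ballI DERIV_continuous[OF dG])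
      then show "continuous_on {0..t} G" by (rule continuous_on_subset) (use t in auto)
    qed
  qed simp
  then have "exp (K * t) * G t \<le> exp (K * t) * G 0" by (intro mult_left_mono) auto
  moreover have "exp (K * t) * G t = (exp (K * t) * exp (- K * t)) * E t" by (simp add: G_def)
  moreover have "exp (K * t) * exp (- K * t) = 1" by (simp flip: exp_add)
  moreover have "exp (K * t) * G 0 = exp (K * t) * E 0" by (simp add: G_def)
  ultimately show ?thesis by (metis mult_1)
qed

definition wsum :: "int set \<Rightarrow> (int \<Rightarrow> real) \<Rightarrow> (int \<Rightarrow> complex) \<Rightarrow> real" where
  "wsum I w f = (\<Sum>k\<in>I. (w k * cmod (f k))\<^sup>2)"

text \<open>
  The factor \<open>3\<close> leaves room for majorants \<open>g\<close> that are averages of up to three normalised sequences.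
\<close>

definition controlled where
  "controlled I A P w0 v u \<longleftrightarrow> (\<exists>g \<omega> \<mu>. weighted_pair I g \<omega> \<mu> A P (3 * sqrt (wsum I w0 (\<lambda>k. v k - u k))) w0 v u)"

lemma wsum_nonneg [simp]: "0 \<le> wsum I w f" by (simp add: wsum_def sum_nonneg)

text \<open>
  The rate is that of the Gronwall inequality for the energy in \<open>galerkin_lipschitz\<close>, with threshold
  frequency \<open>1800 (A P)^3\<close>; the factor \<open>16 = 4 * 4\<close> is the equivalence of the energy with the norm at both
  ends of the time interval.
\<close>

definition lip_const :: "real \<Rightarrow> real \<Rightarrow> real \<Rightarrow> real" where
  "lip_const A P T = 16 * exp ((1 + 4 * (576 * (1800 * (A ^ 3 * P ^ 3)) ^ 4 * (A ^ 3 * P ^ 3)\<^sup>2 + 1778688 * (A ^ 3 * P ^ 3)\<^sup>2)) * T)"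

text \<open>
  At low frequencies the derivative in the nonlinearity costs only the threshold frequency.  At high
  frequencies the normal form is used, which there is a small perturbation of the identity, so that the
  mixed energy \<open>E\<close> is equivalent to the squared norm of the difference.
\<close>

theorem galerkin_lipschitz:
  assumes fin: "finite I" and nz: "0 \<notin> I" and eps: "0 \<le> \<epsilon>"
    and offv: "\<And>s k. k \<notin> I \<Longrightarrow> v s k = 0" and offu: "\<And>s k. k \<notin> I \<Longrightarrow> u s k = 0"
    and dv: "\<And>k t. k \<in> I \<Longrightarrow> t \<in> {0..T} \<Longrightarrow> ((\<lambda>s. v s k) has_vector_derivative
        (lam \<epsilon> k * v t k + \<i> * of_int k * fin_conv I (v t) k)) (at t within {0..T})"
    and du: "\<And>k t. k \<in> I \<Longrightarrow> t \<in> {0..T} \<Longrightarrow> ((\<lambda>s. u s k) has_vector_derivative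
        (lam \<epsilon> k * u t k + \<i> * of_int k * fin_conv I (u t) k)) (at t within {0..T})"
    and ctrl: "\<And>t. t \<in> {0..T} \<Longrightarrow> controlled I A P w0 (v t) (u t)"
    and t: "t \<in> {0..T}"
  shows "wsum I w0 (\<lambda>k. v t k - u t k) \<le> lip_const A P T * wsum I w0 (\<lambda>k. v 0 k - u 0 k)"
proof -
  define D where "D = A ^ 3 * P ^ 3"
  (* Chosen so that the corrections of the normal form, which gain 1/|k|,
     have at most an eighth of the squared norm on frequencies above N. *)
  define N where "N = 1800 * D"
  define lo where "lo = {k\<in>I. \<bar>real_of_int k\<bar> \<le> N}"
  define hi where "hi = {k\<in>I. \<not> \<bar>real_of_int k\<bar> \<le> N}"
  have lohi: "finite lo" "finite hi" "lo \<subseteq> I" "hi \<subseteq> I" and disj: "lo \<inter> hi = {}" and un: "I = lo \<union> hi"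
    using fin by (auto simp: lo_def hi_def)
  have sp: "(\<Sum>k\<in>I. f k) = (\<Sum>k\<in>lo. f k) + (\<Sum>k\<in>hi. f k)" for f :: "int \<Rightarrow> real"
    unfolding un by (rule sum.union_disjoint[OF lohi(1,2) disj])
  have T0: "0 \<in> {0..T}" using t by auto
  define Xs where "Xs t = wsum I w0 (\<lambda>k. v t k - u t k)" for t
  define \<zeta> where "\<zeta> t k = normal_form \<epsilon> I (v t) k - normal_form \<epsilon> I (u t) k" for t k
  define \<eta> where "\<eta> t k = (normal_form \<epsilon> I (v t) k - v t k) - (normal_form \<epsilon> I (u t) k - u t k)" for t k
  define \<rho> where "\<rho> t k = nf_rest \<epsilon> I (v t) k - nf_rest \<epsilon> I (u t) k" for t k
  define nl where "nl t k = \<i> * of_int k * (fin_conv I (v t) k - fin_conv I (u t) k)" for t k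
  define E where "E t = (\<Sum>k\<in>lo. (w0 k)\<^sup>2 * (cmod (v t k - u t k))\<^sup>2) + (\<Sum>k\<in>hi. (w0 k)\<^sup>2 * (cmod (\<zeta> t k))\<^sup>2)" for t
  define E' where "E' t = (\<Sum>k\<in>lo. (w0 k)\<^sup>2 * (2 * ((v t k - u t k) \<bullet> (lam \<epsilon> k * (v t k - u t k) + nl t k))))
      + (\<Sum>k\<in>hi. (w0 k)\<^sup>2 * (2 * (\<zeta> t k \<bullet> (lam \<epsilon> k * \<zeta> t k + \<rho> t k))))" for t
  have dE: "(E has_real_derivative E' t) (at t within {0..T})" if t: "t \<in> {0..T}" for t
  proof -
    have 1: "((\<lambda>s. v s k - u s k) has_vector_derivative (lam \<epsilon> k * (v t k - u t k) + nl t k)) (at t within {0..T})" if "k \<in> I" for k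
      by (rule has_vector_derivative_eq_rhs[OF has_vector_derivative_diff[OF dv[OF that t] du[OF that t]]])
        (simp add: nl_def algebra_simps)
    have 2: "((\<lambda>s. \<zeta> s k) has_vector_derivative (lam \<epsilon> k * \<zeta> t k + \<rho> t k)) (at t within {0..T})" if "k \<in> I" for k
      unfolding \<zeta>_def
      by (rule has_vector_derivative_eq_rhs[OF has_vector_derivative_diff[OF
            normal_form_deriv[OF fin nz offv dv[OF _ t] that] normal_form_deriv[OF fin nz offu du[OF _ t] that]]])
        (simp_all add: \<rho>_def algebra_simps)
    show ?thesis unfolding E_def E'_def
      by (intro DERIV_add DERIV_sum DERIV_cmult norm_sq_deriv 1 2) (use lohi in auto)
  qed
  define c1 where "c1 = 576 * N ^ 4 * D\<^sup>2"
  define c2 where "c2 = 1778688 * D\<^sup>2"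
  have c: "0 \<le> c1" "0 \<le> c2" by (simp_all add: c1_def c2_def)
  have wp: "1 \<le> D \<and> Xs t \<le> 4 * E t \<and> E t \<le> 4 * Xs t \<and>
      E' t \<le> (1 + 4 * (c1 + c2)) * E t" if t: "t \<in> {0..T}" for t
  proof -
    define X where "X = 3 * sqrt (Xs t)"
    have X2: "X\<^sup>2 = 9 * Xs t" by (simp add: X_def Xs_def power_mult_distrib)
    obtain g \<omega> \<mu> where "weighted_pair I g \<omega> \<mu> A P X w0 (v t) (u t)"
      using ctrl[OF t] unfolding controlled_def X_def Xs_def by blast
    then interpret W: weighted_pair I g \<omega> \<mu> A P X w0 "v t" "u t" .
    have D: "1 \<le> D" and WD: "W.D = D" using W.D1(3) by (simp_all add: D_def W.D_def)
    have N: "1800 \<le> N" using D by (simp add: N_def)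
    (* Since X^2 = 9 Xs t, the bound 33280 D^2 X^2 is below N^2 Xs t / 8. *)
    have hi_eta: "(\<Sum>k\<in>hi. (w0 k * cmod (\<eta> t k))\<^sup>2) \<le> Xs t / 8"
    proof -
      have "N\<^sup>2 * (\<Sum>k\<in>hi. (w0 k * cmod (\<eta> t k))\<^sup>2) = (\<Sum>k\<in>hi. (N * (w0 k * cmod (\<eta> t k)))\<^sup>2)"
        by (simp add: sum_distrib_left power_mult_distrib)
      also have "\<dots> \<le> (\<Sum>k\<in>hi. (\<bar>real_of_int k\<bar> * (w0 k * cmod (\<eta> t k)))\<^sup>2)"
        using N W.w0 by (intro sum_mono power_mono mult_right_mono) (auto simp: hi_def)
      also have "\<dots> \<le> (\<Sum>k\<in>I. (\<bar>real_of_int k\<bar> * (w0 k * cmod (\<eta> t k)))\<^sup>2)"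
        by (rule sum_mono2) (use fin lohi in auto)
      also have "\<dots> \<le> 33280 * D\<^sup>2 * X\<^sup>2" using W.boundary_est[of \<epsilon>] by (simp add: \<eta>_def WD)
      also have "\<dots> \<le> N\<^sup>2 * (X\<^sup>2 / 72)" by (simp add: N_def power_mult_distrib)
      finally show ?thesis using N X2 by (simp add: mult_le_cancel_left)
    qed
    have Xsum: "Xs t = (\<Sum>k\<in>lo. (w0 k * cmod (v t k - u t k))\<^sup>2) + (\<Sum>k\<in>hi. (w0 k * cmod (v t k - u t k))\<^sup>2)"
      unfolding Xs_def wsum_def by (rule sp)
    have Es: "E t = (\<Sum>k\<in>lo. (w0 k * cmod (v t k - u t k))\<^sup>2) + (\<Sum>k\<in>hi. (w0 k * cmod (\<zeta> t k))\<^sup>2)"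
      by (simp add: E_def power_mult_distrib)
    have tri: "(w * cmod (a + b))\<^sup>2 \<le> 2 * (w * cmod a)\<^sup>2 + 2 * (w * cmod b)\<^sup>2" for w and a b :: complex
    proof -
      have "(cmod (a + b))\<^sup>2 \<le> (cmod a + cmod b)\<^sup>2" by (intro power_mono norm_triangle_ineq) auto
      also have "\<dots> \<le> 2 * (cmod a)\<^sup>2 + 2 * (cmod b)\<^sup>2"
        using zero_le_power2[of "cmod a - cmod b"] by (simp add: power2_eq_square algebra_simps)
      finally have "w\<^sup>2 * (cmod (a + b))\<^sup>2 \<le> w\<^sup>2 * (2 * (cmod a)\<^sup>2 + 2 * (cmod b)\<^sup>2)" by (intro mult_left_mono) auto
      then show ?thesis by (simp add: power_mult_distrib algebra_simps)
    qed
    have nonneg: "0 \<le> (\<Sum>k\<in>S. (f k)\<^sup>2)" for S and f :: "int \<Rightarrow> real" by (simp add: sum_nonneg)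
    have arith1: "x \<le> 2 * (l + z) + x / 4" if "h \<le> 2 * z + 2 * e" "x = l + h" "e \<le> x / 8" "0 \<le> l" for h z e x l :: real
      using that by argo
    have arith2: "l + z \<le> 2 * x + x / 4" if "z \<le> 2 * h + 2 * e" "x = l + h" "e \<le> x / 8" "0 \<le> l" for h z e x l :: real
      using that by argo
    have "(\<Sum>k\<in>hi. (w0 k * cmod (v t k - u t k))\<^sup>2) \<le> (\<Sum>k\<in>hi. 2 * (w0 k * cmod (\<zeta> t k))\<^sup>2 + 2 * (w0 k * cmod (- \<eta> t k))\<^sup>2)"
      using tri[of "w0 k" "\<zeta> t k" "- \<eta> t k" for k] by (intro sum_mono) (simp add: \<zeta>_def \<eta>_def)
    also have "\<dots> = 2 * (\<Sum>k\<in>hi. (w0 k * cmod (\<zeta> t k))\<^sup>2) + 2 * (\<Sum>k\<in>hi. (w0 k * cmod (\<eta> t k))\<^sup>2)"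
      by (simp add: sum.distrib sum_distrib_left)
    finally have a: "Xs t \<le> 2 * E t + Xs t / 4"
      unfolding Es by (rule arith1[OF _ Xsum hi_eta nonneg])
    have "(\<Sum>k\<in>hi. (w0 k * cmod (\<zeta> t k))\<^sup>2) \<le> (\<Sum>k\<in>hi. 2 * (w0 k * cmod (v t k - u t k))\<^sup>2 + 2 * (w0 k * cmod (\<eta> t k))\<^sup>2)"
      using tri[of "w0 k" "v t k - u t k" "\<eta> t k" for k] by (intro sum_mono) (simp add: \<zeta>_def \<eta>_def)
    also have "\<dots> = 2 * (\<Sum>k\<in>hi. (w0 k * cmod (v t k - u t k))\<^sup>2) + 2 * (\<Sum>k\<in>hi. (w0 k * cmod (\<eta> t k))\<^sup>2)"
      by (simp add: sum.distrib sum_distrib_left)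
    finally have b: "E t \<le> 2 * Xs t + Xs t / 4"
      unfolding Es by (rule arith2[OF _ Xsum hi_eta nonneg])
    have X0: "0 \<le> Xs t" by (simp add: Xs_def)
    have "(\<Sum>k\<in>lo. (w0 k * cmod (nl t k))\<^sup>2) \<le> c1 * Xs t"
    proof -
      have "(w0 k * cmod (nl t k))\<^sup>2 \<le> (N\<^sup>2 * (4 * D * X))\<^sup>2 * (inv_abs k)\<^sup>2" if k: "k \<in> lo" for k
      proof -
        have k0: "k \<noteq> 0" and kN: "\<bar>real_of_int k\<bar> \<le> N" using k nz by (auto simp: lo_def)
        have kk: "\<bar>real_of_int k\<bar> * (\<bar>real_of_int k\<bar> * inv_abs k) = \<bar>real_of_int k\<bar>" using k0 by (simp add: inv_abs_def)
        have "w0 k * cmod (nl t k) = \<bar>real_of_int k\<bar> * (w0 k * cmod (fin_conv I (v t) k - fin_conv I (u t) k))"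
          by (simp add: nl_def norm_mult)
        also have "\<dots> = \<bar>real_of_int k\<bar>\<^sup>2 * inv_abs k * (w0 k * cmod (fin_conv I (v t) k - fin_conv I (u t) k))"
          unfolding power2_eq_square mult.assoc[of "\<bar>real_of_int k\<bar>" "\<bar>real_of_int k\<bar>"] kk ..
        also have "\<dots> \<le> N\<^sup>2 * inv_abs k * (4 * D * X)"
          by (rule mult_mono[OF mult_right_mono[OF power_mono[OF kN]] W.fin_conv_diff[of k, unfolded WD]])
            (use W.w0[of k] N in auto)
        finally have "w0 k * cmod (nl t k) \<le> (N\<^sup>2 * (4 * D * X)) * inv_abs k" by (simp add: mult_ac)
        then have "(w0 k * cmod (nl t k))\<^sup>2 \<le> ((N\<^sup>2 * (4 * D * X)) * inv_abs k)\<^sup>2"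
          by (rule power_mono) (use W.w0[of k] in auto)
        then show ?thesis by (simp only: power_mult_distrib)
      qed
      then have "(\<Sum>k\<in>lo. (w0 k * cmod (nl t k))\<^sup>2) \<le> (\<Sum>k\<in>lo. (N\<^sup>2 * (4 * D * X))\<^sup>2 * (inv_abs k)\<^sup>2)" by (intro sum_mono)
      also have "\<dots> = (N\<^sup>2 * (4 * D * X))\<^sup>2 * (\<Sum>k\<in>lo. (inv_abs k)\<^sup>2)" by (simp add: sum_distrib_left)
      also have "\<dots> \<le> (N\<^sup>2 * (4 * D * X))\<^sup>2 * 4" by (intro mult_left_mono sum_inv_abs_sq lohi) auto
      also have "\<dots> = 64 * N ^ 4 * D\<^sup>2 * X\<^sup>2" by (simp add: power_mult_distrib)
      also have "\<dots> = c1 * Xs t" unfolding X2 c1_def by simp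
      finally show ?thesis .
    qed
    moreover have "(\<Sum>k\<in>hi. (w0 k * cmod (\<rho> t k))\<^sup>2) \<le> c2 * Xs t"
    proof -
      have "(\<Sum>k\<in>hi. (w0 k * cmod (\<rho> t k))\<^sup>2) \<le> (\<Sum>k\<in>I. (w0 k * cmod (\<rho> t k))\<^sup>2)"
        by (rule sum_mono2) (use fin lohi in auto)
      also have "\<dots> \<le> 197632 * D\<^sup>2 * X\<^sup>2" using W.remainder_est[of \<epsilon>] by (simp only: \<rho>_def WD)
      also have "\<dots> = c2 * Xs t" unfolding X2 c2_def by simp
      finally show ?thesis .
    qed
    moreover have "E' t \<le> E t + ((\<Sum>k\<in>lo. (w0 k * cmod (nl t k))\<^sup>2) + (\<Sum>k\<in>hi. (w0 k * cmod (\<rho> t k))\<^sup>2))"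
    proof -
      have "E' t \<le> (\<Sum>k\<in>lo. (w0 k)\<^sup>2 * ((cmod (v t k - u t k))\<^sup>2 + (cmod (nl t k))\<^sup>2))
        + (\<Sum>k\<in>hi. (w0 k)\<^sup>2 * ((cmod (\<zeta> t k))\<^sup>2 + (cmod (\<rho> t k))\<^sup>2))"
        unfolding E'_def by (intro add_mono sum_mono mult_left_mono damped_norm_sq(2) eps) auto
      then show ?thesis unfolding E_def by (simp add: distrib_left sum.distrib power_mult_distrib)
    qed
    ultimately have "E' t \<le> E t + (c1 * Xs t + c2 * Xs t)" by linarith
    also have "\<dots> = E t + (c1 + c2) * Xs t" by (simp only: distrib_right)
    also have "\<dots> \<le> E t + (c1 + c2) * (4 * E t)"
      by (rule add_left_mono, rule mult_left_mono) (use a X0 c in auto)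
    also have "\<dots> = (1 + 4 * (c1 + c2)) * E t" by (simp add: algebra_simps)
    finally show ?thesis using D a b X0 by linarith
  qed
  define \<kappa> where "\<kappa> = 1 + 4 * (c1 + c2)"
  have gr: "E' t \<le> \<kappa> * E t" if "t \<in> {0..T}" for t
    using wp[OF that] unfolding \<kappa>_def by blast
  have "E t \<le> exp (\<kappa> * t) * E 0"
    by (rule gronwall_derivative[OF dE gr t])
  also have "\<dots> \<le> exp (\<kappa> * T) * (4 * Xs 0)"
  proof (rule mult_mono)
    have "0 \<le> \<kappa>" unfolding \<kappa>_def using c by (intro add_nonneg_nonneg mult_nonneg_nonneg) auto
    then have "\<kappa> * t \<le> \<kappa> * T" using t by (intro mult_left_mono) auto
    then show "exp (\<kappa> * t) \<le> exp (\<kappa> * T)" by (rule exp_mono)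
    show "E 0 \<le> 4 * Xs 0" by (rule wp[OF T0, THEN conjunct2, THEN conjunct2, THEN conjunct1])
    show "0 \<le> E 0" unfolding E_def by (intro add_nonneg_nonneg sum_nonneg) auto
  qed simp
  finally have fin: "E t \<le> exp (\<kappa> * T) * (4 * Xs 0)" .
  have "Xs t \<le> 4 * E t" by (rule wp[OF t, THEN conjunct2, THEN conjunct1])
  also have "\<dots> \<le> 4 * (exp (\<kappa> * T) * (4 * Xs 0))" by (rule mult_left_mono[OF fin]) simp
  also have "\<dots> = 16 * exp (\<kappa> * T) * Xs 0" by simp
  finally have "Xs t \<le> 16 * exp (\<kappa> * T) * Xs 0" .
  then show ?thesis unfolding Xs_def lip_const_def \<kappa>_def c1_def c2_def N_def D_def .
qed

section \<open>Ordinary differential equations with a Lipschitz field\<close>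

lemma exp_integral_le:
  fixes c :: real assumes "0 < c" "0 \<le> \<tau>"
  shows "((\<lambda>s. exp (c * s)) has_integral (exp (c * \<tau>) - 1) / c) {0..\<tau>}"
proof -
  have "((\<lambda>s. exp (c * s)) has_integral exp (c * \<tau>) / c - exp (c * 0) / c) {0..\<tau>}"
    by (rule fundamental_theorem_of_calculus[OF assms(2)])
      (use assms in \<open>auto intro!: derivative_eq_intros simp: has_real_derivative_iff_has_vector_derivative[symmetric]\<close>)
  then show ?thesis by (simp add: diff_divide_distrib)
qed

text \<open>
  Picard iteration on all of \<open>[0,T]\<close> at once: with the factor \<open>exp (- \<Omega> t)\<close> in the norm the integral
  operator is a contraction, so the Banach fixed point theorem applies directly.
\<close>

theorem lipschitz_ode_solution:
  fixes F :: "'a::banach \<Rightarrow> 'a"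
  assumes L: "0 \<le> L" and lip: "\<And>x y. norm (F x - F y) \<le> L * norm (x - y)" and T: "0 \<le> T"
  shows "\<exists>x. x 0 = x0 \<and> (\<forall>t\<in>{0..T}. (x has_vector_derivative F (x t)) (at t within {0..T}))"
proof -
  define \<Omega> where "\<Omega> = 2 * L + 1"
  have Om: "0 < \<Omega>" using L by (simp add: \<Omega>_def)
  (* Times are clamped to [0,T], so that the iterates are bounded continuous functions on the line. *)
  define cl where "cl t = max 0 (min T t)" for t :: real
  have cl: "0 \<le> cl t" "cl t \<le> T" for t using T by (auto simp: cl_def)
  have clid: "cl t = t" if "t \<in> {0..T}" for t using that by (auto simp: cl_def)
  have contcl: "continuous_on UNIV cl" unfolding cl_def by (intro continuous_intros)
  have contF: "continuous_on UNIV F"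
    by (rule lipschitz_on_continuous_on[of L]) (use lip L in \<open>auto simp: lipschitz_on_def dist_norm\<close>)
  define h where "h y s = F (exp (\<Omega> * s) *\<^sub>R apply_bcontfun y s)" for y :: "real \<Rightarrow>\<^sub>C 'a" and s
  have conth: "continuous_on S (h y)" for S y
    unfolding h_def by (rule continuous_on_compose2[OF contF]) (auto intro!: continuous_intros)
  define \<Phi> where "\<Phi> y t = exp (- \<Omega> * cl t) *\<^sub>R (x0 + integral {0..cl t} (h y))" for y t
  have Phib: "\<Phi> y \<in> bcontfun" for y
  proof -
    have c: "continuous_on {0..T} (\<lambda>\<tau>. exp (- \<Omega> * \<tau>) *\<^sub>R (x0 + integral {0..\<tau>} (h y)))"
      by (intro continuous_intros indefinite_integral_continuous_1 integrable_continuous_interval conth)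
    have "continuous_on UNIV (\<Phi> y)"
      unfolding \<Phi>_def by (rule continuous_on_compose2[OF c contcl]) (use cl in auto)
    moreover have "bounded (range (\<Phi> y))"
    proof (rule bounded_subset)
      show "bounded ((\<lambda>\<tau>. exp (- \<Omega> * \<tau>) *\<^sub>R (x0 + integral {0..\<tau>} (h y))) ` {0..T})"
        by (intro compact_imp_bounded compact_continuous_image c) auto
      show "range (\<Phi> y) \<subseteq> (\<lambda>\<tau>. exp (- \<Omega> * \<tau>) *\<^sub>R (x0 + integral {0..\<tau>} (h y))) ` {0..T}"
        using cl unfolding \<Phi>_def by (auto intro!: imageI)
    qed
    ultimately show ?thesis by (simp add: bcontfun_def)
  qed
  define G where "G y = Bcontfun (\<Phi> y)" for y
  have G: "apply_bcontfun (G y) = \<Phi> y" for y unfolding G_def using Phib by (rule Bcontfun_inverse)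
  have "\<exists>!y. y \<in> (UNIV :: (real \<Rightarrow>\<^sub>C 'a) set) \<and> G y = y"
  proof (rule Banach_fix)
    show "dist (G y) (G z) \<le> 1/2 * dist y z" for y z
    proof (rule dist_bound)
      fix t
      let ?\<tau> = "cl t"
      have "\<Phi> y t - \<Phi> z t = exp (- \<Omega> * ?\<tau>) *\<^sub>R integral {0..?\<tau>} (\<lambda>s. h y s - h z s)"
        unfolding \<Phi>_def by (subst integral_diff) (auto intro!: integrable_continuous_interval conth simp: algebra_simps)
      then have 1: "norm (\<Phi> y t - \<Phi> z t) = exp (- \<Omega> * ?\<tau>) * norm (integral {0..?\<tau>} (\<lambda>s. h y s - h z s))" by simp
      have pt: "norm (h y s - h z s) \<le> L * dist y z * exp (\<Omega> * s)" for s
      proof -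
        have "norm (h y s - h z s) \<le> L * norm (exp (\<Omega> * s) *\<^sub>R (apply_bcontfun y s - apply_bcontfun z s))"
          unfolding h_def scaleR_diff_right by (rule lip)
        also have "\<dots> = L * (exp (\<Omega> * s) * dist (apply_bcontfun y s) (apply_bcontfun z s))" by (simp add: dist_norm)
        also have "\<dots> \<le> L * (exp (\<Omega> * s) * dist y z)"
          by (intro mult_left_mono dist_bounded L) auto
        finally show ?thesis by (simp add: mult_ac)
      qed
      have hi: "((\<lambda>s. L * dist y z * exp (\<Omega> * s)) has_integral L * dist y z * ((exp (\<Omega> * ?\<tau>) - 1) / \<Omega>)) {0..?\<tau>}"
        by (intro has_integral_mult_right exp_integral_le Om cl)
      have "norm (integral {0..?\<tau>} (\<lambda>s. h y s - h z s)) \<le> integral {0..?\<tau>} (\<lambda>s. L * dist y z * exp (\<Omega> * s))"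
        using hi by (intro integral_norm_bound_integral pt) (auto intro!: integrable_continuous_interval continuous_on_diff conth continuous_intros)
      also have "\<dots> = L * dist y z * ((exp (\<Omega> * ?\<tau>) - 1) / \<Omega>)" using hi by (rule integral_unique)
      also have "\<dots> \<le> L * dist y z * (exp (\<Omega> * ?\<tau>) / \<Omega>)"
        using L Om by (intro mult_left_mono divide_right_mono) auto
      finally have "norm (\<Phi> y t - \<Phi> z t) \<le> exp (- \<Omega> * ?\<tau>) * (L * dist y z * (exp (\<Omega> * ?\<tau>) / \<Omega>))"
        unfolding 1 by (intro mult_left_mono) auto
      also have "\<dots> = (exp (- \<Omega> * ?\<tau>) * exp (\<Omega> * ?\<tau>)) * (L / \<Omega>) * dist y z" by simp
      also have "\<dots> = (L / \<Omega>) * dist y z" by (simp flip: exp_add)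
      also have "\<dots> \<le> 1/2 * dist y z"
        using L Om by (intro mult_right_mono) (auto simp: \<Omega>_def field_simps)
      finally show "dist (apply_bcontfun (G y) t) (apply_bcontfun (G z) t) \<le> 1/2 * dist y z"
        by (simp add: G dist_norm)
    qed
  qed (auto simp: complete_UNIV)
  then obtain y where y: "G y = y" by blast
  define x where "x t = exp (\<Omega> * t) *\<^sub>R apply_bcontfun y t" for t
  have xeq: "x t = x0 + integral {0..t} (\<lambda>s. F (x s))" if t: "t \<in> {0..T}" for t
  proof -
    have "apply_bcontfun y t = \<Phi> y t" using G[of y] y by simp
    then have "x t = (exp (\<Omega> * t) * exp (- \<Omega> * t)) *\<^sub>R (x0 + integral {0..t} (h y))"
      by (simp add: x_def \<Phi>_def clid[OF t])
    also have "\<dots> = x0 + integral {0..t} (h y)" by (simp flip: exp_add)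
    finally show ?thesis by (simp add: h_def[abs_def] x_def[abs_def])
  qed
  have contFx: "continuous_on {0..T} (\<lambda>s. F (x s))"
    using conth[of "{0..T}" y] by (simp add: h_def[abs_def] x_def)
  show ?thesis
  proof (intro exI[of _ x] conjI ballI)
    show "x 0 = x0" using xeq[of 0] T by simp
    fix t assume t: "t \<in> {0..T}"
    have "((\<lambda>u. integral {0..u} (\<lambda>s. F (x s))) has_vector_derivative F (x t)) (at t within {0..T})"
      using integral_has_vector_derivative[OF contFx t] .
    then have "((\<lambda>u. x0 + integral {0..u} (\<lambda>s. F (x s))) has_vector_derivative 0 + F (x t)) (at t within {0..T})"
      by (intro has_vector_derivative_add has_vector_derivative_const)
    then have "((\<lambda>u. x0 + integral {0..u} (\<lambda>s. F (x s))) has_vector_derivative F (x t)) (at t within {0..T})"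
      by simp
    then show "(x has_vector_derivative F (x t)) (at t within {0..T})"
      by (rule has_vector_derivative_transform[OF t, rotated]) (use xeq in auto)
  qed
qed

definition cutoff :: "real \<Rightarrow> real \<Rightarrow> real" where
  "cutoff R r = max 0 (min 1 (2 - r / R))"

lemma cutoff_eq1: "0 < R \<Longrightarrow> r \<le> R \<Longrightarrow> cutoff R r = 1"
  by (auto simp: cutoff_def max_def min_def field_simps)
lemma cutoff_eq0: "0 < R \<Longrightarrow> 2 * R \<le> r \<Longrightarrow> cutoff R r = 0"
  by (auto simp: cutoff_def max_def min_def field_simps)
lemma cutoff_bounds: "0 \<le> cutoff R r" "cutoff R r \<le> 1" by (auto simp: cutoff_def)
lemma cutoff_lip: assumes "0 < R" shows "\<bar>cutoff R r - cutoff R q\<bar> \<le> \<bar>r - q\<bar> / R"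
proof -
  have "\<bar>cutoff R r - cutoff R q\<bar> \<le> \<bar>r / R - q / R\<bar>" unfolding cutoff_def by (auto simp: max_def min_def abs_if)
  also have "\<dots> = \<bar>r - q\<bar> / R" using assms by (simp add: abs_divide flip: diff_divide_distrib)
  finally show ?thesis .
qed

text \<open>
  Truncating a quadratic field outside a ball makes it globally Lipschitz.
\<close>

lemma cutoff_quadratic_lipschitz:
  fixes Q :: "'a::real_normed_vector \<Rightarrow> 'a"
  assumes R: "0 < R" and B: "0 \<le> B" and Q0: "Q 0 = 0"
    and Q: "\<And>x y. norm (Q x - Q y) \<le> B * (norm x + norm y) * norm (x - y)"
  shows "norm (cutoff R (norm x) *\<^sub>R Q x - cutoff R (norm y) *\<^sub>R Q y) \<le> 8 * B * R * norm (x - y)"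
proof -
  have main: "norm (cutoff R (norm x) *\<^sub>R Q x - cutoff R (norm y) *\<^sub>R Q y) \<le> 8 * B * R * norm (x - y)"
    if x: "norm x \<le> 2 * R" for x y
  proof -
    have Qx: "norm (Q x) \<le> B * (2 * R) * (2 * R)"
    proof -
      have "norm (Q x) \<le> B * norm x * norm x" using Q[of x 0] Q0 by simp
      also have "\<dots> \<le> B * (2 * R) * (2 * R)" using x B R by (intro mult_mono) auto
      finally show ?thesis .
    qed
    have "cutoff R (norm x) *\<^sub>R Q x - cutoff R (norm y) *\<^sub>R Q y
      = (cutoff R (norm x) - cutoff R (norm y)) *\<^sub>R Q x + cutoff R (norm y) *\<^sub>R (Q x - Q y)"
      by (simp add: algebra_simps)
    then have "norm (cutoff R (norm x) *\<^sub>R Q x - cutoff R (norm y) *\<^sub>R Q y)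
      \<le> \<bar>cutoff R (norm x) - cutoff R (norm y)\<bar> * norm (Q x) + \<bar>cutoff R (norm y)\<bar> * norm (Q x - Q y)"
      by (metis norm_scaleR norm_triangle_ineq)
    also have "\<dots> \<le> (norm (x - y) / R) * (B * (2 * R) * (2 * R)) + B * (4 * R) * norm (x - y)"
    proof (rule add_mono)
      have "\<bar>cutoff R (norm x) - cutoff R (norm y)\<bar> \<le> norm (x - y) / R"
        by (rule order_trans[OF cutoff_lip[OF R]]) (use R in \<open>auto intro!: divide_right_mono norm_triangle_ineq3\<close>)
      then show "\<bar>cutoff R (norm x) - cutoff R (norm y)\<bar> * norm (Q x) \<le> norm (x - y) / R * (B * (2 * R) * (2 * R))"
        using R by (intro mult_mono Qx) auto
      show "\<bar>cutoff R (norm y)\<bar> * norm (Q x - Q y) \<le> B * (4 * R) * norm (x - y)"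
      proof (cases "norm y \<le> 2 * R")
        case True
        have "\<bar>cutoff R (norm y)\<bar> * norm (Q x - Q y) \<le> 1 * (B * (norm x + norm y) * norm (x - y))"
          using cutoff_bounds[of R "norm y"] by (intro mult_mono Q) auto
        also have "\<dots> \<le> B * (4 * R) * norm (x - y)"
          using True x B by (simp) (intro mult_right_mono mult_left_mono, auto)
        finally show ?thesis .
      next
        case False
        then show ?thesis using cutoff_eq0[OF R, of "norm y"] B R by simp
      qed
    qed
    also have "\<dots> = 8 * B * R * norm (x - y)" using R by (simp add: field_simps)
    finally show ?thesis .
  qed
  show ?thesis
  proof (cases "norm x \<le> 2 * R")
    case True then show ?thesis by (rule main)
  next
    case x: False
    show ?thesis
    proof (cases "norm y \<le> 2 * R")
      case True
      then show ?thesis using main[of y x] by (simp add: norm_minus_commute)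
    next
      case False
      then show ?thesis using x cutoff_eq0[OF R] B R by simp
    qed
  qed
qed

section \<open>Sobolev weights and the two uniform estimates\<close>

definition sw :: "real \<Rightarrow> int \<Rightarrow> real" where
  "sw s k = (1 + (real_of_int k)\<^sup>2) powr (s / 2)"

lemma sw_ge1: "0 \<le> s \<Longrightarrow> 1 \<le> sw s k"
  unfolding sw_def by (rule ge_one_powr_ge_zero) auto

lemma sw_pos [simp]: "0 < sw s k"
  unfolding sw_def by (smt (verit) powr_gt_zero zero_le_power2)

lemma sw_nonneg [simp]: "0 \<le> sw s k" by (rule less_imp_le) simp

lemma sw_uminus [simp]: "sw s (- k) = sw s k" by (simp add: sw_def)

lemma sw_zero [simp]: "sw 0 k = 1"
  unfolding sw_def by (smt (verit) div_0 powr_zero_eq_one zero_le_power2)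

lemma sw_sq: "(sw s k)\<^sup>2 = (1 + (real_of_int k)\<^sup>2) powr s"
proof -
  have "(sw s k)\<^sup>2 = ((1 + (real_of_int k)\<^sup>2) powr (s / 2)) powr 2" using sw_pos[of s k] by (simp add: sw_def)
  then show ?thesis by (simp add: powr_powr)
qed

text \<open>
  Peetre's inequality with the maximum, which the tame weight below needs.
\<close>

lemma sw_add: assumes "0 \<le> s" shows "sw s (a + b) \<le> 2 powr s * max (sw s a) (sw s b)"
proof -
  have 1: "1 + (real_of_int (a + b))\<^sup>2 \<le> 4 * (1 + (real_of_int c)\<^sup>2)"
    if "\<bar>a\<bar> \<le> \<bar>c\<bar>" "\<bar>b\<bar> \<le> \<bar>c\<bar>" for c
  proof -
    have "\<bar>real_of_int (a + b)\<bar> \<le> 2 * \<bar>real_of_int c\<bar>" using that by linarith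
    then have "\<bar>real_of_int (a + b)\<bar>\<^sup>2 \<le> (2 * \<bar>real_of_int c\<bar>)\<^sup>2" by (intro power_mono) auto
    then show ?thesis by (simp add: power_mult_distrib)
  qed
  have 2: "sw s (a + b) \<le> 2 powr s * sw s c" if "\<bar>a\<bar> \<le> \<bar>c\<bar>" "\<bar>b\<bar> \<le> \<bar>c\<bar>" for c
  proof -
    have "sw s (a + b) \<le> (4 * (1 + (real_of_int c)\<^sup>2)) powr (s / 2)"
      unfolding sw_def by (rule powr_mono2) (use 1[OF that] assms in auto)
    also have "\<dots> = 4 powr (s / 2) * sw s c" unfolding sw_def by (rule powr_mult)
    also have "(4::real) powr (s / 2) = 2 powr s"
    proof -
      have "(4::real) = 2 powr 2" by simp
      then have "(4::real) powr (s / 2) = (2 powr 2) powr (s / 2)" by simp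
      then show ?thesis by (simp only: powr_powr) simp
    qed
    finally show ?thesis .
  qed
  show ?thesis
  proof (cases "\<bar>a\<bar> \<le> \<bar>b\<bar>")
    case True
    then have "sw s (a + b) \<le> 2 powr s * sw s b" by (intro 2) auto
    also have "\<dots> \<le> 2 powr s * max (sw s a) (sw s b)" by (intro mult_left_mono) auto
    finally show ?thesis .
  next
    case False
    then have "sw s (a + b) \<le> 2 powr s * sw s a" by (intro 2) auto
    also have "\<dots> \<le> 2 powr s * max (sw s a) (sw s b)" by (intro mult_left_mono) auto
    finally show ?thesis .
  qed
qed

lemma sw_submult: assumes "0 \<le> s" shows "sw s (a + b) \<le> 2 powr s * sw s a * sw s b"
proof -
  have "max (sw s a) (sw s b) \<le> sw s a * sw s b"
    using sw_ge1[OF assms, of a] sw_ge1[OF assms, of b] by (auto simp: mult_le_cancel_left1 mult_le_cancel_right1)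
  then have "2 powr s * max (sw s a) (sw s b) \<le> 2 powr s * (sw s a * sw s b)" by (intro mult_left_mono) auto
  with sw_add[OF assms, of a b] show ?thesis unfolding mult.assoc by (rule order_trans)
qed

text \<open>
  The constant does not depend on \<open>l\<close>.  Therefore \<open>l\<close> can be adapted to the solution.
\<close>

lemma tame_submult: assumes "0 \<le> s" "0 \<le> l"
  shows "1 + l * sw s (a + b) \<le> 2 powr s * (1 + l * sw s a) * (1 + l * sw s b)"
proof -
  have A: "1 \<le> 2 powr s" using assms by (intro ge_one_powr_ge_zero) auto
  have p: "0 \<le> l * sw s k" for k using assms(2) by simp
  have "l * sw s (a + b) \<le> l * (2 powr s * max (sw s a) (sw s b))"
    by (intro mult_left_mono sw_add assms)
  also have "\<dots> \<le> 2 powr s * max (l * sw s a) (l * sw s b)"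
    by (simp add: max_def mult_ac)
  also have "\<dots> \<le> 2 powr s * (l * sw s a + l * sw s b)"
    using p[of a] p[of b] by (intro mult_left_mono) auto
  finally have "1 + l * sw s (a + b) \<le> 2 powr s * 1 + 2 powr s * (l * sw s a + l * sw s b)" using A by simp
  also have "\<dots> \<le> 2 powr s * ((1 + l * sw s a) * (1 + l * sw s b))"
    unfolding distrib_left[symmetric] using mult_nonneg_nonneg[OF p[of a] p[of b]]
    by (intro mult_left_mono) (auto simp: algebra_simps)
  finally show ?thesis by (simp add: mult.assoc)
qed

lemma sq_sum2: "((a + b) / 2)\<^sup>2 \<le> (a\<^sup>2 + b\<^sup>2) / (2::real)"
  using zero_le_power2[of "a - b"] by (simp add: power2_eq_square field_simps)

lemma sq_sum3: "((a + b + c) / 3)\<^sup>2 \<le> (a\<^sup>2 + b\<^sup>2 + c\<^sup>2) / (3::real)"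
  using zero_le_power2[of "a - b"] zero_le_power2[of "a - c"] zero_le_power2[of "b - c"]
  by (simp add: power2_eq_square field_simps)

lemma wsum_scaled_le1:
  assumes "wsum I w f \<le> R\<^sup>2" "0 < R"
  shows "(\<Sum>k\<in>I. (w k * cmod (f k) / R)\<^sup>2) \<le> 1"
proof -
  have "(\<Sum>k\<in>I. (w k * cmod (f k) / R)\<^sup>2) = wsum I w f / R\<^sup>2"
    by (simp add: wsum_def power_divide sum_divide_distrib)
  also have "\<dots> \<le> 1" using assms by (simp add: divide_le_eq_1)
  finally show ?thesis .
qed

lemma wsum_scaled_sqrt_le1: "(\<Sum>k\<in>I. (w k * cmod (f k) / sqrt (wsum I w f))\<^sup>2) \<le> 1"
proof -
  have "(\<Sum>k\<in>I. (w k * cmod (f k) / sqrt (wsum I w f))\<^sup>2) = wsum I w f / wsum I w f"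
    by (simp add: wsum_def power_divide sum_nonneg flip: sum_divide_distrib)
  then show ?thesis by (cases "wsum I w f = 0") auto
qed

lemma wsum_eq_0: assumes "finite I" "wsum I w f = 0" "k \<in> I" shows "w k * cmod (f k) = 0"
proof -
  have "(w k * cmod (f k))\<^sup>2 = 0"
    using assms unfolding wsum_def by (subst (asm) sum_nonneg_eq_0_iff) auto
  then show ?thesis by simp
qed

text \<open>
  Used for differences of two solutions, both bounded in \<open>H^s\<close>.
\<close>

lemma controlled_pair:
  assumes fin: "finite I" and nz: "0 \<notin> I" and s: "0 \<le> s" and R: "1 \<le> R"
    and offv: "\<And>k. k \<notin> I \<Longrightarrow> v k = 0" and offu: "\<And>k. k \<notin> I \<Longrightarrow> u k = 0"
    and v: "wsum I (sw s) v \<le> R\<^sup>2" and u: "wsum I (sw s) u \<le> R\<^sup>2"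
  shows "controlled I (2 powr s) (3 * R) (sw s) v u"
proof -
  define Y where "Y = sqrt (wsum I (sw s) (\<lambda>k. v k - u k))"
  (* When Y = 0 the last quotient is 0, which is consistent: the difference then vanishes on I. *)
  define g where "g k = (sw s k * cmod (v k) / R + sw s k * cmod (u k) / R + sw s k * cmod (v k - u k) / Y) / 3" for k
  have Y: "0 \<le> Y" by (simp add: Y_def)
  have p: "0 \<le> sw s k * cmod z / R" "0 \<le> sw s k * cmod z / Y" for k z
    using R Y by auto
  have Yeq: "sw s k * cmod (v k - u k) = Y * (sw s k * cmod (v k - u k) / Y)" for k
  proof (cases "Y = 0")
    case True
    show ?thesis
    proof (cases "k \<in> I")
      case k: True
      have "wsum I (sw s) (\<lambda>k. v k - u k) = 0" using True by (simp add: Y_def)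
      from wsum_eq_0[OF fin this k] True show ?thesis by simp
    qed (use True offv offu in simp)
  qed simp
  have "weighted_pair I g (sw s) 1 (2 powr s) (3 * R) (3 * Y) (sw s) v u"
  proof
    show "1 \<le> 2 powr s" using s by (intro ge_one_powr_ge_zero) auto
    show "0 \<le> g k" for k unfolding g_def by (intro divide_nonneg_pos add_nonneg_nonneg p) simp
    show "g k = 0" if "k \<notin> I" for k using that by (simp add: g_def offv offu)
    have "(\<Sum>k\<in>I. (g k)\<^sup>2) \<le> (\<Sum>k\<in>I. ((sw s k * cmod (v k) / R)\<^sup>2 + (sw s k * cmod (u k) / R)\<^sup>2 + (sw s k * cmod (v k - u k) / Y)\<^sup>2) / 3)"
      unfolding g_def by (intro sum_mono sq_sum3)
    also have "\<dots> = ((\<Sum>k\<in>I. (sw s k * cmod (v k) / R)\<^sup>2) + (\<Sum>k\<in>I. (sw s k * cmod (u k) / R)\<^sup>2) + (\<Sum>k\<in>I. (sw s k * cmod (v k - u k) / Y)\<^sup>2)) / 3"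
      by (simp only: sum.distrib flip: sum_divide_distrib)
    also have "\<dots> \<le> (1 + 1 + 1) / 3"
      unfolding Y_def using R by (intro divide_right_mono add_mono wsum_scaled_le1 v u wsum_scaled_sqrt_le1) auto
    finally show "(\<Sum>k\<in>I. (g k)\<^sup>2) \<le> 1" by simp
    show "sw s (a + b) \<le> 2 powr s * sw s a * sw s b" for a b by (rule sw_submult[OF s])
    have g3: "3 * R * g k = sw s k * cmod (v k) + sw s k * cmod (u k) + R * (sw s k * cmod (v k - u k) / Y)" for k
      using R by (simp add: g_def field_simps)
    have R0: "0 \<le> R * (sw s k * cmod (v k - u k) / Y)" for k
      using R by (intro mult_nonneg_nonneg p) auto
    have vu0: "0 \<le> sw s k * cmod (v k)" "0 \<le> sw s k * cmod (u k)" for k by auto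
    show "sw s k * cmod (v k) \<le> 3 * R * g k" for k
      unfolding g3 using R0[of k] vu0[of k] by linarith
    show "sw s k * cmod (u k) \<le> 3 * R * g k" for k
      unfolding g3 using R0[of k] vu0[of k] by linarith
    show "sw s k * cmod (v k - u k) \<le> 1 * (3 * Y) * g k" for k
    proof -
      have "sw s k * cmod (v k - u k) / Y \<le> 3 * g k"
        using p(1)[of k "v k"] p(1)[of k "u k"] unfolding g_def by argo
      then have "Y * (sw s k * cmod (v k - u k) / Y) \<le> Y * (3 * g k)" using Y by (intro mult_left_mono)
      with Yeq[of k] show ?thesis by simp
    qed
  qed (use fin nz R Y s in \<open>auto intro: less_imp_le\<close>)
  then show ?thesis unfolding controlled_def Y_def by blast
qed

text \<open>
  Used to compare a solution with \<open>0\<close>.  With the weight \<open>1 + l (1 + k^2)^(s/2)\<close> and \<open>l\<close> of the size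
  (\<open>L^2\<close> bound) / (\<open>H^s\<close> norm), both parts of the weighted norm are of the size of the \<open>L^2\<close> bound; so the
  Lipschitz constant depends on the \<open>L^2\<close> norm alone and the bound on the \<open>H^s\<close> norm is linear.
\<close>

lemma controlled_tame:
  assumes fin: "finite I" and nz: "0 \<notin> I" and s: "0 \<le> s" and R: "1 \<le> R"
    and off: "\<And>k. k \<notin> I \<Longrightarrow> v k = 0"
    and v: "wsum I (\<lambda>_. 1) v \<le> R\<^sup>2"
  shows "controlled I (2 powr s) (2 * R) (sw s) v (\<lambda>_. 0)"
proof -
  define b where "b = sqrt (wsum I (sw s) v)"
  (* For b = 0 the sequence vanishes on I and any positive l will do. *)
  define l where "l = (if b = 0 then 1 else R / b)"
  have b: "0 \<le> b" by (simp add: b_def)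
  have l: "0 < l" using R b by (simp add: l_def)
  define g where "g k = (cmod (v k) / R + sw s k * cmod (v k) / b) / 2" for k
  have p: "0 \<le> cmod (v k) / R" "0 \<le> sw s k * cmod (v k) / b" for k
    using R b by auto
  have beq: "l * (sw s k * cmod (v k)) = R * (sw s k * cmod (v k) / b)" for k
  proof (cases "b = 0")
    case True
    show ?thesis
    proof (cases "k \<in> I")
      case k: True
      have "wsum I (sw s) v = 0" using True by (simp add: b_def)
      from wsum_eq_0[OF fin this k] True show ?thesis by simp
    qed (use True off in simp)
  qed (simp add: l_def)
  have om: "(1 + l * sw s k) * cmod (v k) = 2 * R * g k" for k
  proof -
    have "(1 + l * sw s k) * cmod (v k) = cmod (v k) + R * (sw s k * cmod (v k) / b)"
      using beq[of k] by (simp add: algebra_simps)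
    then show ?thesis using R by (simp add: g_def field_simps)
  qed
  have lb: "R * g k \<le> l * b * g k" for k
  proof (cases "b = 0")
    case True
    show ?thesis
    proof (cases "k \<in> I")
      case k: True
      have "wsum I (sw s) v = 0" using True by (simp add: b_def)
      from wsum_eq_0[OF fin this k] have "cmod (v k) = 0" using sw_pos[of s k] by simp
      then show ?thesis by (simp add: g_def)
    qed (simp add: g_def off)
  qed (simp add: l_def)
  have "weighted_pair I g (\<lambda>k. 1 + l * sw s k) l (2 powr s) (2 * R) (3 * b) (sw s) v (\<lambda>_. 0)"
  proof
    show "1 \<le> 2 powr s" using s by (intro ge_one_powr_ge_zero) auto
    show g0: "0 \<le> g k" for k unfolding g_def by (intro divide_nonneg_pos add_nonneg_nonneg p) simp
    show "g k = 0" if "k \<notin> I" for k using that by (simp add: g_def off)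
    have "(\<Sum>k\<in>I. (g k)\<^sup>2) \<le> (\<Sum>k\<in>I. ((1 * cmod (v k) / R)\<^sup>2 + (sw s k * cmod (v k) / b)\<^sup>2) / 2)"
      unfolding g_def mult_1 by (intro sum_mono sq_sum2)
    also have "\<dots> = ((\<Sum>k\<in>I. (1 * cmod (v k) / R)\<^sup>2) + (\<Sum>k\<in>I. (sw s k * cmod (v k) / b)\<^sup>2)) / 2"
      by (simp only: sum.distrib flip: sum_divide_distrib)
    also have "\<dots> \<le> (1 + 1) / 2"
      unfolding b_def using R by (intro divide_right_mono add_mono wsum_scaled_le1 v wsum_scaled_sqrt_le1) auto
    finally show "(\<Sum>k\<in>I. (g k)\<^sup>2) \<le> 1" by simp
    show "0 < 1 + l * sw s k" for k using l by (intro add_pos_pos mult_pos_pos) auto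
    show "1 + l * sw s (c + d) \<le> 2 powr s * (1 + l * sw s c) * (1 + l * sw s d)" for c d
      using l by (intro tame_submult s) auto
    show "(1 + l * sw s k) * cmod (v k) \<le> 2 * R * g k" for k by (simp add: om)
    show "(1 + l * sw s k) * cmod 0 \<le> 2 * R * g k" for k using R g0 by simp
    show "(1 + l * sw s k) * cmod (v k - 0) \<le> l * (3 * b) * g k" for k
    proof -
      have "0 \<le> R * g k" using R g0 by simp
      then have "2 * (R * g k) \<le> 3 * (l * b * g k)" using lb[of k] by linarith
      then show ?thesis using om[of k] by (simp add: mult_ac)
    qed
    show "l * sw s k \<le> 1 + l * sw s k" for k by simp
  qed (use fin nz R b l in \<open>auto intro: less_imp_le\<close>)
  then show ?thesis unfolding controlled_def b_def diff_zero by blast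
qed

definition galerkin :: "real \<Rightarrow> int set \<Rightarrow> real \<Rightarrow> (real \<Rightarrow> int \<Rightarrow> complex) \<Rightarrow> bool" where
  "galerkin \<epsilon> I T v \<longleftrightarrow> (\<forall>t k. k \<notin> I \<longrightarrow> v t k = 0) \<and>
     (\<forall>t\<in>{0..T}. \<forall>k\<in>I. ((\<lambda>\<tau>. v \<tau> k) has_vector_derivative
        (lam \<epsilon> k * v t k + \<i> * of_int k * fin_conv I (v t) k)) (at t within {0..T}))"

lemma galerkin_difference_bound:
  assumes fin: "finite I" and nz: "0 \<notin> I" and eps: "0 \<le> \<epsilon>" and s: "0 \<le> s" and R: "1 \<le> R"
    and v: "galerkin \<epsilon> I T v" and u: "galerkin \<epsilon> I T u"
    and bv: "\<And>t. t \<in> {0..T} \<Longrightarrow> wsum I (sw s) (v t) \<le> R\<^sup>2" and bu: "\<And>t. t \<in> {0..T} \<Longrightarrow> wsum I (sw s) (u t) \<le> R\<^sup>2"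
    and t: "t \<in> {0..T}"
  shows "wsum I (sw s) (\<lambda>k. v t k - u t k) \<le> lip_const (2 powr s) (3 * R) T * wsum I (sw s) (\<lambda>k. v 0 k - u 0 k)"
proof (rule galerkin_lipschitz[OF fin nz eps _ _ _ _ _ t])
  show "controlled I (2 powr s) (3 * R) (sw s) (v t) (u t)" if "t \<in> {0..T}" for t
    by (rule controlled_pair[OF fin nz s R]) (use v u bv bu that in \<open>auto simp: galerkin_def\<close>)
qed (use v u in \<open>auto simp: galerkin_def\<close>)

lemma galerkin_tame_bound:
  assumes fin: "finite I" and nz: "0 \<notin> I" and eps: "0 \<le> \<epsilon>" and s: "0 \<le> s" and R: "1 \<le> R"
    and v: "galerkin \<epsilon> I T v"
    and bv: "\<And>t. t \<in> {0..T} \<Longrightarrow> wsum I (\<lambda>_. 1) (v t) \<le> R\<^sup>2"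
    and t: "t \<in> {0..T}"
  shows "wsum I (sw s) (v t) \<le> lip_const (2 powr s) (2 * R) T * wsum I (sw s) (v 0)"
proof -
  have "wsum I (sw s) (\<lambda>k. v t k - (\<lambda>_ _. 0) t k) \<le> lip_const (2 powr s) (2 * R) T * wsum I (sw s) (\<lambda>k. v 0 k - (\<lambda>_ _. 0) (0::real) k)"
  proof (rule galerkin_lipschitz[OF fin nz eps _ _ _ _ _ t])
    show "controlled I (2 powr s) (2 * R) (sw s) (v t) (\<lambda>_. 0)" if "t \<in> {0..T}" for t
      by (rule controlled_tame[OF fin nz s R]) (use v bv that in \<open>auto simp: galerkin_def\<close>)
  qed (use v in \<open>auto simp: galerkin_def fin_conv_def\<close>)
  then show ?thesis by simp
qed

section \<open>Galerkin solutions\<close>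

text \<open>
  Bounded continuous functions serve as a Banach space that contains \<open>\<complex>^I\<close> for every finite set \<open>I\<close>
  of modes, since the number of modes is not fixed by a type.  A vector is extended from the integers by
  tent functions, and its components are the values at the integers.
\<close>

instance bcontfun :: (metric_space, banach) banach ..

definition tent :: "int \<Rightarrow> real \<Rightarrow> real" where
  "tent k r = max 0 (1 - \<bar>r - real_of_int k\<bar>)"

lemma tent_bounds: "0 \<le> tent k r" "tent k r \<le> 1" by (auto simp: tent_def)

lemma tent_int: "tent k (real_of_int j) = (if j = k then 1 else 0)"
proof (cases "j = k")
  case False
  then have "1 \<le> \<bar>j - k\<bar>" by simp
  then have "1 \<le> \<bar>real_of_int j - real_of_int k\<bar>" by linarith
  then show ?thesis using False by (simp add: tent_def)
qed (simp add: tent_def)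

definition embed :: "int set \<Rightarrow> (int \<Rightarrow> complex) \<Rightarrow> real \<Rightarrow>\<^sub>C complex" where
  "embed I f = Bcontfun (\<lambda>r. \<Sum>k\<in>I. of_real (tent k r) * f k)"

definition coord :: "(real \<Rightarrow>\<^sub>C complex) \<Rightarrow> int \<Rightarrow> complex" where
  "coord x k = apply_bcontfun x (real_of_int k)"

lemma norm_tent_sum_le: "cmod (\<Sum>k\<in>I. of_real (tent k r) * f k) \<le> (\<Sum>k\<in>I. cmod (f k))"
proof (rule sum_norm_le)
  fix k show "cmod (of_real (tent k r) * f k) \<le> cmod (f k)"
    using tent_bounds[of k r] by (simp add: norm_mult mult_left_le_one_le)
qed

lemma apply_embed: "apply_bcontfun (embed I f) r = (\<Sum>k\<in>I. of_real (tent k r) * f k)"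
proof -
  have "(\<lambda>r. \<Sum>k\<in>I. of_real (tent k r) * f k) \<in> bcontfun"
    unfolding tent_def by (rule bcontfun_normI[OF _ norm_tent_sum_le[unfolded tent_def]]) (intro continuous_intros)
  then show ?thesis unfolding embed_def by (simp add: Bcontfun_inverse)
qed

lemma coord_embed: "finite I \<Longrightarrow> coord (embed I f) k = (if k \<in> I then f k else 0)"
proof -
  assume fin: "finite I"
  have "coord (embed I f) k = (\<Sum>a\<in>I. if k = a then f a else 0)"
    unfolding coord_def apply_embed tent_int by (rule sum.cong) auto
  then show ?thesis using fin by simp
qed

lemma norm_embed_diff: "norm (embed I f - embed I h) \<le> (\<Sum>k\<in>I. cmod (f k - h k))"
proof (rule norm_bound)
  fix r
  have "apply_bcontfun (embed I f - embed I h) r = (\<Sum>k\<in>I. of_real (tent k r) * (f k - h k))"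
    by (simp add: apply_embed sum_subtractf right_diff_distrib)
  then show "norm (apply_bcontfun (embed I f - embed I h) r) \<le> (\<Sum>k\<in>I. cmod (f k - h k))"
    using norm_tent_sum_le[where f = "\<lambda>k. f k - h k"] by simp
qed

lemma norm_coord: "cmod (coord x k) \<le> norm x" unfolding coord_def by (rule norm_bounded)

lemma coord_diff: "coord (x - y) k = coord x k - coord y k" by (simp add: coord_def)

lemma bounded_linear_apply: "bounded_linear (\<lambda>f :: real \<Rightarrow>\<^sub>C complex. apply_bcontfun f r)"
  by (rule bounded_linear_intro[of _ 1]) (auto simp: norm_bounded)

text \<open>
  The projection onto sequences of Fourier coefficients of real functions.
\<close>

definition symmetrize :: "(int \<Rightarrow> complex) \<Rightarrow> int \<Rightarrow> complex" where
  "symmetrize x k = (x k + cnj (x (- k))) / 2"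

lemma symmetrize_diff: "symmetrize x k - symmetrize y k = symmetrize (\<lambda>k. x k - y k) k"
  by (simp add: symmetrize_def field_simps)

lemma norm_symmetrize_le: assumes "\<And>k. cmod (x k) \<le> M" shows "cmod (symmetrize x k) \<le> M"
proof -
  have "cmod (symmetrize x k) \<le> (cmod (x k) + cmod (cnj (x (- k)))) / 2"
    unfolding symmetrize_def norm_divide using norm_triangle_ineq[of "x k" "cnj (x (- k))"] by simp
  then show ?thesis using assms[of k] assms[of "- k"] by simp
qed

lemma fin_conv_diff_le:
  assumes "\<And>k. cmod (x k) \<le> M" "\<And>k. cmod (y k) \<le> N" "\<And>k. cmod (x k - y k) \<le> d" "finite I"
  shows "cmod (fin_conv I x k - fin_conv I y k) \<le> real (card I) * ((M + N) * d)"
proof -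
  have M: "0 \<le> M" "0 \<le> N" "0 \<le> d" using assms(1-3) order_trans[OF norm_ge_zero] by blast+
  have "fin_conv I x k - fin_conv I y k = (\<Sum>a\<in>I. (x a - y a) * x (k - a) + y a * (x (k - a) - y (k - a)))"
    unfolding fin_conv_def sum_subtractf[symmetric] by (simp add: algebra_simps)
  also have "cmod \<dots> \<le> (\<Sum>a\<in>I. d * M + N * d)"
  proof (rule sum_norm_le)
    fix a
    have "cmod ((x a - y a) * x (k - a) + y a * (x (k - a) - y (k - a)))
       \<le> cmod (x a - y a) * cmod (x (k - a)) + cmod (y a) * cmod (x (k - a) - y (k - a))"
      by (metis norm_mult norm_triangle_ineq)
    also have "\<dots> \<le> d * M + N * d"
      by (intro add_mono mult_mono assms M norm_ge_zero)
    finally show "cmod ((x a - y a) * x (k - a) + y a * (x (k - a) - y (k - a))) \<le> d * M + N * d" .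
  qed
  finally show ?thesis by (simp add: algebra_simps)
qed

lemma fin_conv_cnj:
  assumes I: "\<And>k. - k \<in> I \<longleftrightarrow> k \<in> I" and x: "\<And>k. x (- k) = cnj (x k)"
  shows "fin_conv I x (- k) = cnj (fin_conv I x k)"
proof -
  have "fin_conv I x (- k) = (\<Sum>a\<in>I. x (- a) * x (- k + a))"
    unfolding fin_conv_def by (rule sum.reindex_bij_witness[of _ uminus uminus]) (auto simp: I)
  also have "\<dots> = (\<Sum>a\<in>I. x (- a) * x (- (k - a)))" by simp
  also have "\<dots> = cnj (fin_conv I x k)" unfolding fin_conv_def x by simp
  finally show ?thesis .
qed

text \<open>
  The triple sum \<open>\<Sum> p v\<^sub>p v\<^sub>a v\<^sub>b\<close> over \<open>p + a + b = 0\<close> is symmetric, so the factor \<open>p\<close> may be replaced by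
  \<open>(p + a + b) / 3 = 0\<close>.
\<close>

lemma energy_cancellation:
  assumes fin: "finite I" and I: "\<And>k. - k \<in> I \<longleftrightarrow> k \<in> I" and off: "\<And>k. k \<notin> I \<Longrightarrow> v k = 0"
    and re: "\<And>k. v (- k) = cnj (v k)"
  shows "(\<Sum>k\<in>I. v k \<bullet> (\<i> * of_int k * fin_conv I v k)) = 0"
proof -
  define f where "f p a = v p * v a * v (- p - a)" for p a
  define Z where "Z = (\<Sum>p\<in>I. \<Sum>a\<in>I. of_int p * f p a)"
  have fsym: "f p a = f a p" for p a
  proof -
    have "- p - a = - a - p" by simp
    then show ?thesis unfolding f_def by (simp only: mult_ac)
  qed
  have Z2: "Z = (\<Sum>p\<in>I. \<Sum>a\<in>I. of_int a * f p a)"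
    unfolding Z_def by (subst sum.swap) (simp add: fsym)
  have "(\<Sum>a\<in>I. of_int a * f p a) = (\<Sum>a\<in>I. of_int (- p - a) * f p a)" for p
  proof -
    have "(\<Sum>a\<in>I. of_int a * f p a) = (\<Sum>a\<in>{a\<in>I. - p - a \<in> I}. of_int a * f p a)"
      by (rule sum.mono_neutral_right) (use fin off in \<open>auto simp: f_def\<close>)
    also have "\<dots> = (\<Sum>a\<in>{a\<in>I. - p - a \<in> I}. of_int (- p - a) * f p a)"
      by (rule sum.reindex_bij_witness[of _ "\<lambda>a. - p - a" "\<lambda>a. - p - a"]) (auto simp: f_def)
    also have "\<dots> = (\<Sum>a\<in>I. of_int (- p - a) * f p a)"
      by (rule sum.mono_neutral_left) (use fin off in \<open>auto simp: f_def\<close>)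
    finally show ?thesis .
  qed
  then have "Z = (\<Sum>p\<in>I. \<Sum>a\<in>I. of_int (- p - a) * f p a)" unfolding Z2 by simp
  also have "\<dots> = - Z - Z"
    unfolding Z_def[symmetric]
    by (subst (2) Z2, subst Z_def) (simp add: algebra_simps sum.distrib sum_subtractf sum_negf)
  finally have "3 * Z = 0" by (simp add: algebra_simps)
  then have Z0: "Z = 0" by simp
  have "(\<Sum>k\<in>I. cnj (v k) * (\<i> * of_int k * fin_conv I v k)) = (\<Sum>k\<in>I. v k * (- (\<i> * of_int k * fin_conv I v (- k))))"
    by (rule sum.reindex_bij_witness[of _ uminus uminus]) (auto simp: I re)
  also have "\<dots> = - \<i> * Z"
    unfolding Z_def f_def fin_conv_def by (simp add: sum_distrib_left sum_negf mult_ac)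
  finally have "(\<Sum>k\<in>I. cnj (v k) * (\<i> * of_int k * fin_conv I v k)) = 0" using Z0 by simp
  then have "Re (\<Sum>k\<in>I. cnj (v k) * (\<i> * of_int k * fin_conv I v k)) = 0" by simp
  moreover have "z \<bullet> w = Re (cnj z * w)" for z w by (simp add: inner_complex_def)
  ultimately show ?thesis by (simp only: Re_sum)
qed

text \<open>
  The truncated system has a global solution by Lipschitz continuity; its \<open>L^2\<close> norm does not increase, so
  it never reaches the region where the truncation acts.
\<close>

theorem galerkin_exists:
  assumes fin: "finite I" and nz: "0 \<notin> I" and I: "\<And>k. - k \<in> I \<longleftrightarrow> k \<in> I" and eps: "0 \<le> \<epsilon>" and T: "0 \<le> T"
    and off: "\<And>k. k \<notin> I \<Longrightarrow> \<phi> k = 0" and re: "\<And>k. \<phi> (- k) = cnj (\<phi> k)"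
  shows "\<exists>v. galerkin \<epsilon> I T v \<and> v 0 = \<phi> \<and> (\<forall>t k. v t (- k) = cnj (v t k)) \<and>
     (\<forall>t\<in>{0..T}. wsum I (\<lambda>_. 1) (v t) \<le> wsum I (\<lambda>_. 1) \<phi>)"
proof -
  (* Larger than the norm of every vector whose L2 norm is at most that of the data. *)
  define R where "R = real (card I) * sqrt (wsum I (\<lambda>_. 1) \<phi>) + 1"
  have R: "0 < R" by (simp add: R_def add_nonneg_pos)
  define Q where "Q x = embed I (\<lambda>k. \<i> * of_int k * fin_conv I (symmetrize (coord x)) k)" for x
  define P where "P x = embed I (\<lambda>k. lam \<epsilon> k * coord x k)" for x
  define F where "F x = P x + cutoff R (norm x) *\<^sub>R Q x" for x
  define \<Lambda> where "\<Lambda> = (\<Sum>k\<in>I. cmod (lam \<epsilon> k))"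
  define B where "B = (\<Sum>k\<in>I. \<bar>real_of_int k\<bar>) * real (card I)"
  have pos: "0 \<le> \<Lambda>" "0 \<le> B" by (auto simp: \<Lambda>_def B_def intro!: sum_nonneg mult_nonneg_nonneg)
  have P_lip: "norm (P x - P y) \<le> \<Lambda> * norm (x - y)" for x y
  proof -
    have "norm (P x - P y) \<le> (\<Sum>k\<in>I. cmod (lam \<epsilon> k) * cmod (coord (x - y) k))"
      using norm_embed_diff[of I "\<lambda>k. lam \<epsilon> k * coord x k" "\<lambda>k. lam \<epsilon> k * coord y k"]
      by (simp add: P_def coord_diff norm_mult flip: right_diff_distrib)
    also have "\<dots> \<le> (\<Sum>k\<in>I. cmod (lam \<epsilon> k) * norm (x - y))"
      by (intro sum_mono mult_left_mono norm_coord) auto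
    finally show ?thesis by (simp add: \<Lambda>_def sum_distrib_right)
  qed
  have Q_lip: "norm (Q x - Q y) \<le> B * (norm x + norm y) * norm (x - y)" for x y
  proof -
    have "cmod (symmetrize (coord x) a - symmetrize (coord y) a) \<le> norm (x - y)" for a
      unfolding symmetrize_diff coord_diff[symmetric] by (rule norm_symmetrize_le) (rule norm_coord)
    then have cvd: "cmod (fin_conv I (symmetrize (coord x)) k - fin_conv I (symmetrize (coord y)) k) \<le> real (card I) * ((norm x + norm y) * norm (x - y))" for k
      using fin by (intro fin_conv_diff_le norm_symmetrize_le norm_coord) auto
    have "norm (Q x - Q y) \<le> (\<Sum>k\<in>I. \<bar>real_of_int k\<bar> * cmod (fin_conv I (symmetrize (coord x)) k - fin_conv I (symmetrize (coord y)) k))"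
      using norm_embed_diff[of I "\<lambda>k. \<i> * of_int k * fin_conv I (symmetrize (coord x)) k" "\<lambda>k. \<i> * of_int k * fin_conv I (symmetrize (coord y)) k"]
      by (simp add: Q_def norm_mult flip: right_diff_distrib)
    also have "\<dots> \<le> (\<Sum>k\<in>I. \<bar>real_of_int k\<bar> * (real (card I) * ((norm x + norm y) * norm (x - y))))"
      by (intro sum_mono mult_left_mono cvd) auto
    finally show ?thesis by (simp add: B_def sum_distrib_right mult.assoc)
  qed
  have Q0: "Q 0 = 0"
    by (rule bcontfun_eqI) (simp add: Q_def apply_embed fin_conv_def symmetrize_def coord_def)
  have F_lip: "norm (F x - F y) \<le> (\<Lambda> + 8 * B * R) * norm (x - y)" for x y
  proof -
    have "F x - F y = (P x - P y) + (cutoff R (norm x) *\<^sub>R Q x - cutoff R (norm y) *\<^sub>R Q y)"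
      by (simp add: F_def)
    then have "norm (F x - F y) \<le> norm (P x - P y) + norm (cutoff R (norm x) *\<^sub>R Q x - cutoff R (norm y) *\<^sub>R Q y)"
      by (metis norm_triangle_ineq)
    also have "\<dots> \<le> \<Lambda> * norm (x - y) + 8 * B * R * norm (x - y)"
      by (intro add_mono P_lip cutoff_quadratic_lipschitz R pos Q0 Q_lip)
    finally show ?thesis by (simp add: distrib_right)
  qed
  have L0: "0 \<le> \<Lambda> + 8 * B * R" using pos R by simp
  define x0 where "x0 = embed I \<phi>"
  have x0: "coord x0 k = \<phi> k" for k
    unfolding x0_def by (simp add: coord_embed[OF fin] off)
  obtain x where xi: "x 0 = x0" and dx: "\<And>t. t \<in> {0..T} \<Longrightarrow> (x has_vector_derivative F (x t)) (at t within {0..T})"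
    using lipschitz_ode_solution[of "\<Lambda> + 8 * B * R" F T x0, OF L0 F_lip T] by blast
  define c where "c t = cutoff R (norm (x t))" for t
  have cF: "coord (F (x t)) k = (if k \<in> I then lam \<epsilon> k * coord (x t) k + of_real (c t) * (\<i> * of_int k * fin_conv I (symmetrize (coord (x t))) k) else 0)" for t k
  proof -
    have "coord (F (x t)) k = coord (P (x t)) k + of_real (c t) * coord (Q (x t)) k"
      by (simp add: F_def c_def coord_def scaleR_conv_of_real)
    then show ?thesis by (simp add: P_def Q_def coord_embed[OF fin])
  qed
  have dk: "((\<lambda>s. coord (x s) k) has_vector_derivative
     (if k \<in> I then lam \<epsilon> k * coord (x t) k + of_real (c t) * (\<i> * of_int k * fin_conv I (symmetrize (coord (x t))) k) else 0)) (at t within {0..T})"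
    if "t \<in> {0..T}" for t k
    unfolding cF[symmetric] unfolding coord_def
    by (rule bounded_linear.has_vector_derivative[OF bounded_linear_apply dx[OF that]])
  (* The field takes values in the span of the tent functions, so the solution stays in it. *)
  have xvec: "x t = embed I (coord (x t))" if t: "t \<in> {0..T}" for t
  proof (rule bcontfun_eqI)
    fix r
    define e where "e s = apply_bcontfun (x s) r - (\<Sum>k\<in>I. of_real (tent k r) * coord (x s) k)" for s
    have Fr: "apply_bcontfun (F (x s)) r = (\<Sum>k\<in>I. of_real (tent k r) * coord (F (x s)) k)" for s
    proof -
      have "apply_bcontfun (F (x s)) r = apply_bcontfun (P (x s)) r + of_real (c s) * apply_bcontfun (Q (x s)) r"
        by (simp add: F_def c_def scaleR_conv_of_real)
      also have "\<dots> = (\<Sum>k\<in>I. of_real (tent k r) * coord (F (x s)) k)"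
        unfolding P_def Q_def apply_embed sum_distrib_left sum.distrib[symmetric]
        by (rule sum.cong) (simp_all add: cF algebra_simps)
      finally show ?thesis .
    qed
    have de: "(e has_vector_derivative 0) (at s within {0..T})" if s: "s \<in> {0..T}" for s
    proof -
      have "(e has_vector_derivative (apply_bcontfun (F (x s)) r - (\<Sum>k\<in>I. of_real (tent k r) * coord (F (x s)) k))) (at s within {0..T})"
        unfolding e_def coord_def
        by (intro has_vector_derivative_diff has_vector_derivative_sum has_vector_derivative_mult_right
            bounded_linear.has_vector_derivative[OF bounded_linear_apply dx[OF s]])
      then show ?thesis by (simp add: Fr)
    qed
    have "(cmod (e t))\<^sup>2 \<le> exp (0 * t) * (cmod (e 0))\<^sup>2"
      by (rule gronwall_derivative[OF norm_sq_deriv[OF de] _ t]) auto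
    moreover have "e 0 = 0" unfolding e_def xi x0 by (simp add: x0_def apply_embed)
    ultimately have "e t = 0" by simp
    then show "apply_bcontfun (x t) r = apply_bcontfun (embed I (coord (x t))) r" by (simp add: e_def apply_embed)
  qed
  have xoff: "coord (x t) k = 0" if t: "t \<in> {0..T}" and k: "k \<notin> I" for t k
  proof -
    have "(cmod (coord (x t) k))\<^sup>2 \<le> exp (0 * t) * (cmod (coord (x 0) k))\<^sup>2"
      by (rule gronwall_derivative[OF norm_sq_deriv[OF dk] _ t]) (use k in auto)
    then show ?thesis using xi off[OF k] by (simp add: x0)
  qed
  (* The quadratic term is evaluated at the symmetrised vector; hence the antisymmetric part of x
     obeys a linear equation and remains 0. *)
  have xre: "coord (x t) (- k) = cnj (coord (x t) k)" if t: "t \<in> {0..T}" for t k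
  proof (cases "k \<in> I")
    case k: True
    define d where "d s = coord (x s) (- k) - cnj (coord (x s) k)" for s
    have ddt: "(d has_vector_derivative (lam \<epsilon> (- k) * d s)) (at s within {0..T})" if s: "s \<in> {0..T}" for s
    proof -
      let ?q = "fin_conv I (symmetrize (coord (x s)))"
      have q: "?q (- k) = cnj (?q k)" by (rule fin_conv_cnj[OF I]) (simp add: symmetrize_def)
      have l: "lam \<epsilon> (- k) = cnj (lam \<epsilon> k)" by (simp add: lam_def)
      have 1: "((\<lambda>s. cnj (coord (x s) k)) has_vector_derivative
         cnj (lam \<epsilon> k * coord (x s) k + of_real (c s) * (\<i> * of_int k * ?q k))) (at s within {0..T})"
        using bounded_linear.has_vector_derivative[OF bounded_linear_cnj dk[OF s, of k]] k by simp
      have 2: "((\<lambda>s. coord (x s) (- k)) has_vector_derivative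
         (lam \<epsilon> (- k) * coord (x s) (- k) + of_real (c s) * (\<i> * of_int (- k) * ?q (- k)))) (at s within {0..T})"
        using dk[OF s, of "- k"] k by (simp add: I)
      show ?thesis unfolding d_def
        by (rule has_vector_derivative_eq_rhs[OF has_vector_derivative_diff[OF 2 1]]) (simp add: q l algebra_simps)
    qed
    have "(cmod (d t))\<^sup>2 \<le> exp (0 * t) * (cmod (d 0))\<^sup>2"
    proof (rule gronwall_derivative[OF norm_sq_deriv[OF ddt] _ t])
      show "2 * (d s \<bullet> (lam \<epsilon> (- k) * d s)) \<le> 0 * (cmod (d s))\<^sup>2" for s
        using damped_norm_sq(1)[OF eps, of "d s" "- k" 0] by simp
    qed
    then have "d t = 0" using xi re by (simp add: d_def x0)
    then show ?thesis by (simp add: d_def)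
  next
    case False
    then show ?thesis using xoff[OF t, of k] xoff[OF t, of "- k"] by (simp add: I)
  qed
  have sym: "symmetrize (coord (x t)) = coord (x t)" if t: "t \<in> {0..T}" for t
    by (rule ext) (use xre[OF t] in \<open>simp add: symmetrize_def\<close>)
  have en: "wsum I (\<lambda>_. 1) (coord (x t)) \<le> wsum I (\<lambda>_. 1) \<phi>" if t: "t \<in> {0..T}" for t
  proof -
    let ?E' = "\<lambda>t. \<Sum>k\<in>I. 2 * (coord (x t) k \<bullet>
        (lam \<epsilon> k * coord (x t) k + of_real (c t) * (\<i> * of_int k * fin_conv I (coord (x t)) k)))"
    have "(\<Sum>k\<in>I. (cmod (coord (x t) k))\<^sup>2) \<le> exp (0 * t) * (\<Sum>k\<in>I. (cmod (coord (x 0) k))\<^sup>2)"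
    proof (rule gronwall_derivative[where E' = ?E', OF _ _ t])
      fix t assume t: "t \<in> {0..T}"
      show "((\<lambda>t. \<Sum>k\<in>I. (cmod (coord (x t) k))\<^sup>2) has_real_derivative ?E' t) (at t within {0..T})"
      proof (intro DERIV_sum norm_sq_deriv)
        fix k assume "k \<in> I"
        then show "((\<lambda>t. coord (x t) k) has_vector_derivative (lam \<epsilon> k * coord (x t) k + of_real (c t) * (\<i> * of_int k * fin_conv I (coord (x t)) k))) (at t within {0..T})"
          using dk[OF t, of k] by (simp add: sym[OF t])
      qed
      have "?E' t \<le> (\<Sum>k\<in>I. 2 * (coord (x t) k \<bullet> (of_real (c t) * (\<i> * of_int k * fin_conv I (coord (x t)) k))))"
        by (intro sum_mono damped_norm_sq(1) eps)
      also have "\<dots> = 2 * c t * (\<Sum>k\<in>I. coord (x t) k \<bullet> (\<i> * of_int k * fin_conv I (coord (x t)) k))"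
        by (simp add: sum_distrib_left mult_ac flip: scaleR_conv_of_real)
      also have "\<dots> = 0"
        by (subst energy_cancellation[OF fin I]) (use xoff[OF t] xre[OF t] in auto)
      finally show "?E' t \<le> 0 * (\<Sum>k\<in>I. (cmod (coord (x t) k))\<^sup>2)" by simp
    qed
    then show ?thesis by (simp add: wsum_def xi x0)
  qed
  have nx: "norm (x t) \<le> R" if t: "t \<in> {0..T}" for t
  proof -
    have ck: "cmod (coord (x t) k) \<le> sqrt (wsum I (\<lambda>_. 1) \<phi>)" if k: "k \<in> I" for k
    proof -
      have "(cmod (coord (x t) k))\<^sup>2 \<le> wsum I (\<lambda>_. 1) (coord (x t))"
        unfolding wsum_def using member_le_sum[OF k, of "\<lambda>k. (1 * cmod (coord (x t) k))\<^sup>2"] fin by simp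
      also note en[OF t]
      finally show ?thesis by (rule real_le_rsqrt)
    qed
    have v0: "embed I (\<lambda>_. 0) = 0" by (rule bcontfun_eqI) (simp add: apply_embed)
    have "norm (x t) \<le> (\<Sum>k\<in>I. cmod (coord (x t) k))"
      using norm_embed_diff[of I "coord (x t)" "\<lambda>_. 0"] xvec[OF t] v0 by simp
    also have "\<dots> \<le> (\<Sum>k\<in>I. sqrt (wsum I (\<lambda>_. 1) \<phi>))" by (intro sum_mono ck)
    finally show ?thesis by (simp add: R_def)
  qed
  define v where "v t = (if t \<in> {0..T} then coord (x t) else (\<lambda>_. 0))" for t
  show ?thesis
  proof (intro exI[of _ v] conjI)
    show "v 0 = \<phi>" using T by (auto simp: v_def xi x0)
    show "\<forall>t k. v t (- k) = cnj (v t k)" by (simp add: v_def xre)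
    show "\<forall>t\<in>{0..T}. wsum I (\<lambda>_. 1) (v t) \<le> wsum I (\<lambda>_. 1) \<phi>" using en by (simp add: v_def)
    show "galerkin \<epsilon> I T v"
      unfolding galerkin_def
    proof (intro conjI allI ballI impI)
      show "v t k = 0" if "k \<notin> I" for t k using that by (simp add: v_def xoff)
      fix t k assume t: "t \<in> {0..T}" and k: "k \<in> I"
      have "c t = 1" unfolding c_def by (rule cutoff_eq1[OF R nx[OF t]])
      then have "((\<lambda>s. coord (x s) k) has_vector_derivative
         lam \<epsilon> k * v t k + \<i> * of_int k * fin_conv I (v t) k) (at t within {0..T})"
        using dk[OF t, of k] k t by (simp add: sym[OF t] v_def)
      then show "((\<lambda>s. v s k) has_vector_derivative lam \<epsilon> k * v t k + \<i> * of_int k * fin_conv I (v t) k) (at t within {0..T})"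
        by (rule has_vector_derivative_transform[OF t, rotated]) (simp add: v_def)
    qed
  qed
qed

section \<open>Square-summable sequences and convolution\<close>

text \<open>
  The square of the \<open>H^s\<close> norm of a coefficient sequence is at most \<open>B\<close>.  Stated through finite partial
  sums, the bound includes summability and passes to componentwise limits.
\<close>

definition hs :: "real \<Rightarrow> (int \<Rightarrow> complex) \<Rightarrow> real \<Rightarrow> bool" where
  "hs s f B \<longleftrightarrow> (\<forall>S. finite S \<longrightarrow> (\<Sum>k\<in>S. (sw s k * cmod (f k))\<^sup>2) \<le> B)"

lemma hsI: "(\<And>S. finite S \<Longrightarrow> (\<Sum>k\<in>S. (sw s k * cmod (f k))\<^sup>2) \<le> B) \<Longrightarrow> hs s f B"
  by (simp add: hs_def)
lemma hsD: "hs s f B \<Longrightarrow> finite S \<Longrightarrow> (\<Sum>k\<in>S. (sw s k * cmod (f k))\<^sup>2) \<le> B"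
  by (simp add: hs_def)
lemma hs0D: "hs 0 f B \<Longrightarrow> finite S \<Longrightarrow> (\<Sum>k\<in>S. (cmod (f k))\<^sup>2) \<le> B"
  using hsD[of 0 f B S] by simp
lemma hs_nonneg: "hs s f B \<Longrightarrow> 0 \<le> B"
  using hsD[of s f B "{}"] by simp
lemma hs_mono: "hs s f B \<Longrightarrow> B \<le> C \<Longrightarrow> hs s f C"
  by (meson hs_def order_trans)
lemma hs_weaken: assumes "hs s f B" "0 \<le> s" shows "hs 0 f B"
proof (rule hsI)
  fix S :: "int set" assume S: "finite S"
  have "(\<Sum>k\<in>S. (sw 0 k * cmod (f k))\<^sup>2) \<le> (\<Sum>k\<in>S. (sw s k * cmod (f k))\<^sup>2)"
    by (intro sum_mono power_mono mult_right_mono) (use sw_ge1[OF assms(2)] in auto)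
  also have "\<dots> \<le> B" by (rule hsD[OF assms(1) S])
  finally show "(\<Sum>k\<in>S. (sw 0 k * cmod (f k))\<^sup>2) \<le> B" .
qed
lemma hs_component: assumes "hs 0 f B" shows "cmod (f k) \<le> sqrt B"
  using hs0D[OF assms, of "{k}"] by (intro real_le_rsqrt) simp

lemma norm_add_sq_le: "(w * cmod (a + b))\<^sup>2 \<le> 2 * (w * cmod a)\<^sup>2 + 2 * (w * cmod b)\<^sup>2"
proof -
  have "(cmod (a + b))\<^sup>2 \<le> (cmod a + cmod b)\<^sup>2" by (intro power_mono norm_triangle_ineq) auto
  also have "\<dots> \<le> 2 * (cmod a)\<^sup>2 + 2 * (cmod b)\<^sup>2"
    using zero_le_power2[of "cmod a - cmod b"] by (simp add: power2_eq_square algebra_simps)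
  finally have "w\<^sup>2 * (cmod (a + b))\<^sup>2 \<le> w\<^sup>2 * (2 * (cmod a)\<^sup>2 + 2 * (cmod b)\<^sup>2)" by (intro mult_left_mono) auto
  then show ?thesis by (simp add: power_mult_distrib algebra_simps)
qed

lemma sum_norm_add_sq_le:
  "(\<Sum>k\<in>S. (w k * cmod (f k + h k))\<^sup>2) \<le> 2 * (\<Sum>k\<in>S. (w k * cmod (f k))\<^sup>2) + 2 * (\<Sum>k\<in>S. (w k * cmod (h k))\<^sup>2)"
  unfolding sum_distrib_left sum.distrib[symmetric] by (intro sum_mono norm_add_sq_le)

lemma hs_add: assumes "hs s f A" "hs s h B" shows "hs s (\<lambda>k. f k + h k) (2 * A + 2 * B)"
  by (rule hsI, rule order_trans[OF sum_norm_add_sq_le]) (intro add_mono mult_left_mono hsD assms; simp)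

lemma hs_uminus: "hs s f A \<Longrightarrow> hs s (\<lambda>k. - f k) A" by (simp add: hs_def)

lemma hs_diff: assumes "hs s f A" "hs s h B" shows "hs s (\<lambda>k. f k - h k) (2 * A + 2 * B)"
  using hs_add[OF assms(1) hs_uminus[OF assms(2)]] by simp

lemma hs_tail:
  assumes f: "hs s f B" and d: "0 < (d::real)"
  shows "\<exists>K::nat. \<forall>S. finite S \<longrightarrow> (\<forall>k\<in>S. int K < \<bar>k\<bar>) \<longrightarrow> (\<Sum>k\<in>S. (sw s k * cmod (f k))\<^sup>2) \<le> d"
proof -
  let ?q = "\<lambda>k. (sw s k * cmod (f k))\<^sup>2"
  have sm: "?q summable_on UNIV"
    by (rule nonneg_bdd_above_summable_on) (use hsD[OF f] in \<open>auto intro!: bdd_aboveI2\<close>)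
  obtain F where F: "finite F" "dist (sum ?q F) (infsum ?q UNIV) \<le> d"
    using infsum_finite_approximation[OF sm d] by blast
  define K where "K = nat (Max (insert 0 (abs ` F)))"
  have FK: "\<bar>k\<bar> \<le> int K" if "k \<in> F" for k
    using that F(1) unfolding K_def by (subst nat_0_le) auto
  show ?thesis
  proof (intro exI allI impI)
    fix S assume S: "finite S" "\<forall>k\<in>S. int K < \<bar>k\<bar>"
    have "F \<inter> S = {}" using S FK by fastforce
    then have "sum ?q F + sum ?q S = sum ?q (F \<union> S)" using F S by (simp add: sum.union_disjoint)
    also have "\<dots> \<le> infsum ?q UNIV" by (rule finite_sum_le_infsum[OF sm]) (use F S in auto)
    finally show "sum ?q S \<le> d" using F(2) by (simp add: dist_real_def abs_le_iff)
  qed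
qed

lemma inv_abs_tail:
  assumes "0 < (d::real)"
  shows "\<exists>K::nat. \<forall>S. finite S \<longrightarrow> (\<forall>k\<in>S. int K < \<bar>k\<bar>) \<longrightarrow> (\<Sum>k\<in>S. (inv_abs k)\<^sup>2) \<le> d"
  using hs_tail[of 0 "\<lambda>k. of_real (inv_abs k)" 4 d] sum_inv_abs_sq assms by (auto simp: hs_def)

definition conv :: "(int \<Rightarrow> complex) \<Rightarrow> (int \<Rightarrow> complex) \<Rightarrow> int \<Rightarrow> complex" where
  "conv f h k = (\<Sum>\<^sub>\<infinity>a. f a * h (k - a))"

lemma conv_finite_sum_le:
  assumes "hs 0 f A" "hs 0 h B" "finite S"
  shows "(\<Sum>a\<in>S. cmod (f a * h (k - a))) \<le> sqrt (A * B)"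
proof (rule real_le_rsqrt)
  have "(\<Sum>a\<in>S. cmod (f a) * cmod (h (k - a)))\<^sup>2 \<le> (\<Sum>a\<in>S. (cmod (f a))\<^sup>2) * (\<Sum>a\<in>S. (cmod (h (k - a)))\<^sup>2)"
    by (rule Cauchy_Schwarz_ineq_sum)
  also have "(\<Sum>a\<in>S. (cmod (h (k - a)))\<^sup>2) = (\<Sum>a\<in>(\<lambda>a. k - a) ` S. (cmod (h a))\<^sup>2)"
    by (subst sum.reindex) (auto simp: inj_on_def)
  also have "(\<Sum>a\<in>S. (cmod (f a))\<^sup>2) * \<dots> \<le> A * B"
    by (intro mult_mono hs0D assms hs_nonneg[OF assms(1)] sum_nonneg) (use assms in auto)
  finally show "(\<Sum>a\<in>S. cmod (f a * h (k - a)))\<^sup>2 \<le> A * B" by (simp add: norm_mult)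
qed

lemma conv_abs_summable:
  assumes "hs 0 f A" "hs 0 h B"
  shows "(\<lambda>a. cmod (f a * h (k - a))) summable_on UNIV"
  by (rule nonneg_bdd_above_summable_on) (use conv_finite_sum_le[OF assms] in \<open>auto intro!: bdd_aboveI2\<close>)

lemma conv_summable:
  assumes "hs 0 f A" "hs 0 h B"
  shows "(\<lambda>a. f a * h (k - a)) summable_on UNIV"
  by (rule abs_summable_summable[OF conv_abs_summable[OF assms]])

text \<open>
  The Cauchy-Schwarz inequality: the convolution of \<open>\<ell>^2\<close> sequences is bounded.
\<close>

lemma norm_conv_le:
  assumes "hs 0 f A" "hs 0 h B"
  shows "cmod (conv f h k) \<le> sqrt (A * B)"
proof -
  have "cmod (conv f h k) \<le> (\<Sum>\<^sub>\<infinity>a. cmod (f a * h (k - a)))"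
    unfolding conv_def by (rule norm_infsum_bound[OF conv_abs_summable[OF assms]])
  also have "\<dots> \<le> sqrt (A * B)"
    by (rule infsum_le_finite_sums[OF conv_abs_summable[OF assms]]) (rule conv_finite_sum_le[OF assms])
  finally show ?thesis .
qed

lemma conv_diff:
  assumes v: "hs 0 v A" and u: "hs 0 u B"
  shows "conv v v k - conv u u k = conv (\<lambda>k. v k - u k) v k + conv u (\<lambda>k. v k - u k) k"
proof -
  let ?w = "\<lambda>k. v k - u k"
  have w: "hs 0 ?w (2 * A + 2 * B)" by (rule hs_diff[OF v u])
  have "conv ?w v k + conv u ?w k = (\<Sum>\<^sub>\<infinity>a. ?w a * v (k - a) + u a * ?w (k - a))"
    unfolding conv_def by (rule infsum_add[symmetric]) (rule conv_summable[OF w v] conv_summable[OF u w])+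
  also have "\<dots> = (\<Sum>\<^sub>\<infinity>a. v a * v (k - a) + - (u a * u (k - a)))"
    by (rule infsum_cong) (simp add: algebra_simps)
  also have "\<dots> = conv v v k + (\<Sum>\<^sub>\<infinity>a. - (u a * u (k - a)))"
    unfolding conv_def by (rule infsum_add) (use conv_summable[OF v v] conv_summable[OF u u] in \<open>auto simp: summable_on_uminus\<close>)
  also have "\<dots> = conv v v k - conv u u k" by (simp add: conv_def infsum_uminus)
  finally show ?thesis by simp
qed

lemma norm_conv_diff_le:
  assumes v: "hs 0 v B" and u: "hs 0 u B" and w: "hs 0 (\<lambda>k. v k - u k) D"
  shows "cmod (conv v v k - conv u u k) \<le> 2 * sqrt (D * B)"
proof -
  have "cmod (conv v v k - conv u u k) \<le> cmod (conv (\<lambda>k. v k - u k) v k) + cmod (conv u (\<lambda>k. v k - u k) k)"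
    unfolding conv_diff[OF v u] by (rule norm_triangle_ineq)
  also have "\<dots> \<le> sqrt (D * B) + sqrt (B * D)" by (intro add_mono norm_conv_le v u w)
  finally show ?thesis by (simp add: mult.commute)
qed

lemma conv_finite: assumes "finite I" "\<And>k. k \<notin> I \<Longrightarrow> v k = 0" shows "conv v v k = fin_conv I v k"
proof -
  have "conv v v k = (\<Sum>\<^sub>\<infinity>a\<in>I. v a * v (k - a))" unfolding conv_def by (rule infsum_cong_neutral) (use assms in auto)
  then show ?thesis using assms by (simp add: fin_conv_def)
qed

text \<open>
  The system for the modes in \<open>J\<close>; a finite \<open>J\<close> gives Galerkin approximations and infinite \<open>J\<close> the full
  equation, so that one comparison lemma serves both.
\<close>

definition mode_flow :: "real \<Rightarrow> int set \<Rightarrow> real \<Rightarrow> (real \<Rightarrow> int \<Rightarrow> complex) \<Rightarrow> bool" where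
  "mode_flow \<epsilon> J T v \<longleftrightarrow> (\<forall>t\<in>{0..T}. \<forall>k. k \<notin> J \<longrightarrow> v t k = 0) \<and>
     (\<forall>t\<in>{0..T}. \<forall>k\<in>J. ((\<lambda>\<tau>. v \<tau> k) has_vector_derivative
        (lam \<epsilon> k * v t k + \<i> * of_int k * conv (v t) (v t) k)) (at t within {0..T}))"

lemma galerkin_mode_flow: "galerkin \<epsilon> I T v \<Longrightarrow> finite I \<Longrightarrow> mode_flow \<epsilon> I T v"
  unfolding galerkin_def mode_flow_def by (simp add: conv_finite)

lemma Re_lam: "Re (lam \<epsilon> k) = - (\<epsilon> * (real_of_int k)\<^sup>2)"
  by (simp add: lam_def power2_eq_square power3_eq_cube)

text \<open>
  The variation of constants formula for one mode, with a forcing that grows at most like \<open>exp (\<Omega> t)\<close>.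
\<close>

lemma duhamel_bound:
  fixes y :: "real \<Rightarrow> complex"
  assumes dy: "\<And>t. t \<in> {0..T} \<Longrightarrow> (y has_vector_derivative (lam \<epsilon> k * y t + r t)) (at t within {0..T})"
    and r: "\<And>t. t \<in> {0..T} \<Longrightarrow> cmod (r t) \<le> G * exp (\<Omega> * t)"
    and pos: "0 < \<epsilon> * (real_of_int k)\<^sup>2 + \<Omega>" and eps: "0 \<le> \<epsilon>" and G: "0 \<le> G" and t: "t \<in> {0..T}"
  shows "cmod (y t) \<le> cmod (y 0) + G / (\<epsilon> * (real_of_int k)\<^sup>2 + \<Omega>) * exp (\<Omega> * t)"
proof -
  define c where "c = \<epsilon> * (real_of_int k)\<^sup>2"
  have c: "0 \<le> c" "0 < c + \<Omega>" using eps pos by (auto simp: c_def)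
  define p where "p s = exp (- (of_real s * lam \<epsilon> k)) * y s" for s :: real
  define p' where "p' s = exp (- (of_real s * lam \<epsilon> k)) * r s" for s :: real
  have dp: "(p has_vector_derivative p' s) (at s within {0..t})" if s: "s \<in> {0..t}" for s
  proof -
    have e: "((\<lambda>s. exp (- (of_real s * lam \<epsilon> k))) has_vector_derivative (- lam \<epsilon> k * exp (- (of_real s * lam \<epsilon> k)))) (at s within {0..t})"
    proof -
      have "((\<lambda>z. exp (- (z * lam \<epsilon> k))) has_field_derivative (- lam \<epsilon> k * exp (- (of_real s * lam \<epsilon> k)))) (at (of_real s))"
        by (auto intro!: derivative_eq_intros)
      then have "((\<lambda>z. exp (- (z * lam \<epsilon> k))) \<circ> of_real has_vector_derivative 1 * (- lam \<epsilon> k * exp (- (of_real s * lam \<epsilon> k)))) (at s)"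
        by (intro field_vector_diff_chain_at) (auto intro: has_vector_derivative_of_real derivative_eq_intros)
      then show ?thesis by (simp add: o_def has_vector_derivative_at_within)
    qed
    have "s \<in> {0..T}" using s t by auto
    from has_vector_derivative_within_subset[OF dy[OF this], of "{0..t}"]
    have "(y has_vector_derivative (lam \<epsilon> k * y s + r s)) (at s within {0..t})" using t by auto
    from has_vector_derivative_mult[OF e this] show ?thesis
      unfolding p_def p'_def by (rule has_vector_derivative_eq_rhs) (simp add: algebra_simps)
  qed
  have nexp: "cmod (exp (- (of_real s * lam \<epsilon> k))) = exp (c * s)" for s
    by (simp add: norm_exp_eq_Re Re_lam c_def mult_ac)
  have 1: "(p' has_integral p t - p 0) {0..t}"
    by (rule fundamental_theorem_of_calculus) (use t dp in auto)
  have 2: "((\<lambda>s. G * exp ((c + \<Omega>) * s)) has_integral G * ((exp ((c + \<Omega>) * t) - 1) / (c + \<Omega>))) {0..t}"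
    by (intro has_integral_mult_right exp_integral_le c) (use t in auto)
  have "norm (integral {0..t} p') \<le> integral {0..t} (\<lambda>s. G * exp ((c + \<Omega>) * s))"
  proof (rule integral_norm_bound_integral)
    show "p' integrable_on {0..t}" "(\<lambda>s. G * exp ((c + \<Omega>) * s)) integrable_on {0..t}" using 1 2 by blast+
    fix s assume s: "s \<in> {0..t}"
    have "norm (p' s) = exp (c * s) * cmod (r s)" unfolding p'_def norm_mult nexp ..
    also have "\<dots> \<le> exp (c * s) * (G * exp (\<Omega> * s))" using s t by (intro mult_left_mono r) auto
    also have "\<dots> = G * exp ((c + \<Omega>) * s)" by (simp add: distrib_right exp_add)
    finally show "norm (p' s) \<le> G * exp ((c + \<Omega>) * s)" .
  qed
  then have "cmod (p t - p 0) \<le> G * ((exp ((c + \<Omega>) * t) - 1) / (c + \<Omega>))"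
    unfolding integral_unique[OF 1] integral_unique[OF 2] .
  also have "\<dots> \<le> G * (exp ((c + \<Omega>) * t) / (c + \<Omega>))"
    using c G by (intro mult_left_mono divide_right_mono) auto
  finally have d: "cmod (p t - p 0) \<le> G * (exp ((c + \<Omega>) * t) / (c + \<Omega>))" .
  have "cmod (p t) = exp (c * t) * cmod (y t)" unfolding p_def norm_mult nexp ..
  moreover have "cmod (p 0) = cmod (y 0)" by (simp add: p_def)
  moreover have "cmod (p t) \<le> cmod (p 0) + cmod (p t - p 0)" using norm_triangle_ineq[of "p 0" "p t - p 0"] by simp
  ultimately have "exp (c * t) * cmod (y t) \<le> cmod (y 0) + G * (exp ((c + \<Omega>) * t) / (c + \<Omega>))" using d by linarith
  then have "exp (- (c * t)) * (exp (c * t) * cmod (y t)) \<le> exp (- (c * t)) * (cmod (y 0) + G * (exp ((c + \<Omega>) * t) / (c + \<Omega>)))"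
    by (intro mult_left_mono) auto
  also have "\<dots> = exp (- (c * t)) * cmod (y 0) + G * ((exp (- (c * t)) * exp ((c + \<Omega>) * t)) / (c + \<Omega>))"
    by (simp add: algebra_simps)
  also have "exp (- (c * t)) * exp ((c + \<Omega>) * t) = exp (\<Omega> * t)"
    by (simp add: distrib_right flip: exp_add)
  also have "exp (- (c * t)) * (exp (c * t) * cmod (y t)) = cmod (y t)"
    by (simp add: mult.assoc[symmetric] flip: exp_add)
  finally have "cmod (y t) \<le> exp (- (c * t)) * cmod (y 0) + G * (exp (\<Omega> * t) / (c + \<Omega>))" .
  moreover have "exp (- (c * t)) * cmod (y 0) \<le> 1 * cmod (y 0)" using c t by (intro mult_right_mono) auto
  ultimately show ?thesis by (simp add: c_def)
qed

section \<open>Comparison of solutions by dissipation\<close>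

lemma hs_wsum: assumes "finite I" "\<And>k. k \<notin> I \<Longrightarrow> f k = 0" shows "hs s f (wsum I (sw s) f)"
proof (rule hsI)
  fix S :: "int set" assume S: "finite S"
  have "(\<Sum>k\<in>S. (sw s k * cmod (f k))\<^sup>2) = (\<Sum>k\<in>S \<inter> I. (sw s k * cmod (f k))\<^sup>2)"
    by (rule sum.mono_neutral_right) (use S assms in auto)
  also have "\<dots> \<le> wsum I (sw s) f" unfolding wsum_def by (rule sum_mono2) (use assms in auto)
  finally show "(\<Sum>k\<in>S. (sw s k * cmod (f k))\<^sup>2) \<le> wsum I (sw s) f" .
qed

lemma wsum_le_hs: "hs s f B \<Longrightarrow> finite I \<Longrightarrow> wsum I (sw s) f \<le> B"
  unfolding wsum_def by (rule hsD)

lemma hs_limit: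
  assumes lim: "\<And>k. (\<lambda>n. f n k) \<longlonglongrightarrow> g k" and ev: "\<forall>\<^sub>F n in sequentially. hs s (f n) B"
  shows "hs s g B"
proof (rule hsI)
  fix S :: "int set" assume S: "finite S"
  have "(\<lambda>n. \<Sum>k\<in>S. (sw s k * cmod (f n k))\<^sup>2) \<longlonglongrightarrow> (\<Sum>k\<in>S. (sw s k * cmod (g k))\<^sup>2)"
    by (intro tendsto_intros lim)
  then show "(\<Sum>k\<in>S. (sw s k * cmod (g k))\<^sup>2) \<le> B"
    by (rule tendsto_upperbound) (use ev S in \<open>auto elim: eventually_mono dest: hsD\<close>)
qed

text \<open>
  Dissipation pays for the derivative: \<open>|k| / (\<epsilon> k^2 + \<Omega>)\<close> is square-summable, with a sum that vanishes as
  \<open>\<Omega>\<close> grows.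
\<close>

lemma heat_weight_small:
  assumes eps: "0 < \<epsilon>" and d: "0 < (d::real)"
  shows "\<exists>\<Omega>>0. \<forall>S. finite S \<longrightarrow> (\<Sum>k\<in>S. (\<bar>real_of_int k\<bar> / (\<epsilon> * (real_of_int k)\<^sup>2 + \<Omega>))\<^sup>2) \<le> d"
proof -
  obtain K :: nat where K: "\<And>S. finite S \<Longrightarrow> (\<forall>k\<in>S. int K < \<bar>k\<bar>) \<Longrightarrow> (\<Sum>k\<in>S. (inv_abs k)\<^sup>2) \<le> \<epsilon>\<^sup>2 * (d / 2)"
    using inv_abs_tail[of "\<epsilon>\<^sup>2 * (d / 2)"] eps d by auto
  (* Frequencies above K are handled by the dissipation alone, the others by the size of \<Omega>. *)
  define \<Omega> where "\<Omega> = 1 + 8 * real K ^ 4 / d"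
  have Om1: "1 \<le> \<Omega>" using d by (simp add: \<Omega>_def)
  have "8 * real K ^ 4 / d \<le> \<Omega>" by (simp add: \<Omega>_def)
  also have "\<dots> \<le> \<Omega>\<^sup>2" using Om1 by (simp add: power2_eq_square)
  finally have Om2: "4 * (real K ^ 4 / \<Omega>\<^sup>2) \<le> d / 2" using d Om1 by (simp add: field_simps)
  let ?h = "\<lambda>k. (\<bar>real_of_int k\<bar> / (\<epsilon> * (real_of_int k)\<^sup>2 + \<Omega>))\<^sup>2"
  show ?thesis
  proof (intro exI[of _ \<Omega>] conjI allI impI)
    show "0 < \<Omega>" using Om1 by simp
    fix S :: "int set" assume S: "finite S"
    define lo where "lo = {k\<in>S. \<bar>k\<bar> \<le> int K}"
    define hi where "hi = {k\<in>S. int K < \<bar>k\<bar>}"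
    have fin: "finite lo" "finite hi" "lo \<inter> hi = {}" and un: "S = lo \<union> hi" using S by (auto simp: lo_def hi_def)
    have "?h k \<le> (real K ^ 4 / \<Omega>\<^sup>2) * (inv_abs k)\<^sup>2" if k: "k \<in> lo" for k
    proof (cases "k = 0")
      case False
      have kK: "\<bar>real_of_int k\<bar> \<le> real K" using k unfolding lo_def by (metis (mono_tags, lifting) mem_Collect_eq of_int_abs of_int_le_iff of_int_of_nat_eq)
      have kk: "\<bar>real_of_int k\<bar> = \<bar>real_of_int k\<bar>\<^sup>2 * inv_abs k" using False by (simp add: inv_abs_def power2_eq_square del: abs_mult_self_eq)
      have "\<bar>real_of_int k\<bar> / (\<epsilon> * (real_of_int k)\<^sup>2 + \<Omega>) \<le> \<bar>real_of_int k\<bar> / \<Omega>"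
        using eps Om1 by (intro divide_left_mono) (auto intro!: mult_pos_pos add_nonneg_pos)
      also have "\<dots> \<le> (real K)\<^sup>2 * inv_abs k / \<Omega>"
        by (subst kk) (use Om1 kK in \<open>intro divide_right_mono mult_right_mono power_mono; simp\<close>)
      finally have "?h k \<le> ((real K)\<^sup>2 * inv_abs k / \<Omega>)\<^sup>2"
        using eps Om1 by (intro power_mono) (auto intro!: divide_nonneg_nonneg add_nonneg_nonneg)
      then show ?thesis by (simp add: power_mult_distrib power_divide)
    qed simp
    then have "(\<Sum>k\<in>lo. ?h k) \<le> (\<Sum>k\<in>lo. (real K ^ 4 / \<Omega>\<^sup>2) * (inv_abs k)\<^sup>2)" by (intro sum_mono)
    also have "\<dots> = (real K ^ 4 / \<Omega>\<^sup>2) * (\<Sum>k\<in>lo. (inv_abs k)\<^sup>2)" by (rule sum_distrib_left[symmetric])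
    also have "\<dots> \<le> (real K ^ 4 / \<Omega>\<^sup>2) * 4" by (intro mult_left_mono sum_inv_abs_sq fin) auto
    also have "\<dots> \<le> d / 2" using Om2 by simp
    finally have lo: "(\<Sum>k\<in>lo. ?h k) \<le> d / 2" .
    have "?h k \<le> (1 / \<epsilon>\<^sup>2) * (inv_abs k)\<^sup>2" if k: "k \<in> hi" for k
    proof -
      have k0: "k \<noteq> 0" using k by (auto simp: hi_def)
      have "\<bar>real_of_int k\<bar> / (\<epsilon> * (real_of_int k)\<^sup>2 + \<Omega>) \<le> \<bar>real_of_int k\<bar> / (\<epsilon> * (real_of_int k)\<^sup>2)"
        using eps Om1 k0 by (intro divide_left_mono) (auto intro!: mult_pos_pos add_pos_pos)
      also have "\<dots> = inv_abs k / \<epsilon>" using k0 by (auto simp: inv_abs_def power2_eq_square field_simps abs_if)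
      finally have "?h k \<le> (inv_abs k / \<epsilon>)\<^sup>2"
        using eps Om1 by (intro power_mono) (auto intro!: divide_nonneg_nonneg add_nonneg_nonneg)
      then show ?thesis by (simp add: power_divide)
    qed
    then have "(\<Sum>k\<in>hi. ?h k) \<le> (\<Sum>k\<in>hi. (1 / \<epsilon>\<^sup>2) * (inv_abs k)\<^sup>2)" by (intro sum_mono)
    also have "\<dots> = (1 / \<epsilon>\<^sup>2) * (\<Sum>k\<in>hi. (inv_abs k)\<^sup>2)" by (rule sum_distrib_left[symmetric])
    also have "\<dots> \<le> (1 / \<epsilon>\<^sup>2) * (\<epsilon>\<^sup>2 * (d / 2))" by (intro mult_left_mono K fin) (auto simp: hi_def)
    also have "\<dots> = d / 2" using eps by simp
    finally have "(\<Sum>k\<in>hi. ?h k) \<le> d / 2" .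
    then show "(\<Sum>k\<in>S. ?h k) \<le> d"
      using lo sum.union_disjoint[OF fin, of ?h] unfolding un by linarith
  qed
qed

text \<open>
  One step of the contraction.  The solutions \<open>v\<close> and \<open>u\<close> may live on different sets of modes \<open>I\<close> and \<open>J\<close>:
  on \<open>I\<close> the Duhamel formula gains a factor \<open>1/2\<close>, and on \<open>J - I\<close>, where \<open>v\<close> vanishes, \<open>u\<close> is small by its data and by
  smoothing.  That part is collected in \<open>\<tau>\<close>.
\<close>

lemma mode_flow_contraction_step:
  assumes eps: "0 < \<epsilon>" and IJ: "I \<subseteq> J" and nz: "0 \<notin> J"
    and v: "mode_flow \<epsilon> I T v" and u: "mode_flow \<epsilon> J T u"
    and bv: "\<And>t. t \<in> {0..T} \<Longrightarrow> hs 0 (v t) B" and bu: "\<And>t. t \<in> {0..T} \<Longrightarrow> hs 0 (u t) B"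
    and init: "\<And>k. k \<in> I \<Longrightarrow> v 0 k = u 0 k"
    and tau: "\<And>S. finite S \<Longrightarrow> S \<subseteq> J - I \<Longrightarrow> (\<Sum>k\<in>S. 2 * ((cmod (u 0 k))\<^sup>2 + (B / \<epsilon> * inv_abs k)\<^sup>2)) \<le> \<tau>"
    and Om: "0 < \<Omega>" and small: "\<And>S. finite S \<Longrightarrow> (\<Sum>k\<in>S. (\<bar>real_of_int k\<bar> / (\<epsilon> * (real_of_int k)\<^sup>2 + \<Omega>))\<^sup>2) \<le> 1 / (8 * B + 8)"
    and D: "\<And>t. t \<in> {0..T} \<Longrightarrow> hs 0 (\<lambda>k. v t k - u t k) (exp (2 * \<Omega> * t) * D)"
    and t: "t \<in> {0..T}"
  shows "hs 0 (\<lambda>k. v t k - u t k) (exp (2 * \<Omega> * t) * (D / 2 + \<tau>))"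
proof (rule hsI)
  have B0: "0 \<le> B" by (rule hs_nonneg[OF bv[OF t]])
  have D0: "0 \<le> D" using hs_nonneg[OF D[OF t]] by (simp add: zero_le_mult_iff)
  let ?m = "\<lambda>k. \<bar>real_of_int k\<bar> / (\<epsilon> * (real_of_int k)\<^sup>2 + \<Omega>)"
  have lowmode: "(cmod (v t k - u t k))\<^sup>2 \<le> exp (2 * \<Omega> * t) * (4 * D * B) * (?m k)\<^sup>2" if k: "k \<in> I" for k
  proof -
    define G where "G = \<bar>real_of_int k\<bar> * (2 * sqrt (D * B))"
    have "cmod (v t k - u t k) \<le> cmod (v 0 k - u 0 k) + G / (\<epsilon> * (real_of_int k)\<^sup>2 + \<Omega>) * exp (\<Omega> * t)"
    proof (rule duhamel_bound[OF _ _ _ _ _ t])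
      fix t assume t: "t \<in> {0..T}"
      let ?r = "\<i> * of_int k * (conv (v t) (v t) k - conv (u t) (u t) k)"
      have "((\<lambda>\<tau>. v \<tau> k - u \<tau> k) has_vector_derivative (lam \<epsilon> k * v t k + \<i> * of_int k * conv (v t) (v t) k)
         - (lam \<epsilon> k * u t k + \<i> * of_int k * conv (u t) (u t) k)) (at t within {0..T})"
        using v u t k IJ unfolding mode_flow_def by (intro has_vector_derivative_diff) auto
      then show "((\<lambda>\<tau>. v \<tau> k - u \<tau> k) has_vector_derivative (lam \<epsilon> k * (v t k - u t k) + ?r)) (at t within {0..T})"
        by (rule has_vector_derivative_eq_rhs) (simp add: algebra_simps)
      have "cmod (conv (v t) (v t) k - conv (u t) (u t) k) \<le> 2 * sqrt (exp (2 * \<Omega> * t) * D * B)"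
        by (rule norm_conv_diff_le[OF bv[OF t] bu[OF t] D[OF t]])
      also have "exp (2 * \<Omega> * t) = (exp (\<Omega> * t))\<^sup>2" by (simp add: power2_eq_square flip: exp_add)
      also have "sqrt ((exp (\<Omega> * t))\<^sup>2 * D * B) = exp (\<Omega> * t) * sqrt (D * B)"
        by (simp add: real_sqrt_mult mult.assoc)
      finally have "cmod (conv (v t) (v t) k - conv (u t) (u t) k) \<le> 2 * (exp (\<Omega> * t) * sqrt (D * B))" .
      then have "\<bar>real_of_int k\<bar> * cmod (conv (v t) (v t) k - conv (u t) (u t) k) \<le> \<bar>real_of_int k\<bar> * (2 * (exp (\<Omega> * t) * sqrt (D * B)))"
        by (intro mult_left_mono) auto
      then show "cmod ?r \<le> G * exp (\<Omega> * t)" by (simp add: norm_mult G_def mult_ac)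
    next
      show "0 < \<epsilon> * (real_of_int k)\<^sup>2 + \<Omega>" using eps Om by (intro add_nonneg_pos) auto
      show "0 \<le> G" unfolding G_def using B0 D0 by simp
    qed (use eps in auto)
    then have "cmod (v t k - u t k) \<le> (2 * sqrt (D * B)) * ?m k * exp (\<Omega> * t)"
      using init[OF k] by (simp add: G_def mult_ac)
    then have "(cmod (v t k - u t k))\<^sup>2 \<le> ((2 * sqrt (D * B)) * ?m k * exp (\<Omega> * t))\<^sup>2" by (intro power_mono) auto
    also have "\<dots> = 2\<^sup>2 * (sqrt (D * B))\<^sup>2 * (?m k)\<^sup>2 * (exp (\<Omega> * t))\<^sup>2" by (simp only: power_mult_distrib)
    also have "\<dots> = 4 * (D * B) * (?m k)\<^sup>2 * (exp (\<Omega> * t))\<^sup>2" using D0 B0 by simp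
    also have "(exp (\<Omega> * t))\<^sup>2 = exp (2 * \<Omega> * t)" by (simp add: power2_eq_square flip: exp_add)
    finally show ?thesis by (simp add: mult_ac)
  qed
  (* Here v vanishes, and the Duhamel formula for u alone gives the smoothing factor 1/|k|. *)
  have highmode: "(cmod (v t k - u t k))\<^sup>2 \<le> 2 * ((cmod (u 0 k))\<^sup>2 + (B / \<epsilon> * inv_abs k)\<^sup>2)" if k: "k \<in> J - I" for k
  proof -
    have k0: "k \<noteq> 0" using k nz by auto
    have vk: "v t k = 0" using v k t unfolding mode_flow_def by auto
    have "cmod (u t k) \<le> cmod (u 0 k) + \<bar>real_of_int k\<bar> * B / (\<epsilon> * (real_of_int k)\<^sup>2 + 0) * exp (0 * t)"
    proof (rule duhamel_bound[OF _ _ _ _ _ t])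
      fix t assume t: "t \<in> {0..T}"
      show "((\<lambda>\<tau>. u \<tau> k) has_vector_derivative (lam \<epsilon> k * u t k + \<i> * of_int k * conv (u t) (u t) k)) (at t within {0..T})"
        using u t k unfolding mode_flow_def by auto
      have "cmod (conv (u t) (u t) k) \<le> sqrt (B * B)" by (rule norm_conv_le[OF bu[OF t] bu[OF t]])
      then have "\<bar>real_of_int k\<bar> * cmod (conv (u t) (u t) k) \<le> \<bar>real_of_int k\<bar> * B"
        using B0 by (intro mult_left_mono) auto
      then show "cmod (\<i> * of_int k * conv (u t) (u t) k) \<le> \<bar>real_of_int k\<bar> * B * exp (0 * t)"
        by (simp add: norm_mult)
    qed (use eps k0 B0 in auto)
    also have "\<bar>real_of_int k\<bar> * B / (\<epsilon> * (real_of_int k)\<^sup>2 + 0) * exp (0 * t) = B / \<epsilon> * inv_abs k"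
      using k0 eps by (auto simp: inv_abs_def power2_eq_square field_simps abs_if)
    finally have "cmod (u t k) \<le> cmod (u 0 k) + B / \<epsilon> * inv_abs k" .
    then have "(cmod (u t k))\<^sup>2 \<le> (cmod (u 0 k) + B / \<epsilon> * inv_abs k)\<^sup>2" by (intro power_mono) auto
    also have "\<dots> \<le> 2 * ((cmod (u 0 k))\<^sup>2 + (B / \<epsilon> * inv_abs k)\<^sup>2)"
      using zero_le_power2[of "cmod (u 0 k) - B / \<epsilon> * inv_abs k"] by (simp add: power2_sum power2_diff)
    finally show ?thesis by (simp add: vk)
  qed
  fix S :: "int set" assume S: "finite S"
  have E1: "1 \<le> exp (2 * \<Omega> * t)" using Om t by simp
  have tau0: "0 \<le> \<tau>" using tau[of "{}"] by simp
  have sI: "(\<Sum>k\<in>S \<inter> I. (cmod (v t k - u t k))\<^sup>2) \<le> exp (2 * \<Omega> * t) * (D / 2)"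
  proof -
    have "(\<Sum>k\<in>S \<inter> I. (cmod (v t k - u t k))\<^sup>2) \<le> (\<Sum>k\<in>S \<inter> I. exp (2 * \<Omega> * t) * (4 * D * B) * (?m k)\<^sup>2)"
      by (intro sum_mono lowmode) auto
    also have "\<dots> = exp (2 * \<Omega> * t) * (4 * D * B) * (\<Sum>k\<in>S \<inter> I. (?m k)\<^sup>2)" by (rule sum_distrib_left[symmetric])
    also have "\<dots> \<le> exp (2 * \<Omega> * t) * (4 * D * B) * (1 / (8 * B + 8))"
      using S D0 B0 by (intro mult_left_mono small) auto
    also have "\<dots> = exp (2 * \<Omega> * t) * (D * (4 * B / (8 * B + 8)))" by simp
    also have "\<dots> \<le> exp (2 * \<Omega> * t) * (D * (1 / 2))"
      using B0 D0 by (intro mult_left_mono) (auto simp: field_simps)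
    finally show ?thesis by simp
  qed
  have sJ: "(\<Sum>k\<in>S \<inter> (J - I). (cmod (v t k - u t k))\<^sup>2) \<le> exp (2 * \<Omega> * t) * \<tau>"
  proof -
    have "(\<Sum>k\<in>S \<inter> (J - I). (cmod (v t k - u t k))\<^sup>2) \<le> (\<Sum>k\<in>S \<inter> (J - I). 2 * ((cmod (u 0 k))\<^sup>2 + (B / \<epsilon> * inv_abs k)\<^sup>2))"
      by (intro sum_mono highmode) auto
    also have "\<dots> \<le> \<tau>" by (rule tau) (use S in auto)
    also have "\<dots> \<le> exp (2 * \<Omega> * t) * \<tau>" using mult_right_mono[OF E1 tau0] by simp
    finally show ?thesis .
  qed
  have z: "v t k - u t k = 0" if "k \<notin> J" for k
    using that v[unfolded mode_flow_def, THEN conjunct1, rule_format, OF t, of k]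
      u[unfolded mode_flow_def, THEN conjunct1, rule_format, OF t, of k] IJ by auto
  have "(\<Sum>k\<in>S. (sw 0 k * cmod (v t k - u t k))\<^sup>2) = (\<Sum>k\<in>(S \<inter> I) \<union> (S \<inter> (J - I)). (cmod (v t k - u t k))\<^sup>2)"
    by (simp, rule sum.mono_neutral_right) (use S z IJ in auto)
  also have "\<dots> = (\<Sum>k\<in>S \<inter> I. (cmod (v t k - u t k))\<^sup>2) + (\<Sum>k\<in>S \<inter> (J - I). (cmod (v t k - u t k))\<^sup>2)"
    by (rule sum.union_disjoint) (use S in auto)
  also have "\<dots> \<le> exp (2 * \<Omega> * t) * (D / 2) + exp (2 * \<Omega> * t) * \<tau>" by (intro add_mono sI sJ)
  finally show "(\<Sum>k\<in>S. (sw 0 k * cmod (v t k - u t k))\<^sup>2) \<le> exp (2 * \<Omega> * t) * (D / 2 + \<tau>)"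
    by (simp add: algebra_simps)
qed

text \<open>
  Iterating the contraction step removes the a priori bound and leaves a multiple of \<open>\<tau>\<close>.
  Taking \<open>I = J\<close> or \<open>I\<close> exhausting \<open>J\<close> yields uniqueness and convergence of Galerkin approximations.
\<close>

lemma mode_flow_comparison:
  assumes eps: "0 < \<epsilon>" and B: "0 \<le> B"
  obtains C where "0 \<le> C" "\<And>I J v u \<tau> t. I \<subseteq> J \<Longrightarrow> 0 \<notin> J \<Longrightarrow> mode_flow \<epsilon> I T v \<Longrightarrow> mode_flow \<epsilon> J T u \<Longrightarrow>
     (\<And>t. t \<in> {0..T} \<Longrightarrow> hs 0 (v t) B) \<Longrightarrow> (\<And>t. t \<in> {0..T} \<Longrightarrow> hs 0 (u t) B) \<Longrightarrow> (\<And>k. k \<in> I \<Longrightarrow> v 0 k = u 0 k) \<Longrightarrow>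
     (\<And>S. finite S \<Longrightarrow> S \<subseteq> J - I \<Longrightarrow> (\<Sum>k\<in>S. 2 * ((cmod (u 0 k))\<^sup>2 + (B / \<epsilon> * inv_abs k)\<^sup>2)) \<le> \<tau>) \<Longrightarrow>
     t \<in> {0..T} \<Longrightarrow> hs 0 (\<lambda>k. v t k - u t k) (C * \<tau>)"
proof -
  obtain \<Omega> where Om: "0 < \<Omega>" and small: "\<And>S. finite S \<Longrightarrow> (\<Sum>k\<in>S. (\<bar>real_of_int k\<bar> / (\<epsilon> * (real_of_int k)\<^sup>2 + \<Omega>))\<^sup>2) \<le> 1 / (8 * B + 8)"
    using heat_weight_small[OF eps, of "1 / (8 * B + 8)"] B by auto
  show thesis
  proof (rule that[of "2 * exp (2 * \<Omega> * T)"])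
    show "0 \<le> 2 * exp (2 * \<Omega> * T)" by simp
    fix I J v u \<tau> t
    assume IJ: "I \<subseteq> J" and nz: "0 \<notin> J" and v: "mode_flow \<epsilon> I T v" and u: "mode_flow \<epsilon> J T u"
      and bv: "\<And>t. t \<in> {0..T} \<Longrightarrow> hs 0 (v t) B" and bu: "\<And>t. t \<in> {0..T} \<Longrightarrow> hs 0 (u t) B"
      and init: "\<And>k. k \<in> I \<Longrightarrow> v 0 k = u 0 k"
      and tau: "\<And>S. finite S \<Longrightarrow> S \<subseteq> J - I \<Longrightarrow> (\<Sum>k\<in>S. 2 * ((cmod (u 0 k))\<^sup>2 + (B / \<epsilon> * inv_abs k)\<^sup>2)) \<le> \<tau>"
      and t: "t \<in> {0..T}"
    have tau0: "0 \<le> \<tau>" using tau[of "{}"] by simp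
    (* 4 B is the trivial bound for the difference; 2 \<tau> is the fixed point of D |-> D / 2 + \<tau>. *)
    have it: "hs 0 (\<lambda>k. v t k - u t k) (exp (2 * \<Omega> * t) * (4 * B / 2 ^ n + 2 * \<tau>))" if "t \<in> {0..T}" for n t
      using that
    proof (induction n arbitrary: t)
      case 0
      have "hs 0 (\<lambda>k. v t k - u t k) (2 * B + 2 * B)" using 0 by (intro hs_diff bv bu)
      moreover have "1 * (4 * B) \<le> exp (2 * \<Omega> * t) * (4 * B / 2 ^ 0 + 2 * \<tau>)"
        using Om 0 B tau0 by (intro mult_mono) auto
      ultimately show ?case using hs_mono[of 0 "\<lambda>k. v t k - u t k" "2 * B + 2 * B"] by simp
    next
      case (Suc n)
      have "hs 0 (\<lambda>k. v t k - u t k) (exp (2 * \<Omega> * t) * ((4 * B / 2 ^ n + 2 * \<tau>) / 2 + \<tau>))"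
        by (rule mode_flow_contraction_step[OF eps IJ nz v u bv bu init tau Om small Suc.IH Suc.prems])
      moreover have "(4 * B / 2 ^ n + 2 * \<tau>) / 2 + \<tau> = 4 * B / 2 ^ Suc n + 2 * \<tau>" by (simp add: field_simps)
      ultimately show ?case by simp
    qed
    show "hs 0 (\<lambda>k. v t k - u t k) (2 * exp (2 * \<Omega> * T) * \<tau>)"
    proof (rule hsI)
      fix S :: "int set" assume S: "finite S"
      have "(\<lambda>n. 4 * B * (1/2) ^ n) \<longlonglongrightarrow> 4 * B * 0"
        by (intro tendsto_mult tendsto_const LIMSEQ_realpow_zero) simp_all
      then have "(\<lambda>n. exp (2 * \<Omega> * t) * (4 * B * (1/2) ^ n + 2 * \<tau>)) \<longlonglongrightarrow> exp (2 * \<Omega> * t) * (4 * B * 0 + 2 * \<tau>)"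
        by (rule tendsto_mult[OF tendsto_const tendsto_add[OF _ tendsto_const]])
      moreover have "(\<Sum>k\<in>S. (sw 0 k * cmod (v t k - u t k))\<^sup>2) \<le> exp (2 * \<Omega> * t) * (4 * B * (1/2) ^ n + 2 * \<tau>)" for n
        using hsD[OF it[OF t, of n] S] by (simp add: power_divide)
      ultimately have "(\<Sum>k\<in>S. (sw 0 k * cmod (v t k - u t k))\<^sup>2) \<le> exp (2 * \<Omega> * t) * (4 * B * 0 + 2 * \<tau>)"
        by (rule LIMSEQ_le_const[OF _ exI, OF _ allI, OF _ impI])
      also have "\<dots> \<le> exp (2 * \<Omega> * T) * (2 * \<tau>)"
        using t Om tau0 by (simp add: mult_right_mono)
      finally show "(\<Sum>k\<in>S. (sw 0 k * cmod (v t k - u t k))\<^sup>2) \<le> 2 * exp (2 * \<Omega> * T) * \<tau>" by simp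
    qed
  qed
qed

section \<open>Existence of mean-zero solutions\<close>

text \<open>
  The zero mode is left out: it is constant in time.
\<close>

definition modes :: "nat \<Rightarrow> int set" where "modes n = {- int n..int n} - {0}"

lemma modes_simps [simp]: "finite (modes n)" "0 \<notin> modes n" "- k \<in> modes n \<longleftrightarrow> k \<in> modes n"
  by (auto simp: modes_def)
lemma modes_iff: "k \<in> modes n \<longleftrightarrow> k \<noteq> 0 \<and> \<bar>k\<bar> \<le> int n" by (auto simp: modes_def)
lemma modes_mono: "m \<le> n \<Longrightarrow> modes m \<subseteq> modes n" by (auto simp: modes_def)

definition cut :: "nat \<Rightarrow> (int \<Rightarrow> complex) \<Rightarrow> int \<Rightarrow> complex" where
  "cut n \<phi> k = (if k \<in> modes n then \<phi> k else 0)"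

lemma cut_off [simp]: "k \<notin> modes n \<Longrightarrow> cut n \<phi> k = 0" by (simp add: cut_def)
lemma hs_cut: assumes "hs s \<phi> B" shows "hs s (cut n \<phi>) B"
proof (rule hsI)
  fix S :: "int set" assume S: "finite S"
  have "(\<Sum>k\<in>S. (sw s k * cmod (cut n \<phi> k))\<^sup>2) \<le> (\<Sum>k\<in>S. (sw s k * cmod (\<phi> k))\<^sup>2)"
    by (intro sum_mono) (simp add: cut_def)
  also have "\<dots> \<le> B" by (rule hsD[OF assms S])
  finally show "(\<Sum>k\<in>S. (sw s k * cmod (cut n \<phi> k))\<^sup>2) \<le> B" .
qed

text \<open>
  The coefficient sequences of real functions with mean zero.
\<close>

definition admissible :: "(int \<Rightarrow> complex) \<Rightarrow> bool" where
  "admissible \<phi> \<longleftrightarrow> \<phi> 0 = 0 \<and> (\<forall>k. \<phi> (- k) = cnj (\<phi> k))"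

abbreviation "NZ \<equiv> (- {0}) :: int set"

lemma galerkin_family:
  assumes \<phi>: "admissible \<phi>" and B: "hs 0 \<phi> B" and eps: "0 \<le> \<epsilon>" and T: "0 \<le> T"
  shows "\<exists>V. \<forall>n. galerkin \<epsilon> (modes n) T (V n) \<and> V n 0 = cut n \<phi> \<and> (\<forall>t k. V n t (- k) = cnj (V n t k))
     \<and> (\<forall>t\<in>{0..T}. hs 0 (V n t) B)"
proof (rule choice, rule allI)
  fix n
  obtain v where v: "galerkin \<epsilon> (modes n) T v" "v 0 = cut n \<phi>" "\<forall>t k. v t (- k) = cnj (v t k)"
    "\<forall>t\<in>{0..T}. wsum (modes n) (\<lambda>_. 1) (v t) \<le> wsum (modes n) (\<lambda>_. 1) (cut n \<phi>)"
  proof -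
    have re: "cut n \<phi> (- k) = cnj (cut n \<phi> k)" for k using \<phi> by (simp add: cut_def admissible_def)
    show thesis
      using galerkin_exists[of "modes n" \<epsilon> T "cut n \<phi>", OF _ _ _ eps T _ re] that by auto
  qed
  have "hs 0 (v t) B" if t: "t \<in> {0..T}" for t
  proof -
    have "hs 0 (v t) (wsum (modes n) (sw 0) (v t))" using v(1) by (intro hs_wsum) (auto simp: galerkin_def)
    moreover have "wsum (modes n) (sw 0) (v t) \<le> wsum (modes n) (sw 0) (cut n \<phi>)"
      using v(4) t by (simp add: wsum_def)
    moreover have "\<dots> \<le> B" by (rule wsum_le_hs[OF hs_cut[OF B]]) simp
    ultimately show ?thesis by (meson hs_mono order_trans)
  qed
  then show "\<exists>V. galerkin \<epsilon> (modes n) T V \<and> V 0 = cut n \<phi> \<and> (\<forall>t k. V t (- k) = cnj (V t k))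
     \<and> (\<forall>t\<in>{0..T}. hs 0 (V t) B)" using v by blast
qed

lemma data_tail:
  assumes \<phi>: "hs 0 \<phi> B" and eps: "0 < \<epsilon>" and d: "0 < (d::real)"
  shows "\<exists>N. \<forall>n\<ge>N. \<forall>S. finite S \<longrightarrow> S \<subseteq> NZ - modes n \<longrightarrow> (\<Sum>k\<in>S. 2 * ((cmod (\<phi> k))\<^sup>2 + (B / \<epsilon> * inv_abs k)\<^sup>2)) \<le> d"
proof -
  define c where "c = (B / \<epsilon>)\<^sup>2 + 1"
  have c: "0 < c" by (simp add: c_def add_nonneg_pos)
  obtain K1 where K1: "\<And>S. finite S \<Longrightarrow> (\<forall>k\<in>S. int K1 < \<bar>k\<bar>) \<Longrightarrow> (\<Sum>k\<in>S. (cmod (\<phi> k))\<^sup>2) \<le> d / 4"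
    using hs_tail[OF \<phi>, of "d / 4"] d by auto
  obtain K2 where K2: "\<And>S. finite S \<Longrightarrow> (\<forall>k\<in>S. int K2 < \<bar>k\<bar>) \<Longrightarrow> (\<Sum>k\<in>S. (inv_abs k)\<^sup>2) \<le> d / (4 * c)"
    using inv_abs_tail[of "d / (4 * c)"] d c by auto
  show ?thesis
  proof (intro exI[of _ "max K1 K2"] allI impI)
    fix n and S :: "int set" assume n: "max K1 K2 \<le> n" and S: "finite S" "S \<subseteq> NZ - modes n"
    have gt: "int n < \<bar>k\<bar>" if "k \<in> S" for k using S that by (auto simp: modes_iff)
    have "(\<Sum>k\<in>S. 2 * ((cmod (\<phi> k))\<^sup>2 + (B / \<epsilon> * inv_abs k)\<^sup>2)) = 2 * (\<Sum>k\<in>S. (cmod (\<phi> k))\<^sup>2) + 2 * ((B / \<epsilon>)\<^sup>2 * (\<Sum>k\<in>S. (inv_abs k)\<^sup>2))"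
      by (simp only: power_mult_distrib sum.distrib sum_distrib_left distrib_left)
    also have "\<dots> \<le> 2 * (d / 4) + 2 * (c * (d / (4 * c)))"
    proof (intro add_mono mult_left_mono mult_mono K1 K2 S)
      show "\<forall>k\<in>S. int K1 < \<bar>k\<bar>" "\<forall>k\<in>S. int K2 < \<bar>k\<bar>" using gt n by fastforce+
      show "(B / \<epsilon>)\<^sup>2 \<le> c" by (simp add: c_def)
    qed (use c in \<open>auto intro: sum_nonneg\<close>)
    also have "\<dots> = d" using c by simp
    finally show "(\<Sum>k\<in>S. 2 * ((cmod (\<phi> k))\<^sup>2 + (B / \<epsilon> * inv_abs k)\<^sup>2)) \<le> d" .
  qed
qed

text \<open>
  Both parts are instances of the comparison lemma; the second identifies the limit with any given
  bounded solution, which is the reason for unconditional uniqueness.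
\<close>

lemma galerkin_cauchy:
  assumes \<phi>: "admissible \<phi>" and B: "hs 0 \<phi> B" and eps: "0 < \<epsilon>" and d: "0 < (d::real)"
    and V: "\<And>n. galerkin \<epsilon> (modes n) T (V n)" "\<And>n. V n 0 = cut n \<phi>" "\<And>n t. t \<in> {0..T} \<Longrightarrow> hs 0 (V n t) B"
  shows "\<exists>N. \<forall>m\<ge>N. \<forall>n\<ge>m. \<forall>t\<in>{0..T}. hs 0 (\<lambda>k. V m t k - V n t k) d"
    and "mode_flow \<epsilon> NZ T u \<Longrightarrow> u 0 = \<phi> \<Longrightarrow> (\<And>t. t \<in> {0..T} \<Longrightarrow> hs 0 (u t) B) \<Longrightarrow>
      \<exists>N. \<forall>m\<ge>N. \<forall>t\<in>{0..T}. hs 0 (\<lambda>k. V m t k - u t k) d"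
proof -
  have B0: "0 \<le> B" by (rule hs_nonneg[OF B])
  obtain C where C0: "0 \<le> C" and C: "\<And>I J v u \<tau> t. I \<subseteq> J \<Longrightarrow> 0 \<notin> J \<Longrightarrow> mode_flow \<epsilon> I T v \<Longrightarrow> mode_flow \<epsilon> J T u \<Longrightarrow>
     (\<And>t. t \<in> {0..T} \<Longrightarrow> hs 0 (v t) B) \<Longrightarrow> (\<And>t. t \<in> {0..T} \<Longrightarrow> hs 0 (u t) B) \<Longrightarrow> (\<And>k. k \<in> I \<Longrightarrow> v 0 k = u 0 k) \<Longrightarrow>
     (\<And>S. finite S \<Longrightarrow> S \<subseteq> J - I \<Longrightarrow> (\<Sum>k\<in>S. 2 * ((cmod (u 0 k))\<^sup>2 + (B / \<epsilon> * inv_abs k)\<^sup>2)) \<le> \<tau>) \<Longrightarrow>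
     t \<in> {0..T} \<Longrightarrow> hs 0 (\<lambda>k. v t k - u t k) (C * \<tau>)"
  proof (rule mode_flow_comparison[OF eps B0, of T])
    fix C :: real
    assume "0 \<le> C" and "\<And>I J v u \<tau> t. I \<subseteq> J \<Longrightarrow> 0 \<notin> J \<Longrightarrow> mode_flow \<epsilon> I T v \<Longrightarrow> mode_flow \<epsilon> J T u \<Longrightarrow>
     (\<And>t. t \<in> {0..T} \<Longrightarrow> hs 0 (v t) B) \<Longrightarrow> (\<And>t. t \<in> {0..T} \<Longrightarrow> hs 0 (u t) B) \<Longrightarrow> (\<And>k. k \<in> I \<Longrightarrow> v 0 k = u 0 k) \<Longrightarrow>
     (\<And>S. finite S \<Longrightarrow> S \<subseteq> J - I \<Longrightarrow> (\<Sum>k\<in>S. 2 * ((cmod (u 0 k))\<^sup>2 + (B / \<epsilon> * inv_abs k)\<^sup>2)) \<le> \<tau>) \<Longrightarrow>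
     t \<in> {0..T} \<Longrightarrow> hs 0 (\<lambda>k. v t k - u t k) (C * \<tau>)"
    then show thesis by (rule that)
  qed
  define \<tau> where "\<tau> = d / (C + 1)"
  have tau: "0 < \<tau>" using d C0 by (simp add: \<tau>_def)
  have "C * \<tau> = d * (C / (C + 1))" by (simp add: \<tau>_def)
  also have "\<dots> \<le> d * 1" using C0 d by (intro mult_left_mono) auto
  finally have Ctau: "C * \<tau> \<le> d" by simp
  obtain N where N0: "\<forall>n\<ge>N. \<forall>S. finite S \<longrightarrow> S \<subseteq> NZ - modes n \<longrightarrow> (\<Sum>k\<in>S. 2 * ((cmod (\<phi> k))\<^sup>2 + (B / \<epsilon> * inv_abs k)\<^sup>2)) \<le> \<tau>"
    using data_tail[OF B eps tau] ..
  note N = N0[rule_format]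
  have fl: "mode_flow \<epsilon> (modes n) T (V n)" for n by (rule galerkin_mode_flow[OF V(1)]) simp
  show "\<exists>N. \<forall>m\<ge>N. \<forall>n\<ge>m. \<forall>t\<in>{0..T}. hs 0 (\<lambda>k. V m t k - V n t k) d"
  proof (intro exI[of _ N] allI impI ballI)
    fix m n t assume mn: "N \<le> m" "m \<le> n" and t: "t \<in> {0..T}"
    have "hs 0 (\<lambda>k. V m t k - V n t k) (C * \<tau>)"
    proof (rule C[OF modes_mono[OF mn(2)] _ fl fl V(3) V(3) _ _ t])
      show "V m 0 k = V n 0 k" if "k \<in> modes m" for k
        using that modes_mono[OF mn(2)] by (auto simp: V(2) cut_def)
      fix S assume S: "finite S" "S \<subseteq> modes n - modes m"
      have "(\<Sum>k\<in>S. 2 * ((cmod (V n 0 k))\<^sup>2 + (B / \<epsilon> * inv_abs k)\<^sup>2)) = (\<Sum>k\<in>S. 2 * ((cmod (\<phi> k))\<^sup>2 + (B / \<epsilon> * inv_abs k)\<^sup>2))"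
        by (rule sum.cong) (use S in \<open>auto simp: V(2) cut_def\<close>)
      also have "\<dots> \<le> \<tau>" by (rule N[OF mn(1) S(1)]) (use S in \<open>auto simp: modes_iff\<close>)
      finally show "(\<Sum>k\<in>S. 2 * ((cmod (V n 0 k))\<^sup>2 + (B / \<epsilon> * inv_abs k)\<^sup>2)) \<le> \<tau>" .
    qed simp_all
    then show "hs 0 (\<lambda>k. V m t k - V n t k) d" by (rule hs_mono[OF _ Ctau])
  qed
  assume u: "mode_flow \<epsilon> NZ T u" "u 0 = \<phi>" "\<And>t. t \<in> {0..T} \<Longrightarrow> hs 0 (u t) B"
  show "\<exists>N. \<forall>m\<ge>N. \<forall>t\<in>{0..T}. hs 0 (\<lambda>k. V m t k - u t k) d"
  proof (intro exI[of _ N] allI impI ballI)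
    fix m t assume mn: "N \<le> m" and t: "t \<in> {0..T}"
    have "hs 0 (\<lambda>k. V m t k - u t k) (C * \<tau>)"
    proof (rule C[OF _ _ fl u(1) V(3) u(3) _ _ t])
      show "V m 0 k = u 0 k" if "k \<in> modes m" for k
        using that by (auto simp: V(2) cut_def u(2))
      show "(\<Sum>k\<in>S. 2 * ((cmod (u 0 k))\<^sup>2 + (B / \<epsilon> * inv_abs k)\<^sup>2)) \<le> \<tau>" if "finite S" "S \<subseteq> NZ - modes m" for S
        unfolding u(2) by (rule N[OF mn that])
    qed (auto simp: modes_iff)
    then show "hs 0 (\<lambda>k. V m t k - u t k) d" by (rule hs_mono[OF _ Ctau])
  qed
qed

text \<open>
  The Galerkin approximations and, mode by mode, their time derivatives converge uniformly in time, so the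
  limit satisfies the equation.
\<close>

theorem mode_flow_exists:
  assumes \<phi>: "admissible \<phi>" and B: "hs 0 \<phi> B" and eps: "0 < \<epsilon>" and T: "0 \<le> T"
  shows "\<exists>v. mode_flow \<epsilon> NZ T v \<and> v 0 = \<phi> \<and> (\<forall>t. admissible (v t)) \<and> (\<forall>t\<in>{0..T}. hs 0 (v t) B)"
proof -
  have B0: "0 \<le> B" by (rule hs_nonneg[OF B])
  obtain V where V: "\<And>n. galerkin \<epsilon> (modes n) T (V n)" "\<And>n. V n 0 = cut n \<phi>"
    "\<And>n t k. V n t (- k) = cnj (V n t k)" "\<And>n t. t \<in> {0..T} \<Longrightarrow> hs 0 (V n t) B"
    using galerkin_family[OF \<phi> B less_imp_le[OF eps] T] by blast
  note cau = galerkin_cauchy(1)[OF \<phi> B eps _ V(1) V(2) V(4)]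
  have conv: "convergent (\<lambda>n. V n t k)" if t: "t \<in> {0..T}" for t k
    unfolding Cauchy_convergent_iff[symmetric]
  proof (rule metric_CauchyI)
    fix e :: real assume e: "0 < e"
    have "0 < (e / 2)\<^sup>2" using e by simp
    then obtain N where "\<forall>m\<ge>N. \<forall>n\<ge>m. \<forall>t\<in>{0..T}. hs 0 (\<lambda>k. V m t k - V n t k) ((e / 2)\<^sup>2)"
      using cau by blast
    note N = this[rule_format]
    have *: "dist (V m t k) (V n t k) < e" if "N \<le> m" "m \<le> n" for m n
    proof -
      have "cmod (V m t k - V n t k) \<le> sqrt ((e / 2)\<^sup>2)" by (rule hs_component[OF N[OF that t]])
      then show ?thesis using e by (simp add: dist_norm real_sqrt_unique)
    qed
    show "\<exists>M. \<forall>m\<ge>M. \<forall>n\<ge>M. dist (V m t k) (V n t k) < e"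
    proof (intro exI[of _ N] allI impI)
      fix m n assume "N \<le> m" "N \<le> n"
      then show "dist (V m t k) (V n t k) < e"
        using *[of m n] *[of n m] by (cases "m \<le> n") (auto simp: dist_commute)
    qed
  qed
  define v where "v t k = (if t \<in> {0..T} then lim (\<lambda>n. V n t k) else 0)" for t k
  have lim: "(\<lambda>n. V n t k) \<longlonglongrightarrow> v t k" if "t \<in> {0..T}" for t k
    using conv[OF that] that by (simp add: v_def convergent_LIMSEQ_iff)
  have bv: "hs 0 (v t) B" if "t \<in> {0..T}" for t
    by (rule hs_limit[OF lim[OF that]]) (use V(4) that in auto)
  have unif: "\<exists>N. \<forall>m\<ge>N. \<forall>t\<in>{0..T}. hs 0 (\<lambda>k. V m t k - v t k) d" if d: "0 < d" for d
  proof -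
    obtain N where "\<forall>m\<ge>N. \<forall>n\<ge>m. \<forall>t\<in>{0..T}. hs 0 (\<lambda>k. V m t k - V n t k) d"
      using cau[OF d] ..
    note N = this[rule_format]
    show ?thesis
    proof (intro exI[of _ N] allI impI ballI)
      fix m t assume m: "N \<le> m" and t: "t \<in> {0..T}"
      show "hs 0 (\<lambda>k. V m t k - v t k) d"
      proof (rule hs_limit[where f = "\<lambda>n k. V m t k - V n t k"])
        show "(\<lambda>n. V m t k - V n t k) \<longlonglongrightarrow> V m t k - v t k" for k by (intro tendsto_intros lim t)
        show "\<forall>\<^sub>F n in sequentially. hs 0 (\<lambda>k. V m t k - V n t k) d"
          using N[OF m _ t] unfolding eventually_sequentially by blast
      qed
    qed
  qed
  have T0: "0 \<in> {0..T}" using T by simp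
  have init: "v 0 = \<phi>"
  proof
    fix k
    have "\<forall>\<^sub>F n in sequentially. V n 0 k = \<phi> k"
      unfolding eventually_sequentially
    proof (intro exI[of _ "nat \<bar>k\<bar>"] allI impI)
      fix n assume "nat \<bar>k\<bar> \<le> n"
      then show "V n 0 k = \<phi> k" using \<phi> by (cases "k = 0") (auto simp: V(2) cut_def modes_iff admissible_def)
    qed
    then have "(\<lambda>n. V n 0 k) \<longlonglongrightarrow> \<phi> k" by (rule tendsto_eventually)
    then show "v 0 k = \<phi> k" using lim[OF T0, of k] LIMSEQ_unique by blast
  qed
  have v0: "v t 0 = 0" for t
  proof (cases "t \<in> {0..T}")
    case True
    have "V n t 0 = 0" for n using V(1)[of n] by (auto simp: galerkin_def)
    then have "(\<lambda>n. V n t 0) \<longlonglongrightarrow> 0" by simp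
    then show ?thesis using lim[OF True, of 0] LIMSEQ_unique by blast
  next
    case False
    then show ?thesis unfolding v_def by (simp only: if_False)
  qed
  have vre: "v t (- k) = cnj (v t k)" for t k
  proof (cases "t \<in> {0..T}")
    case True
    have "(\<lambda>n. V n t (- k)) \<longlonglongrightarrow> cnj (v t k)" unfolding V(3) by (intro tendsto_cnj lim True)
    then show ?thesis using lim[OF True, of "- k"] LIMSEQ_unique by blast
  next
    case False
    then show ?thesis unfolding v_def by (simp only: if_False complex_cnj_zero)
  qed
  have fl: "mode_flow \<epsilon> (modes n) T (V n)" for n by (rule galerkin_mode_flow[OF V(1)]) simp
  have deriv: "((\<lambda>\<tau>. v \<tau> k) has_vector_derivative (lam \<epsilon> k * v t k + \<i> * of_int k * conv (v t) (v t) k)) (at t within {0..T})"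
    if t: "t \<in> {0..T}" and k: "k \<in> NZ" for t k
  proof -
    define M where "M = nat \<bar>k\<bar>"
    have kM: "k \<in> modes (n + M)" for n using k by (auto simp: M_def modes_iff)
    define f' where "f' n t = lam \<epsilon> k * V (n + M) t k + \<i> * of_int k * conv (V (n + M) t) (V (n + M) t) k" for n t
    define g' where "g' t = lam \<epsilon> k * v t k + \<i> * of_int k * conv (v t) (v t) k" for t
    have "\<exists>g. \<forall>t\<in>{0..T}. (\<lambda>n. V (n + M) t k) \<longlonglongrightarrow> g t \<and> (g has_derivative (\<lambda>h. h *\<^sub>R g' t)) (at t within {0..T})"
    proof (rule has_derivative_sequence[where f' = "\<lambda>n t h. h *\<^sub>R f' n t"])
      show "convex {0..T}" by simp
      show "((\<lambda>t. V (n + M) t k) has_derivative (\<lambda>h. h *\<^sub>R f' n t)) (at t within {0..T})" if "t \<in> {0..T}" for n t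
        using fl[of "n + M"] kM that unfolding mode_flow_def f'_def has_vector_derivative_def by blast
      show "0 \<in> {0..T}" by (rule T0)
      show "(\<lambda>n. V (n + M) 0 k) \<longlonglongrightarrow> v 0 k" by (rule LIMSEQ_ignore_initial_segment[OF lim[OF T0]])
      fix e :: real assume e: "0 < e"
      define c where "c = cmod (lam \<epsilon> k) + \<bar>real_of_int k\<bar> * (2 * sqrt B) + 1"
      have c: "0 < c" using B0 by (simp add: c_def add_nonneg_pos)
      have "0 < (e / c)\<^sup>2" using e c by simp
      from unif[OF this] obtain N where "\<forall>m\<ge>N. \<forall>t\<in>{0..T}. hs 0 (\<lambda>k. V m t k - v t k) ((e / c)\<^sup>2)" ..
      note N = this[rule_format]
      show "\<forall>\<^sub>F n in sequentially. \<forall>t\<in>{0..T}. \<forall>h. norm (h *\<^sub>R f' n t - h *\<^sub>R g' t) \<le> e * norm h"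
        unfolding eventually_sequentially
      proof (intro exI[of _ N] allI impI ballI)
        fix n t and h :: real assume n: "N \<le> n" and t: "t \<in> {0..T}"
        have Nn: "hs 0 (\<lambda>k. V (n + M) t k - v t k) ((e / c)\<^sup>2)" using N[of "n + M" t] n t by simp
        have 1: "cmod (V (n + M) t k - v t k) \<le> e / c"
          using hs_component[OF Nn, of k] e c by simp
        have 2: "cmod (conv (V (n + M) t) (V (n + M) t) k - conv (v t) (v t) k) \<le> 2 * sqrt B * (e / c)"
          using norm_conv_diff_le[OF V(4)[OF t] bv[OF t] Nn, of k] e c by (simp add: real_sqrt_mult mult_ac)
        have "f' n t - g' t = lam \<epsilon> k * (V (n + M) t k - v t k)
            + \<i> * of_int k * (conv (V (n + M) t) (V (n + M) t) k - conv (v t) (v t) k)"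
          by (simp add: f'_def g'_def algebra_simps)
        then have "cmod (f' n t - g' t) \<le> cmod (lam \<epsilon> k * (V (n + M) t k - v t k))
            + cmod (\<i> * of_int k * (conv (V (n + M) t) (V (n + M) t) k - conv (v t) (v t) k))"
          by (metis norm_triangle_ineq)
        also have "\<dots> \<le> cmod (lam \<epsilon> k) * (e / c) + \<bar>real_of_int k\<bar> * (2 * sqrt B * (e / c))"
          unfolding norm_mult by (intro add_mono mult_mono 1 2) auto
        also have "\<dots> = (cmod (lam \<epsilon> k) + \<bar>real_of_int k\<bar> * (2 * sqrt B)) * (e / c)" by (simp only: distrib_right mult.assoc)
        also have "\<dots> = (c - 1) * (e / c)" by (simp add: c_def)
        also have "\<dots> \<le> c * (e / c)" using e c by (intro mult_right_mono) auto
        also have "\<dots> = e" using c by simp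
        finally have "\<bar>h\<bar> * cmod (f' n t - g' t) \<le> \<bar>h\<bar> * e" by (intro mult_left_mono) auto
        then show "norm (h *\<^sub>R f' n t - h *\<^sub>R g' t) \<le> e * norm h"
          unfolding scaleR_diff_right[symmetric] norm_scaleR by (simp add: mult.commute)
      qed
    qed
    then obtain g where g: "\<forall>t\<in>{0..T}. (\<lambda>n. V (n + M) t k) \<longlonglongrightarrow> g t \<and> (g has_derivative (\<lambda>h. h *\<^sub>R g' t)) (at t within {0..T})" ..
    have eq: "v t k = g t" if "t \<in> {0..T}" for t
      by (rule LIMSEQ_unique[OF LIMSEQ_ignore_initial_segment[OF lim[OF that, of k], of M] conjunct1[OF bspec[OF g that]]])
    have "(g has_vector_derivative g' t) (at t within {0..T})"
      unfolding has_vector_derivative_def by (rule conjunct2[OF bspec[OF g t]])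
    then have "((\<lambda>\<tau>. v \<tau> k) has_vector_derivative g' t) (at t within {0..T})"
      by (rule has_vector_derivative_transform[OF t, rotated]) (rule eq)
    then show ?thesis unfolding g'_def .
  qed
  show ?thesis
  proof (intro exI[of _ v] conjI init allI ballI bv)
    show "mode_flow \<epsilon> NZ T v" unfolding mode_flow_def
    proof (intro conjI ballI allI impI deriv)
      show "v t k = 0" if "k \<notin> NZ" for t k using that v0 by simp
    qed
    show "admissible (v t)" for t unfolding admissible_def by (intro conjI allI v0 vre)
  qed
qed

section \<open>Uniform estimates for mean-zero solutions\<close>

text \<open>
  Besides the equation only boundedness in \<open>L^2\<close> is required of a solution; this makes uniqueness
  unconditional.
\<close>

definition mean_zero_sol :: "real \<Rightarrow> real \<Rightarrow> (real \<Rightarrow> int \<Rightarrow> complex) \<Rightarrow> bool" where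
  "mean_zero_sol \<epsilon> T u \<longleftrightarrow> mode_flow \<epsilon> NZ T u \<and> admissible (u 0) \<and> (\<exists>B. \<forall>t\<in>{0..T}. hs 0 (u t) B)"

lemma lip_const_nonneg [simp]: "0 \<le> lip_const A P T" by (simp add: lip_const_def)

lemma lip_const_pos: "0 < lip_const A P T" by (simp add: lip_const_def)

text \<open>
  Every solution is the limit of the Galerkin approximations of its data, so bounds for the latter carry
  over.
\<close>

lemma mean_zero_sol_galerkin_limit:
  assumes u: "mean_zero_sol \<epsilon> T u" and eps: "0 < \<epsilon>" and T: "0 \<le> T" and B: "hs 0 (u 0) B"
  obtains V where "\<And>n. galerkin \<epsilon> (modes n) T (V n)" "\<And>n. V n 0 = cut n (u 0)"
    "\<And>n t. t \<in> {0..T} \<Longrightarrow> hs 0 (V n t) B" "\<And>t k. t \<in> {0..T} \<Longrightarrow> (\<lambda>n. V n t k) \<longlonglongrightarrow> u t k"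
proof -
  obtain B' where B': "\<forall>t\<in>{0..T}. hs 0 (u t) B'" using u unfolding mean_zero_sol_def by blast
  have adm: "admissible (u 0)" and fl: "mode_flow \<epsilon> NZ T u" using u unfolding mean_zero_sol_def by auto
  obtain V where V: "\<forall>n. galerkin \<epsilon> (modes n) T (V n) \<and> V n 0 = cut n (u 0) \<and> (\<forall>t k. V n t (- k) = cnj (V n t k))
     \<and> (\<forall>t\<in>{0..T}. hs 0 (V n t) B)"
    using galerkin_family[OF adm B less_imp_le[OF eps] T] ..
  define M where "M = max B B'"
  have VM: "hs 0 (V n t) M" if "t \<in> {0..T}" for n t
    using V that hs_mono[of 0 "V n t" B M] by (simp add: M_def)
  have uM: "hs 0 (u t) M" if "t \<in> {0..T}" for t
    using B' that hs_mono[of 0 "u t" B' M] by (simp add: M_def)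
  have BM: "hs 0 (u 0) M" using hs_mono[OF B, of M] by (simp add: M_def)
  have lim: "(\<lambda>n. V n t k) \<longlonglongrightarrow> u t k" if t: "t \<in> {0..T}" for t k
  proof (rule LIMSEQ_I)
    fix r :: real assume r: "0 < r"
    then have "0 < (r / 2)\<^sup>2" by simp
    from galerkin_cauchy(2)[OF adm BM eps this, of T V u] V VM fl uM
    obtain N where "\<forall>m\<ge>N. \<forall>t\<in>{0..T}. hs 0 (\<lambda>k. V m t k - u t k) ((r / 2)\<^sup>2)" by presburger
    note N = this[rule_format]
    show "\<exists>N. \<forall>n\<ge>N. norm (V n t k - u t k) < r"
    proof (intro exI[of _ N] allI impI)
      fix n assume "N \<le> n"
      from hs_component[OF N[OF this t], of k] r show "norm (V n t k - u t k) < r" by simp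
    qed
  qed
  show thesis by (rule that[of V]) (use V lim in simp_all)
qed

lemma mean_zero_sol_bound:
  assumes u: "mean_zero_sol \<epsilon> T u" and eps: "0 < \<epsilon>" and T: "0 \<le> T" and s: "0 \<le> s"
    and B: "hs 0 (u 0) (R\<^sup>2)" and R: "1 \<le> R" and Bs: "hs s (u 0) C" and t: "t \<in> {0..T}"
  shows "hs s (u t) (lip_const (2 powr s) (2 * R) T * C)" "hs 0 (u t) (R\<^sup>2)"
proof -
  obtain V where V: "\<And>n. galerkin \<epsilon> (modes n) T (V n)" "\<And>n. V n 0 = cut n (u 0)"
    "\<And>n t. t \<in> {0..T} \<Longrightarrow> hs 0 (V n t) (R\<^sup>2)" "\<And>t k. t \<in> {0..T} \<Longrightarrow> (\<lambda>n. V n t k) \<longlonglongrightarrow> u t k"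
    using mean_zero_sol_galerkin_limit[OF u eps T B] by metis
  have off: "V n t k = 0" if "k \<notin> modes n" for n t k using V(1)[of n] that unfolding galerkin_def by blast
  have w1: "wsum (modes n) (\<lambda>_. 1) (V n t) \<le> R\<^sup>2" if "t \<in> {0..T}" for n t
    using wsum_le_hs[OF V(3)[OF that], of "modes n"] by (simp add: wsum_def)
  have "hs s (V n t) (lip_const (2 powr s) (2 * R) T * C)" for n
  proof -
    have "wsum (modes n) (sw s) (V n t) \<le> lip_const (2 powr s) (2 * R) T * wsum (modes n) (sw s) (V n 0)"
      by (rule galerkin_tame_bound[OF _ _ less_imp_le[OF eps] s R V(1) w1 t]) simp_all
    also have "\<dots> \<le> lip_const (2 powr s) (2 * R) T * C"
      unfolding V(2) by (intro mult_left_mono wsum_le_hs hs_cut Bs) simp_all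
    finally show ?thesis using hs_mono[OF hs_wsum[of "modes n" "V n t" s]] off by simp
  qed
  then show "hs s (u t) (lip_const (2 powr s) (2 * R) T * C)"
    by (intro hs_limit[OF V(4)[OF t]]) simp
  show "hs 0 (u t) (R\<^sup>2)" by (rule hs_limit[OF V(4)[OF t]]) (use V(3)[OF t] in simp)
qed

lemma mean_zero_sol_difference:
  assumes u: "mean_zero_sol \<epsilon> T u" and v: "mean_zero_sol \<epsilon> T v" and eps: "0 < \<epsilon>" and T: "0 \<le> T" and s: "0 \<le> s"
    and R: "1 \<le> R" and Bu: "hs s (u 0) (R\<^sup>2)" and Bv: "hs s (v 0) (R\<^sup>2)"
    and M: "1 \<le> M" "lip_const (2 powr s) (2 * R) T * R\<^sup>2 \<le> M\<^sup>2"
    and D: "hs s (\<lambda>k. u 0 k - v 0 k) D" and t: "t \<in> {0..T}"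
  shows "hs s (\<lambda>k. u t k - v t k) (lip_const (2 powr s) (3 * M) T * D)"
proof -
  have gal: "\<exists>V. (\<forall>n. galerkin \<epsilon> (modes n) T (V n) \<and> V n 0 = cut n (u 0) \<and> (\<forall>t\<in>{0..T}. wsum (modes n) (sw s) (V n t) \<le> M\<^sup>2)) \<and>
      (\<forall>t\<in>{0..T}. \<forall>k. (\<lambda>n. V n t k) \<longlonglongrightarrow> u t k)"
    if u: "mean_zero_sol \<epsilon> T u" and Bu: "hs s (u 0) (R\<^sup>2)" for u
  proof -
    obtain V where V: "\<And>n. galerkin \<epsilon> (modes n) T (V n)" "\<And>n. V n 0 = cut n (u 0)"
      "\<And>n t. t \<in> {0..T} \<Longrightarrow> hs 0 (V n t) (R\<^sup>2)" "\<And>t k. t \<in> {0..T} \<Longrightarrow> (\<lambda>n. V n t k) \<longlonglongrightarrow> u t k"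
      using mean_zero_sol_galerkin_limit[OF u eps T hs_weaken[OF Bu s]] by metis
    have w1: "wsum (modes n) (\<lambda>_. 1) (V n t) \<le> R\<^sup>2" if "t \<in> {0..T}" for n t
      using wsum_le_hs[OF V(3)[OF that], of "modes n"] by (simp add: wsum_def)
    have "wsum (modes n) (sw s) (V n t) \<le> M\<^sup>2" if t: "t \<in> {0..T}" for n t
    proof -
      have "wsum (modes n) (sw s) (V n t) \<le> lip_const (2 powr s) (2 * R) T * wsum (modes n) (sw s) (V n 0)"
        by (rule galerkin_tame_bound[OF _ _ less_imp_le[OF eps] s R V(1) w1 t]) simp_all
      also have "\<dots> \<le> lip_const (2 powr s) (2 * R) T * R\<^sup>2"
        unfolding V(2) by (intro mult_left_mono wsum_le_hs hs_cut Bu) simp_all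
      finally show ?thesis using M(2) by simp
    qed
    then show ?thesis using V by (intro exI[of _ V]) simp
  qed
  obtain U where U: "\<forall>n. galerkin \<epsilon> (modes n) T (U n) \<and> U n 0 = cut n (u 0) \<and> (\<forall>t\<in>{0..T}. wsum (modes n) (sw s) (U n t) \<le> M\<^sup>2)"
    and Ul: "\<forall>t\<in>{0..T}. \<forall>k. (\<lambda>n. U n t k) \<longlonglongrightarrow> u t k"
    using gal[OF u Bu] by (elim exE conjE)
  obtain V where V: "\<forall>n. galerkin \<epsilon> (modes n) T (V n) \<and> V n 0 = cut n (v 0) \<and> (\<forall>t\<in>{0..T}. wsum (modes n) (sw s) (V n t) \<le> M\<^sup>2)"
    and Vl: "\<forall>t\<in>{0..T}. \<forall>k. (\<lambda>n. V n t k) \<longlonglongrightarrow> v t k"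
    using gal[OF v Bv] by (elim exE conjE)
  have off: "U n t k - V n t k = 0" if "k \<notin> modes n" for n t k
    using U[rule_format, of n] V[rule_format, of n] that unfolding galerkin_def by auto
  have bd: "hs s (\<lambda>k. U n t k - V n t k) (lip_const (2 powr s) (3 * M) T * D)" for n
  proof -
    have "wsum (modes n) (sw s) (\<lambda>k. U n t k - V n t k)
        \<le> lip_const (2 powr s) (3 * M) T * wsum (modes n) (sw s) (\<lambda>k. U n 0 k - V n 0 k)"
      by (rule galerkin_difference_bound[OF _ _ less_imp_le[OF eps] s M(1) _ _ _ _ t]) (use U V in simp_all)
    also have "(\<lambda>k. U n 0 k - V n 0 k) = cut n (\<lambda>k. u 0 k - v 0 k)"
      using U V by (auto simp: cut_def)
    also have "lip_const (2 powr s) (3 * M) T * wsum (modes n) (sw s) \<dots> \<le> lip_const (2 powr s) (3 * M) T * D"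
      by (intro mult_left_mono wsum_le_hs hs_cut D) simp_all
    finally show ?thesis using hs_mono[OF hs_wsum[of "modes n" "\<lambda>k. U n t k - V n t k" s]] off by simp
  qed
  show ?thesis
  proof (rule hs_limit[where f = "\<lambda>n k. U n t k - V n t k"])
    show "(\<lambda>n. U n t k - V n t k) \<longlonglongrightarrow> u t k - v t k" for k
      by (rule tendsto_diff[OF Ul[rule_format, OF t] Vl[rule_format, OF t]])
  qed (simp add: bd)
qed

lemma mean_zero_sol_unique:
  assumes u: "mean_zero_sol \<epsilon> T u" and v: "mean_zero_sol \<epsilon> T v" and eps: "0 < \<epsilon>" and T: "0 \<le> T"
    and eq: "u 0 = v 0" and t: "t \<in> {0..T}"
  shows "u t = v t"
proof
  fix k
  obtain B where B: "hs 0 (u 0) B" using u T unfolding mean_zero_sol_def by (metis atLeastAtMost_iff order_refl)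
  define R where "R = sqrt B + 1"
  have B0: "0 \<le> B" by (rule hs_nonneg[OF B])
  have R: "1 \<le> R" using B0 by (simp add: R_def)
  have "B \<le> R\<^sup>2" using B0 by (simp add: R_def power2_sum)
  then have BR: "hs 0 (u 0) (R\<^sup>2)" by (rule hs_mono[OF B])
  define M where "M = sqrt (lip_const (2 powr 0) (2 * R) T * R\<^sup>2) + 1"
  have c0: "0 \<le> lip_const (2 powr 0) (2 * R) T * R\<^sup>2" by simp
  have M: "1 \<le> M" "lip_const (2 powr 0) (2 * R) T * R\<^sup>2 \<le> M\<^sup>2"
    unfolding M_def power2_sum real_sqrt_pow2[OF c0] using real_sqrt_ge_zero[OF c0] by simp_all
  have "hs 0 (\<lambda>k. u t k - v t k) (lip_const (2 powr 0) (3 * M) T * 0)"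
    by (rule mean_zero_sol_difference[OF u v eps T _ R BR _ M _ t]) (use BR eq in \<open>auto simp: hs_def\<close>)
  from hs_component[OF this, of k] show "u t k = v t k" by simp
qed

lemma mean_zero_sol_exists:
  assumes "admissible \<phi>" "hs 0 \<phi> B" "0 < \<epsilon>" "0 \<le> T"
  obtains u where "mean_zero_sol \<epsilon> T u" "u 0 = \<phi>" "\<And>t. admissible (u t)"
proof -
  obtain v where v: "mode_flow \<epsilon> NZ T v \<and> v 0 = \<phi> \<and> (\<forall>t. admissible (v t)) \<and> (\<forall>t\<in>{0..T}. hs 0 (v t) B)"
    using mode_flow_exists[OF assms] ..
  then show thesis using assms(1) by (intro that[of v]) (auto simp: mean_zero_sol_def)
qed

lemma exists_square_bound: "\<exists>R\<ge>1. B \<le> (R::real)\<^sup>2"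
proof (intro exI[of _ "\<bar>B\<bar> + 1"] conjI)
  have "B \<le> \<bar>B\<bar> + 1" by simp
  also have "\<dots> \<le> (\<bar>B\<bar> + 1)\<^sup>2" by (simp add: power2_eq_square algebra_simps)
  finally show "B \<le> (\<bar>B\<bar> + 1)\<^sup>2" .
qed simp

lemma admissible_cut: "admissible \<phi> \<Longrightarrow> admissible (cut n \<phi>)"
  by (auto simp: admissible_def cut_def)

text \<open>
  The frequency \<open>K\<close> depends neither on \<open>t\<close> nor on \<open>\<epsilon>\<close>.  The data are approximated by a trigonometric
  polynomial; its solution is bounded in \<open>H^(s+1)\<close> and hence has small tails in \<open>H^s\<close>, and the difference of
  the two solutions is controlled by the Lipschitz estimate.
\<close>

lemma mean_zero_sol_tight:
  assumes \<phi>: "admissible \<phi>" and B: "hs s \<phi> B" and s: "0 \<le> s" and T: "0 \<le> T" and eta: "0 < (\<eta>::real)"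
  shows "\<exists>K::nat. \<forall>\<epsilon>>0. \<forall>u. mean_zero_sol \<epsilon> T u \<longrightarrow> u 0 = \<phi> \<longrightarrow>
     (\<forall>t\<in>{0..T}. \<forall>S. finite S \<longrightarrow> (\<forall>k\<in>S. int K < \<bar>k\<bar>) \<longrightarrow> (\<Sum>k\<in>S. (sw s k * cmod (u t k))\<^sup>2) \<le> \<eta>)"
proof -
  obtain R where R: "1 \<le> R" "B \<le> R\<^sup>2" using exists_square_bound by blast
  obtain M where M: "1 \<le> M" "lip_const (2 powr s) (2 * R) T * R\<^sup>2 \<le> M\<^sup>2" using exists_square_bound by blast
  have BR: "hs s \<phi> (R\<^sup>2)" by (rule hs_mono[OF B R(2)])
  define L where "L = lip_const (2 powr s) (3 * M) T"
  have L: "0 < L" by (simp add: L_def lip_const_pos)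
  have d: "0 < \<eta> / (4 * L)" using L eta by simp
  obtain n where n: "\<forall>S. finite S \<longrightarrow> (\<forall>k\<in>S. int n < \<bar>k\<bar>) \<longrightarrow> (\<Sum>k\<in>S. (sw s k * cmod (\<phi> k))\<^sup>2) \<le> \<eta> / (4 * L)"
    using hs_tail[OF B d] ..
  (* The smooth approximation of the data; n makes the Lipschitz bound at most a quarter of \<eta>. *)
  define \<psi> where "\<psi> = cut n \<phi>"
  have psi: "admissible \<psi>" "hs s \<psi> (R\<^sup>2)" unfolding \<psi>_def by (rule admissible_cut[OF \<phi>], rule hs_cut[OF BR])
  have diff: "hs s (\<lambda>k. \<phi> k - \<psi> k) (\<eta> / (4 * L))"
  proof (rule hsI)
    fix S :: "int set" assume S: "finite S"
    have "(\<Sum>k\<in>S. (sw s k * cmod (\<phi> k - \<psi> k))\<^sup>2) = (\<Sum>k\<in>{k\<in>S. int n < \<bar>k\<bar>}. (sw s k * cmod (\<phi> k))\<^sup>2)"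
    proof (rule sum.mono_neutral_cong_right)
      have "\<phi> 0 = 0" using \<phi> by (simp add: admissible_def)
      then show "\<forall>k\<in>S - {k\<in>S. int n < \<bar>k\<bar>}. (sw s k * cmod (\<phi> k - \<psi> k))\<^sup>2 = 0"
        by (auto simp: \<psi>_def cut_def modes_iff)
    qed (use S in \<open>auto simp: \<psi>_def cut_def modes_iff\<close>)
    also have "\<dots> \<le> \<eta> / (4 * L)" by (rule n[rule_format]) (use S in auto)
    finally show "(\<Sum>k\<in>S. (sw s k * cmod (\<phi> k - \<psi> k))\<^sup>2) \<le> \<eta> / (4 * L)" .
  qed
  define C where "C = lip_const (2 powr (s + 1)) (2 * R) T * wsum (modes n) (sw (s + 1)) \<psi>"
  have C0: "0 \<le> C" by (simp add: C_def)
  (* Beyond K the weight s + 1 gains K^2, and C divided by that is at most a quarter of \<eta>. *)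
  define K where "K = nat \<lceil>4 * C / \<eta>\<rceil> + 1"
  have K1: "1 \<le> real K" by (simp add: K_def)
  have "4 * C / \<eta> \<le> real K" unfolding K_def by linarith
  then have K2: "4 * C \<le> \<eta> * real K" using eta by (simp add: field_simps)
  show ?thesis
  proof (intro exI[of _ K] allI impI ballI)
    fix \<epsilon> :: real and u t and S :: "int set"
    assume eps: "0 < \<epsilon>" and u: "mean_zero_sol \<epsilon> T u" and u0: "u 0 = \<phi>" and t: "t \<in> {0..T}"
      and S: "finite S" "\<forall>k\<in>S. int K < \<bar>k\<bar>"
    obtain v where v: "mean_zero_sol \<epsilon> T v" "v 0 = \<psi>"
      using mean_zero_sol_exists[OF psi(1) hs_weaken[OF psi(2) s] eps T] by metis
    have "hs s (\<lambda>k. u t k - v t k) (L * (\<eta> / (4 * L)))"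
      unfolding L_def[symmetric] by (unfold L_def, rule mean_zero_sol_difference[OF u v(1) eps T s R(1) _ _ M _ t])
        (use BR psi diff u0 v(2) in \<open>simp_all add: L_def\<close>)
    then have d1: "(\<Sum>k\<in>S. (sw s k * cmod (u t k - v t k))\<^sup>2) \<le> \<eta> / 4"
      using hsD[OF _ S(1)] L by fastforce
    have v1: "hs (s + 1) (v t) C"
      unfolding C_def
    proof (rule mean_zero_sol_bound(1)[OF v(1) eps T _ _ R(1) _ t])
      show "0 \<le> s + 1" using s by simp
      show "hs 0 (v 0) (R\<^sup>2)" unfolding v(2) by (rule hs_weaken[OF psi(2) s])
      show "hs (s + 1) (v 0) (wsum (modes n) (sw (s + 1)) \<psi>)" unfolding v(2) by (rule hs_wsum) (simp_all add: \<psi>_def)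
    qed
    have "(sw s k * cmod (v t k))\<^sup>2 \<le> (sw (s + 1) k * cmod (v t k))\<^sup>2 / (real K)\<^sup>2" if k: "k \<in> S" for k
    proof -
      have "real K \<le> \<bar>real_of_int k\<bar>" using S(2) k by force
      then have kk: "(real K)\<^sup>2 \<le> 1 + (real_of_int k)\<^sup>2" using power_mono[of "real K" "\<bar>real_of_int k\<bar>" 2] by simp
      have "(sw (s + 1) k)\<^sup>2 = (sw s k)\<^sup>2 * (1 + (real_of_int k)\<^sup>2)"
        by (simp add: sw_sq powr_add add_nonneg_nonneg)
      moreover have "(sw s k)\<^sup>2 * (real K)\<^sup>2 \<le> (sw s k)\<^sup>2 * (1 + (real_of_int k)\<^sup>2)" by (rule mult_left_mono[OF kk]) simp
      ultimately have "(sw s k)\<^sup>2 * (real K)\<^sup>2 \<le> (sw (s + 1) k)\<^sup>2" by simp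
      then have "(sw s k)\<^sup>2 * (real K)\<^sup>2 * (cmod (v t k))\<^sup>2 \<le> (sw (s + 1) k)\<^sup>2 * (cmod (v t k))\<^sup>2" by (rule mult_right_mono) simp
      then show ?thesis using K1 by (simp add: power_mult_distrib pos_le_divide_eq mult_ac)
    qed
    then have "(\<Sum>k\<in>S. (sw s k * cmod (v t k))\<^sup>2) \<le> (\<Sum>k\<in>S. (sw (s + 1) k * cmod (v t k))\<^sup>2 / (real K)\<^sup>2)" by (rule sum_mono)
    also have "\<dots> = (\<Sum>k\<in>S. (sw (s + 1) k * cmod (v t k))\<^sup>2) / (real K)\<^sup>2" by (rule sum_divide_distrib[symmetric])
    also have "\<dots> \<le> C / (real K)\<^sup>2" by (rule divide_right_mono[OF hsD[OF v1 S(1)]]) simp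
    also have "\<dots> \<le> C / real K"
      using K1 C0 by (intro divide_left_mono) (auto simp: power2_eq_square)
    also have "\<dots> \<le> \<eta> / 4" using K2 K1 by (simp add: field_simps)
    finally have d2: "(\<Sum>k\<in>S. (sw s k * cmod (v t k))\<^sup>2) \<le> \<eta> / 4" .
    have "(\<Sum>k\<in>S. (sw s k * cmod (u t k))\<^sup>2) = (\<Sum>k\<in>S. (sw s k * cmod ((u t k - v t k) + v t k))\<^sup>2)" by simp
    also have "\<dots> \<le> 2 * (\<Sum>k\<in>S. (sw s k * cmod (u t k - v t k))\<^sup>2) + 2 * (\<Sum>k\<in>S. (sw s k * cmod (v t k))\<^sup>2)"
      by (rule sum_norm_add_sq_le)
    also have "\<dots> \<le> 2 * (\<eta> / 4) + 2 * (\<eta> / 4)" using d1 d2 by (intro add_mono mult_left_mono) auto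
    finally show "(\<Sum>k\<in>S. (sw s k * cmod (u t k))\<^sup>2) \<le> \<eta>" by simp
  qed
qed

section \<open>Uniqueness of Fourier coefficients\<close>

definition fourier_mode :: "int \<Rightarrow> real \<Rightarrow> complex" where "fourier_mode k x = cis (real_of_int k * x)"

lemma norm_fourier_mode [simp]: "cmod (fourier_mode k x) = 1" by (simp add: fourier_mode_def)
lemma fourier_mode_0 [simp]: "fourier_mode 0 x = 1" by (simp add: fourier_mode_def)
lemma fourier_mode_mult: "fourier_mode j x * fourier_mode k x = fourier_mode (j + k) x" by (simp add: fourier_mode_def cis_mult distrib_right)
lemma cnj_fourier_mode: "cnj (fourier_mode k x) = fourier_mode (- k) x" by (simp add: fourier_mode_def cis_cnj)
lemma fourier_mode_continuous [continuous_intros]: "continuous_on S (fourier_mode k)"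
  unfolding fourier_mode_def[abs_def] by (intro continuous_intros)

lemma fourier_coeff_fourier_mode: "fourier_coeff f k = 1 / (2 * pi) * (\<integral>x. fourier_mode (- k) x * of_real (f x) \<partial>torus)"
proof -
  have "exp (- (\<i> * of_int k * of_real x)) = fourier_mode (- k) x" for x by (simp add: fourier_mode_def cis_conv_exp mult.assoc)
  then show ?thesis by (simp add: fourier_coeff_def)
qed

lemma torus_sets [simp]: "{0..2 * pi} \<in> sets lebesgue" by simp

lemma continuous_torus_integrable:
  fixes h :: "real \<Rightarrow> 'b::euclidean_space"
  shows "continuous_on {0..2 * pi} h \<Longrightarrow> integrable torus h"
  by (rule continuous_imp_integrable_real)

lemma continuous_torus_measurable:
  fixes h :: "real \<Rightarrow> 'b::euclidean_space"
  shows "continuous_on {0..2 * pi} h \<Longrightarrow> h \<in> borel_measurable torus"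
  using continuous_torus_integrable by (rule borel_measurable_integrable)

lemma integral_fourier_mode: "(\<integral>x. fourier_mode n x \<partial>torus) = (if n = 0 then 2 * pi else 0)"
proof -
  have 1: "(\<integral>x. fourier_mode n x \<partial>torus) = integral {0..2 * pi} (fourier_mode n)"
    by (rule lebesgue_integral_eq_integral) (auto intro!: continuous_torus_integrable continuous_intros)
  show ?thesis
  proof (cases "n = 0")
    case True
    then have "fourier_mode n = (\<lambda>_. 1)" by (auto simp: fourier_mode_def)
    then show ?thesis unfolding 1 using True by (simp add: scaleR_conv_of_real)
  next
    case False
    define G where "G x = fourier_mode n x / (\<i> * of_int n)" for x
    have "(fourier_mode n has_integral G (2 * pi) - G 0) {0..2 * pi}"
    proof (rule fundamental_theorem_of_calculus)
      fix x :: real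
      have "((\<lambda>z. exp (\<i> * of_int n * z) / (\<i> * of_int n)) has_field_derivative exp (\<i> * of_int n * of_real x)) (at (of_real x))"
        using False by (auto intro!: derivative_eq_intros)
      from has_vector_derivative_real_field[OF this]
      have "((\<lambda>x. exp (\<i> * of_int n * of_real x) / (\<i> * of_int n)) has_vector_derivative exp (\<i> * of_int n * of_real x)) (at x within {0..2 * pi})" .
      then show "(G has_vector_derivative fourier_mode n x) (at x within {0..2 * pi})"
        by (simp add: G_def[abs_def] fourier_mode_def[abs_def] cis_conv_exp mult.assoc)
    qed simp
    moreover have "fourier_mode n (2 * pi) = 1"
    proof -
      have "real_of_int n * (2 * pi) = 2 * pi * real_of_int n" by simp
      moreover have "cis (2 * pi * real_of_int n) = 1" by (rule cis_multiple_2pi) simp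
      ultimately show ?thesis unfolding fourier_mode_def by (simp only:)
    qed
    then have "G (2 * pi) - G 0 = 0" by (simp add: G_def fourier_mode_def)
    ultimately have "integral {0..2 * pi} (fourier_mode n) = 0" by (simp add: integral_unique)
    then show ?thesis unfolding 1 using False by simp
  qed
qed

lemma torus_const_integral: "(\<integral>x. (c::real) \<partial>torus) = 2 * pi * c"
proof -
  have "(\<integral>x. c \<partial>torus) = integral {0..2 * pi} (\<lambda>_. c)"
    by (rule lebesgue_integral_eq_integral) (auto intro!: continuous_torus_integrable continuous_intros)
  then show ?thesis by simp
qed

text \<open>
  Trigonometric polynomials.
\<close>

inductive_set trig :: "(real \<Rightarrow> complex) set" where
  monom: "(\<lambda>x. c * fourier_mode k x) \<in> trig"
| add: "f \<in> trig \<Longrightarrow> g \<in> trig \<Longrightarrow> (\<lambda>x. f x + g x) \<in> trig"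

lemma trig_mult:
  assumes "f \<in> trig" "g \<in> trig" shows "(\<lambda>x. f x * g x) \<in> trig"
  using assms(1)
proof induction
  case (monom c k)
  from assms(2) show ?case
  proof induction
    case (monom d j)
    have "(\<lambda>x. c * fourier_mode k x * (d * fourier_mode j x)) = (\<lambda>x. (c * d) * fourier_mode (k + j) x)"
      by (auto simp: fourier_mode_mult[symmetric])
    then show ?case using trig.monom[of "c * d" "k + j"] by simp
  next
    case (add f g)
    then show ?case using trig.add by (simp add: distrib_left)
  qed
next
  case (add f1 f2)
  then show ?case using trig.add by (simp add: distrib_right)
qed

text \<open>
  Real polynomials in the two coordinates of the plane, restricted to the circle, are trigonometric
  polynomials.  This makes the Stone-Weierstrass theorem applicable.
\<close>

lemma real_polynomial_trig:
  assumes "real_polynomial_function p" shows "(\<lambda>x. of_real (p (cis x))) \<in> trig"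
  using assms
proof induction
  case (linear f)
  interpret f: bounded_linear f by (rule linear)
  have "complex_of_real (f (cis x)) = (f 1 / 2 + f \<i> / (2 * \<i>)) * fourier_mode 1 x + (f 1 / 2 - f \<i> / (2 * \<i>)) * fourier_mode (- 1) x" for x
  proof -
    have "cis x = cos x *\<^sub>R 1 + sin x *\<^sub>R \<i>" by (simp add: complex_eq_iff)
    then have "f (cis x) = cos x * f 1 + sin x * f \<i>" by (simp only: f.add f.scaleR real_scaleR_def)
    then show ?thesis by (simp add: fourier_mode_def complex_eq_iff Re_divide Im_divide algebra_simps)
  qed
  then have "(\<lambda>x. complex_of_real (f (cis x))) =
     (\<lambda>x. (f 1 / 2 + f \<i> / (2 * \<i>)) * fourier_mode 1 x + (f 1 / 2 - f \<i> / (2 * \<i>)) * fourier_mode (- 1) x)" by (rule ext)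
  then show ?case using trig.add[OF trig.monom trig.monom] by simp
next
  case (const c)
  then show ?case using trig.monom[of "of_real c" 0] by simp
next
  case (add f g)
  then show ?case using trig.add by simp
next
  case (mult f g)
  then show ?case using trig_mult by simp
qed

lemma fourier_mode_measurable [measurable]: "fourier_mode k \<in> borel_measurable torus"
  by (rule continuous_torus_measurable) (intro continuous_intros)

lemma integrable_fourier_mode_mult:
  fixes f :: "real \<Rightarrow> complex"
  assumes "integrable torus f" shows "integrable torus (\<lambda>x. fourier_mode k x * f x)"
  by (rule Bochner_Integration.integrable_bound[OF assms]) (use borel_measurable_integrable[OF assms] in \<open>auto simp: norm_mult\<close>)

lemma trig_orthogonal:
  assumes f: "integrable torus f" and z: "\<And>k. fourier_coeff f k = 0" and h: "h \<in> trig"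
  shows "integrable torus (\<lambda>x. h x * of_real (f x)) \<and> (\<integral>x. h x * of_real (f x) \<partial>torus) = 0"
  using h
proof induction
  case (monom c k)
  have i: "integrable torus (\<lambda>x. fourier_mode k x * of_real (f x))" using f by (intro integrable_fourier_mode_mult) auto
  have "(\<integral>x. fourier_mode k x * of_real (f x) \<partial>torus) = 0"
    using z[of "- k"] by (simp add: fourier_coeff_fourier_mode)
  then show ?case using i by (simp add: mult.assoc)
next
  case (add g1 g2)
  then show ?case by (simp add: distrib_right)
qed

text \<open>
  Orthogonality to all trigonometric polynomials passes to their uniform limits, the continuous functions on
  the circle.
\<close>

lemma circle_orthogonal:
  assumes f: "integrable torus f" and z: "\<And>k. fourier_coeff f k = 0"
    and G: "continuous_on (sphere 0 1) (G :: complex \<Rightarrow> real)"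
  shows "integrable torus (\<lambda>x. G (cis x) * f x) \<and> (\<integral>x. G (cis x) * f x \<partial>torus) = 0"
proof
  have Gc: "continuous_on {0..2 * pi} (\<lambda>x. G (cis x))"
    by (rule continuous_on_compose2[OF G]) (auto intro!: continuous_intros)
  then have Gm: "(\<lambda>x. G (cis x)) \<in> borel_measurable torus" by (rule continuous_torus_measurable)
  have fm: "f \<in> borel_measurable torus" using f by (rule borel_measurable_integrable)
  have "bounded (G ` sphere 0 1)" by (intro compact_imp_bounded compact_continuous_image G) simp
  then obtain C where C: "\<forall>y\<in>G ` sphere 0 1. norm y \<le> C" unfolding bounded_iff ..
  have Gb: "\<bar>G (cis x)\<bar> \<le> C" for x
    using C[rule_format, OF imageI, of "cis x"] by simp
  have bound: "integrable torus (\<lambda>x. g x * f x)"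
    if g: "g \<in> borel_measurable torus" "\<And>x. \<bar>g x\<bar> \<le> K" for g :: "real \<Rightarrow> real" and K
  proof (rule Bochner_Integration.integrable_bound[OF integrable_mult_right[of K torus f]])
    show "(\<lambda>x. g x * f x) \<in> borel_measurable torus" using g(1) fm by measurable
    have "\<bar>g x\<bar> * \<bar>f x\<bar> \<le> \<bar>K\<bar> * \<bar>f x\<bar>" for x
      using g(2)[of x] by (intro mult_right_mono) auto
    then show "AE x in torus. norm (g x * f x) \<le> norm (K * f x)" by (simp add: abs_mult)
  qed (rule f)
  show iG: "integrable torus (\<lambda>x. G (cis x) * f x)" by (rule bound[OF Gm Gb])
  have "\<bar>\<integral>x. G (cis x) * f x \<partial>torus\<bar> \<le> e * (\<integral>x. \<bar>f x\<bar> \<partial>torus)" if e: "0 < e" for e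
  proof -
    obtain p where p: "real_polynomial_function p" "\<And>w. w \<in> sphere 0 1 \<Longrightarrow> \<bar>G w - p w\<bar> < e"
      using Stone_Weierstrass_real_polynomial_function[OF compact_sphere G e] by metis
    have tp: "integrable torus (\<lambda>x. of_real (p (cis x)) * complex_of_real (f x))"
      "(\<integral>x. of_real (p (cis x)) * complex_of_real (f x) \<partial>torus) = 0"
      using trig_orthogonal[OF f z real_polynomial_trig[OF p(1)]] by auto
    have ip: "integrable torus (\<lambda>x. p (cis x) * f x)"
      using integrable_Re[OF tp(1)] by simp
    have "complex_of_real (\<integral>x. p (cis x) * f x \<partial>torus) = 0"
      using tp(2) by (simp only: of_real_mult[symmetric] integral_complex_of_real)
    then have p0: "(\<integral>x. p (cis x) * f x \<partial>torus) = 0" by simp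
    have "(\<integral>x. G (cis x) * f x \<partial>torus) = (\<integral>x. G (cis x) * f x - p (cis x) * f x \<partial>torus)"
      using iG ip p0 by simp
    also have "\<bar>\<dots>\<bar> \<le> (\<integral>x. \<bar>G (cis x) * f x - p (cis x) * f x\<bar> \<partial>torus)"
      using integral_norm_bound[of torus "\<lambda>x. G (cis x) * f x - p (cis x) * f x"] by simp
    also have "\<dots> \<le> (\<integral>x. e * \<bar>f x\<bar> \<partial>torus)"
    proof (rule integral_mono)
      fix x
      have "\<bar>G (cis x) - p (cis x)\<bar> \<le> e" using p(2)[of "cis x"] by simp
      then have "\<bar>G (cis x) - p (cis x)\<bar> * \<bar>f x\<bar> \<le> e * \<bar>f x\<bar>" by (rule mult_right_mono) simp
      then show "\<bar>G (cis x) * f x - p (cis x) * f x\<bar> \<le> e * \<bar>f x\<bar>"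
        by (simp add: left_diff_distrib[symmetric] abs_mult)
    qed (use iG ip f in auto)
    finally show ?thesis by simp
  qed
  note small = this
  show "(\<integral>x. G (cis x) * f x \<partial>torus) = 0"
  proof (rule ccontr)
    assume "(\<integral>x. G (cis x) * f x \<partial>torus) \<noteq> 0"
    define A where "A = \<bar>\<integral>x. G (cis x) * f x \<partial>torus\<bar>"
    define Fn where "Fn = (\<integral>x. \<bar>f x\<bar> \<partial>torus)"
    have A: "0 < A" using \<open>_ \<noteq> 0\<close> by (simp add: A_def)
    have F: "0 \<le> Fn" by (simp add: Fn_def)
    have "0 < A / (2 * (Fn + 1))" using A F by simp
    from small[OF this] have "A \<le> A / (2 * (Fn + 1)) * Fn" unfolding A_def[symmetric] Fn_def[symmetric] .
    also have "\<dots> = A * (Fn / (2 * (Fn + 1)))" by simp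
    also have "\<dots> \<le> A * (1 / 2)" using A F by (intro mult_left_mono) (auto simp: field_simps)
    finally show False using A by simp
  qed
qed

lemma AE_torus_negligible: assumes "negligible N" shows "AE x in torus. x \<notin> N"
proof -
  have "AE x in lebesgue. x \<notin> N" using assms negligible_iff_null_sets AE_not_in by blast
  then show ?thesis by (subst AE_restrict_space_iff) auto
qed

text \<open>
  Testing against continuous periodic functions that converge to \<open>sgn f\<close> almost everywhere gives
  \<open>\<integral> |f| = 0\<close>.
\<close>

theorem fourier_coeff_zero_imp_AE_zero:
  assumes f: "integrable torus f" and z: "\<And>k. fourier_coeff f k = 0"
  shows "AE x in torus. f x = 0"
proof -
  have fm [measurable]: "f \<in> borel_measurable torus" using f by (rule borel_measurable_integrable)
  have "(\<lambda>x. sgn (f x)) \<in> borel_measurable torus" by measurable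
  then have "(\<lambda>x. if x \<in> {0..2 * pi} then sgn (f x) else 0) \<in> borel_measurable lebesgue"
    by (subst borel_measurable_if) auto
  then have "(\<lambda>x. if x \<in> {0..2 * pi} then sgn (f x) else 0) measurable_on UNIV"
    by (rule lebesgue_measurable_imp_measurable_on_real) simp
  then obtain N g where N: "negligible N" and gc: "\<And>n. continuous_on UNIV (g n)"
    and gl: "\<And>x. x \<notin> N \<Longrightarrow> (\<lambda>n. g n x) \<longlonglongrightarrow> (if x \<in> {0..2 * pi} then sgn (f x) else 0)"
    unfolding measurable_on_def by auto
  define \<gamma> where "\<gamma> n x = max (- 1) (min 1 (g n x))" for n :: nat and x :: real
  have g1: "\<bar>\<gamma> n x\<bar> \<le> 1" for n x by (auto simp: \<gamma>_def)
  have gcont: "continuous_on UNIV (\<gamma> n)" for n unfolding \<gamma>_def[abs_def] by (intro continuous_intros gc)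
  (* The factor min 1 (n (1 - Re w)) makes G n continuous across the point 1, where Arg2pi jumps. *)
  define G where "G n w = min 1 (real n * (1 - Re w)) * \<gamma> n (Arg2pi w)" for n :: nat and w :: complex
  have G1: "\<bar>G n w\<bar> \<le> 1" if "w \<in> sphere 0 1" for n w
  proof -
    have "Re w \<le> 1" using that complex_Re_le_cmod[of w] by simp
    then have "0 \<le> min 1 (real n * (1 - Re w))" "min 1 (real n * (1 - Re w)) \<le> 1" by auto
    then have "\<bar>min 1 (real n * (1 - Re w))\<bar> * \<bar>\<gamma> n (Arg2pi w)\<bar> \<le> 1 * 1" by (intro mult_mono g1) auto
    then show ?thesis by (simp add: G_def abs_mult)
  qed
  have Gcont: "continuous_on (sphere 0 1) (G n)" for n
    unfolding continuous_on_eq_continuous_within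
  proof
    fix w :: complex assume w: "w \<in> sphere 0 1"
    show "continuous (at w within sphere 0 1) (G n)"
    proof (cases "w = 1")
      case True
      have "((\<lambda>z. \<bar>min 1 (real n * (1 - Re z))\<bar>) \<longlongrightarrow> \<bar>min 1 (real n * (1 - Re w))\<bar>) (at w within sphere 0 1)"
        by (intro tendsto_intros)
      then have 0: "((\<lambda>z. \<bar>min 1 (real n * (1 - Re z))\<bar>) \<longlongrightarrow> 0) (at w within sphere 0 1)"
        using True by simp
      have "(G n \<longlongrightarrow> 0) (at w within sphere 0 1)"
      proof (rule Lim_null_comparison[OF always_eventually 0], rule allI)
        fix z show "norm (G n z) \<le> \<bar>min 1 (real n * (1 - Re z))\<bar>"
          using mult_left_mono[OF g1[of n "Arg2pi z"], of "\<bar>min 1 (real n * (1 - Re z))\<bar>"] by (simp add: G_def abs_mult)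
      qed
      moreover have "G n w = 0" using True by (simp add: G_def)
      ultimately show ?thesis by (simp add: continuous_within)
    next
      case False
      have "w \<notin> \<real>\<^sub>\<ge>\<^sub>0"
      proof
        assume "w \<in> \<real>\<^sub>\<ge>\<^sub>0"
        then obtain r where "w = of_real r" "0 \<le> r" by (auto elim: nonneg_Reals_cases)
        then show False using w False by simp
      qed
      then have "continuous (at w) Arg2pi" by (rule continuous_at_Arg2pi)
      moreover have "continuous (at (Arg2pi w)) (\<gamma> n)" using gcont[of n] by (simp add: continuous_on_eq_continuous_at)
      ultimately have "continuous (at w) (\<lambda>z. \<gamma> n (Arg2pi z))" using continuous_at_compose[of w Arg2pi "\<gamma> n"] by (simp add: o_def)
      moreover have "continuous (at w) Re" by (rule linear_continuous_at[OF bounded_linear_Re])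
      ultimately have "continuous (at w) (G n)" unfolding G_def[abs_def] by (intro continuous_intros)
      then show ?thesis by (rule continuous_at_imp_continuous_within)
    qed
  qed
  have orth: "integrable torus (\<lambda>x. G n (cis x) * f x)" "(\<integral>x. G n (cis x) * f x \<partial>torus) = 0" for n
    using circle_orthogonal[OF f z Gcont] by auto
  have "(\<lambda>n. \<integral>x. G n (cis x) * f x \<partial>torus) \<longlonglongrightarrow> (\<integral>x. \<bar>f x\<bar> \<partial>torus)"
  proof (rule integral_dominated_convergence[where w = "\<lambda>x. \<bar>f x\<bar>"])
    show "(\<lambda>x. \<bar>f x\<bar>) \<in> borel_measurable torus" by measurable
    show "(\<lambda>x. G n (cis x) * f x) \<in> borel_measurable torus" for n using orth(1) by (rule borel_measurable_integrable)
    show "integrable torus (\<lambda>x. \<bar>f x\<bar>)" using f by simp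
    show "AE x in torus. norm (G n (cis x) * f x) \<le> \<bar>f x\<bar>" for n
    proof (intro always_eventually allI)
      fix x
      have "\<bar>G n (cis x)\<bar> * \<bar>f x\<bar> \<le> 1 * \<bar>f x\<bar>" by (intro mult_right_mono G1) auto
      then show "norm (G n (cis x) * f x) \<le> \<bar>f x\<bar>" by (simp add: abs_mult)
    qed
    have "negligible (N \<union> {0, 2 * pi})" using N by (intro negligible_Un) auto
    from AE_torus_negligible[OF this]
    show "AE x in torus. (\<lambda>n. G n (cis x) * f x) \<longlonglongrightarrow> \<bar>f x\<bar>"
    proof (rule AE_mp, intro AE_I2 impI)
      fix x assume "x \<in> space torus" and xN: "x \<notin> N \<union> {0, 2 * pi}"
      then have x: "0 < x" "x < 2 * pi" by (auto simp: less_le)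
      have arg: "Arg2pi (cis x) = x" by (rule Arg2pi_unique[of 1]) (use x in \<open>auto simp: cis_conv_exp\<close>)
      have "0 < sin (x / 2)" by (rule sin_gt_zero) (use x in auto)
      moreover have "cos x = 1 - 2 * (sin (x / 2))\<^sup>2" using cos_double_sin[of "x / 2"] by simp
      ultimately have c: "0 < 1 - cos x" by simp
      have "\<forall>\<^sub>F n in sequentially. 1 / (1 - cos x) \<le> real n"
        using filterlim_real_sequentially unfolding filterlim_at_top by blast
      then have "\<forall>\<^sub>F n in sequentially. min 1 (real n * (1 - Re (cis x))) = 1"
        by eventually_elim (use c in \<open>simp add: field_simps\<close>)
      then have l1: "(\<lambda>n. min 1 (real n * (1 - Re (cis x)))) \<longlonglongrightarrow> 1" by (rule tendsto_eventually)
      have "(\<lambda>n. g n x) \<longlonglongrightarrow> sgn (f x)" using gl[of x] xN x by auto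
      then have "(\<lambda>n. \<gamma> n x) \<longlonglongrightarrow> max (- 1) (min 1 (sgn (f x)))"
        unfolding \<gamma>_def by (intro tendsto_intros)
      moreover have "max (- 1) (min 1 (sgn (f x))) = sgn (f x)" by (auto simp: sgn_real_def)
      ultimately have "(\<lambda>n. min 1 (real n * (1 - Re (cis x))) * \<gamma> n x * f x) \<longlonglongrightarrow> 1 * sgn (f x) * f x"
        by (intro tendsto_mult l1 tendsto_const) auto
      then show "(\<lambda>n. G n (cis x) * f x) \<longlonglongrightarrow> \<bar>f x\<bar>"
        unfolding G_def arg by (simp add: abs_sgn mult.commute)
    qed
  qed
  then have "(\<lambda>n::nat. 0) \<longlonglongrightarrow> (\<integral>x. \<bar>f x\<bar> \<partial>torus)" unfolding orth(2) .
  then have "(\<integral>x. \<bar>f x\<bar> \<partial>torus) = 0" by (rule LIMSEQ_unique[OF _ tendsto_const])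
  then have "AE x in torus. \<bar>f x\<bar> = 0" using f by (subst (asm) integral_nonneg_eq_0_iff_AE) auto
  then show ?thesis by simp
qed

section \<open>The Riesz-Fischer theorem and the square of a function\<close>

definition torus_L2 :: "(real \<Rightarrow> real) \<Rightarrow> bool" where
  "torus_L2 f \<longleftrightarrow> f \<in> borel_measurable torus \<and> integrable torus (\<lambda>x. (f x)\<^sup>2)"

lemma torus_L2_measurable: "torus_L2 f \<Longrightarrow> f \<in> borel_measurable torus" by (simp add: torus_L2_def)

lemma torus_const_integrable [simp]: "integrable torus (\<lambda>x. c :: 'b::euclidean_space)"
  by (rule continuous_torus_integrable) (rule continuous_on_const)

lemma torus_L2_mult: assumes "torus_L2 f" "torus_L2 g" shows "integrable torus (\<lambda>x. f x * g x)"
proof (rule Bochner_Integration.integrable_bound)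
  show "integrable torus (\<lambda>x. (f x)\<^sup>2 + (g x)\<^sup>2)" using assms by (simp add: torus_L2_def)
  show "(\<lambda>x. f x * g x) \<in> borel_measurable torus"
    using assms[THEN torus_L2_measurable] by (rule borel_measurable_times)
  have "\<bar>f x * g x\<bar> \<le> (f x)\<^sup>2 + (g x)\<^sup>2" for x
  proof -
    have "2 * \<bar>f x * g x\<bar> \<le> (f x)\<^sup>2 + (g x)\<^sup>2"
      using zero_le_power2[of "\<bar>f x\<bar> - \<bar>g x\<bar>"] by (simp add: power2_eq_square algebra_simps abs_mult)
    then show ?thesis by simp
  qed
  then show "AE x in torus. norm (f x * g x) \<le> norm ((f x)\<^sup>2 + (g x)\<^sup>2)" by simp
qed

lemma torus_L2_continuous: assumes "continuous_on {0..2 * pi} f" shows "torus_L2 f"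
  unfolding torus_L2_def using assms
  by (auto intro!: continuous_torus_measurable continuous_torus_integrable continuous_intros)

lemma torus_L2_integrable: assumes "torus_L2 f" shows "integrable torus f"
  using torus_L2_mult[OF assms torus_L2_continuous[of "\<lambda>_. 1"]] by simp

lemma torus_L2_diff: assumes f: "torus_L2 f" and g: "torus_L2 g" shows "torus_L2 (\<lambda>x. f x - g x)"
proof -
  have "integrable torus (\<lambda>x. (f x)\<^sup>2 - 2 * (f x * g x) + (g x)\<^sup>2)"
    using f g torus_L2_mult[OF f g] by (simp add: torus_L2_def)
  moreover have "(\<lambda>x. (f x)\<^sup>2 - 2 * (f x * g x) + (g x)\<^sup>2) = (\<lambda>x. (f x - g x)\<^sup>2)"
    by (auto simp: power2_diff)
  ultimately show ?thesis using borel_measurable_diff[OF torus_L2_measurable[OF f] torus_L2_measurable[OF g]]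
    by (simp add: torus_L2_def)
qed

lemma fc_integrable: "integrable torus f \<Longrightarrow> integrable torus (\<lambda>x. fourier_mode k x * complex_of_real (f x))"
  by (intro integrable_fourier_mode_mult) simp

lemma fc_diff: assumes "integrable torus f" "integrable torus g"
  shows "fourier_coeff (\<lambda>x. f x - g x) k = fourier_coeff f k - fourier_coeff g k"
  using fc_integrable[OF assms(1), of "- k"] fc_integrable[OF assms(2), of "- k"]
  by (simp add: fourier_coeff_fourier_mode right_diff_distrib)

lemma fc_add: assumes "integrable torus f" "integrable torus g"
  shows "fourier_coeff (\<lambda>x. f x + g x) k = fourier_coeff f k + fourier_coeff g k"
  using fc_integrable[OF assms(1), of "- k"] fc_integrable[OF assms(2), of "- k"]
  by (simp add: fourier_coeff_fourier_mode distrib_left)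

lemma fc_cnj: "fourier_coeff f (- k) = cnj (fourier_coeff f k)"
proof -
  have "cnj (\<integral>x. fourier_mode (- k) x * of_real (f x) \<partial>torus) = (\<integral>x. cnj (fourier_mode (- k) x * of_real (f x)) \<partial>torus)"
    by (rule Bochner_Integration.integral_cnj[symmetric])
  then show ?thesis by (simp add: fourier_coeff_fourier_mode cnj_fourier_mode)
qed

lemma fc_norm_le: assumes "integrable torus f" shows "cmod (fourier_coeff f k) \<le> 1 / (2 * pi) * (\<integral>x. \<bar>f x\<bar> \<partial>torus)"
proof -
  have "cmod (\<integral>x. fourier_mode (- k) x * of_real (f x) \<partial>torus) \<le> (\<integral>x. cmod (fourier_mode (- k) x * of_real (f x)) \<partial>torus)"
    by (rule integral_norm_bound)
  then have "1 / (2 * pi) * cmod (\<integral>x. fourier_mode (- k) x * of_real (f x) \<partial>torus) \<le> 1 / (2 * pi) * (\<integral>x. \<bar>f x\<bar> \<partial>torus)"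
    by (intro mult_left_mono) (simp_all add: norm_mult)
  then show ?thesis by (simp add: fourier_coeff_fourier_mode norm_mult norm_divide)
qed

lemma fc_0: "fourier_coeff f 0 = of_real ((\<integral>x. f x \<partial>torus) / (2 * pi))"
  by (simp add: fourier_coeff_fourier_mode)

lemma fc_one: "fourier_coeff (\<lambda>_. 1) k = (if k = 0 then 1 else 0)"
  by (simp add: fourier_coeff_fourier_mode integral_fourier_mode)

text \<open>
  The symmetry of coefficient sequences of real functions.
\<close>

definition symm :: "(int \<Rightarrow> complex) \<Rightarrow> bool" where "symm c \<longleftrightarrow> (\<forall>k. c (- k) = cnj (c k))"

definition partial_sum :: "nat \<Rightarrow> (int \<Rightarrow> complex) \<Rightarrow> real \<Rightarrow> real" where
  "partial_sum n c x = Re (\<Sum>k\<in>{- int n..int n}. c k * fourier_mode k x)"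

definition trunc :: "nat \<Rightarrow> (int \<Rightarrow> complex) \<Rightarrow> int \<Rightarrow> complex" where
  "trunc n c k = (if k \<in> {- int n..int n} then c k else 0)"

lemma symm_trunc: "symm c \<Longrightarrow> symm (trunc n c)" by (auto simp: symm_def trunc_def)
lemma symm_diff: "symm c \<Longrightarrow> symm d \<Longrightarrow> symm (\<lambda>k. c k - d k)" by (simp add: symm_def)
lemma symm_fc: "symm (fourier_coeff f)" by (simp add: symm_def fc_cnj)

lemma partial_sum_complex: assumes "symm c" shows "complex_of_real (partial_sum n c x) = (\<Sum>k\<in>{- int n..int n}. c k * fourier_mode k x)"
proof -
  let ?S = "\<Sum>k\<in>{- int n..int n}. c k * fourier_mode k x"
  have "cnj ?S = (\<Sum>k\<in>{- int n..int n}. c (- k) * fourier_mode (- k) x)"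
    using assms by (simp add: symm_def cnj_fourier_mode)
  also have "\<dots> = ?S" by (rule sum.reindex_bij_witness[of _ uminus uminus]) auto
  finally have "?S \<in> \<real>" by (simp add: Reals_cnj_iff)
  then show ?thesis unfolding partial_sum_def by (rule of_real_Re)
qed

lemma partial_sum_continuous: "continuous_on S (partial_sum n c)"
  unfolding partial_sum_def[abs_def] by (intro continuous_intros)

lemma torus_L2_partial_sum: "torus_L2 (partial_sum n c)" by (rule torus_L2_continuous[OF partial_sum_continuous])

lemma partial_sum_times_integrable: assumes "integrable torus f" shows "integrable torus (\<lambda>x. partial_sum n c x * f x)"
proof -
  have "bounded (partial_sum n c ` {0..2 * pi})" by (intro compact_imp_bounded compact_continuous_image partial_sum_continuous) simp
  then obtain C where C: "\<forall>y\<in>partial_sum n c ` {0..2 * pi}. norm y \<le> C" unfolding bounded_iff ..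
  show ?thesis
  proof (rule Bochner_Integration.integrable_bound[OF integrable_mult_right[of C, OF assms]])
    show "(\<lambda>x. partial_sum n c x * f x) \<in> borel_measurable torus"
      by (rule borel_measurable_times[OF torus_L2_measurable[OF torus_L2_partial_sum] borel_measurable_integrable[OF assms]])
    show "AE x in torus. norm (partial_sum n c x * f x) \<le> norm (C * f x)"
    proof (rule AE_I2)
      fix x assume "x \<in> space torus"
      then have "x \<in> {0..2 * pi}" by simp
      from C[rule_format, OF imageI[OF this]] have "\<bar>partial_sum n c x\<bar> \<le> \<bar>C\<bar>" by simp
      then have "\<bar>partial_sum n c x\<bar> * \<bar>f x\<bar> \<le> \<bar>C\<bar> * \<bar>f x\<bar>" by (rule mult_right_mono) simp
      then show "norm (partial_sum n c x * f x) \<le> norm (C * f x)" by (simp add: abs_mult)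
    qed
  qed
qed

lemma fc_partial_sum_times:
  assumes f: "integrable torus f" and c: "symm c"
  shows "fourier_coeff (\<lambda>x. partial_sum n c x * f x) k = (\<Sum>j\<in>{- int n..int n}. c j * fourier_coeff f (k - j))"
proof -
  have "fourier_mode (- k) x * complex_of_real (partial_sum n c x * f x) = (\<Sum>j\<in>{- int n..int n}. c j * (fourier_mode (- (k - j)) x * of_real (f x)))" for x
  proof -
    have "fourier_mode (- k) x * complex_of_real (partial_sum n c x * f x) = (\<Sum>j\<in>{- int n..int n}. c j * ((fourier_mode (- k) x * fourier_mode j x) * of_real (f x)))"
      by (simp add: partial_sum_complex[OF c] sum_distrib_left sum_distrib_right mult_ac)
    then show ?thesis by (simp add: fourier_mode_mult)
  qed
  then have "(\<integral>x. fourier_mode (- k) x * complex_of_real (partial_sum n c x * f x) \<partial>torus)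
      = (\<integral>x. (\<Sum>j\<in>{- int n..int n}. c j * (fourier_mode (- (k - j)) x * of_real (f x))) \<partial>torus)" by (simp only:)
  also have "\<dots> = (\<Sum>j\<in>{- int n..int n}. (\<integral>x. c j * (fourier_mode (- (k - j)) x * of_real (f x)) \<partial>torus))"
    by (rule Bochner_Integration.integral_sum) (intro integrable_mult_right fc_integrable f)
  also have "\<dots> = (\<Sum>j\<in>{- int n..int n}. c j * (\<integral>x. fourier_mode (- (k - j)) x * of_real (f x) \<partial>torus))" by simp
  finally show ?thesis by (simp only: fourier_coeff_fourier_mode sum_distrib_left mult_ac)
qed

lemma fc_partial_sum: assumes "symm c" shows "fourier_coeff (partial_sum n c) k = trunc n c k"
proof -
  have "fourier_coeff (partial_sum n c) k = (\<Sum>j\<in>{- int n..int n}. c j * fourier_coeff (\<lambda>_. 1) (k - j))"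
    using fc_partial_sum_times[OF _ assms, of "\<lambda>_. 1" n k] by simp
  also have "\<dots> = (\<Sum>j\<in>{- int n..int n}. if j = k then c j else 0)"
    by (rule sum.cong) (auto simp: fc_one)
  finally show ?thesis by (simp add: trunc_def)
qed

lemma integral_partial_sum_times:
  assumes f: "integrable torus f" and c: "symm c"
  shows "complex_of_real (\<integral>x. partial_sum n c x * f x \<partial>torus) = 2 * pi * (\<Sum>j\<in>{- int n..int n}. c j * fourier_coeff f (- j))"
  using fc_partial_sum_times[OF assms, of n 0] fc_0[of "\<lambda>x. partial_sum n c x * f x"] by (simp add: field_simps)

lemma integral_partial_sum_times_fc:
  assumes f: "integrable torus f" and c: "symm c" and eq: "\<And>k. k \<in> {- int n..int n} \<Longrightarrow> fourier_coeff f k = c k"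
  shows "(\<integral>x. partial_sum n c x * f x \<partial>torus) = 2 * pi * (\<Sum>j\<in>{- int n..int n}. (cmod (c j))\<^sup>2)"
proof -
  have "(\<Sum>j\<in>{- int n..int n}. c j * fourier_coeff f (- j)) = (\<Sum>j\<in>{- int n..int n}. of_real ((cmod (c j))\<^sup>2))"
  proof (rule sum.cong)
    fix j assume "j \<in> {- int n..int n}"
    then have "fourier_coeff f (- j) = cnj (c j)" using eq[of "- j"] c by (simp add: symm_def)
    then show "c j * fourier_coeff f (- j) = of_real ((cmod (c j))\<^sup>2)" by (simp only: complex_norm_square)
  qed simp
  then have "complex_of_real (\<integral>x. partial_sum n c x * f x \<partial>torus) = of_real (2 * pi * (\<Sum>j\<in>{- int n..int n}. (cmod (c j))\<^sup>2))"
    unfolding integral_partial_sum_times[OF f c] by simp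
  then show ?thesis by (simp only: of_real_eq_iff)
qed

lemma integral_partial_sum_sq:
  assumes "symm c" shows "(\<integral>x. (partial_sum n c x)\<^sup>2 \<partial>torus) = 2 * pi * (\<Sum>j\<in>{- int n..int n}. (cmod (c j))\<^sup>2)"
  using integral_partial_sum_times_fc[OF torus_L2_integrable[OF torus_L2_partial_sum] assms, of n n c] by (simp add: fc_partial_sum[OF assms] trunc_def power2_eq_square)

lemma subset_symmetric_interval: assumes "finite (S :: int set)" shows "\<exists>n::nat. S \<subseteq> {- int n..int n}"
proof -
  define n where "n = nat (Max (insert 0 (abs ` S)))"
  have "\<bar>k\<bar> \<le> int n" if "k \<in> S" for k
    using that assms unfolding n_def by (subst nat_0_le) auto
  then show ?thesis by (intro exI[of _ n]) (fastforce simp: abs_le_iff)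
qed

text \<open>
  Expanding the square of the difference of \<open>f\<close> and its partial sum.
\<close>

lemma bessel: assumes f: "torus_L2 f" shows "hs 0 (fourier_coeff f) ((\<integral>x. (f x)\<^sup>2 \<partial>torus) / (2 * pi))"
proof (rule hsI)
  fix S :: "int set" assume "finite S"
  then obtain n where S: "S \<subseteq> {- int n..int n}" using subset_symmetric_interval by blast
  let ?c = "fourier_coeff f"
  let ?E = "2 * pi * (\<Sum>j\<in>{- int n..int n}. (cmod (?c j))\<^sup>2)"
  have i: "integrable torus (\<lambda>x. (f x)\<^sup>2)" "integrable torus (\<lambda>x. partial_sum n ?c x * f x)" "integrable torus (\<lambda>x. (partial_sum n ?c x)\<^sup>2)"
    using f torus_L2_mult[OF torus_L2_partial_sum f] torus_L2_partial_sum[of n ?c] by (auto simp: torus_L2_def)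
  have "0 \<le> (\<integral>x. (f x - partial_sum n ?c x)\<^sup>2 \<partial>torus)" by simp
  also have "(\<lambda>x. (f x - partial_sum n ?c x)\<^sup>2) = (\<lambda>x. (f x)\<^sup>2 - 2 * (partial_sum n ?c x * f x) + (partial_sum n ?c x)\<^sup>2)"
    by (rule ext) (simp add: power2_eq_square algebra_simps)
  also have "(\<integral>x. (f x)\<^sup>2 - 2 * (partial_sum n ?c x * f x) + (partial_sum n ?c x)\<^sup>2 \<partial>torus)
     = (\<integral>x. (f x)\<^sup>2 \<partial>torus) - 2 * (\<integral>x. partial_sum n ?c x * f x \<partial>torus) + (\<integral>x. (partial_sum n ?c x)\<^sup>2 \<partial>torus)"
    using i by simp
  also have "\<dots> = (\<integral>x. (f x)\<^sup>2 \<partial>torus) - ?E"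
    using integral_partial_sum_times_fc[OF torus_L2_integrable[OF f] symm_fc, of n f] integral_partial_sum_sq[OF symm_fc, of n f] by simp
  finally have "(\<Sum>j\<in>{- int n..int n}. (cmod (?c j))\<^sup>2) \<le> (\<integral>x. (f x)\<^sup>2 \<partial>torus) / (2 * pi)"
    by (simp add: field_simps)
  moreover have "(\<Sum>k\<in>S. (sw 0 k * cmod (?c k))\<^sup>2) \<le> (\<Sum>j\<in>{- int n..int n}. (cmod (?c j))\<^sup>2)"
    unfolding sw_zero mult_1 by (rule sum_mono2) (use S in auto)
  ultimately show "(\<Sum>k\<in>S. (sw 0 k * cmod (?c k))\<^sup>2) \<le> (\<integral>x. (f x)\<^sup>2 \<partial>torus) / (2 * pi)" by linarith
qed

lemma partial_sum_diff: "partial_sum n (\<lambda>k. c k - d k) x = partial_sum n c x - partial_sum n d x"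
  by (simp add: partial_sum_def left_diff_distrib sum_subtractf)

lemma partial_sum_trunc: assumes "m \<le> n" shows "partial_sum n (trunc m c) x = partial_sum m c x"
proof -
  have "(\<Sum>k\<in>{- int n..int n}. trunc m c k * fourier_mode k x) = (\<Sum>k\<in>{- int m..int m}. c k * fourier_mode k x)"
    by (rule sum.mono_neutral_cong_right) (use assms in \<open>auto simp: trunc_def\<close>)
  then show ?thesis by (simp add: partial_sum_def)
qed

lemma trunc_tail:
  assumes "hs 0 c B" "0 < (d::real)"
  shows "\<exists>K. \<forall>n\<ge>K. hs 0 (\<lambda>k. c k - trunc n c k) d"
proof -
  obtain K where K: "\<forall>S. finite S \<longrightarrow> (\<forall>k\<in>S. int K < \<bar>k\<bar>) \<longrightarrow> (\<Sum>k\<in>S. (sw 0 k * cmod (c k))\<^sup>2) \<le> d"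
    using hs_tail[OF assms] ..
  show ?thesis
  proof (intro exI[of _ K] allI impI hsI)
    fix n and S :: "int set" assume n: "K \<le> n" and S: "finite S"
    have "(\<Sum>k\<in>S. (sw 0 k * cmod (c k - trunc n c k))\<^sup>2) = (\<Sum>k\<in>{k\<in>S. int n < \<bar>k\<bar>}. (sw 0 k * cmod (c k))\<^sup>2)"
      by (rule sum.mono_neutral_cong_right) (use S in \<open>auto simp: trunc_def\<close>)
    also have "\<dots> \<le> d" by (rule K[rule_format]) (use S n in auto)
    finally show "(\<Sum>k\<in>S. (sw 0 k * cmod (c k - trunc n c k))\<^sup>2) \<le> d" .
  qed
qed

text \<open>
  A subsequence of the partial sums with geometrically decreasing differences converges almost everywhere and in
  \<open>L^1\<close>, which identifies the coefficients of the limit; Fatou's lemma bounds its \<open>L^2\<close> norm.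
\<close>

theorem riesz_fischer:
  assumes B: "hs 0 c B" and c: "symm c"
  shows "\<exists>f. torus_L2 f \<and> (\<forall>k. fourier_coeff f k = c k) \<and> (\<integral>x. (f x)\<^sup>2 \<partial>torus) \<le> 2 * pi * B"
proof -
  have B0: "0 \<le> B" by (rule hs_nonneg[OF B])
  (* Squared norms (1/4)^j make the norms of consecutive differences summable. *)
  have "\<forall>j. \<exists>K. \<forall>n\<ge>K. hs 0 (\<lambda>k. c k - trunc n c k) ((1 / 4) ^ j)"
    using trunc_tail[OF B] by simp
  then obtain K where K: "\<And>j n. K j \<le> n \<Longrightarrow> hs 0 (\<lambda>k. c k - trunc n c k) ((1 / 4) ^ j)" by metis
  define r where "r j = (\<Sum>i\<le>j. K i) + j" for j
  have rK: "K j \<le> r j" for j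
    using member_le_sum[of j "{..j}" K] by (simp add: r_def)
  have rmono: "r j \<le> r (Suc j)" for j by (simp add: r_def)
  have rj: "j \<le> r j" for j by (simp add: r_def)
  define g where "g j x = partial_sum (r (Suc j)) c x - partial_sum (r j) c x" for j x
  have gsqi: "torus_L2 (g j)" for j unfolding g_def[abs_def] by (rule torus_L2_diff[OF torus_L2_partial_sum torus_L2_partial_sum])
  have gi: "integrable torus (g j)" for j by (rule torus_L2_integrable[OF gsqi])
  have g2: "(\<integral>x. (g j x)\<^sup>2 \<partial>torus) \<le> 2 * pi * (1 / 4) ^ j" for j
  proof -
    have "g j x = partial_sum (r (Suc j)) (\<lambda>k. c k - trunc (r j) c k) x" for x
      by (simp add: g_def partial_sum_diff partial_sum_trunc[OF rmono])
    then have "(\<integral>x. (g j x)\<^sup>2 \<partial>torus) = 2 * pi * (\<Sum>k\<in>{- int (r (Suc j))..int (r (Suc j))}. (cmod (c k - trunc (r j) c k))\<^sup>2)"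
      using integral_partial_sum_sq[OF symm_diff[OF c symm_trunc[OF c]]] by (simp only:)
    also have "\<dots> \<le> 2 * pi * (1 / 4) ^ j"
      by (intro mult_left_mono hs0D[OF K[OF rK]]) auto
    finally show ?thesis .
  qed
  have g1: "(\<integral>x. \<bar>g j x\<bar> \<partial>torus) \<le> 2 * pi * (1 / 2) ^ j" for j
  proof -
    have "(\<integral>x. \<bar>g j x\<bar> \<partial>torus) \<le> (\<integral>x. ((1 / 2) ^ j + 2 ^ j * (g j x)\<^sup>2) / 2 \<partial>torus)"
    proof (rule integral_mono)
      show "integrable torus (\<lambda>x. \<bar>g j x\<bar>)" using gi by simp
      show "integrable torus (\<lambda>x. ((1 / 2) ^ j + 2 ^ j * (g j x)\<^sup>2) / 2)" using gsqi[of j] by (simp add: torus_L2_def)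
      fix x
      have "0 \<le> (1 / 2) ^ j * (1 - 2 ^ j * \<bar>g j x\<bar>)\<^sup>2" by simp
      also have "\<dots> = (1 / 2) ^ j - 2 * \<bar>g j x\<bar> + 2 ^ j * (g j x)\<^sup>2"
        by (simp add: power2_eq_square algebra_simps power_divide)
      finally show "\<bar>g j x\<bar> \<le> ((1 / 2) ^ j + 2 ^ j * (g j x)\<^sup>2) / 2" by simp
    qed
    also have "\<dots> = (2 * pi * (1 / 2) ^ j + 2 ^ j * (\<integral>x. (g j x)\<^sup>2 \<partial>torus)) / 2"
      using gsqi[of j] torus_const_integral[of 1] by (simp add: torus_L2_def)
    also have "\<dots> \<le> (2 * pi * (1 / 2) ^ j + 2 ^ j * (2 * pi * (1 / 4) ^ j)) / 2"
      by (intro divide_right_mono add_left_mono mult_left_mono g2) auto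
    also have "(2::real) ^ j * (2 * pi * (1 / 4) ^ j) = 2 * pi * (1 / 2) ^ j"
    proof -
      have "(2::real) ^ j * (1 / 4) ^ j = (1 / 2) ^ j" by (simp flip: power_mult_distrib)
      then show ?thesis by (simp add: mult_ac)
    qed
    finally show ?thesis by simp
  qed
  have sumg: "summable (\<lambda>j. \<integral>x. \<bar>g j x\<bar> \<partial>torus)"
    by (rule summable_comparison_test'[OF summable_mult[OF summable_geometric[of "1 / 2 :: real"], of "2 * pi"]])
      (use g1 in auto)
  have AEs: "AE x in torus. summable (\<lambda>j. \<bar>g j x\<bar>)"
  proof -
    have gm [measurable]: "(\<lambda>x. ennreal \<bar>g j x\<bar>) \<in> borel_measurable torus" for j using borel_measurable_integrable[OF gi[of j]] by measurable
    have "(\<integral>\<^sup>+x. (\<Sum>j. ennreal \<bar>g j x\<bar>) \<partial>torus) = (\<Sum>j. \<integral>\<^sup>+x. ennreal \<bar>g j x\<bar> \<partial>torus)"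
      by (rule nn_integral_suminf[OF gm])
    also have "\<dots> = (\<Sum>j. ennreal (\<integral>x. \<bar>g j x\<bar> \<partial>torus))"
      using gi by (subst nn_integral_eq_integral) auto
    also have "\<dots> = ennreal (\<Sum>j. \<integral>x. \<bar>g j x\<bar> \<partial>torus)" by (rule suminf_ennreal2[OF _ sumg]) simp
    finally have fin: "(\<integral>\<^sup>+x. (\<Sum>j. ennreal \<bar>g j x\<bar>) \<partial>torus) \<noteq> \<infinity>" by simp
    have "AE x in torus. (\<Sum>j. ennreal \<bar>g j x\<bar>) \<noteq> \<infinity>"
      by (rule nn_integral_PInf_AE[OF _ fin]) measurable
    then show ?thesis
      by eventually_elim (rule summable_suminf_not_top, auto)
  qed
  define G where "G x = (\<Sum>j. g j x)" for x
  have Gi: "integrable torus G" unfolding G_def[abs_def]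
    by (rule integrable_suminf[OF gi]) (use AEs sumg in simp_all)
  define f where "f x = partial_sum (r 0) c x + G x" for x
  have fi: "integrable torus f" unfolding f_def[abs_def]
    by (intro Bochner_Integration.integrable_add Gi torus_L2_integrable[OF torus_L2_partial_sum])
  have tel: "(\<Sum>i<j. g i x) = partial_sum (r j) c x - partial_sum (r 0) c x" for j x
    unfolding g_def by (rule sum_lessThan_telescope)
  have AEl: "AE x in torus. (\<lambda>j. partial_sum (r j) c x) \<longlonglongrightarrow> f x"
    using AEs
  proof eventually_elim
    case (elim x)
    then have "summable (\<lambda>j. g j x)" by (rule summable_rabs_cancel)
    then have "(\<lambda>j. \<Sum>i<j. g i x) \<longlonglongrightarrow> G x" unfolding G_def by (rule summable_LIMSEQ)
    then have "(\<lambda>j. partial_sum (r 0) c x + (\<Sum>i<j. g i x)) \<longlonglongrightarrow> f x" unfolding f_def by (rule tendsto_add[OF tendsto_const])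
    then show ?case by (simp add: tel)
  qed
  have coeff: "fourier_coeff f k = c k" for k
  proof -
    let ?h = "\<lambda>j x. fourier_mode (- k) x * complex_of_real (g j x)"
    have hi: "integrable torus (?h j)" for j by (rule fc_integrable[OF gi])
    have hn: "norm (?h j x) = \<bar>g j x\<bar>" for j x by (simp add: norm_mult)
    have "(\<lambda>j. \<integral>x. ?h j x \<partial>torus) sums (\<integral>x. (\<Sum>j. ?h j x) \<partial>torus)"
      by (rule sums_integral[OF hi]) (simp_all only: hn AEs sumg)
    also have "(\<integral>x. (\<Sum>j. ?h j x) \<partial>torus) = (\<integral>x. fourier_mode (- k) x * of_real (G x) \<partial>torus)"
    proof (rule integral_cong_AE)
      show "(\<lambda>x. \<Sum>j. ?h j x) \<in> borel_measurable torus"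
        by (rule borel_measurable_suminf) (rule borel_measurable_integrable[OF hi])
      show "(\<lambda>x. fourier_mode (- k) x * of_real (G x)) \<in> borel_measurable torus"
        by (rule borel_measurable_integrable[OF fc_integrable[OF Gi]])
      show "AE x in torus. (\<Sum>j. ?h j x) = fourier_mode (- k) x * of_real (G x)"
        using AEs
      proof eventually_elim
        case (elim x)
        then have s: "summable (\<lambda>j. g j x)" by (rule summable_rabs_cancel)
        then have "(\<lambda>j. g j x) sums G x" unfolding G_def by (rule summable_sums)
        then have "(\<lambda>j. ?h j x) sums (fourier_mode (- k) x * of_real (G x))" by (intro sums_mult sums_of_real)
        then show ?case by (rule sums_unique[symmetric])
      qed
    qed
    finally have "(\<lambda>j. 1 / (2 * pi) * (\<integral>x. ?h j x \<partial>torus)) sums (1 / (2 * pi) * (\<integral>x. fourier_mode (- k) x * of_real (G x) \<partial>torus))"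
      by (rule sums_mult)
    then have "(\<lambda>j. fourier_coeff (g j) k) sums fourier_coeff G k" by (simp only: fourier_coeff_fourier_mode)
    then have l1: "(\<lambda>j. \<Sum>i<j. fourier_coeff (g i) k) \<longlonglongrightarrow> fourier_coeff G k" by (simp add: sums_def)
    have "fourier_coeff (g i) k = trunc (r (Suc i)) c k - trunc (r i) c k" for i
      unfolding g_def[abs_def] by (subst fc_diff) (auto intro: torus_L2_integrable[OF torus_L2_partial_sum] simp: fc_partial_sum[OF c])
    then have "(\<Sum>i<j. fourier_coeff (g i) k) = trunc (r j) c k - trunc (r 0) c k" for j
      by (simp only:) (rule sum_lessThan_telescope)
    moreover have "\<forall>\<^sub>F j in sequentially. trunc (r j) c k - trunc (r 0) c k = c k - trunc (r 0) c k"
      unfolding eventually_sequentially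
    proof (intro exI[of _ "nat \<bar>k\<bar>"] allI impI)
      fix j assume "nat \<bar>k\<bar> \<le> j"
      then have "\<bar>k\<bar> \<le> int (r j)" using rj[of j] by linarith
      then show "trunc (r j) c k - trunc (r 0) c k = c k - trunc (r 0) c k" by (auto simp: trunc_def)
    qed
    ultimately have "(\<lambda>j. \<Sum>i<j. fourier_coeff (g i) k) \<longlonglongrightarrow> c k - trunc (r 0) c k"
      by (simp add: tendsto_eventually)
    with l1 have "fourier_coeff G k = c k - trunc (r 0) c k" by (rule LIMSEQ_unique)
    then show ?thesis unfolding f_def[abs_def]
      by (subst fc_add[OF torus_L2_integrable[OF torus_L2_partial_sum] Gi]) (simp add: fc_partial_sum[OF c])
  qed
  have fm: "f \<in> borel_measurable torus" by (rule borel_measurable_integrable[OF fi])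
  have nn: "(\<integral>\<^sup>+x. ennreal ((f x)\<^sup>2) \<partial>torus) \<le> ennreal (2 * pi * B)"
  proof -
    have Pm: "(\<lambda>x. ennreal ((partial_sum (r j) c x)\<^sup>2)) \<in> borel_measurable torus" for j
      using torus_L2_measurable[OF torus_L2_partial_sum[of "r j" c]] by measurable
    have "(\<integral>\<^sup>+x. ennreal ((f x)\<^sup>2) \<partial>torus) = (\<integral>\<^sup>+x. liminf (\<lambda>j. ennreal ((partial_sum (r j) c x)\<^sup>2)) \<partial>torus)"
    proof (rule nn_integral_cong_AE, use AEl in eventually_elim)
      case (elim x)
      then have "(\<lambda>j. ennreal ((partial_sum (r j) c x)\<^sup>2)) \<longlonglongrightarrow> ennreal ((f x)\<^sup>2)" by (rule tendsto_ennrealI[OF tendsto_power])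
      then show ?case by (rule lim_imp_Liminf[symmetric, rotated]) simp
    qed
    also have "\<dots> \<le> liminf (\<lambda>j. \<integral>\<^sup>+x. ennreal ((partial_sum (r j) c x)\<^sup>2) \<partial>torus)" by (rule nn_integral_liminf[OF Pm])
    also have "\<dots> \<le> ennreal (2 * pi * B)"
    proof (rule Liminf_le[OF sequentially_bot always_eventually[OF allI]])
      fix j
      have "(\<integral>\<^sup>+x. ennreal ((partial_sum (r j) c x)\<^sup>2) \<partial>torus) = ennreal (\<integral>x. (partial_sum (r j) c x)\<^sup>2 \<partial>torus)"
        by (rule nn_integral_eq_integral) (use torus_L2_partial_sum[of "r j" c] in \<open>auto simp: torus_L2_def\<close>)
      also have "\<dots> \<le> ennreal (2 * pi * B)"
        unfolding integral_partial_sum_sq[OF c] by (intro ennreal_leI mult_left_mono hs0D[OF B]) auto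
      finally show "(\<integral>\<^sup>+x. ennreal ((partial_sum (r j) c x)\<^sup>2) \<partial>torus) \<le> ennreal (2 * pi * B)" .
    qed
    finally show ?thesis .
  qed
  have f2: "integrable torus (\<lambda>x. (f x)\<^sup>2)"
  proof (rule integrableI_nonneg)
    show "(\<lambda>x. (f x)\<^sup>2) \<in> borel_measurable torus" using fm by measurable
    show "(\<integral>\<^sup>+x. ennreal ((f x)\<^sup>2) \<partial>torus) < \<infinity>" by (rule order_le_less_trans[OF nn]) simp
  qed simp
  have "ennreal (\<integral>x. (f x)\<^sup>2 \<partial>torus) = (\<integral>\<^sup>+x. ennreal ((f x)\<^sup>2) \<partial>torus)"
    by (rule nn_integral_eq_integral[symmetric, OF f2]) simp
  then have "ennreal (\<integral>x. (f x)\<^sup>2 \<partial>torus) \<le> ennreal (2 * pi * B)" using nn by (rule ord_eq_le_trans)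
  moreover have "0 \<le> 2 * pi * B" using B0 by simp
  ultimately have "(\<integral>x. (f x)\<^sup>2 \<partial>torus) \<le> 2 * pi * B" by (simp only: ennreal_le_iff)
  then show ?thesis using fm f2 coeff unfolding torus_L2_def by blast
qed

lemma fc_eq_imp_AE_eq:
  assumes "torus_L2 f" "torus_L2 g" "\<And>k. fourier_coeff f k = fourier_coeff g k"
  shows "AE x in torus. f x = g x"
proof -
  have "AE x in torus. f x - g x = 0"
  proof (rule fourier_coeff_zero_imp_AE_zero)
    show "integrable torus (\<lambda>x. f x - g x)" by (rule torus_L2_integrable[OF torus_L2_diff[OF assms(1,2)]])
    show "fourier_coeff (\<lambda>x. f x - g x) k = 0" for k
      using assms by (simp add: fc_diff torus_L2_integrable)
  qed
  then show ?thesis by simp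
qed

text \<open>
  By uniqueness of Fourier coefficients \<open>f\<close> agrees with the function that the Riesz-Fischer theorem
  constructs from them, so it satisfies the same bound.
\<close>

lemma parseval_le:
  assumes f: "torus_L2 f" and B: "hs 0 (fourier_coeff f) B"
  shows "(\<integral>x. (f x)\<^sup>2 \<partial>torus) \<le> 2 * pi * B"
proof -
  obtain g where g: "torus_L2 g \<and> (\<forall>k. fourier_coeff g k = fourier_coeff f k) \<and> (\<integral>x. (g x)\<^sup>2 \<partial>torus) \<le> 2 * pi * B"
    using riesz_fischer[OF B symm_fc] ..
  have ae: "AE x in torus. f x = g x" by (rule fc_eq_imp_AE_eq) (use f g in auto)
  have "(\<integral>x. (f x)\<^sup>2 \<partial>torus) = (\<integral>x. (g x)\<^sup>2 \<partial>torus)"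
  proof (rule integral_cong_AE)
    show "AE x in torus. (f x)\<^sup>2 = (g x)\<^sup>2" using ae by eventually_elim simp
  qed (use f g in \<open>auto simp: torus_L2_def intro: borel_measurable_integrable\<close>)
  then show ?thesis using g by simp
qed

text \<open>
  For a partial sum \<open>P\<close> the identity for \<open>P f\<close> is a finite computation.  With \<open>f = P + (f - P)\<close> all other
  terms are small together with the tail of the coefficients.
\<close>

theorem fc_square:
  assumes f: "torus_L2 f"
  shows "fourier_coeff (\<lambda>x. (f x)\<^sup>2) k = conv (fourier_coeff f) (fourier_coeff f) k"
proof -
  let ?c = "fourier_coeff f"
  define B where "B = (\<integral>x. (f x)\<^sup>2 \<partial>torus) / (2 * pi)"
  have B: "hs 0 ?c B" unfolding B_def by (rule bessel[OF f])
  have B0: "0 \<le> B" by (rule hs_nonneg[OF B])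
  have est: "cmod (fourier_coeff (\<lambda>x. (f x)\<^sup>2) k - conv ?c ?c k) \<le> 2 * sqrt (d * B) + d" if d: "0 < d" for d
  proof -
    obtain n where n: "hs 0 (\<lambda>k. ?c k - trunc n ?c k) d" using trunc_tail[OF B d] by blast
    let ?P = "partial_sum n ?c" let ?t = "trunc n ?c" let ?e = "\<lambda>k. ?c k - ?t k"
    have Bt: "hs 0 ?t B"
    proof (rule hsI)
      fix S :: "int set" assume S: "finite S"
      have "(\<Sum>k\<in>S. (sw 0 k * cmod (?t k))\<^sup>2) \<le> (\<Sum>k\<in>S. (sw 0 k * cmod (?c k))\<^sup>2)"
        by (intro sum_mono) (simp add: trunc_def)
      also have "\<dots> \<le> B" by (rule hsD[OF B S])
      finally show "(\<Sum>k\<in>S. (sw 0 k * cmod (?t k))\<^sup>2) \<le> B" .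
    qed
    have fP: "torus_L2 (\<lambda>x. f x - ?P x)" by (rule torus_L2_diff[OF f torus_L2_partial_sum])
    have cP: "fourier_coeff (\<lambda>x. f x - ?P x) k = ?e k" for k
      by (simp add: fc_diff[OF torus_L2_integrable[OF f] torus_L2_integrable[OF torus_L2_partial_sum]] fc_partial_sum[OF symm_fc])
    have cP': "fourier_coeff (\<lambda>x. f x - ?P x) = ?e" by (rule ext) (rule cP)
    have conv: "(\<Sum>j\<in>{- int n..int n}. ?c j * h (k - j)) = conv ?t h k" for h
    proof -
      have "conv ?t h k = (\<Sum>\<^sub>\<infinity>j\<in>{- int n..int n}. ?c j * h (k - j))"
        unfolding conv_def by (rule infsum_cong_neutral) (auto simp: trunc_def)
      then show ?thesis by simp
    qed
    have i1: "integrable torus (\<lambda>x. ?P x * f x)" by (rule partial_sum_times_integrable[OF torus_L2_integrable[OF f]])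
    have i2: "integrable torus (\<lambda>x. ?P x * (f x - ?P x))" by (rule partial_sum_times_integrable[OF torus_L2_integrable[OF fP]])
    have i3: "integrable torus (\<lambda>x. (f x - ?P x)\<^sup>2)" using fP by (simp add: torus_L2_def)
    have "(\<lambda>x. (f x)\<^sup>2) = (\<lambda>x. (?P x * f x + ?P x * (f x - ?P x)) + (f x - ?P x)\<^sup>2)"
      by (auto simp: power2_eq_square algebra_simps)
    then have "fourier_coeff (\<lambda>x. (f x)\<^sup>2) k = fourier_coeff (\<lambda>x. (?P x * f x + ?P x * (f x - ?P x)) + (f x - ?P x)\<^sup>2) k"
      by (rule arg_cong)
    also have "\<dots> = conv ?t ?c k + conv ?t ?e k + fourier_coeff (\<lambda>x. (f x - ?P x)\<^sup>2) k"
      unfolding fc_add[OF Bochner_Integration.integrable_add[OF i1 i2] i3] fc_add[OF i1 i2]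
        fc_partial_sum_times[OF torus_L2_integrable[OF f] symm_fc] fc_partial_sum_times[OF torus_L2_integrable[OF fP] symm_fc] cP conv[of ?c] conv[of ?e] ..
    also have "conv ?t ?c k = conv ?c ?c k - conv ?e ?c k"
    proof -
      have "conv ?c ?c k = (\<Sum>\<^sub>\<infinity>a. ?t a * ?c (k - a) + ?e a * ?c (k - a))"
        unfolding conv_def by (rule infsum_cong) (simp add: algebra_simps)
      also have "\<dots> = conv ?t ?c k + conv ?e ?c k"
        unfolding conv_def by (rule infsum_add[OF conv_summable[OF Bt B] conv_summable[OF n B]])
      finally show ?thesis by simp
    qed
    finally have eq: "fourier_coeff (\<lambda>x. (f x)\<^sup>2) k - conv ?c ?c k = conv ?t ?e k - conv ?e ?c k + fourier_coeff (\<lambda>x. (f x - ?P x)\<^sup>2) k"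
      by simp
    have n1: "cmod (conv ?t ?e k) \<le> sqrt (B * d)" by (rule norm_conv_le[OF Bt n])
    have n2: "cmod (conv ?e ?c k) \<le> sqrt (d * B)" by (rule norm_conv_le[OF n B])
    have n3: "cmod (fourier_coeff (\<lambda>x. (f x - ?P x)\<^sup>2) k) \<le> d"
    proof -
      have "cmod (fourier_coeff (\<lambda>x. (f x - ?P x)\<^sup>2) k) \<le> 1 / (2 * pi) * (\<integral>x. \<bar>(f x - ?P x)\<^sup>2\<bar> \<partial>torus)"
        by (rule fc_norm_le[OF i3])
      also have "\<dots> \<le> 1 / (2 * pi) * (2 * pi * d)"
        unfolding abs_power2 by (rule mult_left_mono[OF parseval_le[OF fP]]) (simp_all only: cP' n, simp)
      finally show ?thesis by simp
    qed
    have "cmod (fourier_coeff (\<lambda>x. (f x)\<^sup>2) k - conv ?c ?c k)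
        \<le> cmod (conv ?t ?e k) + cmod (conv ?e ?c k) + cmod (fourier_coeff (\<lambda>x. (f x - ?P x)\<^sup>2) k)"
      unfolding eq by (rule order_trans[OF norm_triangle_ineq add_right_mono[OF norm_triangle_ineq4]])
    also have "\<dots> \<le> sqrt (B * d) + sqrt (d * B) + d" by (intro add_mono n1 n2 n3)
    finally show ?thesis by (simp add: mult.commute)
  qed
  have "((\<lambda>d. 2 * sqrt (d * B) + d) \<longlongrightarrow> 2 * sqrt (0 * B) + 0) (at_right 0)" by (intro tendsto_intros)
  then have "cmod (fourier_coeff (\<lambda>x. (f x)\<^sup>2) k - conv ?c ?c k) \<le> 2 * sqrt (0 * B) + 0"
    by (rule tendsto_lowerbound) (auto simp: eventually_at_filter est)
  then show ?thesis by simp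
qed

section \<open>Sobolev norms of functions and of coefficient sequences\<close>

lemma weight_eq: "(1 + (real_of_int \<bar>k\<bar>)\<^sup>2) powr s * x\<^sup>2 = (sw s k * x)\<^sup>2"
  by (simp add: power_mult_distrib sw_sq)

lemma sobolev_norm_sw:
  "sobolev_norm s f = sqrt (2 * pi * (\<Sum>\<^sub>\<infinity>k. (sw s k * cmod (fourier_coeff f k))\<^sup>2))"
  unfolding sobolev_norm_def weight_eq ..

lemma sobolev_norm_nonneg: "0 \<le> sobolev_norm s f"
  unfolding sobolev_norm_sw by (intro real_sqrt_ge_zero mult_nonneg_nonneg infsum_nonneg) auto

lemma hs_summable: "hs s c B \<Longrightarrow> (\<lambda>k. (sw s k * cmod (c k))\<^sup>2) summable_on UNIV"
  by (rule nonneg_bdd_above_summable_on) (auto intro!: bdd_aboveI2 dest: hsD)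

lemma hs_infsum:
  assumes "(\<lambda>k. (sw s k * cmod (c k))\<^sup>2) summable_on UNIV"
  shows "hs s c (\<Sum>\<^sub>\<infinity>k. (sw s k * cmod (c k))\<^sup>2)"
  by (rule hsI, rule finite_sum_le_infsum[OF assms]) auto

lemma sobolev_iff: "f \<in> sobolev s \<longleftrightarrow> torus_L2 f \<and> (\<exists>B. hs s (fourier_coeff f) B)"
proof -
  have "(\<lambda>k. (sw s k * cmod (fourier_coeff f k))\<^sup>2) summable_on UNIV \<longleftrightarrow> (\<exists>B. hs s (fourier_coeff f) B)"
    by (rule iffI, rule exI, erule hs_infsum, elim exE, erule hs_summable)
  then show ?thesis unfolding sobolev_def torus_L2_def weight_eq mem_Collect_eq by (simp only: conj_assoc)
qed

lemma sobolev_torus_L2: "f \<in> sobolev s \<Longrightarrow> torus_L2 f" by (simp add: sobolev_iff)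

lemma sobolev_hs: assumes "f \<in> sobolev s" shows "hs s (fourier_coeff f) ((sobolev_norm s f)\<^sup>2 / (2 * pi))"
proof -
  let ?I = "\<Sum>\<^sub>\<infinity>k. (sw s k * cmod (fourier_coeff f k))\<^sup>2"
  have "0 \<le> 2 * pi * ?I" by (intro mult_nonneg_nonneg infsum_nonneg) auto
  then have "(sobolev_norm s f)\<^sup>2 / (2 * pi) = ?I" unfolding sobolev_norm_sw by simp
  moreover obtain B where "hs s (fourier_coeff f) B" using assms unfolding sobolev_iff by (elim conjE exE)
  then have "hs s (fourier_coeff f) ?I" by (rule hs_infsum[OF hs_summable])
  ultimately show ?thesis by simp
qed

lemma sobolev_norm_le: assumes "hs s (fourier_coeff f) B" shows "sobolev_norm s f \<le> sqrt (2 * pi * B)"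
proof -
  have "(\<Sum>\<^sub>\<infinity>k. (sw s k * cmod (fourier_coeff f k))\<^sup>2) \<le> B"
    by (rule infsum_le_finite_sums[OF hs_summable[OF assms]]) (rule hsD[OF assms])
  then show ?thesis unfolding sobolev_norm_sw by simp
qed

lemma fc_sobolev_diff: assumes "f \<in> sobolev s" "g \<in> sobolev s"
  shows "fourier_coeff (\<lambda>x. f x - g x) = (\<lambda>k. fourier_coeff f k - fourier_coeff g k)"
  by (rule ext) (rule fc_diff[OF torus_L2_integrable[OF sobolev_torus_L2] torus_L2_integrable[OF sobolev_torus_L2], OF assms])

lemma sobolev_diff: assumes "f \<in> sobolev s" "g \<in> sobolev s" shows "(\<lambda>x. f x - g x) \<in> sobolev s"
  unfolding sobolev_iff fc_sobolev_diff[OF assms]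
  by (rule conjI, rule torus_L2_diff[OF sobolev_torus_L2 sobolev_torus_L2, OF assms], rule exI, rule hs_diff[OF sobolev_hs sobolev_hs, OF assms])

text \<open>
  Minkowski's inequality.
\<close>

lemma hs_triangle:
  assumes "hs s f (a\<^sup>2)" "hs s h (b\<^sup>2)" "0 \<le> a" "0 \<le> b"
  shows "hs s (\<lambda>k. f k + h k) ((a + b)\<^sup>2)"
proof (rule hsI)
  fix S :: "int set" assume S: "finite S"
  let ?L = "\<lambda>f. L2_set (\<lambda>k. sw s k * cmod (f k)) S"
  have "?L (\<lambda>k. f k + h k) \<le> L2_set (\<lambda>k. sw s k * cmod (f k) + sw s k * cmod (h k)) S"
    by (rule L2_set_mono) (simp_all add: norm_triangle_ineq mult_left_mono flip: distrib_left)
  also have "\<dots> \<le> ?L f + ?L h" by (rule L2_set_triangle_ineq)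
  also have "\<dots> \<le> a + b"
    unfolding L2_set_def by (intro add_mono real_le_lsqrt) (use assms hsD[OF assms(1) S] hsD[OF assms(2) S] in auto)
  finally have "(?L (\<lambda>k. f k + h k))\<^sup>2 \<le> (a + b)\<^sup>2" by (rule power_mono) (rule L2_set_nonneg)
  then show "(\<Sum>k\<in>S. (sw s k * cmod (f k + h k))\<^sup>2) \<le> (a + b)\<^sup>2"
    by (simp add: L2_set_def sum_nonneg)
qed

lemma sobolev_norm_triangle: assumes f: "f \<in> sobolev s" and g: "g \<in> sobolev s"
  shows "\<bar>sobolev_norm s f - sobolev_norm s g\<bar> \<le> sobolev_norm s (\<lambda>x. f x - g x)"
proof -
  have *: "sobolev_norm s f \<le> sobolev_norm s g + sobolev_norm s (\<lambda>x. f x - g x)"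
    if f: "f \<in> sobolev s" and g: "g \<in> sobolev s" for f g
  proof -
    define a where "a h = sobolev_norm s h / sqrt (2 * pi)" for h
    have a: "0 \<le> a h" for h by (simp add: a_def sobolev_norm_nonneg)
    have a2: "(a h)\<^sup>2 = (sobolev_norm s h)\<^sup>2 / (2 * pi)" for h by (simp add: a_def power_divide)
    let ?h = "\<lambda>x. f x - g x"
    have "hs s (\<lambda>k. fourier_coeff g k + fourier_coeff ?h k) ((a g + a ?h)\<^sup>2)"
      by (rule hs_triangle) (use a sobolev_hs[OF g] sobolev_hs[OF sobolev_diff[OF f g]] in \<open>simp_all add: a2\<close>)
    then have "hs s (fourier_coeff f) ((a g + a ?h)\<^sup>2)" by (simp add: fc_sobolev_diff[OF f g])
    from sobolev_norm_le[OF this] have "sobolev_norm s f \<le> sqrt (2 * pi) * (a g + a ?h)"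
      using a[of g] a[of ?h] by (simp add: real_sqrt_mult)
    then show ?thesis by (simp add: a_def distrib_left)
  qed
  have "sobolev_norm s (\<lambda>x. g x - f x) = sobolev_norm s (\<lambda>x. f x - g x)"
    unfolding sobolev_norm_sw fc_sobolev_diff[OF f g] fc_sobolev_diff[OF g f] by (simp add: norm_minus_commute)
  then show ?thesis using *[OF f g] *[OF g f] by (simp add: abs_le_iff)
qed

section \<open>Solutions with nonzero mean\<close>

text \<open>
  As \<open>mean_zero_sol\<close>, with an arbitrary real mean.
\<close>

definition fourier_sol :: "real \<Rightarrow> real \<Rightarrow> (real \<Rightarrow> int \<Rightarrow> complex) \<Rightarrow> bool" where
  "fourier_sol \<epsilon> T c \<longleftrightarrow> mode_flow \<epsilon> UNIV T c \<and> symm (c 0) \<and> (\<exists>B. \<forall>t\<in>{0..T}. hs 0 (c t) B)"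

text \<open>
  Setting the mean to \<open>p\<close> and translating the rest by \<open>a\<close> in space.
\<close>

definition boost :: "real \<Rightarrow> real \<Rightarrow> (int \<Rightarrow> complex) \<Rightarrow> int \<Rightarrow> complex" where
  "boost p a z k = (if k = 0 then of_real p else cis (of_int k * a) * z k)"

lemma hs_boost: assumes z: "hs s z A" shows "hs s (boost p a z) (A + p\<^sup>2)"
proof (rule hsI)
  fix S :: "int set" assume S: "finite S"
  have "(\<Sum>k\<in>S. (sw s k * cmod (boost p a z k))\<^sup>2) \<le> (\<Sum>k\<in>insert 0 S. (sw s k * cmod (boost p a z k))\<^sup>2)"
    by (rule sum_mono2) (use S in auto)
  also have "\<dots> = p\<^sup>2 + (\<Sum>k\<in>S - {0}. (sw s k * cmod (boost p a z k))\<^sup>2)"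
    using S by (simp add: sum.insert_remove boost_def sw_def)
  also have "(\<Sum>k\<in>S - {0}. (sw s k * cmod (boost p a z k))\<^sup>2) = (\<Sum>k\<in>S - {0}. (sw s k * cmod (z k))\<^sup>2)"
    by (rule sum.cong) (auto simp: boost_def norm_mult)
  also have "\<dots> \<le> A" by (rule hsD[OF z]) (use S in simp)
  finally show "(\<Sum>k\<in>S. (sw s k * cmod (boost p a z k))\<^sup>2) \<le> A + p\<^sup>2" by simp
qed

text \<open>
  Convolution commutes with translations.
\<close>

lemma conv_phase: "conv (\<lambda>k. cis (of_int k * a) * z k) (\<lambda>k. cis (of_int k * a) * z k) k = cis (of_int k * a) * conv z z k"
proof -
  have "cis (of_int j * a) * z j * (cis (of_int (k - j) * a) * z (k - j)) = cis (of_int k * a) * (z j * z (k - j))" (is "?l j = ?r j") for j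
  proof -
    have "cis (of_int j * a) * z j * (cis (of_int (k - j) * a) * z (k - j))
        = (cis (of_int j * a) * cis (of_int (k - j) * a)) * (z j * z (k - j))" by (simp only: mult_ac)
    also have "cis (of_int j * a) * cis (of_int (k - j) * a) = cis (of_int k * a)"
      by (simp add: cis_mult algebra_simps)
    finally show ?thesis .
  qed
  then have "(\<Sum>\<^sub>\<infinity>j. ?l j) = (\<Sum>\<^sub>\<infinity>j. ?r j)" by (rule infsum_cong)
  then show ?thesis unfolding conv_def by (simp only: infsum_cmult_right')
qed

text \<open>
  A nonzero mean contributes a transport term, which the moving frame will cancel.
\<close>

lemma conv_boost_zero:
  assumes z: "hs 0 z B" and z0: "z 0 = 0" and k: "k \<noteq> 0"
  shows "conv (boost p 0 z) (boost p 0 z) k = 2 * of_real p * z k + conv z z k"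
proof -
  let ?c = "boost p 0 z" let ?w = "\<lambda>k. ?c k - z k"
  have w: "?w j = (if j = 0 then of_real p else 0)" for j using z0 by (simp add: boost_def)
  have "conv ?w ?c k = (\<Sum>\<^sub>\<infinity>j\<in>{0}. ?w j * ?c (k - j))" unfolding conv_def by (rule infsum_cong_neutral) (auto simp: w)
  then have 1: "conv ?w ?c k = of_real p * z k" using k by (simp add: w) (simp add: boost_def)
  have "conv z ?w k = (\<Sum>\<^sub>\<infinity>j\<in>{k}. z j * ?w (k - j))" unfolding conv_def by (rule infsum_cong_neutral) (auto simp: w)
  then have 2: "conv z ?w k = of_real p * z k" by (simp add: w)
  show ?thesis using conv_diff[OF hs_boost[OF z, of p 0] z, of k] 1 2 by (simp add: algebra_simps)
qed

lemma conv_boost: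
  assumes z: "hs 0 z B" and z0: "z 0 = 0" and k: "k \<noteq> 0"
  shows "conv (boost p a z) (boost p a z) k = cis (of_int k * a) * (2 * of_real p * z k + conv z z k)"
proof -
  have "boost p a z = (\<lambda>k. cis (of_int k * a) * boost p 0 z k)" by (auto simp: boost_def)
  then have "conv (boost p a z) (boost p a z) k
      = conv (\<lambda>k. cis (of_int k * a) * boost p 0 z k) (\<lambda>k. cis (of_int k * a) * boost p 0 z k) k"
    by (rule arg_cong[where f = "\<lambda>c. conv c c k"])
  also have "\<dots> = cis (of_int k * a) * conv (boost p 0 z) (boost p 0 z) k" by (rule conv_phase)
  finally show ?thesis unfolding conv_boost_zero[OF assms] .
qed

lemma phase_derivative:
  assumes "(y has_vector_derivative y') (at t within S)"
  shows "((\<lambda>\<tau>. cis (of_int k * (b * \<tau>)) * y \<tau>) has_vector_derivative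
     cis (of_int k * (b * t)) * (y' + \<i> * of_int k * of_real b * y t)) (at t within S)"
proof -
  have "((\<lambda>z. exp (\<i> * of_int k * of_real b * z)) has_field_derivative
      (\<i> * of_int k * of_real b * exp (\<i> * of_int k * of_real b * of_real t))) (at (of_real t))"
    by (auto intro!: derivative_eq_intros)
  then have "((\<lambda>z. exp (\<i> * of_int k * of_real b * z)) \<circ> of_real has_vector_derivative
      1 * (\<i> * of_int k * of_real b * exp (\<i> * of_int k * of_real b * of_real t))) (at t)"
    by (intro field_vector_diff_chain_at) (auto intro: has_vector_derivative_of_real derivative_eq_intros)
  moreover have e: "exp (\<i> * of_int k * of_real b * of_real \<tau>) = cis (of_int k * (b * \<tau>))" for \<tau>
    by (simp add: cis_conv_exp mult_ac)
  ultimately have "((\<lambda>\<tau>. cis (of_int k * (b * \<tau>))) has_vector_derivative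
      (\<i> * of_int k * of_real b * cis (of_int k * (b * t)))) (at t within S)"
    by (simp add: o_def e has_vector_derivative_at_within)
  from has_vector_derivative_mult[OF this assms] show ?thesis
    by (rule has_vector_derivative_eq_rhs) (simp add: algebra_simps)
qed

text \<open>
  The Galilean transformation with velocity \<open>2 m\<close>.
\<close>

lemma mean_zero_sol_fourier_sol:
  assumes v: "mean_zero_sol \<epsilon> T v"
  shows "fourier_sol \<epsilon> T (\<lambda>t. boost m (2 * m * t) (v t))"
proof -
  obtain B where B: "\<forall>t\<in>{0..T}. hs 0 (v t) B" using v unfolding mean_zero_sol_def by blast
  have fl: "mode_flow \<epsilon> NZ T v" and adm: "admissible (v 0)" using v unfolding mean_zero_sol_def by auto
  have z0: "v t 0 = 0" if "t \<in> {0..T}" for t using fl that unfolding mode_flow_def by auto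
  have "((\<lambda>\<tau>. boost m (2 * m * \<tau>) (v \<tau>) k) has_vector_derivative
        (lam \<epsilon> k * boost m (2 * m * t) (v t) k
         + \<i> * of_int k * conv (boost m (2 * m * t) (v t)) (boost m (2 * m * t) (v t)) k)) (at t within {0..T})"
    if t: "t \<in> {0..T}" for t k
  proof (cases "k = 0")
    case True then show ?thesis by (simp add: boost_def lam_def)
  next
    case False
    then have "((\<lambda>\<tau>. v \<tau> k) has_vector_derivative (lam \<epsilon> k * v t k + \<i> * of_int k * conv (v t) (v t) k)) (at t within {0..T})"
      using fl t unfolding mode_flow_def by auto
    from phase_derivative[OF this, of k "2 * m"] False show ?thesis
      unfolding conv_boost[OF B[rule_format, OF t] z0[OF t] False]
      by (simp add: boost_def algebra_simps)
  qed
  then have "mode_flow \<epsilon> UNIV T (\<lambda>t. boost m (2 * m * t) (v t))" unfolding mode_flow_def by simp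
  moreover have "symm (boost m (2 * m * 0) (v 0))" using adm by (auto simp: symm_def admissible_def boost_def)
  moreover have "\<forall>t\<in>{0..T}. hs 0 (boost m (2 * m * t) (v t)) (B + m\<^sup>2)" using B by (intro ballI hs_boost) auto
  ultimately show ?thesis unfolding fourier_sol_def by (intro conjI exI[of _ "B + m\<^sup>2"])
qed

lemma symm_zero_real: "symm c \<Longrightarrow> c 0 = of_real (Re (c 0))"
proof -
  assume "symm c"
  then have "c (- 0) = cnj (c 0)" unfolding symm_def ..
  then have "Im (c 0) = - Im (c 0)" by (simp add: complex_eq_iff)
  then show ?thesis by (simp add: complex_eq_iff)
qed

lemma fourier_sol_derivative:
  assumes c: "fourier_sol \<epsilon> T c" and t: "t \<in> {0..T}"
  shows "((\<lambda>\<tau>. c \<tau> k) has_vector_derivative (lam \<epsilon> k * c t k + \<i> * of_int k * conv (c t) (c t) k)) (at t within {0..T})"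
proof -
  have "mode_flow \<epsilon> UNIV T c" using c unfolding fourier_sol_def by (rule conjunct1)
  then have "\<forall>t\<in>{0..T}. \<forall>k\<in>UNIV. ((\<lambda>\<tau>. c \<tau> k) has_vector_derivative
      (lam \<epsilon> k * c t k + \<i> * of_int k * conv (c t) (c t) k)) (at t within {0..T})"
    unfolding mode_flow_def by (rule conjunct2)
  from this[rule_format, OF t UNIV_I] show ?thesis .
qed

lemma fourier_sol_mean:
  assumes c: "fourier_sol \<epsilon> T c" and t: "t \<in> {0..T}"
  shows "c t 0 = of_real (Re (c 0 0))"
proof -
  have d: "((\<lambda>\<tau>. c \<tau> 0) has_vector_derivative 0) (at r within {0..T})" if r: "r \<in> {0..T}" for r
    using fourier_sol_derivative[OF c r, of 0] by (simp add: lam_def)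
  obtain q where q: "\<And>r. r \<in> {0..T} \<Longrightarrow> c r 0 = q"
    using has_vector_derivative_zero_constant[OF convex_real_interval(5)[of 0 T] d] by blast
  have "0 \<in> {0..T}" using t by auto
  from q[OF this] q[OF t] have "c t 0 = c 0 0" by (simp only:)
  moreover have "symm (c 0)" using c unfolding fourier_sol_def by blast
  ultimately show ?thesis by (rule trans[OF _ symm_zero_real])
qed

text \<open>
  The inverse transformation; its velocity is constant because the mean is conserved.
\<close>

lemma fourier_sol_mean_zero_sol:
  assumes c: "fourier_sol \<epsilon> T c" and T: "0 \<le> T"
  obtains v where "mean_zero_sol \<epsilon> T v" "v 0 = (c 0)(0 := 0)"
    "\<And>t. t \<in> {0..T} \<Longrightarrow> c t = boost (Re (c 0 0)) (2 * Re (c 0 0) * t) (v t)"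
proof -
  define m where "m = Re (c 0 0)"
  define v where "v t = boost 0 (- 2 * m * t) (c t)" for t
  have fin_conv: "c t = boost m (2 * m * t) (v t)" if t: "t \<in> {0..T}" for t
  proof
    fix k show "c t k = boost m (2 * m * t) (v t) k"
    proof (cases "k = 0")
      case True then show ?thesis using fourier_sol_mean[OF c t] by (simp add: boost_def m_def)
    next
      case False
      have "cis (of_int k * (2 * m * t)) * (cis (of_int k * (- 2 * m * t)) * c t k)
          = (cis (of_int k * (2 * m * t)) * cis (of_int k * (- 2 * m * t))) * c t k" by (simp only: mult.assoc)
      also have "\<dots> = c t k" by (simp add: cis_mult)
      finally show ?thesis using False by (simp add: boost_def v_def)
    qed
  qed
  obtain B where B: "\<forall>t\<in>{0..T}. hs 0 (c t) B" using c unfolding fourier_sol_def by blast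
  have vB: "hs 0 (v t) B" if "t \<in> {0..T}" for t
    using hs_boost[OF B[rule_format, OF that], of 0 "- 2 * m * t"] unfolding v_def by simp
  have v0: "v 0 = (c 0)(0 := 0)" by (auto simp: v_def boost_def)
  have "((\<lambda>\<tau>. v \<tau> k) has_vector_derivative (lam \<epsilon> k * v t k + \<i> * of_int k * conv (v t) (v t) k)) (at t within {0..T})"
    if t: "t \<in> {0..T}" and k: "k \<noteq> 0" for t k
  proof -
    let ?e = "cis (of_int k * (2 * m * t))" and ?f = "cis (of_int k * (- 2 * m * t))"
    have d: "((\<lambda>\<tau>. v \<tau> k) has_vector_derivative ?f *
        (lam \<epsilon> k * c t k + \<i> * of_int k * conv (c t) (c t) k + \<i> * of_int k * of_real (- 2 * m) * c t k)) (at t within {0..T})"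
      using phase_derivative[OF fourier_sol_derivative[OF c t], of k "- 2 * m" k] k by (simp add: v_def boost_def)
    have vt0: "v t 0 = 0" by (simp add: v_def boost_def)
    have "conv (c t) (c t) k = conv (boost m (2 * m * t) (v t)) (boost m (2 * m * t) (v t)) k"
      using fin_conv[OF t] by (rule arg_cong[where f = "\<lambda>c. conv c c k"])
    then have q: "conv (c t) (c t) k = ?e * (2 * of_real m * v t k + conv (v t) (v t) k)"
      unfolding conv_boost[OF vB[OF t] vt0 k] .
    have e: "c t k = ?e * v t k" using fun_cong[OF fin_conv[OF t], of k] k by (simp add: boost_def)
    have fe: "?f * ?e = 1" by (simp add: cis_mult)
    have "?f * (lam \<epsilon> k * c t k + \<i> * of_int k * conv (c t) (c t) k + \<i> * of_int k * of_real (- 2 * m) * c t k)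
        = (?f * ?e) * (lam \<epsilon> k * v t k + \<i> * of_int k * conv (v t) (v t) k)"
      unfolding q e of_real_mult of_real_minus of_real_numeral by algebra
    then show ?thesis using d unfolding fe mult_1_left by (rule subst)
  qed
  note dv = this
  have v00: "v t 0 = 0" for t by (simp add: v_def boost_def)
  have adm: "admissible (v 0)" using c unfolding v0 fourier_sol_def by (auto simp: symm_def admissible_def)
  have "mode_flow \<epsilon> NZ T v" unfolding mode_flow_def
  proof (intro conjI ballI allI impI)
    fix t k assume t: "t \<in> {0..T}"
    show "v t k = 0" if "k \<notin> NZ" using that v00 by simp
    show "((\<lambda>\<tau>. v \<tau> k) has_vector_derivative (lam \<epsilon> k * v t k + \<i> * of_int k * conv (v t) (v t) k)) (at t within {0..T})"
      if "k \<in> NZ" by (rule dv[OF t]) (use that in simp)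
  qed
  moreover have "\<forall>t\<in>{0..T}. hs 0 (v t) B" using vB by simp
  ultimately have bf: "mean_zero_sol \<epsilon> T v" unfolding mean_zero_sol_def using adm by (intro conjI exI[of _ B])
  show thesis by (rule that[OF bf v0]) (use fin_conv in \<open>simp only: m_def\<close>)
qed

lemma hs_zero_mode: "hs s c B \<Longrightarrow> hs s (c(0 := 0)) B"
proof (rule hsI)
  fix S :: "int set" assume c: "hs s c B" and S: "finite S"
  have "(\<Sum>k\<in>S. (sw s k * cmod ((c(0 := 0)) k))\<^sup>2) \<le> (\<Sum>k\<in>S. (sw s k * cmod (c k))\<^sup>2)"
    by (rule sum_mono) auto
  also have "\<dots> \<le> B" by (rule hsD[OF c S])
  finally show "(\<Sum>k\<in>S. (sw s k * cmod ((c(0 := 0)) k))\<^sup>2) \<le> B" .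
qed

text \<open>
  Equal data have equal means, so both solutions are reduced by the same Galilean transformation.
\<close>

theorem fourier_sol_unique:
  assumes c: "fourier_sol \<epsilon> T c" and d: "fourier_sol \<epsilon> T d" and eps: "0 < \<epsilon>" and T: "0 \<le> T"
    and eq: "c 0 = d 0" and t: "t \<in> {0..T}"
  shows "c t = d t"
proof -
  obtain v where v: "mean_zero_sol \<epsilon> T v" "v 0 = (c 0)(0 := 0)"
    "\<And>t. t \<in> {0..T} \<Longrightarrow> c t = boost (Re (c 0 0)) (2 * Re (c 0 0) * t) (v t)" using fourier_sol_mean_zero_sol[OF c T] by blast
  obtain w where w: "mean_zero_sol \<epsilon> T w" "w 0 = (d 0)(0 := 0)"
    "\<And>t. t \<in> {0..T} \<Longrightarrow> d t = boost (Re (d 0 0)) (2 * Re (d 0 0) * t) (w t)" using fourier_sol_mean_zero_sol[OF d T] by blast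
  have "v t = w t" by (rule mean_zero_sol_unique[OF v(1) w(1) eps T _ t]) (simp only: v(2) w(2) eq)
  then show ?thesis unfolding v(3)[OF t] w(3)[OF t] eq by (rule arg_cong)
qed

theorem fourier_sol_exists:
  assumes \<phi>: "symm \<phi>" and B: "hs 0 \<phi> B" and eps: "0 < \<epsilon>" and T: "0 \<le> T"
  obtains c where "fourier_sol \<epsilon> T c" "c 0 = \<phi>" "\<And>t. symm (c t)"
proof -
  let ?p = "Re (\<phi> 0)"
  have adm: "admissible (\<phi>(0 := 0))" using \<phi> by (auto simp: symm_def admissible_def)
  obtain v where v: "mean_zero_sol \<epsilon> T v" "v 0 = \<phi>(0 := 0)" "\<And>t. admissible (v t)"
    using mean_zero_sol_exists[OF adm hs_zero_mode[OF B] eps T] by blast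
  show thesis
  proof (rule that[of "\<lambda>t. boost ?p (2 * ?p * t) (v t)"])
    show "fourier_sol \<epsilon> T (\<lambda>t. boost ?p (2 * ?p * t) (v t))" by (rule mean_zero_sol_fourier_sol[OF v(1)])
    have "boost ?p 0 (\<phi>(0 := 0)) k = \<phi> k" for k
      by (cases "k = 0") (simp_all add: boost_def flip: symm_zero_real[OF \<phi>])
    then show "boost ?p (2 * ?p * 0) (v 0) = \<phi>" unfolding v(2) by auto
    show "symm (boost ?p (2 * ?p * t) (v t))" for t
      using v(3)[of t] by (simp add: symm_def admissible_def boost_def cis_cnj)
  qed
qed

lemma Re_mode_sq_le: assumes "hs s f D" "0 \<le> s" shows "(Re (f k))\<^sup>2 \<le> D"
proof -
  have "\<bar>Re (f k)\<bar> \<le> sqrt D" using abs_Re_le_cmod hs_component[OF hs_weaken[OF assms]] by (rule order_trans)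
  then have "\<bar>Re (f k)\<bar>\<^sup>2 \<le> (sqrt D)\<^sup>2" by (rule power_mono) simp
  then show ?thesis using hs_nonneg[OF assms(1)] by simp
qed

lemma fourier_sol_bound:
  assumes c: "fourier_sol \<epsilon> T c" and eps: "0 < \<epsilon>" and T: "0 \<le> T" and s: "0 \<le> s" and R: "1 \<le> R"
    and C: "hs s (c 0) C" and CR: "C \<le> R\<^sup>2" and t: "t \<in> {0..T}"
  shows "hs s (c t) (lip_const (2 powr s) (2 * R) T * C + C)"
proof -
  obtain v where v: "mean_zero_sol \<epsilon> T v" "v 0 = (c 0)(0 := 0)"
    "\<And>t. t \<in> {0..T} \<Longrightarrow> c t = boost (Re (c 0 0)) (2 * Re (c 0 0) * t) (v t)" using fourier_sol_mean_zero_sol[OF c T] by blast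
  have Cs: "hs s (v 0) C" unfolding v(2) by (rule hs_zero_mode[OF C])
  have "hs s (v t) (lip_const (2 powr s) (2 * R) T * C)"
    by (rule mean_zero_sol_bound(1)[OF v(1) eps T s hs_mono[OF hs_weaken[OF Cs s] CR] R Cs t])
  then have "hs s (c t) (lip_const (2 powr s) (2 * R) T * C + (Re (c 0 0))\<^sup>2)"
    unfolding v(3)[OF t] by (rule hs_boost)
  then show ?thesis by (rule hs_mono) (use Re_mode_sq_le[OF C s] in simp)
qed

text \<open>
  Convergence in \<open>H^s\<close> follows from small tails and convergence of each mode.
\<close>

lemma hs_split:
  assumes tail: "\<And>S. finite S \<Longrightarrow> (\<forall>k\<in>S. int K < \<bar>k\<bar>) \<Longrightarrow> (\<Sum>k\<in>S. (sw s k * cmod (f k))\<^sup>2) \<le> a"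
    and low: "(\<Sum>k\<in>{- int K..int K}. (sw s k * cmod (f k))\<^sup>2) \<le> b"
  shows "hs s f (a + b)"
proof (rule hsI)
  fix S :: "int set" assume S: "finite S"
  let ?q = "\<lambda>k. (sw s k * cmod (f k))\<^sup>2"
  have "sum ?q S \<le> sum ?q ((S - {- int K..int K}) \<union> {- int K..int K})" by (rule sum_mono2) (use S in auto)
  also have "\<dots> = sum ?q (S - {- int K..int K}) + sum ?q {- int K..int K}" by (rule sum.union_disjoint) (use S in auto)
  also have "\<dots> \<le> a + b" by (intro add_mono tail low) (use S in auto)
  finally show "sum ?q S \<le> a + b" .
qed

text \<open>
  Each mode is continuous and the tails are uniformly small.
\<close>

lemma fourier_sol_hs_continuous:
  assumes c: "fourier_sol \<epsilon> T c" and B: "hs s (c 0) B" and eps: "0 < \<epsilon>" and T: "0 \<le> T" and s: "0 \<le> s"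
    and t: "t \<in> {0..T}" and eta: "0 < (\<eta>::real)"
  shows "\<forall>\<^sub>F \<tau> in at t within {0..T}. hs s (\<lambda>k. c \<tau> k - c t k) \<eta>"
proof -
  obtain v where v: "mean_zero_sol \<epsilon> T v" "v 0 = (c 0)(0 := 0)"
    "\<And>t. t \<in> {0..T} \<Longrightarrow> c t = boost (Re (c 0 0)) (2 * Re (c 0 0) * t) (v t)" using fourier_sol_mean_zero_sol[OF c T] by blast
  have adm: "admissible (v 0)" using v(1) unfolding mean_zero_sol_def by blast
  have Bv: "hs s (v 0) B" unfolding v(2) by (rule hs_zero_mode[OF B])
  have e8: "0 < \<eta> / 8" using eta by simp
  obtain K :: nat where "\<forall>\<epsilon>>0. \<forall>u. mean_zero_sol \<epsilon> T u \<longrightarrow> u 0 = v 0 \<longrightarrow>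
     (\<forall>t\<in>{0..T}. \<forall>S. finite S \<longrightarrow> (\<forall>k\<in>S. int K < \<bar>k\<bar>) \<longrightarrow> (\<Sum>k\<in>S. (sw s k * cmod (u t k))\<^sup>2) \<le> \<eta> / 8)"
    using mean_zero_sol_tight[OF adm Bv s T e8] ..
  note K = this[rule_format, OF eps v(1) refl]
  have tl: "(\<Sum>k\<in>S. (sw s k * cmod (c r k))\<^sup>2) \<le> \<eta> / 8"
    if r: "r \<in> {0..T}" and S: "finite S" "\<forall>k\<in>S. int K < \<bar>k\<bar>" for r S
  proof -
    have "(\<Sum>k\<in>S. (sw s k * cmod (c r k))\<^sup>2) = (\<Sum>k\<in>S. (sw s k * cmod (v r k))\<^sup>2)"
      unfolding v(3)[OF r] by (rule sum.cong) (use S in \<open>auto simp: boost_def norm_mult\<close>)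
    also have "\<dots> \<le> \<eta> / 8" by (rule K[OF r S(1)]) (use S(2) in blast)
    finally show ?thesis .
  qed
  have lim: "((\<lambda>\<tau>. c \<tau> k) \<longlongrightarrow> c t k) (at t within {0..T})" for k
    using has_vector_derivative_continuous[OF fourier_sol_derivative[OF c t, of k]] unfolding continuous_within .
  have "((\<lambda>\<tau>. \<Sum>k\<in>{- int K..int K}. (sw s k * cmod (c \<tau> k - c t k))\<^sup>2) \<longlongrightarrow>
      (\<Sum>k\<in>{- int K..int K}. (sw s k * cmod (c t k - c t k))\<^sup>2)) (at t within {0..T})"
    by (intro tendsto_sum tendsto_power tendsto_mult tendsto_const tendsto_norm tendsto_diff lim)
  then have "((\<lambda>\<tau>. \<Sum>k\<in>{- int K..int K}. (sw s k * cmod (c \<tau> k - c t k))\<^sup>2) \<longlongrightarrow> 0) (at t within {0..T})" by simp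
  moreover have "0 < \<eta> / 2" using eta by simp
  ultimately have "\<forall>\<^sub>F \<tau> in at t within {0..T}. (\<Sum>k\<in>{- int K..int K}. (sw s k * cmod (c \<tau> k - c t k))\<^sup>2) < \<eta> / 2"
    by (rule order_tendstoD(2))
  moreover have "\<forall>\<^sub>F \<tau> in at t within {0..T}. \<tau> \<in> {0..T}" by (simp add: eventually_at_filter)
  ultimately show ?thesis
  proof eventually_elim
    case (elim \<tau>)
    have "hs s (\<lambda>k. c \<tau> k - c t k) (\<eta> / 2 + \<eta> / 2)"
    proof (rule hs_split)
      show "(\<Sum>k\<in>{- int K..int K}. (sw s k * cmod (c \<tau> k - c t k))\<^sup>2) \<le> \<eta> / 2" using elim by simp
      fix S assume S: "finite S" "\<forall>k\<in>S. int K < \<bar>k\<bar>"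
      have "(\<Sum>k\<in>S. (sw s k * cmod (c \<tau> k + - c t k))\<^sup>2)
          \<le> 2 * (\<Sum>k\<in>S. (sw s k * cmod (c \<tau> k))\<^sup>2) + 2 * (\<Sum>k\<in>S. (sw s k * cmod (- c t k))\<^sup>2)"
        by (rule sum_norm_add_sq_le)
      also have "\<dots> \<le> 2 * (\<eta> / 8) + 2 * (\<eta> / 8)"
        unfolding norm_minus_cancel by (intro add_mono mult_left_mono tl elim(2) t S) simp_all
      finally show "(\<Sum>k\<in>S. (sw s k * cmod (c \<tau> k - c t k))\<^sup>2) \<le> \<eta> / 2" by simp
    qed
    then show ?case by simp
  qed
qed

lemma norm_cis_diff_le: "cmod (cis a - cis b) \<le> \<bar>a - b\<bar>"
proof -
  have "cis a - cis b = cis b * (exp (\<i> * of_real (a - b)) - 1)"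
    unfolding cis_conv_exp[symmetric] right_diff_distrib cis_mult by simp
  then have "cmod (cis a - cis b) = cmod (exp (\<i> * of_real (a - b)) - 1)" by (simp only: norm_mult norm_cis mult_1_left)
  then have "cmod (cis a - cis b) = 2 * \<bar>sin ((a - b) / 2)\<bar>" unfolding dist_exp_i_1 .
  also have "\<dots> \<le> \<bar>a - b\<bar>" using abs_sin_x_le_abs_x[of "(a - b) / 2"] by simp
  finally show ?thesis .
qed

text \<open>
  Translation is continuous on \<open>H^s\<close> but not uniformly on bounded sets, so the tail of \<open>v\<close> enters.
\<close>

lemma hs_phase_diff:
  assumes v: "hs s v (M\<^sup>2)" and ab: "real K * \<bar>a - b\<bar> \<le> \<rho>"
    and tail: "\<And>S. finite S \<Longrightarrow> (\<forall>k\<in>S. int K < \<bar>k\<bar>) \<Longrightarrow> (\<Sum>k\<in>S. (sw s k * cmod (v k))\<^sup>2) \<le> \<eta>"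
  shows "hs s (\<lambda>k. (cis (of_int k * a) - cis (of_int k * b)) * v k) (4 * \<eta> + \<rho>\<^sup>2 * M\<^sup>2)"
proof -
  let ?e = "\<lambda>k::int. cmod (cis (of_int k * a) - cis (of_int k * b))"
  have le: "(\<Sum>k\<in>S. (sw s k * cmod ((cis (of_int k * a) - cis (of_int k * b)) * v k))\<^sup>2) \<le> r\<^sup>2 * (\<Sum>k\<in>S. (sw s k * cmod (v k))\<^sup>2)"
    if r: "\<And>k. k \<in> S \<Longrightarrow> ?e k \<le> r" for S r
  proof -
    have "(sw s k * cmod ((cis (of_int k * a) - cis (of_int k * b)) * v k))\<^sup>2 \<le> r\<^sup>2 * (sw s k * cmod (v k))\<^sup>2" if "k \<in> S" for k
    proof -
      have "(?e k)\<^sup>2 * (sw s k * cmod (v k))\<^sup>2 \<le> r\<^sup>2 * (sw s k * cmod (v k))\<^sup>2"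
        by (intro mult_right_mono power_mono r[OF that]) simp_all
      then show ?thesis by (simp add: norm_mult power_mult_distrib mult_ac)
    qed
    then show ?thesis unfolding sum_distrib_left by (rule sum_mono)
  qed
  show ?thesis
  proof (rule hs_split[of K])
    fix S :: "int set" assume S: "finite S" "\<forall>k\<in>S. int K < \<bar>k\<bar>"
    have "?e k \<le> 2" for k using norm_triangle_ineq4[of "cis (of_int k * a)" "cis (of_int k * b)"] by simp
    then have "(\<Sum>k\<in>S. (sw s k * cmod ((cis (of_int k * a) - cis (of_int k * b)) * v k))\<^sup>2) \<le> 2\<^sup>2 * (\<Sum>k\<in>S. (sw s k * cmod (v k))\<^sup>2)"
      by (rule le)
    also have "\<dots> \<le> 2\<^sup>2 * \<eta>" by (rule mult_left_mono[OF tail[OF S]]) simp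
    finally show "(\<Sum>k\<in>S. (sw s k * cmod ((cis (of_int k * a) - cis (of_int k * b)) * v k))\<^sup>2) \<le> 4 * \<eta>" by simp
  next
    have "?e k \<le> \<rho>" if k: "k \<in> {- int K..int K}" for k
    proof -
      have "?e k \<le> \<bar>of_int k * a - of_int k * b\<bar>" by (rule norm_cis_diff_le)
      also have "\<dots> = \<bar>of_int k\<bar> * \<bar>a - b\<bar>" by (simp add: abs_mult flip: right_diff_distrib)
      also have "\<dots> \<le> real K * \<bar>a - b\<bar>" by (rule mult_right_mono) (use k in \<open>auto simp: abs_le_iff\<close>)
      finally show ?thesis using ab by simp
    qed
    then have "(\<Sum>k\<in>{- int K..int K}. (sw s k * cmod ((cis (of_int k * a) - cis (of_int k * b)) * v k))\<^sup>2)
        \<le> \<rho>\<^sup>2 * (\<Sum>k\<in>{- int K..int K}. (sw s k * cmod (v k))\<^sup>2)" by (rule le)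
    also have "\<dots> \<le> \<rho>\<^sup>2 * M\<^sup>2" by (rule mult_left_mono[OF hsD[OF v]]) simp_all
    finally show "(\<Sum>k\<in>{- int K..int K}. (sw s k * cmod ((cis (of_int k * a) - cis (of_int k * b)) * v k))\<^sup>2) \<le> \<rho>\<^sup>2 * M\<^sup>2" .
  qed
qed

text \<open>
  For data \<open>\<phi>\<close> and \<open>\<psi>\<close> with means \<open>p\<close> and \<open>q\<close>, the difference of the solutions is the translated difference of
  their mean-zero parts, bounded by the Lipschitz estimate, plus the effect of the different translations on the
  solution with data \<open>\<phi>\<close>, whose tails are small uniformly in \<open>\<epsilon>\<close>.
\<close>

theorem fourier_sol_stable:
  assumes \<phi>: "symm \<phi>" and B: "hs s \<phi> B" and s: "0 \<le> s" and T: "0 \<le> T" and th: "0 < (\<theta>::real)"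
  shows "\<exists>D>0. \<forall>\<epsilon>>0. \<forall>c d. fourier_sol \<epsilon> T c \<longrightarrow> fourier_sol \<epsilon> T d \<longrightarrow> c 0 = \<phi> \<longrightarrow> hs s (\<lambda>k. d 0 k - \<phi> k) D \<longrightarrow>
     (\<forall>t\<in>{0..T}. hs s (\<lambda>k. d t k - c t k) \<theta>)"
proof -
  obtain R where R: "1 \<le> R" "2 * B + 2 \<le> R\<^sup>2" using exists_square_bound by blast
  obtain M where M: "1 \<le> M" "lip_const (2 powr s) (2 * R) T * R\<^sup>2 \<le> M\<^sup>2" using exists_square_bound by blast
  have B0: "0 \<le> B" by (rule hs_nonneg[OF B])
  have BR: "B \<le> R\<^sup>2" using B0 R(2) by linarith
  define L where "L = lip_const (2 powr s) (3 * M) T"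
  have L: "0 \<le> L" by (simp add: L_def)
  have adm: "admissible (\<phi>(0 := 0))" using \<phi> by (auto simp: symm_def admissible_def)
  have th32: "0 < \<theta> / 32" using th by simp
  obtain K :: nat where "\<forall>\<epsilon>>0. \<forall>u. mean_zero_sol \<epsilon> T u \<longrightarrow> u 0 = \<phi>(0 := 0) \<longrightarrow>
     (\<forall>t\<in>{0..T}. \<forall>S. finite S \<longrightarrow> (\<forall>k\<in>S. int K < \<bar>k\<bar>) \<longrightarrow> (\<Sum>k\<in>S. (sw s k * cmod (u t k))\<^sup>2) \<le> \<theta> / 32)"
    using mean_zero_sol_tight[OF adm hs_zero_mode[OF B] s T th32] ..
  note K = this[rule_format]
  (* The total bound is \<theta>/4 + D P: the fixed part comes from the tails, P collects the factors of D. *)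
  define P where "P = 2 * L + 2 + 8 * (real K * T * M)\<^sup>2"
  have P: "2 \<le> P" using L by (simp add: P_def)
  define D where "D = min 1 (\<theta> / (2 * P))"
  have D0: "0 < D" "D \<le> 1" using th P by (auto simp: D_def)
  have "D \<le> \<theta> / (2 * P)" by (simp add: D_def)
  then have DP: "D * P \<le> \<theta> / 2" using P by (simp add: field_simps)
  show ?thesis
  proof (intro exI[of _ D] conjI allI impI ballI)
    fix \<epsilon> c d t
    assume eps: "0 < \<epsilon>" and c: "fourier_sol \<epsilon> T c" and d: "fourier_sol \<epsilon> T d" and c0: "c 0 = \<phi>"
      and dD: "hs s (\<lambda>k. d 0 k - \<phi> k) D" and t: "t \<in> {0..T}"
    obtain v where v: "mean_zero_sol \<epsilon> T v" "v 0 = (c 0)(0 := 0)"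
      "\<And>t. t \<in> {0..T} \<Longrightarrow> c t = boost (Re (c 0 0)) (2 * Re (c 0 0) * t) (v t)" using fourier_sol_mean_zero_sol[OF c T] by blast
    obtain w where w: "mean_zero_sol \<epsilon> T w" "w 0 = (d 0)(0 := 0)"
      "\<And>t. t \<in> {0..T} \<Longrightarrow> d t = boost (Re (d 0 0)) (2 * Re (d 0 0) * t) (w t)" using fourier_sol_mean_zero_sol[OF d T] by blast
    define p q where "p = Re (c 0 0)" and "q = Re (d 0 0)"
    have pq: "(q - p)\<^sup>2 \<le> D" using Re_mode_sq_le[OF dD s, of 0] by (simp add: p_def q_def c0)
    have v0: "v 0 = \<phi>(0 := 0)" using v(2) c0 by simp
    have Bv: "hs s (v 0) (R\<^sup>2)" unfolding v0 by (rule hs_mono[OF hs_zero_mode[OF B] BR])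
    have "hs s (\<lambda>k. \<phi> k + (d 0 k - \<phi> k)) (2 * B + 2 * D)" by (rule hs_add[OF B dD])
    then have "hs s (d 0) (2 * B + 2 * D)" by simp
    then have Bw: "hs s (w 0) (R\<^sup>2)" unfolding w(2) by (rule hs_mono[OF hs_zero_mode]) (use R(2) D0 in linarith)
    have wv: "hs s (\<lambda>k. w 0 k - v 0 k) D"
    proof -
      have e: "(\<lambda>k. w 0 k - v 0 k) = (\<lambda>k. d 0 k - \<phi> k)(0 := 0)" unfolding v0 w(2) by auto
      show ?thesis unfolding e by (rule hs_zero_mode[OF dD])
    qed
    have "hs s (\<lambda>k. w t k - v t k) (L * D)"
      unfolding L_def by (rule mean_zero_sol_difference[OF w(1) v(1) eps T s R(1) Bw Bv M wv t])
    then have F: "hs s (boost (q - p) (2 * q * t) (\<lambda>k. w t k - v t k)) (L * D + D)"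
      by (rule hs_mono[OF hs_boost]) (use pq in simp)
    have vM: "hs s (v t) (M\<^sup>2)"
      by (rule hs_mono[OF mean_zero_sol_bound(1)[OF v(1) eps T s hs_weaken[OF Bv s] R(1) Bv t] M(2)])
    have H: "hs s (\<lambda>k. (cis (of_int k * (2 * q * t)) - cis (of_int k * (2 * p * t))) * v t k)
        (4 * (\<theta> / 32) + (2 * real K * T * \<bar>q - p\<bar>)\<^sup>2 * M\<^sup>2)"
    proof (rule hs_phase_diff[OF vM])
      show "(\<Sum>k\<in>S. (sw s k * cmod (v t k))\<^sup>2) \<le> \<theta> / 32" if "finite S" "\<forall>k\<in>S. int K < \<bar>k\<bar>" for S
        by (rule K[OF eps v(1) v0 t that(1)]) (rule that(2)[rule_format])
      have "2 * q * t - 2 * p * t = (2 * t) * (q - p)" by algebra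
      moreover have "0 \<le> 2 * t" using t by simp
      ultimately have "\<bar>2 * q * t - 2 * p * t\<bar> = 2 * t * \<bar>q - p\<bar>" by (simp only: abs_mult abs_of_nonneg)
      also have "\<dots> \<le> 2 * T * \<bar>q - p\<bar>" using t by (intro mult_right_mono) auto
      finally have "real K * \<bar>2 * q * t - 2 * p * t\<bar> \<le> real K * (2 * T * \<bar>q - p\<bar>)" by (rule mult_left_mono) simp
      then show "real K * \<bar>2 * q * t - 2 * p * t\<bar> \<le> 2 * real K * T * \<bar>q - p\<bar>" by (simp add: mult_ac)
    qed
    have "d t k - c t k = boost (q - p) (2 * q * t) (\<lambda>k. w t k - v t k) k
        + (cis (of_int k * (2 * q * t)) - cis (of_int k * (2 * p * t))) * v t k" for k
      unfolding v(3)[OF t] w(3)[OF t] by (cases "k = 0") (simp_all add: boost_def p_def q_def algebra_simps)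
    then have e: "(\<lambda>k. d t k - c t k) = (\<lambda>k. boost (q - p) (2 * q * t) (\<lambda>k. w t k - v t k) k
        + (cis (of_int k * (2 * q * t)) - cis (of_int k * (2 * p * t))) * v t k)" by (rule ext)
    have "(2 * real K * T * \<bar>q - p\<bar>)\<^sup>2 * M\<^sup>2 = 4 * (real K * T * M)\<^sup>2 * (q - p)\<^sup>2"
      by (simp add: power_mult_distrib)
    also have "\<dots> \<le> 4 * (real K * T * M)\<^sup>2 * D" by (rule mult_left_mono[OF pq]) simp
    finally have X: "(2 * real K * T * \<bar>q - p\<bar>)\<^sup>2 * M\<^sup>2 \<le> 4 * (real K * T * M)\<^sup>2 * D" .
    have "2 * (L * D + D) + 2 * (4 * (\<theta> / 32) + (2 * real K * T * \<bar>q - p\<bar>)\<^sup>2 * M\<^sup>2)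
        \<le> 2 * (L * D + D) + 2 * (4 * (\<theta> / 32) + 4 * (real K * T * M)\<^sup>2 * D)"
      by (intro add_left_mono mult_left_mono X) simp
    also have "\<dots> = \<theta> / 4 + D * P" by (simp add: P_def algebra_simps)
    also have "\<dots> \<le> \<theta>" using DP th by simp
    finally show "hs s (\<lambda>k. d t k - c t k) \<theta>" unfolding e by (rule hs_mono[OF hs_add[OF F H]])
  qed (rule D0)
qed

section \<open>Solutions as functions on the torus\<close>

text \<open>
  The integrand in the definition of a solution is the right-hand side of the mode system.
\<close>

lemma drift_eq: assumes "torus_L2 f"
  shows "- ((\<i> * of_int k) ^ 3 * fourier_coeff f k) + of_real \<epsilon> * (\<i> * of_int k)\<^sup>2 * fourier_coeff f k
      + \<i> * of_int k * fourier_coeff (\<lambda>x. (f x)\<^sup>2) k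
    = lam \<epsilon> k * fourier_coeff f k + \<i> * of_int k * conv (fourier_coeff f) (fourier_coeff f) k"
proof -
  have i3: "\<i> ^ 3 = - \<i>" by (simp add: power3_eq_cube)
  have "- ((\<i> * of_int k) ^ 3) + of_real \<epsilon> * (\<i> * of_int k)\<^sup>2 = lam \<epsilon> k"
    using i3 by (simp add: lam_def power_mult_distrib)
  then have "lam \<epsilon> k * fourier_coeff f k
      = (- ((\<i> * of_int k) ^ 3) + of_real \<epsilon> * (\<i> * of_int k)\<^sup>2) * fourier_coeff f k" by (simp only:)
  then show ?thesis unfolding fc_square[OF assms] distrib_right by (simp only: mult_minus_left)
qed

lemma C_sobolevD:
  assumes "u \<in> C_sobolev s T" "t \<in> {0..T}"
  shows "u t \<in> sobolev s" "((\<lambda>\<tau>. sobolev_norm s (\<lambda>x. u \<tau> x - u t x)) \<longlongrightarrow> 0) (at t within {0..T})"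
  using assms unfolding C_sobolev_def by simp_all

lemma eventually_in_within: "\<forall>\<^sub>F \<tau> in at t within S. \<tau> \<in> S" by (simp add: eventually_at_filter)

text \<open>
  By the triangle inequality the norm is a continuous function of time on a compact interval.
\<close>

lemma C_sobolev_bounded:
  assumes u: "u \<in> C_sobolev s T"
  obtains N where "\<And>t. t \<in> {0..T} \<Longrightarrow> sobolev_norm s (u t) \<le> N"
proof -
  have "continuous_on {0..T} (\<lambda>t. sobolev_norm s (u t))"
    unfolding continuous_on_def
  proof
    fix t assume t: "t \<in> {0..T}"
    have "((\<lambda>\<tau>. sobolev_norm s (u \<tau>) - sobolev_norm s (u t)) \<longlongrightarrow> 0) (at t within {0..T})"
    proof (rule Lim_null_comparison[OF _ C_sobolevD(2)[OF u t]])
      show "\<forall>\<^sub>F \<tau> in at t within {0..T}. norm (sobolev_norm s (u \<tau>) - sobolev_norm s (u t)) \<le> sobolev_norm s (\<lambda>x. u \<tau> x - u t x)"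
        using eventually_in_within
      proof eventually_elim
        case (elim \<tau>)
        show ?case using sobolev_norm_triangle[OF C_sobolevD(1)[OF u elim] C_sobolevD(1)[OF u t]] by simp
      qed
    qed
    then show "((\<lambda>t. sobolev_norm s (u t)) \<longlongrightarrow> sobolev_norm s (u t)) (at t within {0..T})" by (rule LIM_zero_cancel)
  qed
  then have "compact ((\<lambda>t. sobolev_norm s (u t)) ` {0..T})" by (rule compact_continuous_image) simp
  then have "bounded ((\<lambda>t. sobolev_norm s (u t)) ` {0..T})" by (rule compact_imp_bounded)
  then obtain N where N: "\<forall>y\<in>(\<lambda>t. sobolev_norm s (u t)) ` {0..T}. norm y \<le> N" unfolding bounded_iff ..
  show thesis
  proof (rule that)
    fix t assume "t \<in> {0..T}"
    then have "norm (sobolev_norm s (u t)) \<le> N" using N by blast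
    then show "sobolev_norm s (u t) \<le> N" by simp
  qed
qed

text \<open>
  Continuity in \<open>H^s\<close>, and so in \<open>L^2\<close>, makes the integrand of the time-integrated equation continuous, so each
  coefficient is continuously differentiable.
\<close>

theorem kdvb_fourier_sol:
  assumes sol: "kdvb_solution s T \<epsilon> \<phi> u" and s: "0 \<le> s"
  shows "fourier_sol \<epsilon> T (\<lambda>t. fourier_coeff (u t))"
proof -
  define c where "c t = fourier_coeff (u t)" for t
  have u: "u \<in> C_sobolev s T" using sol unfolding kdvb_solution_def by blast
  obtain N where N: "\<And>t. t \<in> {0..T} \<Longrightarrow> sobolev_norm s (u t) \<le> N" by (rule C_sobolev_bounded[OF u]) (rule that)
  define B where "B = N\<^sup>2 / (2 * pi)"
  have B: "hs 0 (c t) B" if t: "t \<in> {0..T}" for t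
    unfolding c_def B_def
    by (rule hs_mono[OF hs_weaken[OF sobolev_hs[OF C_sobolevD(1)[OF u t]] s]])
      (intro divide_right_mono power_mono N[OF t] sobolev_norm_nonneg; simp)
  define d where "d t \<tau> = sobolev_norm s (\<lambda>x. u \<tau> x - u t x)" for t \<tau>
  have d0: "0 \<le> d t \<tau>" for t \<tau> by (simp add: d_def sobolev_norm_nonneg)
  have dl: "((\<lambda>\<tau>. d t \<tau>) \<longlongrightarrow> 0) (at t within {0..T})" if "t \<in> {0..T}" for t
    unfolding d_def by (rule C_sobolevD(2)[OF u that])
  have D: "hs 0 (\<lambda>k. c \<tau> k - c t k) ((d t \<tau>)\<^sup>2 / (2 * pi))" if t: "t \<in> {0..T}" and r: "\<tau> \<in> {0..T}" for t \<tau>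
    using hs_weaken[OF sobolev_hs[OF sobolev_diff[OF C_sobolevD(1)[OF u r] C_sobolevD(1)[OF u t]]] s]
    unfolding fc_sobolev_diff[OF C_sobolevD(1)[OF u r] C_sobolevD(1)[OF u t]] c_def d_def .
  have limc: "((\<lambda>\<tau>. c \<tau> k) \<longlongrightarrow> c t k) (at t within {0..T})" if t: "t \<in> {0..T}" for t k
  proof (rule LIM_zero_cancel, rule Lim_null_comparison)
    have "((\<lambda>\<tau>. sqrt ((d t \<tau>)\<^sup>2 / (2 * pi))) \<longlongrightarrow> sqrt (0\<^sup>2 / (2 * pi))) (at t within {0..T})"
      by (intro tendsto_real_sqrt tendsto_divide tendsto_power dl[OF t] tendsto_const) simp
    then show "((\<lambda>\<tau>. sqrt ((d t \<tau>)\<^sup>2 / (2 * pi))) \<longlongrightarrow> 0) (at t within {0..T})" by simp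
    show "\<forall>\<^sub>F \<tau> in at t within {0..T}. norm (c \<tau> k - c t k) \<le> sqrt ((d t \<tau>)\<^sup>2 / (2 * pi))"
      using eventually_in_within by eventually_elim (rule hs_component[OF D[OF t]])
  qed
  have limq: "((\<lambda>\<tau>. conv (c \<tau>) (c \<tau>) k) \<longlongrightarrow> conv (c t) (c t) k) (at t within {0..T})" if t: "t \<in> {0..T}" for t k
  proof (rule LIM_zero_cancel, rule Lim_null_comparison)
    have "((\<lambda>\<tau>. 2 * sqrt ((d t \<tau>)\<^sup>2 / (2 * pi) * B)) \<longlongrightarrow> 2 * sqrt (0\<^sup>2 / (2 * pi) * B)) (at t within {0..T})"
      by (intro tendsto_mult tendsto_real_sqrt tendsto_divide tendsto_power dl[OF t] tendsto_const) simp
    then show "((\<lambda>\<tau>. 2 * sqrt ((d t \<tau>)\<^sup>2 / (2 * pi) * B)) \<longlongrightarrow> 0) (at t within {0..T})" by simp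
    show "\<forall>\<^sub>F \<tau> in at t within {0..T}. norm (conv (c \<tau>) (c \<tau>) k - conv (c t) (c t) k) \<le> 2 * sqrt ((d t \<tau>)\<^sup>2 / (2 * pi) * B)"
      using eventually_in_within by eventually_elim (rule norm_conv_diff_le[OF B B[OF t] D[OF t]])
  qed
  define g where "g k \<tau> = lam \<epsilon> k * c \<tau> k + \<i> * of_int k * conv (c \<tau>) (c \<tau>) k" for k \<tau>
  have cont: "continuous_on {0..T} (g k)" for k
    unfolding continuous_on_def g_def
    by (intro ballI tendsto_add tendsto_mult tendsto_const limc limq)
  have int: "(g k has_integral (c t k - c 0 k)) {0..t}" if t: "t \<in> {0..T}" for t k
  proof -
    have "((\<lambda>\<tau>. - ((\<i> * of_int k) ^ 3 * fourier_coeff (u \<tau>) k)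
              + of_real \<epsilon> * (\<i> * of_int k)\<^sup>2 * fourier_coeff (u \<tau>) k
              + \<i> * of_int k * fourier_coeff (\<lambda>x. (u \<tau> x)\<^sup>2) k)
          has_integral (fourier_coeff (u t) k - fourier_coeff (u 0) k)) {0..t}"
      using sol t unfolding kdvb_solution_def by simp
    then show ?thesis unfolding c_def
    proof (rule has_integral_eq[rotated])
      fix \<tau> assume "\<tau> \<in> {0..t}"
      then have "\<tau> \<in> {0..T}" using t by simp
      from drift_eq[OF sobolev_torus_L2[OF C_sobolevD(1)[OF u this]]]
      show "- ((\<i> * of_int k) ^ 3 * fourier_coeff (u \<tau>) k)
              + of_real \<epsilon> * (\<i> * of_int k)\<^sup>2 * fourier_coeff (u \<tau>) k
              + \<i> * of_int k * fourier_coeff (\<lambda>x. (u \<tau> x)\<^sup>2) k = g k \<tau>"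
        unfolding g_def c_def .
    qed
  qed
  have der: "((\<lambda>\<tau>. c \<tau> k) has_vector_derivative g k t) (at t within {0..T})" if t: "t \<in> {0..T}" for t k
  proof (rule has_vector_derivative_transform[OF t])
    show "((\<lambda>\<tau>. c 0 k + integral {0..\<tau>} (g k)) has_vector_derivative g k t) (at t within {0..T})"
      using has_vector_derivative_add[OF has_vector_derivative_const integral_has_vector_derivative[OF cont t]] by simp
    show "c \<tau> k = c 0 k + integral {0..\<tau>} (g k)" if "\<tau> \<in> {0..T}" for \<tau>
      using integral_unique[OF int[OF that]] by simp
  qed
  have "mode_flow \<epsilon> UNIV T c" unfolding mode_flow_def
  proof (intro conjI ballI allI impI)
    fix t k assume t: "t \<in> {0..T}"
    show "c t k = 0" if "k \<notin> UNIV" using that by simp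
    show "((\<lambda>\<tau>. c \<tau> k) has_vector_derivative (lam \<epsilon> k * c t k + \<i> * of_int k * conv (c t) (c t) k)) (at t within {0..T})"
      using der[OF t, of k] unfolding g_def .
  qed
  moreover have "symm (c 0)" unfolding c_def by (rule symm_fc)
  moreover have "\<forall>t\<in>{0..T}. hs 0 (c t) B" using B by simp
  ultimately have "fourier_sol \<epsilon> T c" unfolding fourier_sol_def by (intro conjI exI[of _ B])
  then show ?thesis unfolding c_def .
qed

lemma kdvb_initial:
  assumes "kdvb_solution s T \<epsilon> \<phi> u" "\<phi> \<in> sobolev s" "0 \<le> T"
  shows "fourier_coeff (u 0) = fourier_coeff \<phi>"
proof
  fix k
  have ae: "AE x in torus. u 0 x = \<phi> x" and u: "u \<in> C_sobolev s T" using assms unfolding kdvb_solution_def by auto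
  have u0: "u 0 \<in> sobolev s" by (rule C_sobolevD(1)[OF u]) (use assms(3) in simp)
  have "(\<integral>x. fourier_mode (- k) x * of_real (u 0 x) \<partial>torus) = (\<integral>x. fourier_mode (- k) x * of_real (\<phi> x) \<partial>torus)"
  proof (rule integral_cong_AE)
    show "AE x in torus. fourier_mode (- k) x * complex_of_real (u 0 x) = fourier_mode (- k) x * of_real (\<phi> x)"
      using ae by eventually_elim simp
  qed (rule borel_measurable_integrable[OF fc_integrable[OF torus_L2_integrable[OF sobolev_torus_L2]]], rule u0 assms(2))+
  then show "fourier_coeff (u 0) k = fourier_coeff \<phi> k" unfolding fourier_coeff_fourier_mode by (rule arg_cong)
qed

text \<open>
  Functions with the coefficients \<open>c t\<close> solve the equation, whichever representatives are chosen.
\<close>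

theorem fourier_sol_kdvb:
  assumes c: "fourier_sol \<epsilon> T c" and B: "hs s (c 0) B" and eps: "0 < \<epsilon>" and T: "0 \<le> T" and s: "0 \<le> s"
    and u: "\<And>t. t \<in> {0..T} \<Longrightarrow> u t \<in> sobolev s" and fc: "\<And>t. t \<in> {0..T} \<Longrightarrow> fourier_coeff (u t) = c t"
    and u0: "AE x in torus. u 0 x = \<phi> x"
  shows "kdvb_solution s T \<epsilon> \<phi> u"
proof -
  have fcd: "fourier_coeff (\<lambda>x. u \<tau> x - u t x) = (\<lambda>k. c \<tau> k - c t k)" if "t \<in> {0..T}" "\<tau> \<in> {0..T}" for t \<tau>
    unfolding fc_sobolev_diff[OF u[OF that(2)] u[OF that(1)]] fc[OF that(1)] fc[OF that(2)] ..
  have "((\<lambda>\<tau>. sobolev_norm s (\<lambda>x. u \<tau> x - u t x)) \<longlongrightarrow> 0) (at t within {0..T})" if t: "t \<in> {0..T}" for t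
  proof (rule tendstoI)
    fix e :: real assume e: "0 < e"
    then have "0 < (e / 2)\<^sup>2 / (2 * pi)" by simp
    from fourier_sol_hs_continuous[OF c B eps T s t this] eventually_in_within
    show "\<forall>\<^sub>F \<tau> in at t within {0..T}. dist (sobolev_norm s (\<lambda>x. u \<tau> x - u t x)) 0 < e"
    proof eventually_elim
      case (elim \<tau>)
      have "hs s (fourier_coeff (\<lambda>x. u \<tau> x - u t x)) ((e / 2)\<^sup>2 / (2 * pi))"
        unfolding fcd[OF t elim(2)] by (rule elim(1))
      from sobolev_norm_le[OF this] have "sobolev_norm s (\<lambda>x. u \<tau> x - u t x) \<le> sqrt ((e / 2)\<^sup>2)" by simp
      also have "\<dots> = e / 2" using e by (intro real_sqrt_unique) simp_all
      finally show ?case using sobolev_norm_nonneg[of s "\<lambda>x. u \<tau> x - u t x"] e by (simp add: dist_real_def)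
    qed
  qed
  then have C: "u \<in> C_sobolev s T" unfolding C_sobolev_def using u by simp
  have "((\<lambda>\<tau>. - ((\<i> * of_int k) ^ 3 * fourier_coeff (u \<tau>) k)
              + of_real \<epsilon> * (\<i> * of_int k)\<^sup>2 * fourier_coeff (u \<tau>) k
              + \<i> * of_int k * fourier_coeff (\<lambda>x. (u \<tau> x)\<^sup>2) k)
          has_integral (fourier_coeff (u t) k - fourier_coeff (u 0) k)) {0..t}" if t: "t \<in> {0..T}" for k t
  proof -
    have sub: "{0..t} \<subseteq> {0..T}" "0 \<le> t" using t by auto
    have "((\<lambda>\<tau>. lam \<epsilon> k * c \<tau> k + \<i> * of_int k * conv (c \<tau>) (c \<tau>) k) has_integral (c t k - c 0 k)) {0..t}"
      by (rule fundamental_theorem_of_calculus[OF sub(2)], rule has_vector_derivative_within_subset[OF fourier_sol_derivative[OF c] sub(1)])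
        (rule subsetD[OF sub(1)])
    then have "((\<lambda>\<tau>. - ((\<i> * of_int k) ^ 3 * fourier_coeff (u \<tau>) k)
              + of_real \<epsilon> * (\<i> * of_int k)\<^sup>2 * fourier_coeff (u \<tau>) k
              + \<i> * of_int k * fourier_coeff (\<lambda>x. (u \<tau> x)\<^sup>2) k) has_integral (c t k - c 0 k)) {0..t}"
    proof (rule has_integral_eq[rotated])
      fix \<tau> assume "\<tau> \<in> {0..t}"
      then have r: "\<tau> \<in> {0..T}" using sub by blast
      show "lam \<epsilon> k * c \<tau> k + \<i> * of_int k * conv (c \<tau>) (c \<tau>) k = - ((\<i> * of_int k) ^ 3 * fourier_coeff (u \<tau>) k)
              + of_real \<epsilon> * (\<i> * of_int k)\<^sup>2 * fourier_coeff (u \<tau>) k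
              + \<i> * of_int k * fourier_coeff (\<lambda>x. (u \<tau> x)\<^sup>2) k"
        unfolding drift_eq[OF sobolev_torus_L2[OF u[OF r]]] unfolding fc[OF r] ..
    qed
    then show ?thesis using fc[OF t] fc[of 0] T by simp
  qed
  then show ?thesis unfolding kdvb_solution_def using C u0 by (intro conjI allI ballI)
qed

text \<open>
  At time \<open>0\<close> the datum itself is taken, at other times any function with the right coefficients.
\<close>

theorem kdvb_exists:
  assumes \<phi>: "\<phi> \<in> sobolev s" and eps: "0 < \<epsilon>" and T: "0 \<le> T" and s: "0 \<le> s"
  shows "\<exists>u. kdvb_solution s T \<epsilon> \<phi> u"
proof -
  note B = sobolev_hs[OF \<phi>]
  obtain c where c: "fourier_sol \<epsilon> T c" "c 0 = fourier_coeff \<phi>" "\<And>t. symm (c t)"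
    using fourier_sol_exists[OF symm_fc hs_weaken[OF B s] eps T] by blast
  have Bc: "hs s (c 0) ((sobolev_norm s \<phi>)\<^sup>2 / (2 * pi))" unfolding c(2) by (rule B)
  obtain R where R: "1 \<le> R" "(sobolev_norm s \<phi>)\<^sup>2 / (2 * pi) \<le> R\<^sup>2" using exists_square_bound by blast
  note bd = fourier_sol_bound[OF c(1) eps T s R(1) Bc R(2)]
  have "\<exists>f. torus_L2 f \<and> (\<forall>k. fourier_coeff f k = c t k)" if "t \<in> {0..T}" for t
    using riesz_fischer[OF hs_weaken[OF bd[OF that] s] c(3)] by blast
  then have "\<forall>t\<in>{0..T}. \<exists>f. torus_L2 f \<and> (\<forall>k. fourier_coeff f k = c t k)" by (rule ballI)
  from bchoice[OF this] obtain F where F: "\<forall>t\<in>{0..T}. torus_L2 (F t) \<and> (\<forall>k. fourier_coeff (F t) k = c t k)" ..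
  define u where "u t = (if t = 0 then \<phi> else F t)" for t
  have fc: "fourier_coeff (u t) = c t" if "t \<in> {0..T}" for t
    using F[rule_format, OF that] c(2) by (auto simp: u_def)
  have "torus_L2 (u t)" if "t \<in> {0..T}" for t
    using F[rule_format, OF that] sobolev_torus_L2[OF \<phi>] by (simp add: u_def)
  then have us: "u t \<in> sobolev s" if "t \<in> {0..T}" for t
    unfolding sobolev_iff fc[OF that] using that bd[OF that] by (intro conjI exI)
  have "kdvb_solution s T \<epsilon> \<phi> u"
    by (rule fourier_sol_kdvb[OF c(1) Bc eps T s us fc]) (simp_all add: u_def)
  then show ?thesis by (intro exI[of _ u])
qed

theorem kdvb_unique:
  assumes \<phi>: "\<phi> \<in> sobolev s" and eps: "0 < \<epsilon>" and T: "0 \<le> T" and s: "0 \<le> s"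
    and u: "kdvb_solution s T \<epsilon> \<phi> u" and v: "kdvb_solution s T \<epsilon> \<phi> v" and t: "t \<in> {0..T}"
  shows "AE x in torus. v t x = u t x"
proof (rule fc_eq_imp_AE_eq)
  have uv: "u \<in> C_sobolev s T" "v \<in> C_sobolev s T" using u v unfolding kdvb_solution_def by auto
  show "torus_L2 (v t)" "torus_L2 (u t)" by (rule sobolev_torus_L2[OF C_sobolevD(1)[OF _ t]], rule uv)+
  have "fourier_coeff (v t) = fourier_coeff (u t)"
    by (rule fourier_sol_unique[OF kdvb_fourier_sol[OF v s] kdvb_fourier_sol[OF u s] eps T _ t])
      (simp only: kdvb_initial[OF u \<phi> T] kdvb_initial[OF v \<phi> T])
  then show "fourier_coeff (v t) k = fourier_coeff (u t) k" for k by simp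
qed

text \<open>
  The radius \<open>sobolev_norm s \<phi> + 1\<close> is at least \<open>1\<close>, as the uniform estimates require.
\<close>

theorem kdvb_bound:
  assumes \<phi>: "\<phi> \<in> sobolev s" and eps: "0 < \<epsilon>" and T: "0 \<le> T" and s: "0 \<le> s"
    and u: "kdvb_solution s T \<epsilon> \<phi> u"
  shows "C_sobolev_norm s T u
    \<le> sqrt (lip_const (2 powr s) (2 * (sobolev_norm s \<phi> + 1)) T * (sobolev_norm s \<phi>)\<^sup>2 + (sobolev_norm s \<phi>)\<^sup>2)"
  unfolding C_sobolev_norm_def
proof (rule cSUP_least)
  let ?r = "sobolev_norm s \<phi>"
  show "{0..T} \<noteq> {}" using T by simp
  fix t assume t: "t \<in> {0..T}"
  have r: "0 \<le> ?r" by (rule sobolev_norm_nonneg)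
  have C: "hs s (fourier_coeff (u 0)) (?r\<^sup>2 / (2 * pi))" unfolding kdvb_initial[OF u \<phi> T] by (rule sobolev_hs[OF \<phi>])
  have "1 \<le> 2 * pi" using pi_gt3 by simp
  then have "?r\<^sup>2 / (2 * pi) \<le> ?r\<^sup>2 / 1" by (intro divide_left_mono) simp_all
  also have "\<dots> \<le> (?r + 1)\<^sup>2" using r by (simp add: power_mono)
  finally have CR: "?r\<^sup>2 / (2 * pi) \<le> (?r + 1)\<^sup>2" .
  have "1 \<le> ?r + 1" using r by simp
  from sobolev_norm_le[OF fourier_sol_bound[OF kdvb_fourier_sol[OF u s] eps T s this C CR t]]
  show "sobolev_norm s (u t) \<le> sqrt (lip_const (2 powr s) (2 * (?r + 1)) T * ?r\<^sup>2 + ?r\<^sup>2)"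
    by (simp add: distrib_left)
qed

theorem kdvb_stable:
  assumes \<phi>: "\<phi> \<in> sobolev s" and T: "0 \<le> T" and s: "0 \<le> s" and eta: "0 < (\<eta>::real)"
  shows "\<exists>\<delta>>0. \<forall>\<psi>\<in>sobolev s. sobolev_norm s (\<lambda>x. \<psi> x - \<phi> x) < \<delta> \<longrightarrow>
    (\<forall>\<epsilon>>0. \<forall>u v. kdvb_solution s T \<epsilon> \<phi> u \<longrightarrow> kdvb_solution s T \<epsilon> \<psi> v \<longrightarrow>
      C_sobolev_norm s T (\<lambda>t x. v t x - u t x) < \<eta>)"
proof -
  define \<theta> where "\<theta> = (\<eta> / 2)\<^sup>2 / (2 * pi)"
  have th: "0 < \<theta>" using eta by (simp add: \<theta>_def)
  obtain D where D0: "0 < D" and "\<forall>\<epsilon>>0. \<forall>c d. fourier_sol \<epsilon> T c \<longrightarrow> fourier_sol \<epsilon> T d \<longrightarrow> c 0 = fourier_coeff \<phi> \<longrightarrow>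
      hs s (\<lambda>k. d 0 k - fourier_coeff \<phi> k) D \<longrightarrow> (\<forall>t\<in>{0..T}. hs s (\<lambda>k. d t k - c t k) \<theta>)"
    using fourier_sol_stable[OF symm_fc sobolev_hs[OF \<phi>] s T th] by (elim exE conjE)
  note D = this(2)[rule_format]
  show ?thesis
  proof (intro exI[of _ "sqrt (2 * pi * D)"] conjI ballI allI impI)
    show "0 < sqrt (2 * pi * D)" using D0 by simp
    fix \<psi> \<epsilon> u v
    assume psi: "\<psi> \<in> sobolev s" and small: "sobolev_norm s (\<lambda>x. \<psi> x - \<phi> x) < sqrt (2 * pi * D)" and eps: "0 < \<epsilon>"
      and u: "kdvb_solution s T \<epsilon> \<phi> u" and v: "kdvb_solution s T \<epsilon> \<psi> v"
    have "(sobolev_norm s (\<lambda>x. \<psi> x - \<phi> x))\<^sup>2 \<le> (sqrt (2 * pi * D))\<^sup>2"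
      by (rule power_mono) (use small sobolev_norm_nonneg in auto)
    then have "(sobolev_norm s (\<lambda>x. \<psi> x - \<phi> x))\<^sup>2 / (2 * pi) \<le> D" using D0 by (simp add: field_simps)
    from hs_mono[OF sobolev_hs[OF sobolev_diff[OF psi \<phi>]] this]
    have "hs s (\<lambda>k. fourier_coeff (v 0) k - fourier_coeff \<phi> k) D"
      unfolding fc_sobolev_diff[OF psi \<phi>] kdvb_initial[OF v psi T] .
    note E = D[OF eps kdvb_fourier_sol[OF u s] kdvb_fourier_sol[OF v s] kdvb_initial[OF u \<phi> T] this]
    have uv: "u \<in> C_sobolev s T" "v \<in> C_sobolev s T" using u v unfolding kdvb_solution_def by auto
    have "C_sobolev_norm s T (\<lambda>t x. v t x - u t x) \<le> \<eta> / 2"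
      unfolding C_sobolev_norm_def
    proof (rule cSUP_least)
      show "{0..T} \<noteq> {}" using T by simp
      fix t assume t: "t \<in> {0..T}"
      have "hs s (fourier_coeff (\<lambda>x. v t x - u t x)) \<theta>"
        unfolding fc_sobolev_diff[OF C_sobolevD(1)[OF uv(2) t] C_sobolevD(1)[OF uv(1) t]] by (rule E[OF t])
      from sobolev_norm_le[OF this] have "sobolev_norm s (\<lambda>x. v t x - u t x) \<le> sqrt ((\<eta> / 2)\<^sup>2)" by (simp add: \<theta>_def)
      also have "\<dots> = \<eta> / 2" using eta by (intro real_sqrt_unique) simp_all
      finally show "sobolev_norm s (\<lambda>x. v t x - u t x) \<le> \<eta> / 2" .
    qed
    then show "C_sobolev_norm s T (\<lambda>t x. v t x - u t x) < \<eta>" using eta by simp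
  qed
qed

theorem theorem1p1:
  fixes s :: real
  assumes "s \<ge> 0"
  shows
    "(\<forall>T>0. \<forall>\<phi>\<in>sobolev s. \<forall>\<epsilon>\<in>{0<..1}.
        \<exists>u. kdvb_solution s T \<epsilon> \<phi> u \<and>
          (\<forall>v. kdvb_solution s T \<epsilon> \<phi> v \<longrightarrow> (\<forall>t\<in>{0..T}. AE x in torus. v t x = u t x)))
     \<and> (\<exists>C :: real \<Rightarrow> real \<Rightarrow> real. \<forall>T>0. \<forall>\<phi>\<in>sobolev s. \<forall>\<epsilon>\<in>{0<..1}.
        \<forall>u. kdvb_solution s T \<epsilon> \<phi> u \<longrightarrow> C_sobolev_norm s T u \<le> C T (sobolev_norm s \<phi>))
     \<and> (\<forall>T>0. \<forall>\<phi>\<in>sobolev s. \<forall>\<eta>>0. \<exists>\<delta>>0. \<forall>\<psi>\<in>sobolev s.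
        sobolev_norm s (\<lambda>x. \<psi> x - \<phi> x) < \<delta> \<longrightarrow>
        (\<forall>\<epsilon>\<in>{0<..1}.
           C_sobolev_norm s T
             (\<lambda>t x. kdvb_solution_map s T \<epsilon> \<psi> t x - kdvb_solution_map s T \<epsilon> \<phi> t x) < \<eta>))"
proof (intro conjI allI ballI impI)
  fix T \<phi> \<epsilon> assume T: "(0::real) < T" and \<phi>: "\<phi> \<in> sobolev s" and eps: "\<epsilon> \<in> {0<..(1::real)}"
  have e: "0 < \<epsilon>" using eps by simp
  obtain u where u: "kdvb_solution s T \<epsilon> \<phi> u" using kdvb_exists[OF \<phi> e less_imp_le[OF T] assms] ..
  show "\<exists>u. kdvb_solution s T \<epsilon> \<phi> u \<and>
          (\<forall>v. kdvb_solution s T \<epsilon> \<phi> v \<longrightarrow> (\<forall>t\<in>{0..T}. AE x in torus. v t x = u t x))"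
    by (intro exI[of _ u] conjI allI impI ballI u) (rule kdvb_unique[OF \<phi> e less_imp_le[OF T] assms u])
next
  show "\<exists>C :: real \<Rightarrow> real \<Rightarrow> real. \<forall>T>0. \<forall>\<phi>\<in>sobolev s. \<forall>\<epsilon>\<in>{0<..1}.
        \<forall>u. kdvb_solution s T \<epsilon> \<phi> u \<longrightarrow> C_sobolev_norm s T u \<le> C T (sobolev_norm s \<phi>)"
  proof (intro exI[of _ "\<lambda>T r. sqrt (lip_const (2 powr s) (2 * (r + 1)) T * r\<^sup>2 + r\<^sup>2)"] allI impI ballI)
    fix T \<phi> \<epsilon> u assume T: "(0::real) < T" and \<phi>: "\<phi> \<in> sobolev s" and eps: "\<epsilon> \<in> {0<..(1::real)}"
      and u: "kdvb_solution s T \<epsilon> \<phi> u"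
    have e: "0 < \<epsilon>" using eps by simp
    show "C_sobolev_norm s T u \<le> sqrt (lip_const (2 powr s) (2 * (sobolev_norm s \<phi> + 1)) T * (sobolev_norm s \<phi>)\<^sup>2 + (sobolev_norm s \<phi>)\<^sup>2)"
      by (rule kdvb_bound[OF \<phi> e less_imp_le[OF T] assms u])
  qed
next
  fix T \<phi> \<eta> assume T: "(0::real) < T" and \<phi>: "\<phi> \<in> sobolev s" and eta: "(0::real) < \<eta>"
  obtain \<delta> where d0: "0 < \<delta>" and "\<forall>\<psi>\<in>sobolev s. sobolev_norm s (\<lambda>x. \<psi> x - \<phi> x) < \<delta> \<longrightarrow>
    (\<forall>\<epsilon>>0. \<forall>u v. kdvb_solution s T \<epsilon> \<phi> u \<longrightarrow> kdvb_solution s T \<epsilon> \<psi> v \<longrightarrow>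
      C_sobolev_norm s T (\<lambda>t x. v t x - u t x) < \<eta>)"
    using kdvb_stable[OF \<phi> less_imp_le[OF T] assms eta] by (elim exE conjE)
  note d = this(2)[rule_format]
  have map: "kdvb_solution s T \<epsilon> \<psi> (kdvb_solution_map s T \<epsilon> \<psi>)" if "\<psi> \<in> sobolev s" "0 < \<epsilon>" for \<psi> \<epsilon>
    unfolding kdvb_solution_map_def by (rule someI_ex[OF kdvb_exists[OF that less_imp_le[OF T] assms]])
  show "\<exists>\<delta>>0. \<forall>\<psi>\<in>sobolev s. sobolev_norm s (\<lambda>x. \<psi> x - \<phi> x) < \<delta> \<longrightarrow>
        (\<forall>\<epsilon>\<in>{0<..1}. C_sobolev_norm s T
             (\<lambda>t x. kdvb_solution_map s T \<epsilon> \<psi> t x - kdvb_solution_map s T \<epsilon> \<phi> t x) < \<eta>)"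
  proof (intro exI[of _ \<delta>] conjI ballI impI d0)
    fix \<psi> \<epsilon> assume psi: "\<psi> \<in> sobolev s" and small: "sobolev_norm s (\<lambda>x. \<psi> x - \<phi> x) < \<delta>" and eps: "\<epsilon> \<in> {0<..(1::real)}"
    have e: "0 < \<epsilon>" using eps by simp
    show "C_sobolev_norm s T (\<lambda>t x. kdvb_solution_map s T \<epsilon> \<psi> t x - kdvb_solution_map s T \<epsilon> \<phi> t x) < \<eta>"
      by (rule d[OF psi small e map[OF \<phi> e] map[OF psi e]])
  qed
qed

end
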